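(* Let $A$ be a connected, cocommutative, finite dimensional graded Hopf algebra over $\mathbb{F}=\mathbb{F}_2$, let $B\subset A$ be a normal Hopf subalgebra, and let $q$ be a positive integer. Suppose that 1. $(A/\!/B)^{*}=E(\tau)$ is an exterior algebra on one element $\tau$ of degree $|\tau|\ge 1$; 2. $\theta^{q}=0$ in $\mathrm{Ext}_A^{*,*}(\mathbb{F},\mathbb{F})$, where $\theta$ is the class of bidegree $(1,|\tau|)$ corresponding to $\tau$; 3. $(q+1)|\tau|<|B|$, where $|B|$ is the maximal internal degree of a nonzero homogeneous element of $B$. Then the relative Picard group $\mathrm{Pic}(A,B)$ is trivial.
   Context: Everything is over the field $\mathbb{F}$ with two elements, and $\otimes=\otimes_{\mathbb{F}}$. Stable category: for a connected, cocommutative, finite dimensional graded Hopf algebra $A$, $\mathbf{Mod}(A)$ is the category of bounded below graded $A$-modules with degree preserving $A$-linear maps, symmetric monoidal under $\otimes$ with $A$ acting on $M\otimes N$ through the coproduct. The stable category $\mathbf{St}(A)$ has the same objects, and its morphisms are the quotient of $\mathbf{Mod}(A)(M,N)$ by the subspace of maps that factor through a projective $A$-module. The tensor product descends to a symmetric monoidal structure on $\mathbf{St}(A)$ with unit $\mathbb{S}_A=\mathbb{F}$ concentrated in degree $0$. Picard groups: $\mathrm{Pic}(A)$ is the group, under $\otimes$, of isomorphism classes in $\mathbf{St}(A)$ of objects $M$ for which there is an $N$ with $M\otimes N\cong\mathbb{S}_A$ in $\mathbf{St}(A)$. For a Hopf subalgebra $B\subset A$, the restriction functor $U:\mathbf{St}(A)\to\mathbf{St}(B)$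 is monoidal and induces a homomorphism $\mathrm{Pic}(U):\mathrm{Pic}(A)\to\mathrm{Pic}(B)$; the relative Picard group is $\mathrm{Pic}(A,B)=\ker(\mathrm{Pic}(U))$. The class $\theta$: $A/\!/B=A\otimes_B\mathbb{F}$ is the quotient Hopf algebra of $A$ by $B$, and $(A/\!/B)^*$ is its dual, a sub-Hopf algebra of $A^*$. When $(A/\!/B)^*=E(\tau)$, one has $\mathrm{Ext}_{A/\!/B}^{*,*}(\mathbb{F},\mathbb{F})=\mathbb{F}[\theta]$ with $\theta$ of bidegree $(1,|\tau|)$ (homological degree, internal degree), represented by $[\tau]$ in the cobar complex; $\theta$ also denotes its image in $\mathrm{Ext}_A^{1,|\tau|}(\mathbb{F},\mathbb{F})$ under the map induced by $A\to A/\!/B$. *)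

theory Defs
  imports
    "HOL-Algebra.Algebra"
    "HOL-Library.Z2"
    "HOL-Library.Poly_Mapping"
    "HOL-Library.Infinite_Typeclass"
    "HOL-Computational_Algebra.Group_Closure"
begin

section \<open>Graded vector spaces over the field with two elements\<close>

text \<open>
  The field is the type \<^typ>\<open>bit\<close>.  A vector space over it is an abelian group in which
  \<open>x + x = 0\<close> (scalar multiplication is then determined and carries no information), and its
  linear maps are the additive maps.  Gradings are by the integers.  Spaces that are not algebras
  use the same records; their fields \<^const>\<open>monoid.mult\<close> and \<^const>\<open>monoid.one\<close> carry
  no meaning and are never used.
\<close>

record 'a graded = "'a ring" +
  homog :: "int \<Rightarrow> 'a set"

locale graded_space = abelian_group V for V :: "('v, 's) graded_scheme" (structure) +
  assumes char2: "x \<in> carrier V \<Longrightarrow> x \<oplus> x = \<zero>"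
    and homog_subgroup: "subgroup (homog V n) (add_monoid V)"
    and homog_decomposition: "x \<in> carrier V \<Longrightarrow>
      \<exists>!c. (\<forall>n. c n \<in> homog V n) \<and> finite {n. c n \<noteq> \<zero>} \<and> x = (\<Oplus>n\<in>{n. c n \<noteq> \<zero>}. c n)"

definition linear_maps :: "('v, 's) ring_scheme \<Rightarrow> ('w, 't) ring_scheme \<Rightarrow> ('v \<Rightarrow> 'w) set" where
  "linear_maps V W = hom (add_monoid V) (add_monoid W)"

definition graded_maps :: "('v, 's) graded_scheme \<Rightarrow> ('w, 't) graded_scheme \<Rightarrow> ('v \<Rightarrow> 'w) set" where
  "graded_maps V W = {f \<in> linear_maps V W. \<forall>n. f ` homog V n \<subseteq> homog W n}"

definition finite_dimensional :: "('v, 's) ring_scheme \<Rightarrow> bool" where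
  "finite_dimensional V \<longleftrightarrow>
     (\<exists>S. finite S \<and> S \<subseteq> carrier V \<and> generate (add_monoid V) S = carrier V)"

definition bounded_below :: "('v, 's) graded_scheme \<Rightarrow> bool" where
  "bounded_below V \<longleftrightarrow> (\<exists>k. \<forall>n<k. homog V n = {\<zero>\<^bsub>V\<^esub>})"

definition top_degree :: "('v, 's) graded_scheme \<Rightarrow> int" where
  "top_degree V = Max {n. \<exists>x\<in>homog V n. x \<noteq> \<zero>\<^bsub>V\<^esub>}"

definition F2 :: "bit graded" where
  "F2 = \<lparr>carrier = UNIV, monoid.mult = (*), one = 1, ring.zero = 0, ring.add = (+),
         homog = (\<lambda>n. if n = 0 then UNIV else {0})\<rparr>"

definition scale2 :: "('v, 's) ring_scheme \<Rightarrow> bit \<Rightarrow> 'v \<Rightarrow> 'v" where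
  "scale2 V c x = (if c = 1 then x else \<zero>\<^bsub>V\<^esub>)"


section \<open>Tensor products\<close>

text \<open>
  The tensor product is the quotient of the vector space with basis
  \<^term>\<open>carrier V \<times> carrier W\<close> by the bilinearity relations.
\<close>

definition tensor_relations ::
    "('v, 's) ring_scheme \<Rightarrow> ('w, 't) ring_scheme \<Rightarrow> (('v \<times> 'w) \<Rightarrow>\<^sub>0 bit) set" where
  "tensor_relations V W = group_closure
    ({Poly_Mapping.single (x \<oplus>\<^bsub>V\<^esub> x', y) 1 - Poly_Mapping.single (x, y) 1
        - Poly_Mapping.single (x', y) 1 | x x' y.
        x \<in> carrier V \<and> x' \<in> carrier V \<and> y \<in> carrier W} \<union>
     {Poly_Mapping.single (x, y \<oplus>\<^bsub>W\<^esub> y') 1 - Poly_Mapping.single (x, y) 1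
        - Poly_Mapping.single (x, y') 1 | x y y'.
        x \<in> carrier V \<and> y \<in> carrier W \<and> y' \<in> carrier W})"

definition tensor_class ::
    "('v, 's) ring_scheme \<Rightarrow> ('w, 't) ring_scheme \<Rightarrow> (('v \<times> 'w) \<Rightarrow>\<^sub>0 bit) \<Rightarrow>
     (('v \<times> 'w) \<Rightarrow>\<^sub>0 bit) set" where
  "tensor_class V W p = {p + r | r. r \<in> tensor_relations V W}"

definition tens ::
    "('v, 's) ring_scheme \<Rightarrow> ('w, 't) ring_scheme \<Rightarrow> 'v \<Rightarrow> 'w \<Rightarrow> (('v \<times> 'w) \<Rightarrow>\<^sub>0 bit) set" where
  "tens V W x y = tensor_class V W (Poly_Mapping.single (x, y) 1)"

text \<open>
  The multiplication is \<open>(v \<otimes> w)(v' \<otimes> w') = vv' \<otimes> ww'\<close>; it is meaningful if both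
  factors are algebras.
\<close>

definition tensor ::
    "('v, 's) graded_scheme \<Rightarrow> ('w, 't) graded_scheme \<Rightarrow> (('v \<times> 'w) \<Rightarrow>\<^sub>0 bit) set graded" where
  "tensor V W =
    \<lparr>carrier = tensor_class V W ` {p. Poly_Mapping.keys p \<subseteq> carrier V \<times> carrier W},
     monoid.mult = (\<lambda>T T'. the_elem {tensor_class V W
        (sum (\<lambda>(v, w). sum (\<lambda>(v', w').
             Poly_Mapping.single (v \<otimes>\<^bsub>V\<^esub> v', w \<otimes>\<^bsub>W\<^esub> w') 1)
           (Poly_Mapping.keys p')) (Poly_Mapping.keys p)) | p p'. p \<in> T \<and> p' \<in> T'}),
     one = tens V W \<one>\<^bsub>V\<^esub> \<one>\<^bsub>W\<^esub>,
     ring.zero = tensor_class V W 0,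
     ring.add = (\<lambda>T T'. {p + p' | p p'. p \<in> T \<and> p' \<in> T'}),
     homog = (\<lambda>n. tensor_class V W `
        {p. Poly_Mapping.keys p \<subseteq> (\<Union>i. homog V i \<times> homog W (n - i))})\<rparr>"

text \<open>The linear map on a tensor product with values in \<open>Z\<close> induced by a bilinear map \<open>b\<close>.\<close>

definition tensor_lift ::
    "('z, 's) ring_scheme \<Rightarrow> ('v \<Rightarrow> 'w \<Rightarrow> 'z) \<Rightarrow> (('v \<times> 'w) \<Rightarrow>\<^sub>0 bit) set \<Rightarrow> 'z" where
  "tensor_lift Z b T = the_elem ((\<lambda>p. finsum Z (\<lambda>(v, w). b v w) (Poly_Mapping.keys p)) ` T)"

definition tensor_map ::
    "('v', 's) graded_scheme \<Rightarrow> ('w', 't) graded_scheme \<Rightarrow> ('v \<Rightarrow> 'v') \<Rightarrow> ('w \<Rightarrow> 'w') \<Rightarrow>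
     (('v \<times> 'w) \<Rightarrow>\<^sub>0 bit) set \<Rightarrow> (('v' \<times> 'w') \<Rightarrow>\<^sub>0 bit) set" where
  "tensor_map V' W' f g = tensor_lift (tensor V' W') (\<lambda>v w. tens V' W' (f v) (g w))"


section \<open>Graded Hopf algebras\<close>

record 'a hopf = "'a graded" +
  counit :: "'a \<Rightarrow> bit"
  coprod :: "'a \<Rightarrow> (('a \<times> 'a) \<Rightarrow>\<^sub>0 bit) set"

definition tensor_assoc ::
    "('a, 's) graded_scheme \<Rightarrow> (((('a \<times> 'a) \<Rightarrow>\<^sub>0 bit) set \<times> 'a) \<Rightarrow>\<^sub>0 bit) set \<Rightarrow>
     (('a \<times> (('a \<times> 'a) \<Rightarrow>\<^sub>0 bit) set) \<Rightarrow>\<^sub>0 bit) set" where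
  "tensor_assoc A =
     tensor_lift (tensor A (tensor A A))
       (\<lambda>T c. tensor_lift (tensor A (tensor A A))
          (\<lambda>a b. tens A (tensor A A) a (tens A A b c)) T)"

locale hopf_algebra = graded_space A + ring A for A :: "'a hopf" (structure) +
  assumes one_homog: "\<one> \<in> homog A 0"
    and mult_homog: "\<lbrakk>a \<in> homog A i; b \<in> homog A j\<rbrakk> \<Longrightarrow> a \<otimes> b \<in> homog A (i + j)"
    and counit_graded: "counit A \<in> graded_maps A F2"
    and counit_ring_hom: "counit A \<in> ring_hom A F2"
    and coprod_graded: "coprod A \<in> graded_maps A (tensor A A)"
    and coprod_ring_hom: "coprod A \<in> ring_hom A (tensor A A)"
    and coassociative: "a \<in> carrier A \<Longrightarrow>
      tensor_assoc A (tensor_map (tensor A A) A (coprod A) id (coprod A a)) =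
      tensor_map A (tensor A A) id (coprod A) (coprod A a)"
    and counit_left: "a \<in> carrier A \<Longrightarrow>
      tensor_lift A (\<lambda>x y. scale2 A (counit A x) y) (coprod A a) = a"
    and counit_right: "a \<in> carrier A \<Longrightarrow>
      tensor_lift A (\<lambda>x y. scale2 A (counit A y) x) (coprod A a) = a"
    and antipode: "\<exists>S \<in> graded_maps A A. \<forall>a\<in>carrier A.
      tensor_lift A (\<lambda>x y. S x \<otimes> y) (coprod A a) = scale2 A (counit A a) \<one> \<and>
      tensor_lift A (\<lambda>x y. x \<otimes> S y) (coprod A a) = scale2 A (counit A a) \<one>"

definition connected_hopf :: "'a hopf \<Rightarrow> bool" where
  "connected_hopf A \<longleftrightarrow>
     (\<forall>n<0. homog A n = {\<zero>\<^bsub>A\<^esub>}) \<and> homog A 0 = {\<zero>\<^bsub>A\<^esub>, \<one>\<^bsub>A\<^esub>}"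

definition cocommutative :: "'a hopf \<Rightarrow> bool" where
  "cocommutative A \<longleftrightarrow> (\<forall>a\<in>carrier A.
     tensor_lift (tensor A A) (\<lambda>x y. tens A A y x) (coprod A a) = coprod A a)"

definition aug_ideal :: "'a hopf \<Rightarrow> 'a set" where
  "aug_ideal A = {a \<in> carrier A. counit A a = 0}"

subsection \<open>Hopf subalgebras and quotients\<close>

text \<open>
  A Hopf subalgebra is given by its underlying set \<open>B\<close>.  The tensor square of \<open>B\<close> consists of
  cosets different from those of the tensor square of \<open>A\<close>, so the restricted coproduct is the
  unique lift along the inclusion of tensor squares.
\<close>

definition sub_graded :: "'a hopf \<Rightarrow> 'a set \<Rightarrow> 'a hopf" where
  "sub_graded A B = A\<lparr>carrier := B, homog := (\<lambda>n. homog A n \<inter> B)\<rparr>"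

definition sub_hopf :: "'a hopf \<Rightarrow> 'a set \<Rightarrow> 'a hopf" where
  "sub_hopf A B = (sub_graded A B)\<lparr>coprod := (\<lambda>b. THE t.
     t \<in> carrier (tensor (sub_graded A B) (sub_graded A B)) \<and>
     tensor_map A A id id t = coprod A b)\<rparr>"

definition hopf_subalgebra :: "'a set \<Rightarrow> 'a hopf \<Rightarrow> bool" where
  "hopf_subalgebra B A \<longleftrightarrow> subring B A \<and>
     (\<forall>b\<in>B. coprod A b \<in>
        tensor_map A A id id ` carrier (tensor (sub_graded A B) (sub_graded A B))) \<and>
     hopf_algebra (sub_hopf A B)"

definition left_aug :: "'a hopf \<Rightarrow> 'a set \<Rightarrow> 'a set" where
  "left_aug A B = generate (add_monoid A)
     {a \<otimes>\<^bsub>A\<^esub> b | a b. a \<in> carrier A \<and> b \<in> aug_ideal (sub_hopf A B)}"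

definition right_aug :: "'a hopf \<Rightarrow> 'a set \<Rightarrow> 'a set" where
  "right_aug A B = generate (add_monoid A)
     {b \<otimes>\<^bsub>A\<^esub> a | a b. a \<in> carrier A \<and> b \<in> aug_ideal (sub_hopf A B)}"

definition normal_hopf_subalgebra :: "'a set \<Rightarrow> 'a hopf \<Rightarrow> bool" where
  "normal_hopf_subalgebra B A \<longleftrightarrow> hopf_subalgebra B A \<and> left_aug A B = right_aug A B"

text \<open>
  \<open>A \<otimes>\<^sub>B \<bbbF>\<close> is the quotient of \<open>A\<close> by the left ideal generated by the augmentation ideal
  of \<open>B\<close>, which for normal \<open>B\<close> is a two-sided ideal.
\<close>

definition quot_map :: "'a hopf \<Rightarrow> 'a set \<Rightarrow> 'a \<Rightarrow> 'a set" where
  "quot_map A B a = left_aug A B +>\<^bsub>A\<^esub> a"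

definition quot_graded :: "'a hopf \<Rightarrow> 'a set \<Rightarrow> 'a set graded" where
  "quot_graded A B = ring.extend (A Quot left_aug A B)
     (graded.fields (\<lambda>n. quot_map A B ` homog A n))"

definition quot_hopf :: "'a hopf \<Rightarrow> 'a set \<Rightarrow> 'a set hopf" where
  "quot_hopf A B = graded.extend (quot_graded A B)
     (hopf.fields
        (\<lambda>T. the_elem (counit A ` T))
        (\<lambda>T. the_elem ((\<lambda>a. tensor_map (quot_graded A B) (quot_graded A B)
           (quot_map A B) (quot_map A B) (coprod A a)) ` T)))"

subsection \<open>Duals and exterior algebras\<close>

text \<open>Linear functionals are normalised to be zero outside the carrier, so that they are determined by
  their values on it.\<close>

definition dual_algebra :: "'a hopf \<Rightarrow> ('a \<Rightarrow> bit) graded" where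
  "dual_algebra H =
    \<lparr>carrier = {f \<in> linear_maps H F2. \<forall>a. a \<notin> carrier H \<longrightarrow> f a = 0},
     monoid.mult = (\<lambda>f g a. if a \<in> carrier H
        then tensor_lift F2 (\<lambda>x y. f x * g y) (coprod H a) else 0),
     one = (\<lambda>a. if a \<in> carrier H then counit H a else 0),
     ring.zero = (\<lambda>a. 0),
     ring.add = (\<lambda>f g a. f a + g a),
     homog = (\<lambda>n. {f \<in> linear_maps H F2. (\<forall>a. a \<notin> carrier H \<longrightarrow> f a = 0) \<and>
        (\<forall>m. m \<noteq> n \<longrightarrow> (\<forall>a\<in>homog H m. f a = 0))})\<rparr>"

text \<open>\<open>D = E(\<tau>)\<close>: the elements \<open>1, \<tau>\<close> form a basis of \<open>D\<close>, and \<open>\<tau>\<^sup>2 = 0\<close>.\<close>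

definition exterior_on :: "('a, 's) ring_scheme \<Rightarrow> 'a \<Rightarrow> bool" where
  "exterior_on D \<tau> \<longleftrightarrow>
     carrier D = {\<zero>\<^bsub>D\<^esub>, \<one>\<^bsub>D\<^esub>, \<tau>, \<one>\<^bsub>D\<^esub> \<oplus>\<^bsub>D\<^esub> \<tau>} \<and>
     distinct [\<zero>\<^bsub>D\<^esub>, \<one>\<^bsub>D\<^esub>, \<tau>, \<one>\<^bsub>D\<^esub> \<oplus>\<^bsub>D\<^esub> \<tau>] \<and>
     \<tau> \<otimes>\<^bsub>D\<^esub> \<tau> = \<zero>\<^bsub>D\<^esub>"


section \<open>The cobar complex and Ext\<close>

text \<open>
  For finite dimensional \<open>A\<close>, the \<open>s\<close>-fold tensor power of the augmentation ideal of the dual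
  of \<open>A\<close> is the space of multilinear functionals on \<open>s\<close>-tuples from the augmentation ideal of
  \<open>A\<close>, and \<open>[x\<^sub>1|\<dots>|x\<^sub>s]\<close> is \<open>(a\<^sub>1, \<dots>, a\<^sub>s) \<mapsto> x\<^sub>1(a\<^sub>1) \<cdots> x\<^sub>s(a\<^sub>s)\<close>.  In this form the
  cobar differential is dual to multiplying adjacent entries, and the cobar product is
  concatenation.  An element of the total complex, the direct sum over \<open>s\<close>, is a function on
  lists that vanishes on all long lists; internal degrees are the degrees of functionals.
\<close>

definition cobar :: "'a hopf \<Rightarrow> ('a list \<Rightarrow> bit) ring" where
  "cobar A =
    \<lparr>carrier = {f.
       (\<forall>xs. \<not> set xs \<subseteq> aug_ideal A \<longrightarrow> f xs = 0) \<and>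
       (\<forall>us x y vs. set (us @ x # y # vs) \<subseteq> aug_ideal A \<longrightarrow>
          f (us @ (x \<oplus>\<^bsub>A\<^esub> y) # vs) = f (us @ x # vs) + f (us @ y # vs)) \<and>
       (\<exists>N. \<forall>xs. length xs > N \<longrightarrow> f xs = 0)},
     monoid.mult = (\<lambda>f g xs. \<Sum>i\<le>length xs. f (take i xs) * g (drop i xs)),
     one = (\<lambda>xs. if xs = [] then 1 else 0),
     ring.zero = (\<lambda>xs. 0),
     ring.add = (\<lambda>f g xs. f xs + g xs)\<rparr>"

definition cobar_diff :: "'a hopf \<Rightarrow> ('a list \<Rightarrow> bit) \<Rightarrow> 'a list \<Rightarrow> bit" where
  "cobar_diff A f xs = (if set xs \<subseteq> aug_ideal A
     then \<Sum>i | Suc i < length xs.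
            f (take i xs @ (xs ! i \<otimes>\<^bsub>A\<^esub> xs ! Suc i) # drop (Suc (Suc i)) xs)
     else 0)"

definition cocycles :: "'a hopf \<Rightarrow> ('a list \<Rightarrow> bit) set" where
  "cocycles A = {f \<in> carrier (cobar A). cobar_diff A f = \<zero>\<^bsub>cobar A\<^esub>}"

definition coboundaries :: "'a hopf \<Rightarrow> ('a list \<Rightarrow> bit) set" where
  "coboundaries A = cobar_diff A ` carrier (cobar A)"

text \<open>The algebra \<open>Ext\<^sub>A(\<bbbF>, \<bbbF>)\<close>, as the direct sum of all its bidegrees.\<close>

definition Ext :: "'a hopf \<Rightarrow> ('a list \<Rightarrow> bit) set ring" where
  "Ext A = (cobar A)\<lparr>carrier := cocycles A\<rparr> Quot coboundaries A"

definition Ext_class :: "'a hopf \<Rightarrow> ('a list \<Rightarrow> bit) \<Rightarrow> ('a list \<Rightarrow> bit) set" where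
  "Ext_class A f = coboundaries A +>\<^bsub>cobar A\<^esub> f"

definition cobar_single :: "'a hopf \<Rightarrow> ('a \<Rightarrow> bit) \<Rightarrow> 'a list \<Rightarrow> bit" where
  "cobar_single A x xs =
     (if set xs \<subseteq> aug_ideal A \<and> length xs = 1 then x (hd xs) else 0)"

text \<open>The map on Ext induced by a homomorphism \<open>\<pi>\<close> with source \<open>A\<close>.\<close>

definition Ext_map ::
    "'a hopf \<Rightarrow> ('a \<Rightarrow> 'c) \<Rightarrow> ('c list \<Rightarrow> bit) set \<Rightarrow> ('a list \<Rightarrow> bit) set" where
  "Ext_map A \<pi> T = (\<Union>f\<in>T. Ext_class A
     (\<lambda>xs. if set xs \<subseteq> aug_ideal A then f (map \<pi> xs) else 0))"

text \<open>For \<open>\<tau>\<close> of degree \<open>d\<close> in the dual of the quotient, \<open>[\<tau>]\<close> has bidegree \<open>(1, d)\<close>.\<close>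

definition theta :: "'a hopf \<Rightarrow> 'a set \<Rightarrow> ('a set \<Rightarrow> bit) \<Rightarrow> ('a list \<Rightarrow> bit) set" where
  "theta A B \<tau> = Ext_map A (quot_map A B)
     (Ext_class (quot_hopf A B) (cobar_single (quot_hopf A B) \<tau>))"


section \<open>Modules and the stable category\<close>

record ('a, 'm) gmod = "'m graded" +
  act :: "'a \<Rightarrow> 'm \<Rightarrow> 'm"

text \<open>
  Since only the action of elements of \<^term>\<open>carrier A\<close> matters, an
  \<open>A\<close>-module is also, as it stands, a module over each Hopf subalgebra of \<open>A\<close>.
\<close>

locale gmodule = graded_space M for A :: "'a hopf" and M :: "('a, 'm) gmod" (structure) +
  assumes act_closed: "\<lbrakk>a \<in> carrier A; x \<in> carrier M\<rbrakk> \<Longrightarrow> act M a x \<in> carrier M"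
    and act_add_left: "\<lbrakk>a \<in> carrier A; b \<in> carrier A; x \<in> carrier M\<rbrakk> \<Longrightarrow>
      act M (a \<oplus>\<^bsub>A\<^esub> b) x = act M a x \<oplus> act M b x"
    and act_add_right: "\<lbrakk>a \<in> carrier A; x \<in> carrier M; y \<in> carrier M\<rbrakk> \<Longrightarrow>
      act M a (x \<oplus> y) = act M a x \<oplus> act M a y"
    and act_mult: "\<lbrakk>a \<in> carrier A; b \<in> carrier A; x \<in> carrier M\<rbrakk> \<Longrightarrow>
      act M (a \<otimes>\<^bsub>A\<^esub> b) x = act M a (act M b x)"
    and act_one: "x \<in> carrier M \<Longrightarrow> act M \<one>\<^bsub>A\<^esub> x = x"
    and act_homog: "\<lbrakk>a \<in> homog A i; x \<in> homog M j\<rbrakk> \<Longrightarrow> act M a x \<in> homog M (i + j)"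
    and bounded_below: "bounded_below M"

definition mod_hom :: "'a hopf \<Rightarrow> ('a, 'm) gmod \<Rightarrow> ('a, 'n) gmod \<Rightarrow> ('m \<Rightarrow> 'n) set" where
  "mod_hom A M N = {f \<in> graded_maps M N.
     \<forall>a\<in>carrier A. \<forall>x\<in>carrier M. f (act M a x) = act N a (f x)}"

definition mod_iso :: "'a hopf \<Rightarrow> ('a, 'm) gmod \<Rightarrow> ('a, 'n) gmod \<Rightarrow> bool" where
  "mod_iso A M N \<longleftrightarrow> (\<exists>f\<in>mod_hom A M N. \<exists>g\<in>mod_hom A N M.
     (\<forall>x\<in>carrier M. g (f x) = x) \<and> (\<forall>y\<in>carrier N. f (g y) = y))"

definition unit_mod :: "'a hopf \<Rightarrow> ('a, bit) gmod" where
  "unit_mod A = graded.extend F2 (gmod.fields (\<lambda>a x. counit A a * x))"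

definition tensor_mod ::
    "'a hopf \<Rightarrow> ('a, 'm) gmod \<Rightarrow> ('a, 'n) gmod \<Rightarrow> ('a, (('m \<times> 'n) \<Rightarrow>\<^sub>0 bit) set) gmod" where
  "tensor_mod A M N = graded.extend (tensor M N)
     (gmod.fields (\<lambda>a T. tensor_lift (tensor M N)
        (\<lambda>a' a''. tensor_map M N (act M a') (act N a'') T) (coprod A a)))"

text \<open>
  An infinite type \<open>'u\<close> serves as the universe: the category \<open>Mod(A)\<close> consists of the modules
  whose carriers are sets of elements of \<open>'u\<close>.  For finite dimensional \<open>A\<close> this is closed, up to
  isomorphism, under tensor products and under free covers; tensor products are moved back into
  the universe along an isomorphism of modules.
\<close>

definition in_universe :: "'a hopf \<Rightarrow> ('a, 'm) gmod \<Rightarrow> ('a, 'u::infinite) gmod" where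
  "in_universe A M = (SOME N. gmodule A N \<and> mod_iso A M N)"

definition tens_obj ::
    "'a hopf \<Rightarrow> ('a, 'u::infinite) gmod \<Rightarrow> ('a, 'u) gmod \<Rightarrow> ('a, 'u) gmod" where
  "tens_obj A M N = in_universe A (tensor_mod A M N)"

definition unit_obj :: "'a hopf \<Rightarrow> ('a, 'u::infinite) gmod" where
  "unit_obj A = in_universe A (unit_mod A)"

definition projective :: "'a hopf \<Rightarrow> ('a, 'u::infinite) gmod \<Rightarrow> bool" where
  "projective A P \<longleftrightarrow> gmodule A P \<and>
     (\<forall>(M::('a, 'u) gmod) (N::('a, 'u) gmod). \<forall>e\<in>mod_hom A M N. \<forall>f\<in>mod_hom A P N.
        gmodule A M \<and> gmodule A N \<and> e ` carrier M = carrier N \<longrightarrow>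
        (\<exists>g\<in>mod_hom A P M. \<forall>x\<in>carrier P. e (g x) = f x))"

text \<open>Equality of the morphisms of \<open>St(A)\<close> represented by \<open>f\<close> and \<open>g\<close>.\<close>

definition stable_eq ::
    "'a hopf \<Rightarrow> ('a, 'u::infinite) gmod \<Rightarrow> ('a, 'u) gmod \<Rightarrow> ('u \<Rightarrow> 'u) \<Rightarrow> ('u \<Rightarrow> 'u) \<Rightarrow> bool" where
  "stable_eq A M N f g \<longleftrightarrow> (\<exists>P::('a, 'u) gmod. projective A P \<and>
     (\<exists>h\<in>mod_hom A M P. \<exists>k\<in>mod_hom A P N. \<forall>x\<in>carrier M. f x \<ominus>\<^bsub>N\<^esub> g x = k (h x)))"

definition stable_iso :: "'a hopf \<Rightarrow> ('a, 'u::infinite) gmod \<Rightarrow> ('a, 'u) gmod \<Rightarrow> bool" where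
  "stable_iso A M N \<longleftrightarrow> (\<exists>f\<in>mod_hom A M N. \<exists>g\<in>mod_hom A N M.
     stable_eq A M M (g \<circ> f) id \<and> stable_eq A N N (f \<circ> g) id)"


section \<open>Picard groups\<close>

definition stable_class :: "'a hopf \<Rightarrow> ('a, 'u::infinite) gmod \<Rightarrow> ('a, 'u) gmod set" where
  "stable_class A M = {N. gmodule A N \<and> stable_iso A M N}"

definition invertible_obj :: "'a hopf \<Rightarrow> ('a, 'u::infinite) gmod \<Rightarrow> bool" where
  "invertible_obj A M \<longleftrightarrow> gmodule A M \<and>
     (\<exists>N. gmodule A N \<and> stable_iso A (tens_obj A M N) (unit_obj A))"

definition Pic :: "'a hopf \<Rightarrow> ('a, 'u::infinite) gmod set monoid" where
  "Pic A =
    \<lparr>carrier = {stable_class A M | M. invertible_obj A M},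
     monoid.mult = (\<lambda>T T'. \<Union>M\<in>T. \<Union>N\<in>T'. stable_class A (tens_obj A M N)),
     one = stable_class A (unit_obj A)\<rparr>"

definition Pic_restrict ::
    "'a hopf \<Rightarrow> 'a set \<Rightarrow> ('a, 'u::infinite) gmod set \<Rightarrow> ('a, 'u) gmod set" where
  "Pic_restrict A B T = (\<Union>M\<in>T. stable_class (sub_hopf A B) M)"

definition rel_Pic :: "'a hopf \<Rightarrow> 'a set \<Rightarrow> ('a, 'u::infinite) gmod set monoid" where
  "rel_Pic A B =
     (Pic A)\<lparr>carrier := kernel (Pic A) (Pic (sub_hopf A B)) (Pic_restrict A B)\<rparr>"

end

theory Submission
  imports Defs
begin

text \<open>
  Let \<open>\<lambda>\<close> be the nonzero element of top degree \<open>|A|\<close>.  It spans the socle of \<open>A\<close> (\<open>socle\<close>), and a bounded below module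
  is free, equivalently projective, if and only if every element killed by \<open>\<lambda>\<close> lies in the span of the augmentation
  ideal (\<open>free_if_socle_exact\<close>, \<open>projective_if_socle_exact\<close>, \<open>socle_exact_if_projective\<close>).  If \<open>|A| > 0\<close>, it follows that a
  module is stably isomorphic to the unit if and only if it is the sum of a trivial module in degree \<open>0\<close> and a free one
  (\<open>stably_unit_if_stable_iso\<close>, \<open>stable_iso_if_stably_unit\<close>).  This property of modules is closed under tensor products
  (\<open>stably_unit_tensor\<close>) and restricts to \<open>B\<close>.  An element of \<open>Pic(A, B)\<close> is the class of an \<open>A\<close>-module \<open>M\<close> which over \<open>B\<close>
  is a sum of a trivial module, spanned by \<open>m\<^sub>0\<close>, and a free module \<open>K\<close>; what has to be shown is that \<open>M\<close> splits in this way
  over \<open>A\<close> as well (\<open>stably_unit_descends\<close>).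

  Write \<open>d\<close> for the degree of \<open>\<tau>\<close>.  The functional \<open>\<tau>\<close> acts on \<open>A\<close> as a derivation \<open>D\<close> that vanishes on \<open>B\<close>, and
  \<open>A = B \<oplus> Bx\<close> with \<open>D(x) = 1\<close>.  On \<open>V/I(B)V\<close>, for an \<open>A\<close>-module \<open>V\<close>, the element \<open>x\<close> acts with square zero.  The main
  point is that the homology of this action vanishes if \<open>V\<close> is free over \<open>B\<close> and \<open>\<theta>\<^sup>q = 0\<close> (\<open>homology_vanishes\<close>).
  Indeed, a homology class of degree \<open>e\<close> is detected by an \<open>A\<close>-linear functional \<open>u\<close>, and \<open>\<theta>\<^sup>q u\<close> is a coboundary.  The
  extension of \<open>V\<close> by \<open>\<Sigma>\<^sup>d V\<close> given by \<open>\<theta>\<close> has the free module \<open>A \<otimes>\<^sub>B V\<close> in the middle, so factors \<open>\<theta>\<close> can be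
  cancelled one by one (\<open>descend\<close>), until \<open>\<theta>u\<close> is the coboundary of a functional on \<open>V\<close>.  This is absurd
  on a cycle detected by \<open>u\<close>.  Each cancellation looks at degrees larger by \<open>d\<close>, so for a class of degree \<open>e\<close> it
  suffices that \<open>V\<close> is free over \<open>B\<close> below some degree greater than \<open>e + qd\<close>.

  Applied to \<open>M\<close> this yields an \<open>A\<close>-invariant generator of the trivial summand (\<open>corrected_generator\<close>).  The
  obstruction \<open>x m\<^sub>0\<close> is a \<open>B\<close>-invariant element of \<open>K\<close>, hence \<open>x m\<^sub>0 = \<lambda>\<^sub>B k\<close> with \<open>k\<close> of degree \<open>d - |B|\<close>.  In negative
  degrees \<open>M\<close> agrees with the free module \<open>K\<close>, and \<open>d - |B| + qd < 0\<close> by assumption.  So the class of \<open>k\<close> vanishes,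
  \<open>x m\<^sub>0 = x \<lambda>\<^sub>B k'\<close> for some \<open>k'\<close>, and \<open>m = m\<^sub>0 + \<lambda>\<^sub>B k'\<close> is \<open>A\<close>-invariant.  Applied to \<open>M/m\<close>, which is free over \<open>B\<close> in all degrees,
  it shows that \<open>M/m\<close> is free over \<open>A\<close>; therefore \<open>M\<close> is the sum of a trivial module and a free one.
\<close>

text \<open>
  These rules turn sums and products of bits into exclusive disjunctions and conjunctions, which hides
  linearity from the simplifier.
\<close>

declare add_bit_eq_xor [simp del] mult_bit_eq_and [simp del]

section \<open>Boolean groups\<close>

locale boolean_group = abelian_group V for V :: "('v, 's) ring_scheme" (structure) +
  assumes add_self: "x \<in> carrier V \<Longrightarrow> x \<oplus> x = \<zero>"

sublocale graded_space \<subseteq> boolean_group V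
  by unfold_locales (rule char2)

definition bool_subspace :: "('v, 's) ring_scheme \<Rightarrow> 'v set \<Rightarrow> bool" where
  "bool_subspace V U \<longleftrightarrow> U \<subseteq> carrier V \<and> \<zero>\<^bsub>V\<^esub> \<in> U \<and> (\<forall>x\<in>U. \<forall>y\<in>U. x \<oplus>\<^bsub>V\<^esub> y \<in> U)"

context boolean_group
begin

lemma uminus_self [simp]: "x \<in> carrier V \<Longrightarrow> \<ominus> x = x"
  using add_self minus_equality by blast

lemma minus_self: "x \<in> carrier V \<Longrightarrow> y \<in> carrier V \<Longrightarrow> x \<ominus> y = x \<oplus> y"
  by (simp add: minus_eq)

lemma add_cancel_left: "x \<in> carrier V \<Longrightarrow> y \<in> carrier V \<Longrightarrow> x \<oplus> (x \<oplus> y) = y"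
  by (metis a_assoc add_self l_zero)

lemma add_eq_zero_iff: "x \<in> carrier V \<Longrightarrow> y \<in> carrier V \<Longrightarrow> x \<oplus> y = \<zero> \<longleftrightarrow> x = y"
  by (metis add_cancel_left add_self r_zero)

lemma bool_subspace_imp_subgroup: "bool_subspace V U \<Longrightarrow> subgroup U (add_monoid V)"
  unfolding bool_subspace_def
  by (auto intro!: subgroup.intro simp: a_inv_def[symmetric] subsetD)

lemma subgroup_imp_bool_subspace: "subgroup U (add_monoid V) \<Longrightarrow> bool_subspace V U"
  unfolding bool_subspace_def
  using subgroup.subset subgroup.one_closed subgroup.m_closed by fastforce

lemma bool_subspace_finsum:
  assumes "bool_subspace V U" "\<And>i. i \<in> S \<Longrightarrow> f i \<in> U"
  shows "finsum V f S \<in> U"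
  using assms(2)
proof (induct S rule: infinite_finite_induct)
  case (insert i S)
  then have "f \<in> S \<rightarrow> carrier V" "f i \<in> carrier V"
    using assms(1) unfolding bool_subspace_def by auto
  then show ?case
    using insert assms(1) unfolding bool_subspace_def by (simp add: finsum_insert)
qed (use assms(1) in \<open>auto simp: bool_subspace_def finsum_infinite\<close>)

text \<open>
  A subspace that is maximal among those containing \<open>W\<close> and avoiding \<open>x\<close> is a hyperplane,
  because over the field with two elements a vector outside it differs from \<open>x\<close> by an element of it.
\<close>

lemma separating_functional:
  assumes W: "bool_subspace V W" and x: "x \<in> carrier V" "x \<notin> W"
  obtains f :: "_ \<Rightarrow> bit" where
    "\<And>v w. v \<in> carrier V \<Longrightarrow> w \<in> carrier V \<Longrightarrow> f (v \<oplus> w) = f v + f w"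
    "\<And>w. w \<in> W \<Longrightarrow> f w = 0" "f x = 1"
proof -
  define F where "F = {U. bool_subspace V U \<and> W \<subseteq> U \<and> x \<notin> U}"
  have "\<exists>M\<in>F. \<forall>E\<in>F. M \<subseteq> E \<longrightarrow> E = M"
  proof (rule subset_Zorn_nonempty)
    show "F \<noteq> {}" using W x by (auto simp: F_def)
  next
    fix C assume C: "C \<noteq> {}" "subset.chain F C"
    then have sub: "C \<subseteq> F" and ch: "\<And>E Y. E \<in> C \<Longrightarrow> Y \<in> C \<Longrightarrow> E \<subseteq> Y \<or> Y \<subseteq> E"
      by (auto simp: subset_chain_def)
    have "\<And>u v. u \<in> \<Union>C \<Longrightarrow> v \<in> \<Union>C \<Longrightarrow> u \<oplus> v \<in> \<Union>C"
    proof -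
      fix u v assume "u \<in> \<Union>C" "v \<in> \<Union>C"
      then obtain E Y where "E \<in> C" "u \<in> E" "Y \<in> C" "v \<in> Y" by auto
      then obtain Z where "Z \<in> C" "u \<in> Z" "v \<in> Z" using ch by blast
      moreover from \<open>Z \<in> C\<close> have "bool_subspace V Z" using sub by (auto simp: F_def)
      ultimately show "u \<oplus> v \<in> \<Union>C" unfolding bool_subspace_def by blast
    qed
    then show "\<Union>C \<in> F"
      using C(1) sub by (auto simp: F_def bool_subspace_def) blast+
  qed
  then obtain U where U: "bool_subspace V U" "W \<subseteq> U" "x \<notin> U"
    and max: "\<And>E. bool_subspace V E \<Longrightarrow> W \<subseteq> E \<Longrightarrow> x \<notin> E \<Longrightarrow> U \<subseteq> E \<Longrightarrow> E = U"
    by (auto simp: F_def)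
  have Uc: "U \<subseteq> carrier V" "\<zero> \<in> U" "\<And>u v. u \<in> U \<Longrightarrow> v \<in> U \<Longrightarrow> u \<oplus> v \<in> U"
    using U(1) by (auto simp: bool_subspace_def)
  have key: "x \<oplus> v \<in> U" if v: "v \<in> carrier V" "v \<notin> U" for v
  proof -
    define E where "E = U \<union> (\<lambda>u. u \<oplus> v) ` U"
    have eq: "u \<oplus> (u' \<oplus> v) = (u \<oplus> u') \<oplus> v" "(u \<oplus> v) \<oplus> u' = (u \<oplus> u') \<oplus> v"
      "(u \<oplus> v) \<oplus> (u' \<oplus> v) = u \<oplus> u'" if "u \<in> U" "u' \<in> U" for u u'
    proof -
      have c: "u \<in> carrier V" "u' \<in> carrier V" using that Uc by auto
      show "u \<oplus> (u' \<oplus> v) = (u \<oplus> u') \<oplus> v" "(u \<oplus> v) \<oplus> u' = (u \<oplus> u') \<oplus> v"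
        using c v by (simp_all add: a_ac)
      have "(u \<oplus> v) \<oplus> (u' \<oplus> v) = u \<oplus> (v \<oplus> (v \<oplus> u'))"
        using c v by (simp add: a_ac)
      then show "(u \<oplus> v) \<oplus> (u' \<oplus> v) = u \<oplus> u'"
        using c v by (simp add: add_cancel_left)
    qed
    have "bool_subspace V E"
      unfolding bool_subspace_def
    proof (intro conjI ballI)
      show "E \<subseteq> carrier V" using Uc v by (auto simp: E_def)
      show "\<zero> \<in> E" using Uc by (simp add: E_def)
      fix a b assume "a \<in> E" "b \<in> E"
      then show "a \<oplus> b \<in> E" unfolding E_def using eq Uc(3) by (auto simp: image_iff)
    qed
    moreover have "v \<in> E" using Uc v by (force simp: E_def)
    ultimately have "x \<in> E" using max[of E] U v by (auto simp: E_def)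
    then obtain u where "u \<in> U" "x = u \<oplus> v" using U(3) by (auto simp: E_def)
    then show ?thesis using Uc v by (metis a_assoc add_self r_zero subsetD)
  qed
  define f :: "_ \<Rightarrow> bit" where "f v = (if v \<in> U then 0 else 1)" for v
  show thesis
  proof
    show "f x = 1" "\<And>w. w \<in> W \<Longrightarrow> f w = 0" using U by (auto simp: f_def)
    fix v w assume vw: "v \<in> carrier V" "w \<in> carrier V"
    have 1: "v \<oplus> w \<in> U" if "v \<notin> U" "w \<notin> U"
    proof -
      have "(x \<oplus> v) \<oplus> (x \<oplus> w) = x \<oplus> (x \<oplus> (v \<oplus> w))" using x vw by (simp add: a_ac)
      moreover have "(x \<oplus> v) \<oplus> (x \<oplus> w) \<in> U"
        using key that vw by (blast intro: Uc(3))
      ultimately show ?thesis using vw x(1) by (simp add: add_cancel_left)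
    qed
    have 2: "w \<in> U" if "v \<in> U" "v \<oplus> w \<in> U"
      using Uc(3)[OF that] vw by (simp add: add_cancel_left)
    have 3: "v \<in> U" if "w \<in> U" "v \<oplus> w \<in> U"
      using Uc(3)[OF that] vw by (metis a_comm add_cancel_left)
    show "f (v \<oplus> w) = f v + f w"
      using 1 2 3 Uc(3)[of v w] by (cases "v \<in> U"; cases "w \<in> U"; cases "v \<oplus> w \<in> U") (simp_all add: f_def)
  qed
qed

lemma finsum_sym_diff:
  assumes "finite S" "finite T" "\<And>i. i \<in> S \<union> T \<Longrightarrow> f i \<in> carrier V"
  shows "finsum V f ((S - T) \<union> (T - S)) = finsum V f S \<oplus> finsum V f T"
proof -
  have S: "finsum V f S = finsum V f (S - T) \<oplus> finsum V f (S \<inter> T)"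
    using assms finsum_Un_disjoint[of "S - T" "S \<inter> T" f] by (auto simp: Un_Diff_Int)
  have T: "finsum V f T = finsum V f (T - S) \<oplus> finsum V f (S \<inter> T)"
    using assms finsum_Un_disjoint[of "T - S" "T \<inter> S" f] by (auto simp: Un_Diff_Int Int_commute[of S T])
  have c: "finsum V f (S - T) \<in> carrier V" "finsum V f (T - S) \<in> carrier V"
    "finsum V f (S \<inter> T) \<in> carrier V"
    using assms by (auto intro!: finsum_closed)
  have "finsum V f ((S - T) \<union> (T - S)) = finsum V f (S - T) \<oplus> finsum V f (T - S)"
    using assms by (intro finsum_Un_disjoint) auto
  also have "\<dots> = finsum V f S \<oplus> finsum V f T"
    unfolding S T using c by (metis a_assoc a_comm add_self r_zero a_closed)
  finally show ?thesis .
qed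

lemma finsum_support:
  assumes "finite S" "{i\<in>S. f i \<noteq> \<zero>} \<subseteq> T" "T \<subseteq> S" "\<And>i. i \<in> S \<Longrightarrow> f i \<in> carrier V"
  shows "finsum V f T = finsum V f S"
  using assms by (intro add.finprod_mono_neutral_cong_left) auto

end

lemma linear_maps_iff:
  "f \<in> linear_maps V W \<longleftrightarrow> (\<forall>x\<in>carrier V. f x \<in> carrier W) \<and>
    (\<forall>x\<in>carrier V. \<forall>y\<in>carrier V. f (x \<oplus>\<^bsub>V\<^esub> y) = f x \<oplus>\<^bsub>W\<^esub> f y)"
  by (auto simp: linear_maps_def hom_def)

lemma linear_maps_closed: "f \<in> linear_maps V W \<Longrightarrow> x \<in> carrier V \<Longrightarrow> f x \<in> carrier W"
  by (simp add: linear_maps_iff)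

lemma linear_maps_add:
  "f \<in> linear_maps V W \<Longrightarrow> x \<in> carrier V \<Longrightarrow> y \<in> carrier V \<Longrightarrow>
    f (x \<oplus>\<^bsub>V\<^esub> y) = f x \<oplus>\<^bsub>W\<^esub> f y"
  by (simp add: linear_maps_iff)

lemma linear_maps_zero:
  assumes "boolean_group V" "boolean_group W" "f \<in> linear_maps V W"
  shows "f \<zero>\<^bsub>V\<^esub> = \<zero>\<^bsub>W\<^esub>"
proof -
  interpret V: boolean_group V by fact
  interpret W: boolean_group W by fact
  have "f (\<zero>\<^bsub>V\<^esub> \<oplus>\<^bsub>V\<^esub> \<zero>\<^bsub>V\<^esub>) = f \<zero>\<^bsub>V\<^esub> \<oplus>\<^bsub>W\<^esub> f \<zero>\<^bsub>V\<^esub>"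
    by (rule linear_maps_add[OF assms(3)]) simp_all
  then show ?thesis using linear_maps_closed[OF assms(3) V.zero_closed]
    by (simp add: W.add_self)
qed

lemma linear_maps_finsum:
  assumes "boolean_group V" "boolean_group W" "f \<in> linear_maps V W" "\<And>i. i \<in> S \<Longrightarrow> g i \<in> carrier V"
  shows "f (finsum V g S) = finsum W (\<lambda>i. f (g i)) S"
proof -
  interpret V: boolean_group V by fact
  interpret W: boolean_group W by fact
  show ?thesis using assms(4)
  proof (induct S rule: infinite_finite_induct)
    case (insert i S)
    then have "g \<in> S \<rightarrow> carrier V" "(\<lambda>i. f (g i)) \<in> S \<rightarrow> carrier W" "g i \<in> carrier V"
      using linear_maps_closed[OF assms(3)] by auto
    then show ?case using insert linear_maps_closed[OF assms(3)] linear_maps_add[OF assms(3)]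
      by (simp add: V.finsum_insert W.finsum_insert)
  qed (use linear_maps_zero[OF assms(1-3)] in simp_all)
qed

lemma F2_simps [simp]:
  "carrier F2 = UNIV" "\<zero>\<^bsub>F2\<^esub> = 0" "\<one>\<^bsub>F2\<^esub> = 1" "x \<oplus>\<^bsub>F2\<^esub> y = x + y" "x \<otimes>\<^bsub>F2\<^esub> y = x * y"
  "homog F2 n = (if n = 0 then UNIV else {0})"
  by (simp_all add: F2_def)

lemma bit_add_self [simp]: "(x::bit) + x = 0"
  by (cases x) auto

lemma bit_eq_if_not_zero: "(x::bit) \<noteq> 0 \<Longrightarrow> x = 1"
  by (cases x) auto

lemma boolean_group_F2: "boolean_group F2"
proof -
  have "abelian_group F2"
  proof (rule abelian_groupI)
    fix x :: bit
    show "\<exists>y\<in>carrier F2. y \<oplus>\<^bsub>F2\<^esub> x = \<zero>\<^bsub>F2\<^esub>" by (intro bexI[of _ x]) auto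
  qed (auto simp: add.assoc add.commute)
  then show ?thesis by (intro boolean_group.intro boolean_group_axioms.intro) auto
qed

lemma finsum_F2: "finite S \<Longrightarrow> finsum F2 f S = sum f S"
proof -
  interpret F: boolean_group F2 by (rule boolean_group_F2)
  show "finite S \<Longrightarrow> ?thesis"
    by (induct S rule: finite_induct) (auto simp: F.finsum_insert)
qed

lemma scale2_simps [simp]: "scale2 V 0 x = \<zero>\<^bsub>V\<^esub>" "scale2 V 1 x = x"
  by (simp_all add: scale2_def)

context boolean_group
begin

lemma scale2_closed [simp]: "x \<in> carrier V \<Longrightarrow> scale2 V c x \<in> carrier V"
  by (simp add: scale2_def)

lemma scale2_add_right:
  "x \<in> carrier V \<Longrightarrow> y \<in> carrier V \<Longrightarrow> scale2 V c (x \<oplus> y) = scale2 V c x \<oplus> scale2 V c y"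
  by (simp add: scale2_def)

lemma scale2_add_left:
  "x \<in> carrier V \<Longrightarrow> scale2 V (c + e) x = scale2 V c x \<oplus> scale2 V e x"
  by (cases c; cases e) (auto simp: add_self)

end

section \<open>Graded spaces\<close>

definition component :: "('v, 's) graded_scheme \<Rightarrow> int \<Rightarrow> 'v \<Rightarrow> 'v" where
  "component V n x = (THE c. (\<forall>n. c n \<in> homog V n) \<and> finite {n. c n \<noteq> \<zero>\<^bsub>V\<^esub>} \<and>
     x = finsum V c {n. c n \<noteq> \<zero>\<^bsub>V\<^esub>}) n"

context graded_space
begin

lemma homog_subspace: "bool_subspace V (homog V n)"
  using homog_subgroup subgroup_imp_bool_subspace by blast

lemma homog_closed: "x \<in> homog V n \<Longrightarrow> x \<in> carrier V"
  using homog_subspace by (auto simp: bool_subspace_def)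

lemma homog_zero [simp]: "\<zero> \<in> homog V n"
  using homog_subspace by (auto simp: bool_subspace_def)

lemma homog_add: "x \<in> homog V n \<Longrightarrow> y \<in> homog V n \<Longrightarrow> x \<oplus> y \<in> homog V n"
  using homog_subspace by (auto simp: bool_subspace_def)

lemma comp_all:
  assumes "x \<in> carrier V"
  shows "(\<forall>n. component V n x \<in> homog V n) \<and> finite {n. component V n x \<noteq> \<zero>} \<and>
     x = finsum V (\<lambda>n. component V n x) {n. component V n x \<noteq> \<zero>}"
  using theI'[OF homog_decomposition[OF assms]] unfolding component_def .

lemma comp_homog: "x \<in> carrier V \<Longrightarrow> component V n x \<in> homog V n"
  using comp_all by blast

lemma comp_closed [simp]: "x \<in> carrier V \<Longrightarrow> component V n x \<in> carrier V"
  using comp_homog homog_closed by blast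

lemma comp_finite: "x \<in> carrier V \<Longrightarrow> finite {n. component V n x \<noteq> \<zero>}"
  using comp_all by blast

lemma comp_sum: "x \<in> carrier V \<Longrightarrow> x = finsum V (\<lambda>n. component V n x) {n. component V n x \<noteq> \<zero>}"
  using comp_all by blast

lemma comp_unique:
  assumes "finite S" "\<And>n. c n \<in> homog V n" "\<And>n. n \<notin> S \<Longrightarrow> c n = \<zero>" "x = finsum V c S"
  shows "component V n x = c n"
proof -
  have x: "x \<in> carrier V" using assms homog_closed by (auto intro!: finsum_closed)
  have "finite {n. c n \<noteq> \<zero>}" by (rule finite_subset[OF _ assms(1)]) (use assms(3) in auto)
  moreover have "x = finsum V c {n. c n \<noteq> \<zero>}"
    unfolding assms(4) using assms homog_closed by (intro finsum_support[symmetric]) auto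
  ultimately have "c = (THE c. (\<forall>n. c n \<in> homog V n) \<and> finite {n. c n \<noteq> \<zero>} \<and>
     x = finsum V c {n. c n \<noteq> \<zero>})"
    using the1_equality[OF homog_decomposition[OF x], of c] assms(2) by auto
  then show ?thesis unfolding component_def by simp
qed

lemma comp_of_homog: "x \<in> homog V m \<Longrightarrow> component V n x = (if n = m then x else \<zero>)"
  by (rule comp_unique[where S = "{m}"])
    (auto simp: homog_closed)

lemma comp_zero [simp]: "component V n \<zero> = \<zero>"
  using comp_of_homog[of \<zero> n n] by simp

lemma homog_disjoint: "x \<in> homog V m \<Longrightarrow> x \<in> homog V n \<Longrightarrow> m \<noteq> n \<Longrightarrow> x = \<zero>"
  using comp_of_homog[of x m n] comp_of_homog[of x n n] by simp

lemma comp_add: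
  assumes "x \<in> carrier V" "y \<in> carrier V"
  shows "component V n (x \<oplus> y) = component V n x \<oplus> component V n y"
proof (rule comp_unique)
  let ?S = "{n. component V n x \<noteq> \<zero>} \<union> {n. component V n y \<noteq> \<zero>}"
  show f: "finite ?S" using comp_finite assms by auto
  have "x = finsum V (\<lambda>n. component V n x) ?S"
    by (subst comp_sum[OF assms(1)], rule finsum_support) (use f assms in auto)
  moreover have "y = finsum V (\<lambda>n. component V n y) ?S"
    by (subst comp_sum[OF assms(2)], rule finsum_support) (use f assms in auto)
  ultimately show "x \<oplus> y = (\<Oplus>n\<in>?S. component V n x \<oplus> component V n y)"
    using assms by (subst finsum_addf) auto
qed (use assms comp_homog homog_add in auto)

lemma graded_induct [consumes 1, case_names zero homog add]:
  assumes x: "x \<in> carrier V" and "P \<zero>"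
    and h: "\<And>n x. x \<in> homog V n \<Longrightarrow> P x"
    and a: "\<And>x y. x \<in> carrier V \<Longrightarrow> y \<in> carrier V \<Longrightarrow> P x \<Longrightarrow> P y \<Longrightarrow> P (x \<oplus> y)"
  shows "P x"
proof -
  have "P (finsum V (\<lambda>n. component V n x) S)" if "finite S" for S
    using that
  proof (induct S rule: finite_induct)
    case (insert n S)
    then show ?case using x a h[OF comp_homog[OF x]]
      by (simp add: finsum_insert Pi_def finsum_closed)
  qed (use assms in simp)
  then show ?thesis using comp_sum[OF x] comp_finite[OF x] by metis
qed

lemma eq_zero_if_comps_zero: "x \<in> carrier V \<Longrightarrow> (\<And>n. component V n x = \<zero>) \<Longrightarrow> x = \<zero>"
  using comp_sum[of x] by simp

lemma comp_linear: "component V n \<in> linear_maps V V"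
  by (auto simp: linear_maps_iff comp_add)

end

inductive_set homog_span :: "('v, 's) graded_scheme \<Rightarrow> 'v set" for V where
  zero: "\<zero>\<^bsub>V\<^esub> \<in> homog_span V"
| homog: "x \<in> homog V n \<Longrightarrow> x \<in> homog_span V"
| add: "x \<in> homog_span V \<Longrightarrow> y \<in> homog_span V \<Longrightarrow> x \<oplus>\<^bsub>V\<^esub> y \<in> homog_span V"

text \<open>
  A direct sum decomposition is recognised by its projections, which spares the comparison of
  two finite sums.
\<close>

lemma graded_spaceI:
  fixes V :: "('v, 's) graded_scheme"
  assumes V: "boolean_group V" and sub: "\<And>n. bool_subspace V (homog V n)"
    and span: "\<And>x. x \<in> carrier V \<Longrightarrow> x \<in> homog_span V"
    and P: "\<And>n. P n \<in> linear_maps V V"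
    and P_homog: "\<And>n m x. x \<in> homog V m \<Longrightarrow> P n x = (if n = m then x else \<zero>\<^bsub>V\<^esub>)"
  shows "graded_space V"
proof -
  interpret V: boolean_group V by fact
  have hc: "x \<in> homog V n \<Longrightarrow> x \<in> carrier V" and h0: "\<zero>\<^bsub>V\<^esub> \<in> homog V n" for x n
    using sub[of n] by (auto simp: bool_subspace_def)
  have Pc [simp]: "x \<in> carrier V \<Longrightarrow> P n x \<in> carrier V" for n x
    using linear_maps_closed[OF P] .
  have ex: "x \<in> carrier V \<and> (\<forall>n. P n x \<in> homog V n) \<and>
      (\<exists>S. finite S \<and> (\<forall>n. n \<notin> S \<longrightarrow> P n x = \<zero>\<^bsub>V\<^esub>) \<and> finsum V (\<lambda>n. P n x) S = x)"
    if "x \<in> homog_span V" for x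
    using that
  proof (induct rule: homog_span.induct)
    case zero
    then show ?case using linear_maps_zero[OF V V P] h0 by (auto intro!: exI[of _ "{}"])
  next
    case (homog x n)
    then show ?case using P_homog[OF homog] hc h0 by (auto intro!: exI[of _ "{n}"])
  next
    case (add x y)
    then obtain S T where S: "finite S" "\<forall>n. n \<notin> S \<longrightarrow> P n x = \<zero>\<^bsub>V\<^esub>" "finsum V (\<lambda>n. P n x) S = x"
      and T: "finite T" "\<forall>n. n \<notin> T \<longrightarrow> P n y = \<zero>\<^bsub>V\<^esub>" "finsum V (\<lambda>n. P n y) T = y" by auto
    have xy: "x \<in> carrier V" "y \<in> carrier V" using add by auto
    have eq: "P n (x \<oplus>\<^bsub>V\<^esub> y) = P n x \<oplus>\<^bsub>V\<^esub> P n y" for n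
      using linear_maps_add[OF P] xy by simp
    have "finsum V (\<lambda>n. P n x) (S \<union> T) = x" "finsum V (\<lambda>n. P n y) (S \<union> T) = y"
      by (subst (2) S(3)[symmetric], rule V.finsum_support[symmetric], use S T xy in auto)
        (subst (2) T(3)[symmetric], rule V.finsum_support[symmetric], use S T xy in auto)
    then have "finsum V (\<lambda>n. P n (x \<oplus>\<^bsub>V\<^esub> y)) (S \<union> T) = x \<oplus>\<^bsub>V\<^esub> y"
      unfolding eq using xy by (subst V.finsum_addf) auto
    moreover have "P n (x \<oplus>\<^bsub>V\<^esub> y) \<in> homog V n" for n
      unfolding eq using add sub[of n] by (auto simp: bool_subspace_def)
    moreover have "\<forall>n. n \<notin> S \<union> T \<longrightarrow> P n (x \<oplus>\<^bsub>V\<^esub> y) = \<zero>\<^bsub>V\<^esub>"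
      unfolding eq using S T by auto
    ultimately show ?case using xy S(1) T(1) by (intro conjI exI[of _ "S \<union> T"]) auto
  qed
  show ?thesis
  proof (intro graded_space.intro graded_space_axioms.intro)
    fix x assume x: "x \<in> carrier V"
    from ex[OF span[OF x]] obtain S where S: "finite S" "\<forall>n. n \<notin> S \<longrightarrow> P n x = \<zero>\<^bsub>V\<^esub>"
      "finsum V (\<lambda>n. P n x) S = x" and Ph: "\<forall>n. P n x \<in> homog V n" by auto
    show "\<exists>!c. (\<forall>n. c n \<in> homog V n) \<and> finite {n. c n \<noteq> \<zero>\<^bsub>V\<^esub>} \<and>
        x = (\<Oplus>\<^bsub>V\<^esub>n\<in>{n. c n \<noteq> \<zero>\<^bsub>V\<^esub>}. c n)"
    proof (rule ex1I[of _ "\<lambda>n. P n x"])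
      have "finite {n. P n x \<noteq> \<zero>\<^bsub>V\<^esub>}" by (rule finite_subset[OF _ S(1)]) (use S in auto)
      moreover have "finsum V (\<lambda>n. P n x) {n. P n x \<noteq> \<zero>\<^bsub>V\<^esub>} = finsum V (\<lambda>n. P n x) S"
        by (rule V.finsum_support) (use S x in auto)
      ultimately show "(\<forall>n. P n x \<in> homog V n) \<and> finite {n. P n x \<noteq> \<zero>\<^bsub>V\<^esub>} \<and>
        x = (\<Oplus>\<^bsub>V\<^esub>n\<in>{n. P n x \<noteq> \<zero>\<^bsub>V\<^esub>}. P n x)"
        using Ph S by simp
    next
      fix c assume c: "(\<forall>n. c n \<in> homog V n) \<and> finite {n. c n \<noteq> \<zero>\<^bsub>V\<^esub>} \<and>
        x = (\<Oplus>\<^bsub>V\<^esub>n\<in>{n. c n \<noteq> \<zero>\<^bsub>V\<^esub>}. c n)"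
      show "c = (\<lambda>n. P n x)"
      proof
        fix m
        let ?T = "insert m {n. c n \<noteq> \<zero>\<^bsub>V\<^esub>}"
        have cc: "c n \<in> carrier V" for n using c hc by blast
        have "P m x = finsum V (\<lambda>n. P m (c n)) {n. c n \<noteq> \<zero>\<^bsub>V\<^esub>}"
        proof -
          have "P m (finsum V c {n. c n \<noteq> \<zero>\<^bsub>V\<^esub>}) = finsum V (\<lambda>n. P m (c n)) {n. c n \<noteq> \<zero>\<^bsub>V\<^esub>}"
            by (rule linear_maps_finsum[OF V V P]) (use c hc in blast)
          then show ?thesis using c by metis
        qed
        also have "\<dots> = finsum V (\<lambda>n. if m = n then c n else \<zero>\<^bsub>V\<^esub>) {n. c n \<noteq> \<zero>\<^bsub>V\<^esub>}"
          using c cc by (intro V.finsum_cong') (auto simp: P_homog)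
        also have "\<dots> = finsum V (\<lambda>n. if m = n then c n else \<zero>\<^bsub>V\<^esub>) ?T"
          using c cc by (intro V.finsum_support) auto
        also have "\<dots> = c m"
          using c cc by (subst V.add.finprod_singleton) auto
        finally show "c m = P m x" by simp
      qed
    qed
  qed (use V sub in \<open>auto simp: V.add_self V.bool_subspace_imp_subgroup boolean_group_def\<close>)
qed

section \<open>Tensor products\<close>

definition bilin ::
    "('v, 's) ring_scheme \<Rightarrow> ('w, 't) ring_scheme \<Rightarrow> ('z, 'r) ring_scheme \<Rightarrow> ('v \<Rightarrow> 'w \<Rightarrow> 'z) \<Rightarrow> bool" where
  "bilin V W Z b \<longleftrightarrow> (\<forall>v\<in>carrier V. b v \<in> linear_maps W Z) \<and>
     (\<forall>w\<in>carrier W. (\<lambda>v. b v w) \<in> linear_maps V Z)"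

lemma bilinI:
  assumes "\<And>v w. v \<in> carrier V \<Longrightarrow> w \<in> carrier W \<Longrightarrow> b v w \<in> carrier Z"
    "\<And>v v' w. v \<in> carrier V \<Longrightarrow> v' \<in> carrier V \<Longrightarrow> w \<in> carrier W \<Longrightarrow>
      b (v \<oplus>\<^bsub>V\<^esub> v') w = b v w \<oplus>\<^bsub>Z\<^esub> b v' w"
    "\<And>v w w'. v \<in> carrier V \<Longrightarrow> w \<in> carrier W \<Longrightarrow> w' \<in> carrier W \<Longrightarrow>
      b v (w \<oplus>\<^bsub>W\<^esub> w') = b v w \<oplus>\<^bsub>Z\<^esub> b v w'"
  shows "bilin V W Z b"
  using assms by (auto simp: bilin_def linear_maps_iff)

lemma bilin_closed: "bilin V W Z b \<Longrightarrow> v \<in> carrier V \<Longrightarrow> w \<in> carrier W \<Longrightarrow> b v w \<in> carrier Z"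
  by (auto simp: bilin_def linear_maps_iff)

lemma bilin_add_left: "bilin V W Z b \<Longrightarrow> v \<in> carrier V \<Longrightarrow> v' \<in> carrier V \<Longrightarrow> w \<in> carrier W \<Longrightarrow>
    b (v \<oplus>\<^bsub>V\<^esub> v') w = b v w \<oplus>\<^bsub>Z\<^esub> b v' w"
  by (auto simp: bilin_def linear_maps_iff)

lemma bilin_add_right: "bilin V W Z b \<Longrightarrow> v \<in> carrier V \<Longrightarrow> w \<in> carrier W \<Longrightarrow> w' \<in> carrier W \<Longrightarrow>
    b v (w \<oplus>\<^bsub>W\<^esub> w') = b v w \<oplus>\<^bsub>Z\<^esub> b v w'"
  by (auto simp: bilin_def linear_maps_iff)

lemma pm_bit_add_self [simp]: "(p :: 'x \<Rightarrow>\<^sub>0 bit) + p = 0"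
  by (rule poly_mapping_eqI) (simp add: lookup_add)

lemma pm_bit_minus: "(p :: 'x \<Rightarrow>\<^sub>0 bit) - q = p + q"
proof -
  have "q = - q" using pm_bit_add_self[of q] by (simp add: eq_neg_iff_add_eq_0)
  then show ?thesis by (metis diff_conv_add_uminus)
qed

lemma keys_add_bit:
  "Poly_Mapping.keys ((p :: 'x \<Rightarrow>\<^sub>0 bit) + q) =
    (Poly_Mapping.keys p - Poly_Mapping.keys q) \<union> (Poly_Mapping.keys q - Poly_Mapping.keys p)"
proof -
  have *: "(x::bit) + y \<noteq> 0 \<longleftrightarrow> (x \<noteq> 0 \<and> y = 0) \<or> (y \<noteq> 0 \<and> x = 0)" for x y
    by (cases x; cases y) auto
  show ?thesis by (auto simp: in_keys_iff lookup_add *)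
qed

text \<open>Over the field with two elements a formal linear combination is a finite set of basis vectors.\<close>

lemma pm_bit_induct [consumes 1, case_names zero add]:
  fixes p :: "'x \<Rightarrow>\<^sub>0 bit"
  assumes "Poly_Mapping.keys p \<subseteq> A" "P 0" "\<And>x p. x \<in> A \<Longrightarrow> Poly_Mapping.keys p \<subseteq> A \<Longrightarrow> P p \<Longrightarrow> P (Poly_Mapping.single x 1 + p)"
  shows "P p"
  using assms(1)
proof (induct "card (Poly_Mapping.keys p)" arbitrary: p)
  case 0
  then show ?case using assms(2) by simp
next
  case (Suc n)
  then obtain x where x: "x \<in> Poly_Mapping.keys p" by (metis card.empty ex_in_conv nat.distinct(1))
  define q where "q = Poly_Mapping.single x 1 + p"
  have k: "Poly_Mapping.keys q = Poly_Mapping.keys p - {x}"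
    unfolding q_def keys_add_bit using x by auto
  then have "n = card (Poly_Mapping.keys q)" using Suc(2) x by simp
  moreover have "Poly_Mapping.keys q \<subseteq> A" using Suc(3) k by auto
  ultimately have "P q" by (rule Suc(1))
  then have "P (Poly_Mapping.single x 1 + q)" using assms(3) x Suc(3) k by blast
  moreover have "Poly_Mapping.single x 1 + q = p"
    unfolding q_def by (simp add: add.assoc[symmetric])
  ultimately show ?case by simp
qed

locale tensor_spaces = V: boolean_group V + W: boolean_group W
  for V :: "('v, 's) graded_scheme" and W :: "('w, 't) graded_scheme"
begin

abbreviation "R \<equiv> tensor_relations V W"
abbreviation "cls \<equiv> tensor_class V W"
abbreviation "T \<equiv> tensor V W"
abbreviation "formal (p :: ('v \<times> 'w) \<Rightarrow>\<^sub>0 bit) \<equiv> Poly_Mapping.keys p \<subseteq> carrier V \<times> carrier W"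

lemma R_add: "p \<in> R \<Longrightarrow> q \<in> R \<Longrightarrow> p + q \<in> R"
  unfolding tensor_relations_def by (rule group_closure_add)

lemma R_zero [simp]: "0 \<in> R"
  unfolding tensor_relations_def by simp

lemma formal_add: "formal p \<Longrightarrow> formal q \<Longrightarrow> formal (p + q)"
  by (auto simp: keys_add_bit)

lemma lift_formal_add:
  assumes Z: "boolean_group Z" and b: "bilin V W Z b" and pq: "formal p" "formal q"
  shows "finsum Z (\<lambda>(v, w). b v w) (Poly_Mapping.keys (p + q)) =
    finsum Z (\<lambda>(v, w). b v w) (Poly_Mapping.keys p) \<oplus>\<^bsub>Z\<^esub> finsum Z (\<lambda>(v, w). b v w) (Poly_Mapping.keys q)"
  unfolding keys_add_bit
  by (rule boolean_group.finsum_sym_diff[OF Z]) (use pq bilin_closed[OF b] in auto)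

lemma lift_formal_single:
  assumes Z: "boolean_group Z" and b: "bilin V W Z b" and vw: "v \<in> carrier V" "w \<in> carrier W"
  shows "finsum Z (\<lambda>(v, w). b v w) (Poly_Mapping.keys (Poly_Mapping.single (v, w) (1::bit))) = b v w"
proof -
  interpret Z: boolean_group Z by fact
  show ?thesis using bilin_closed[OF b] vw by (simp add: Z.finsum_insert)
qed

lemma formal_single: "v \<in> carrier V \<Longrightarrow> w \<in> carrier W \<Longrightarrow> formal (Poly_Mapping.single (v, w) (1::bit))"
  by simp

lemma relations_vanish:
  assumes "r \<in> R"
  shows "formal r"
    and "boolean_group Z \<Longrightarrow> bilin V W Z b \<Longrightarrow>
      finsum Z (\<lambda>(v, w). b v w) (Poly_Mapping.keys r) = \<zero>\<^bsub>Z\<^esub>"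
proof -
  have "formal r \<and> (boolean_group Z \<longrightarrow> bilin V W Z b \<longrightarrow>
      finsum Z (\<lambda>(v, w). b v w) (Poly_Mapping.keys r) = \<zero>\<^bsub>Z\<^esub>)"
    using assms unfolding tensor_relations_def
  proof (induct rule: group_closure.induct)
    case (base s)
    show ?case
    proof (cases "s = 0")
      case True
      have "finsum Z f {} = \<zero>\<^bsub>Z\<^esub>" if "boolean_group Z" for f :: "'v \<times> 'w \<Rightarrow> _"
      proof -
        interpret Z: boolean_group Z by fact
        show ?thesis by simp
      qed
      with True show ?thesis by simp
    next
      case False
      then consider (l) x x' y where "x \<in> carrier V" "x' \<in> carrier V" "y \<in> carrier W"
          "s = Poly_Mapping.single (x \<oplus>\<^bsub>V\<^esub> x', y) 1 + Poly_Mapping.single (x, y) 1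
            + Poly_Mapping.single (x', y) 1"
        | (r) x y y' where "x \<in> carrier V" "y \<in> carrier W" "y' \<in> carrier W"
          "s = Poly_Mapping.single (x, y \<oplus>\<^bsub>W\<^esub> y') 1 + Poly_Mapping.single (x, y) 1
            + Poly_Mapping.single (x, y') 1"
        using base unfolding pm_bit_minus by auto
      then show ?thesis
      proof cases
        case l
        then have f: "formal (Poly_Mapping.single (x \<oplus>\<^bsub>V\<^esub> x', y) (1::bit) + Poly_Mapping.single (x, y) 1)"
          by (intro formal_add formal_single) auto
        moreover have "finsum Z (\<lambda>(v, w). b v w) (Poly_Mapping.keys s) = \<zero>\<^bsub>Z\<^esub>"
          if Z: "boolean_group Z" and b: "bilin V W Z b"
        proof -
          interpret Z: boolean_group Z by fact
          show ?thesis
            unfolding l(4) using l(1-3) f bilin_closed[OF b]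
            by (simp add: lift_formal_add[OF Z b] lift_formal_single[OF Z b] formal_single
                bilin_add_left[OF b] Z.a_ac Z.add_self Z.add_cancel_left del: Poly_Mapping.keys_single)
        qed
        ultimately show ?thesis unfolding l(4) using l(1-3) by (intro conjI formal_add) auto
      next
        case r
        then have f: "formal (Poly_Mapping.single (x, y \<oplus>\<^bsub>W\<^esub> y') (1::bit) + Poly_Mapping.single (x, y) 1)"
          by (intro formal_add formal_single) auto
        moreover have "finsum Z (\<lambda>(v, w). b v w) (Poly_Mapping.keys s) = \<zero>\<^bsub>Z\<^esub>"
          if Z: "boolean_group Z" and b: "bilin V W Z b"
        proof -
          interpret Z: boolean_group Z by fact
          show ?thesis
            unfolding r(4) using r(1-3) f bilin_closed[OF b]
            by (simp add: lift_formal_add[OF Z b] lift_formal_single[OF Z b] formal_single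
                bilin_add_right[OF b] Z.a_ac Z.add_self Z.add_cancel_left del: Poly_Mapping.keys_single)
        qed
        ultimately show ?thesis unfolding r(4) using r(1-3) by (intro conjI formal_add) auto
      qed
    qed
  next
    case (diff s t)
    have "finsum Z (\<lambda>(v, w). b v w) (Poly_Mapping.keys (s + t)) = \<zero>\<^bsub>Z\<^esub>"
      if Z: "boolean_group Z" and b: "bilin V W Z b"
    proof -
      interpret Z: boolean_group Z by fact
      show ?thesis using diff Z b by (simp add: lift_formal_add)
    qed
    moreover have "formal (s + t)" using diff by (intro formal_add) blast+
    ultimately show ?case unfolding pm_bit_minus[of s t] by blast
  qed
  then show "formal r" "boolean_group Z \<Longrightarrow> bilin V W Z b \<Longrightarrow>
      finsum Z (\<lambda>(v, w). b v w) (Poly_Mapping.keys r) = \<zero>\<^bsub>Z\<^esub>" by auto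
qed

lemma cls_eq_iff: "cls p = cls q \<longleftrightarrow> p + q \<in> R"
proof
  assume "cls p = cls q"
  moreover have "p \<in> cls p" unfolding tensor_class_def by (auto intro: exI[of _ 0])
  ultimately obtain r where "p = q + r" "r \<in> R" unfolding tensor_class_def by auto
  then have "p + q = r" by (metis add.commute add.left_commute add.right_neutral pm_bit_add_self)
  with \<open>r \<in> R\<close> show "p + q \<in> R" by simp
next
  have *: "cls p \<subseteq> cls q" if "p + q \<in> R" for p q
  proof
    fix x assume "x \<in> cls p"
    then obtain r where "x = p + r" "r \<in> R" unfolding tensor_class_def by auto
    moreover from this have "x = q + ((p + q) + r)"
      by (metis add.assoc add.commute add.right_neutral pm_bit_add_self)
    ultimately have "x = q + ((p + q) + r)" "(p + q) + r \<in> R"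
      using R_add[OF that] by simp_all
    then show "x \<in> cls q" unfolding tensor_class_def by blast
  qed
  assume "p + q \<in> R"
  then show "cls p = cls q" using *[of p q] *[of q p] by (auto simp: add.commute)
qed

lemma mem_cls_self: "p \<in> cls p"
  unfolding tensor_class_def by (auto intro: exI[of _ 0])

lemma T_carrier: "carrier T = cls ` {p. formal p}"
  by (simp add: tensor_def)

lemma T_zero: "\<zero>\<^bsub>T\<^esub> = cls 0"
  by (simp add: tensor_def)

lemma T_add: "cls p \<oplus>\<^bsub>T\<^esub> cls q = cls (p + q)"
proof -
  have "{x + y |x y. x \<in> cls p \<and> y \<in> cls q} = cls (p + q)"
  proof (intro Set.set_eqI iffI)
    fix x assume "x \<in> {x + y |x y. x \<in> cls p \<and> y \<in> cls q}"
    then obtain r r' where "x = (p + r) + (q + r')" "r \<in> R" "r' \<in> R"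
      unfolding tensor_class_def by auto
    then have "x = (p + q) + (r + r')" "r + r' \<in> R" using R_add by (auto simp: ac_simps)
    then show "x \<in> cls (p + q)" unfolding tensor_class_def by blast
  next
    fix x assume "x \<in> cls (p + q)"
    then obtain r where "x = p + (q + r)" "r \<in> R" unfolding tensor_class_def by (auto simp: ac_simps)
    then show "x \<in> {x + y |x y. x \<in> cls p \<and> y \<in> cls q}"
      using mem_cls_self[of p] unfolding tensor_class_def[of V W q] by blast
  qed
  then show ?thesis by (simp add: tensor_def)
qed

lemma cls_closed: "formal p \<Longrightarrow> cls p \<in> carrier T"
  by (auto simp: T_carrier)

lemma T_boolean: "boolean_group T"
proof -
  have "abelian_group T"
  proof (rule abelian_groupI)
    fix x assume "x \<in> carrier T"
    then obtain p where p: "x = cls p" "formal p" by (auto simp: T_carrier)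
    then show "\<exists>y\<in>carrier T. y \<oplus>\<^bsub>T\<^esub> x = \<zero>\<^bsub>T\<^esub>"
      by (intro bexI[of _ x]) (auto simp: T_add T_zero cls_closed)
  qed (auto simp: T_carrier T_zero T_add formal_add ac_simps intro!: imageI)
  then show ?thesis
    by (intro boolean_group.intro boolean_group_axioms.intro)
      (auto simp: T_carrier T_zero T_add)
qed

lemma tens_closed: "v \<in> carrier V \<Longrightarrow> w \<in> carrier W \<Longrightarrow> tens V W v w \<in> carrier T"
  unfolding tens_def by (intro cls_closed formal_single)

lemma tens_add_left:
  assumes "v \<in> carrier V" "v' \<in> carrier V" "w \<in> carrier W"
  shows "tens V W (v \<oplus>\<^bsub>V\<^esub> v') w = tens V W v w \<oplus>\<^bsub>T\<^esub> tens V W v' w"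
proof -
  have "Poly_Mapping.single (v \<oplus>\<^bsub>V\<^esub> v', w) 1 - Poly_Mapping.single (v, w) 1
        - Poly_Mapping.single (v', w) (1::bit) \<in> R"
    unfolding tensor_relations_def by (rule group_closure.base) (use assms in blast)
  then show ?thesis
    unfolding tens_def T_add cls_eq_iff pm_bit_minus by (simp add: ac_simps)
qed

lemma tens_add_right:
  assumes "v \<in> carrier V" "w \<in> carrier W" "w' \<in> carrier W"
  shows "tens V W v (w \<oplus>\<^bsub>W\<^esub> w') = tens V W v w \<oplus>\<^bsub>T\<^esub> tens V W v w'"
proof -
  have "Poly_Mapping.single (v, w \<oplus>\<^bsub>W\<^esub> w') 1 - Poly_Mapping.single (v, w) 1
        - Poly_Mapping.single (v, w') (1::bit) \<in> R"
    unfolding tensor_relations_def by (rule group_closure.base) (use assms in blast)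
  then show ?thesis
    unfolding tens_def T_add cls_eq_iff pm_bit_minus by (simp add: ac_simps)
qed

lemma tens_bilin: "bilin V W T (tens V W)"
  by (intro bilinI tens_closed tens_add_left tens_add_right)

lemma tens_zero_left [simp]: "w \<in> carrier W \<Longrightarrow> tens V W \<zero>\<^bsub>V\<^esub> w = \<zero>\<^bsub>T\<^esub>"
  using linear_maps_zero[OF V.boolean_group_axioms T_boolean, of "\<lambda>v. tens V W v w"] tens_bilin
  by (simp add: bilin_def)

lemma tens_zero_right [simp]: "v \<in> carrier V \<Longrightarrow> tens V W v \<zero>\<^bsub>W\<^esub> = \<zero>\<^bsub>T\<^esub>"
  using linear_maps_zero[OF W.boolean_group_axioms T_boolean, of "tens V W v"] tens_bilin
  by (simp add: bilin_def)

lemma tensor_induct [consumes 1, case_names zero tens add]: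
  assumes "t \<in> carrier T" "P \<zero>\<^bsub>T\<^esub>" "\<And>v w. v \<in> carrier V \<Longrightarrow> w \<in> carrier W \<Longrightarrow> P (tens V W v w)"
    "\<And>t t'. t \<in> carrier T \<Longrightarrow> t' \<in> carrier T \<Longrightarrow> P t \<Longrightarrow> P t' \<Longrightarrow> P (t \<oplus>\<^bsub>T\<^esub> t')"
  shows "P t"
proof -
  obtain p where p: "t = cls p" "formal p" using assms(1) by (auto simp: T_carrier)
  have "P (cls p)"
    using p(2)
  proof (induct p rule: pm_bit_induct)
    case (add x p)
    then have "cls (Poly_Mapping.single x 1) \<in> carrier T" "cls p \<in> carrier T"
      by (auto simp: mem_Times_iff intro!: cls_closed)
    with add show ?case
      using assms(3)[of "fst x" "snd x"] assms(4)[of "cls (Poly_Mapping.single x 1)" "cls p"]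
      by (auto simp: T_add tens_def mem_Times_iff cls_closed)
  qed (use assms(2) in \<open>auto simp: T_zero\<close>)
  then show ?thesis using p by simp
qed

lemma lift_cls:
  assumes Z: "boolean_group Z" and b: "bilin V W Z b" and p: "formal p"
  shows "tensor_lift Z b (cls p) = finsum Z (\<lambda>(v, w). b v w) (Poly_Mapping.keys p)"
proof -
  interpret Z: boolean_group Z by fact
  have c: "finsum Z (\<lambda>(v, w). b v w) (Poly_Mapping.keys p) \<in> carrier Z"
    using p bilin_closed[OF b] by (intro Z.finsum_closed) auto
  have "finsum Z (\<lambda>(v, w). b v w) (Poly_Mapping.keys (p + r)) =
      finsum Z (\<lambda>(v, w). b v w) (Poly_Mapping.keys p)" if "r \<in> R" for r
    using lift_formal_add[OF Z b p relations_vanish(1)[OF that]] relations_vanish(2)[OF that Z b] c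
    by simp
  then have "(\<lambda>p. finsum Z (\<lambda>(v, w). b v w) (Poly_Mapping.keys p)) ` cls p =
      {finsum Z (\<lambda>(v, w). b v w) (Poly_Mapping.keys p)}"
    unfolding tensor_class_def using R_zero by (auto simp: image_iff intro!: exI[of _ p] exI[of _ 0])
  then show ?thesis unfolding tensor_lift_def by simp
qed

lemma lift_tens:
  assumes "boolean_group Z" "bilin V W Z b" "v \<in> carrier V" "w \<in> carrier W"
  shows "tensor_lift Z b (tens V W v w) = b v w"
  unfolding tens_def using lift_cls[OF assms(1,2) formal_single] lift_formal_single assms by simp

lemma lift_linear:
  assumes "boolean_group Z" "bilin V W Z b"
  shows "tensor_lift Z b \<in> linear_maps T Z"
  unfolding linear_maps_iff
proof (intro conjI ballI)
  interpret Z: boolean_group Z by fact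
  fix t assume "t \<in> carrier T"
  then obtain p where p: "t = cls p" "formal p" by (auto simp: T_carrier)
  then show "tensor_lift Z b t \<in> carrier Z"
    using lift_cls[OF assms] bilin_closed[OF assms(2)] by (auto intro!: Z.finsum_closed)
  fix t' assume "t' \<in> carrier T"
  then obtain q where q: "t' = cls q" "formal q" by (auto simp: T_carrier)
  show "tensor_lift Z b (t \<oplus>\<^bsub>T\<^esub> t') = tensor_lift Z b t \<oplus>\<^bsub>Z\<^esub> tensor_lift Z b t'"
    using p q by (simp add: T_add lift_cls[OF assms] formal_add lift_formal_add[OF assms])
qed

end

locale tensor_graded = V: graded_space V + W: graded_space W
  for V :: "('v, 's) graded_scheme" and W :: "('w, 't) graded_scheme"

sublocale tensor_graded \<subseteq> tensor_spaces V W
  by unfold_locales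

context tensor_graded
begin

lemma T_homog: "homog T n =
    cls ` {p. Poly_Mapping.keys p \<subseteq> (\<Union>i. homog V i \<times> homog W (n - i))}"
  by (simp add: tensor_def)

lemma formal_homog: "Poly_Mapping.keys p \<subseteq> (\<Union>i. homog V i \<times> homog W (n - i)) \<Longrightarrow> formal p"
  using V.homog_closed W.homog_closed by fastforce

lemma tens_homog: "v \<in> homog V i \<Longrightarrow> w \<in> homog W j \<Longrightarrow> tens V W v w \<in> homog T (i + j)"
  unfolding T_homog tens_def by (rule imageI) (auto intro!: exI[of _ i])

lemma T_homog_subspace: "bool_subspace T (homog T n)"
  unfolding bool_subspace_def
proof (intro conjI ballI)
  show "homog T n \<subseteq> carrier T" using formal_homog by (auto simp: T_homog T_carrier)
  show "\<zero>\<^bsub>T\<^esub> \<in> homog T n" by (auto simp: T_homog T_zero)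
  fix x y assume "x \<in> homog T n" "y \<in> homog T n"
  then obtain p q where "x = cls p" "y = cls q"
    "Poly_Mapping.keys p \<subseteq> (\<Union>i. homog V i \<times> homog W (n - i))"
    "Poly_Mapping.keys q \<subseteq> (\<Union>i. homog V i \<times> homog W (n - i))" by (auto simp: T_homog)
  then have "x \<oplus>\<^bsub>T\<^esub> y = cls (p + q)"
    "Poly_Mapping.keys (p + q) \<subseteq> (\<Union>i. homog V i \<times> homog W (n - i))"
    by (auto simp: T_add keys_add_bit)
  then show "x \<oplus>\<^bsub>T\<^esub> y \<in> homog T n" by (simp add: T_homog)
qed

lemma homog_tensor_induct [consumes 1, case_names zero tens add]:
  assumes "t \<in> homog T n" "P \<zero>\<^bsub>T\<^esub>"
    "\<And>i v w. v \<in> homog V i \<Longrightarrow> w \<in> homog W (n - i) \<Longrightarrow> P (tens V W v w)"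
    "\<And>t t'. t \<in> homog T n \<Longrightarrow> t' \<in> homog T n \<Longrightarrow> P t \<Longrightarrow> P t' \<Longrightarrow> P (t \<oplus>\<^bsub>T\<^esub> t')"
  shows "P t"
proof -
  obtain p where p: "t = cls p" "Poly_Mapping.keys p \<subseteq> (\<Union>i. homog V i \<times> homog W (n - i))"
    using assms(1) by (auto simp: T_homog)
  have "P (cls p)"
    using p(2)
  proof (induct p rule: pm_bit_induct)
    case (add x p)
    obtain i where i: "fst x \<in> homog V i" "snd x \<in> homog W (n - i)" using add(1) by auto
    have "cls (Poly_Mapping.single x 1) \<in> homog T n" "cls p \<in> homog T n"
      using add unfolding T_homog by (auto intro!: imageI)
    then show ?case
      using assms(3)[OF i] assms(4)[of "cls (Poly_Mapping.single x 1)" "cls p"] add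
      by (auto simp: T_add tens_def)
  qed (use assms(2) in \<open>auto simp: T_zero\<close>)
  then show ?thesis using p by simp
qed

text \<open>
  The homogeneous projections that recognise the grading of a tensor product.
\<close>

definition proj :: "int \<Rightarrow> (('v \<times> 'w) \<Rightarrow>\<^sub>0 bit) set \<Rightarrow> (('v \<times> 'w) \<Rightarrow>\<^sub>0 bit) set" where
  "proj n = tensor_lift T (\<lambda>v w. finsum T (\<lambda>i. tens V W (component V i v) (component W (n - i) w))
     {i. component V i v \<noteq> \<zero>\<^bsub>V\<^esub>})"

lemma proj_bilin: "bilin V W T (\<lambda>v w. finsum T (\<lambda>i. tens V W (component V i v) (component W (n - i) w))
     {i. component V i v \<noteq> \<zero>\<^bsub>V\<^esub>})"
proof -
  interpret T: boolean_group T by (rule T_boolean)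
  let ?s = "\<lambda>v. {i. component V i v \<noteq> \<zero>\<^bsub>V\<^esub>}"
  let ?f = "\<lambda>v w i. tens V W (component V i v) (component W (n - i) w)"
  have fc: "?f v w i \<in> carrier T" if "v \<in> carrier V" "w \<in> carrier W" for v w i
    using that by (intro tens_closed) auto
  have ext: "finsum T (?f v w) (?s v) = finsum T (?f v w) S"
    if "v \<in> carrier V" "w \<in> carrier W" "finite S" "?s v \<subseteq> S" for v w S
    by (rule T.finsum_support) (use that fc in auto)
  show ?thesis
  proof (rule bilinI)
    fix v w assume "v \<in> carrier V" "w \<in> carrier W"
    then show "finsum T (?f v w) (?s v) \<in> carrier T" using fc by (intro T.finsum_closed) auto
  next
    fix v v' w assume c: "v \<in> carrier V" "v' \<in> carrier V" "w \<in> carrier W"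
    let ?S = "?s v \<union> ?s v'"
    have S: "finite ?S" "?s (v \<oplus>\<^bsub>V\<^esub> v') \<subseteq> ?S" using V.comp_finite V.comp_add c by auto
    have "finsum T (?f (v \<oplus>\<^bsub>V\<^esub> v') w) ?S = finsum T (?f v w) ?S \<oplus>\<^bsub>T\<^esub> finsum T (?f v' w) ?S"
      using c fc by (subst T.finsum_addf[symmetric]) (auto simp: V.comp_add tens_add_left intro!: T.finsum_cong')
    then show "finsum T (?f (v \<oplus>\<^bsub>V\<^esub> v') w) (?s (v \<oplus>\<^bsub>V\<^esub> v')) =
        finsum T (?f v w) (?s v) \<oplus>\<^bsub>T\<^esub> finsum T (?f v' w) (?s v')"
      using S c ext[of v w ?S] ext[of v' w ?S] ext[of "v \<oplus>\<^bsub>V\<^esub> v'" w ?S] by auto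
  next
    fix v w w' assume c: "v \<in> carrier V" "w \<in> carrier W" "w' \<in> carrier W"
    show "finsum T (?f v (w \<oplus>\<^bsub>W\<^esub> w')) (?s v) = finsum T (?f v w) (?s v) \<oplus>\<^bsub>T\<^esub> finsum T (?f v w') (?s v)"
      using c fc by (subst T.finsum_addf[symmetric])
        (auto simp: W.comp_add tens_add_right intro!: T.finsum_cong')
  qed
qed

lemma proj_tens:
  assumes "v \<in> homog V i" "w \<in> homog W j"
  shows "proj n (tens V W v w) = (if n = i + j then tens V W v w else \<zero>\<^bsub>T\<^esub>)"
proof -
  interpret T: boolean_group T by (rule T_boolean)
  have vw: "v \<in> carrier V" "w \<in> carrier W" using assms V.homog_closed W.homog_closed by auto
  have "proj n (tens V W v w) = finsum T (\<lambda>i. tens V W (component V i v) (component W (n - i) w))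
     {i. component V i v \<noteq> \<zero>\<^bsub>V\<^esub>}"
    unfolding proj_def by (rule lift_tens[OF T_boolean proj_bilin vw])
  also have "\<dots> = finsum T (\<lambda>i. tens V W (component V i v) (component W (n - i) w)) {i}"
    by (rule T.finsum_support) (use vw tens_closed V.comp_of_homog[OF assms(1)] in auto)
  also have "\<dots> = tens V W (component V i v) (component W (n - i) w)"
    using vw by (simp add: T.finsum_insert tens_closed)
  finally show ?thesis
    using vw V.comp_of_homog[OF assms(1)] W.comp_of_homog[OF assms(2)] by auto
qed

lemma T_graded: "graded_space T"
proof (rule graded_spaceI[where P = proj])
  show "boolean_group T" by (rule T_boolean)
  show lin: "proj n \<in> linear_maps T T" for n
    unfolding proj_def by (rule lift_linear[OF T_boolean proj_bilin])
  show "bool_subspace T (homog T n)" for n by (rule T_homog_subspace)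
  interpret T: boolean_group T by (rule T_boolean)
  show "proj n x = (if n = m then x else \<zero>\<^bsub>T\<^esub>)" if "x \<in> homog T m" for n m x
    using that
  proof (induct rule: homog_tensor_induct)
    case zero
    then show ?case using linear_maps_zero[OF T_boolean T_boolean lin] by simp
  next
    case (tens i v w)
    then show ?case using proj_tens[OF tens] by simp
  next
    case (add t t')
    then have "t \<in> carrier T" "t' \<in> carrier T" using T_homog_subspace[of m] by (auto simp: bool_subspace_def)
    then show ?case using linear_maps_add[OF lin] add by auto
  qed
  show "x \<in> homog_span T" if "x \<in> carrier T" for x
    using that
  proof (induct rule: tensor_induct)
    case (tens v w)
    have "tens V W v w \<in> homog_span T" if "v \<in> homog V i" for i v
      using tens(2)
    proof (induct rule: W.graded_induct)
      case zero
      then show ?case using V.homog_closed[OF that] by (simp add: homog_span.zero)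
    next
      case (homog n x)
      then show ?case using homog_span.homog[OF tens_homog[OF that]] by blast
    next
      case (add x y)
      then show ?case using V.homog_closed[OF that] by (simp add: tens_add_right homog_span.add)
    qed
    with tens(1) show ?case
    proof (induct rule: V.graded_induct)
      case zero
      then show ?case using tens(2) by (simp add: homog_span.zero)
    next
      case (add x y)
      then show ?case using tens(2) by (simp add: tens_add_left homog_span.add)
    qed blast
  qed (simp_all add: homog_span.zero homog_span.add)
qed

end

lemma comp_degree_map:
  assumes "graded_space V" "graded_space W" "f \<in> linear_maps V W"
    "\<And>i x. x \<in> homog V i \<Longrightarrow> f x \<in> homog W (i + m)" "x \<in> carrier V"
  shows "component W (n + m) (f x) = f (component V n x)"
proof -
  interpret V: graded_space V by fact
  interpret W: graded_space W by fact
  have z: "f \<zero>\<^bsub>V\<^esub> = \<zero>\<^bsub>W\<^esub>"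
    by (rule linear_maps_zero[OF V.boolean_group_axioms W.boolean_group_axioms assms(3)])
  show ?thesis using assms(5)
  proof (induct rule: V.graded_induct)
    case (homog i x)
    then show ?case using V.comp_of_homog W.comp_of_homog[OF assms(4)] z by simp
  next
    case (add x y)
    then show ?case
      by (simp add: linear_maps_add[OF assms(3)] linear_maps_closed[OF assms(3)] V.comp_add W.comp_add)
  qed (simp add: z)
qed

lemma (in graded_space) comps_induct:
  assumes x: "x \<in> carrier V" and "P \<zero>" and h: "\<And>n. P (component V n x)"
    and a: "\<And>x y. x \<in> carrier V \<Longrightarrow> y \<in> carrier V \<Longrightarrow> P x \<Longrightarrow> P y \<Longrightarrow> P (x \<oplus> y)"
  shows "P x"
proof -
  have "P (finsum V (\<lambda>n. component V n x) S)" if "finite S" for S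
    using that
  proof (induct S rule: finite_induct)
    case (insert n S)
    then show ?case using x a h by (simp add: Pi_def finsum_closed)
  qed (use assms in simp)
  then show ?thesis using comp_sum[OF x] comp_finite[OF x] by metis
qed

lemma (in tensor_spaces) cls_sum:
  assumes "finite S" "\<And>i. i \<in> S \<Longrightarrow> formal (f i)"
  shows "cls (sum f S) = finsum T (\<lambda>i. cls (f i)) S"
proof -
  interpret T: boolean_group T by (rule T_boolean)
  show ?thesis using assms
  proof (induct S rule: finite_induct)
    case (insert i S)
    then show ?case using cls_closed by (simp add: T_add[symmetric] Pi_def)
  qed (simp add: T_zero)
qed

section \<open>Coproducts\<close>

text \<open>
  Contraction of one tensor factor with a functional.  For the counit the coproduct is undone; for
  other functionals these are the operations of the dual algebra on \<open>A\<close>.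
\<close>

definition lslice :: "('v, 's) ring_scheme \<Rightarrow> ('v \<Rightarrow> bit) \<Rightarrow> (('v \<times> 'v) \<Rightarrow>\<^sub>0 bit) set \<Rightarrow> 'v" where
  "lslice V f = tensor_lift V (\<lambda>x y. scale2 V (f x) y)"

definition rslice :: "('v, 's) ring_scheme \<Rightarrow> ('v \<Rightarrow> bit) \<Rightarrow> (('v \<times> 'v) \<Rightarrow>\<^sub>0 bit) set \<Rightarrow> 'v" where
  "rslice V f = tensor_lift V (\<lambda>x y. scale2 V (f y) x)"

text \<open>
  Terms \<open>v \<otimes> w\<close> of total degree \<open>n\<close> whose left factor has smaller degree.  Induction on the degree
  always compares an action through the coproduct with its leading part, modulo such terms.
\<close>

inductive_set low_terms :: "'a hopf \<Rightarrow> int \<Rightarrow> (('a \<times> 'a) \<Rightarrow>\<^sub>0 bit) set set" for A n where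
  zero: "\<zero>\<^bsub>tensor A A\<^esub> \<in> low_terms A n"
| tens: "v \<in> homog A i \<Longrightarrow> w \<in> homog A (n - i) \<Longrightarrow> i < n \<Longrightarrow> tens A A v w \<in> low_terms A n"
| add: "s \<in> low_terms A n \<Longrightarrow> t \<in> low_terms A n \<Longrightarrow> s \<oplus>\<^bsub>tensor A A\<^esub> t \<in> low_terms A n"

context hopf_algebra
begin

sublocale AA: tensor_graded A A by unfold_locales

abbreviation "A2 \<equiv> tensor A A"

sublocale A2: graded_space A2 by (rule AA.T_graded)

lemma coprod_linear: "coprod A \<in> linear_maps A A2"
  using coprod_graded by (simp add: graded_maps_def)

lemma coprod_closed [simp]: "a \<in> carrier A \<Longrightarrow> coprod A a \<in> carrier A2"
  by (rule linear_maps_closed[OF coprod_linear])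

lemma coprod_add: "a \<in> carrier A \<Longrightarrow> b \<in> carrier A \<Longrightarrow> coprod A (a \<oplus> b) = coprod A a \<oplus>\<^bsub>A2\<^esub> coprod A b"
  by (rule linear_maps_add[OF coprod_linear])

lemma coprod_zero [simp]: "coprod A \<zero> = \<zero>\<^bsub>A2\<^esub>"
  by (rule linear_maps_zero[OF boolean_group_axioms AA.T_boolean coprod_linear])

lemma coprod_mult: "a \<in> carrier A \<Longrightarrow> b \<in> carrier A \<Longrightarrow> coprod A (a \<otimes> b) = coprod A a \<otimes>\<^bsub>A2\<^esub> coprod A b"
  using coprod_ring_hom by (simp add: ring_hom_def)

lemma coprod_one: "coprod A \<one> = tens A A \<one> \<one>"
  using coprod_ring_hom by (simp add: ring_hom_def tensor_def)

lemma coprod_homog: "a \<in> homog A n \<Longrightarrow> coprod A a \<in> homog A2 n"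
  using coprod_graded by (auto simp: graded_maps_def)

lemma counit_linear: "counit A \<in> linear_maps A F2"
  using counit_graded by (simp add: graded_maps_def)

lemma counit_add: "a \<in> carrier A \<Longrightarrow> b \<in> carrier A \<Longrightarrow> counit A (a \<oplus> b) = counit A a + counit A b"
  using linear_maps_add[OF counit_linear] by simp

lemma counit_zero [simp]: "counit A \<zero> = 0"
  using linear_maps_zero[OF boolean_group_axioms boolean_group_F2 counit_linear] by simp

lemma counit_mult: "a \<in> carrier A \<Longrightarrow> b \<in> carrier A \<Longrightarrow> counit A (a \<otimes> b) = counit A a * counit A b"
  using counit_ring_hom by (simp add: ring_hom_def)

lemma counit_one [simp]: "counit A \<one> = 1"
  using counit_ring_hom by (simp add: ring_hom_def)

lemma counit_homog:
  assumes "a \<in> homog A n" "n \<noteq> 0"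
  shows "counit A a = 0"
proof -
  have "counit A ` homog A n \<subseteq> homog F2 n" using counit_graded by (simp add: graded_maps_def)
  then show ?thesis using assms by auto
qed

lemma one_not_zero: "\<one> \<noteq> \<zero>"
  using counit_one counit_zero by (metis zero_neq_one)

lemma inner_mult_bilin:
  assumes "a \<in> carrier A" "b \<in> carrier A"
  shows "bilin A A A2 (\<lambda>v w. tens A A (a \<otimes> v) (b \<otimes> w))"
  using assms by (intro bilinI) (auto simp: AA.tens_closed AA.tens_add_left AA.tens_add_right r_distr)

lemma outer_mult_bilin:
  assumes t: "t \<in> carrier A2"
  shows "bilin A A A2 (\<lambda>v w. tensor_lift A2 (\<lambda>v' w'. tens A A (v \<otimes> v') (w \<otimes> w')) t)"
proof (rule bilinI)
  note L = AA.lift_linear[OF AA.T_boolean inner_mult_bilin]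
  fix v w assume vw: "v \<in> carrier A" "w \<in> carrier A"
  show "tensor_lift A2 (\<lambda>v' w'. tens A A (v \<otimes> v') (w \<otimes> w')) t \<in> carrier A2"
    by (rule linear_maps_closed[OF L[OF vw] t])
next
  note L = AA.lift_tens[OF AA.T_boolean inner_mult_bilin]
    linear_maps_zero[OF AA.T_boolean AA.T_boolean AA.lift_linear[OF AA.T_boolean inner_mult_bilin]]
    linear_maps_add[OF AA.lift_linear[OF AA.T_boolean inner_mult_bilin]]
    linear_maps_closed[OF AA.lift_linear[OF AA.T_boolean inner_mult_bilin]]
  fix v v' w assume vw: "v \<in> carrier A" "v' \<in> carrier A" "w \<in> carrier A"
  show "tensor_lift A2 (\<lambda>x y. tens A A ((v \<oplus> v') \<otimes> x) (w \<otimes> y)) t =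
    tensor_lift A2 (\<lambda>x y. tens A A (v \<otimes> x) (w \<otimes> y)) t \<oplus>\<^bsub>A2\<^esub>
    tensor_lift A2 (\<lambda>x y. tens A A (v' \<otimes> x) (w \<otimes> y)) t"
    using t
  proof (induct rule: AA.tensor_induct)
    case (add s t)
    then show ?case using vw by (simp add: L A2.a_ac)
  qed (use vw in \<open>simp_all add: L l_distr AA.tens_add_left\<close>)
next
  note L = AA.lift_tens[OF AA.T_boolean inner_mult_bilin]
    linear_maps_zero[OF AA.T_boolean AA.T_boolean AA.lift_linear[OF AA.T_boolean inner_mult_bilin]]
    linear_maps_add[OF AA.lift_linear[OF AA.T_boolean inner_mult_bilin]]
    linear_maps_closed[OF AA.lift_linear[OF AA.T_boolean inner_mult_bilin]]
  fix v w w' assume vw: "v \<in> carrier A" "w \<in> carrier A" "w' \<in> carrier A"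
  show "tensor_lift A2 (\<lambda>x y. tens A A (v \<otimes> x) ((w \<oplus> w') \<otimes> y)) t =
    tensor_lift A2 (\<lambda>x y. tens A A (v \<otimes> x) (w \<otimes> y)) t \<oplus>\<^bsub>A2\<^esub>
    tensor_lift A2 (\<lambda>x y. tens A A (v \<otimes> x) (w' \<otimes> y)) t"
    using t
  proof (induct rule: AA.tensor_induct)
    case (add s t)
    then show ?case using vw by (simp add: L A2.a_ac)
  qed (use vw in \<open>simp_all add: L l_distr AA.tens_add_right\<close>)
qed

text \<open>
  The product of two classes is defined by choosing representatives; a lift of a lift is visibly
  independent of them and bilinear.
\<close>

lemma tensor_mult_eq_lift:
  assumes s: "s \<in> carrier A2" and t: "t \<in> carrier A2"
  shows "s \<otimes>\<^bsub>A2\<^esub> t = tensor_lift A2 (\<lambda>v w. tensor_lift A2 (\<lambda>v' w'. tens A A (v \<otimes> v') (w \<otimes> w')) t) s"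
proof -
  have formal_sum: "AA.formal (sum f S)" if "finite S" "\<And>i. i \<in> S \<Longrightarrow> AA.formal (f i)"
    for f and S :: "('a \<times> 'a) set"
    using that by (induct S rule: finite_induct) (simp_all add: AA.formal_add)
  have eq: "AA.cls (sum (\<lambda>(v, w). sum (\<lambda>(v', w').
             Poly_Mapping.single (v \<otimes> v', w \<otimes> w') 1) (Poly_Mapping.keys q)) (Poly_Mapping.keys p)) =
      tensor_lift A2 (\<lambda>v w. tensor_lift A2 (\<lambda>v' w'. tens A A (v \<otimes> v') (w \<otimes> w')) t) s"
    if p: "AA.formal p" "AA.cls p = s" and q: "AA.formal q" "AA.cls q = t" for p q
  proof -
    have f1: "AA.formal (Poly_Mapping.single (v \<otimes> v', w \<otimes> w') 1)"
      if "(v, w) \<in> Poly_Mapping.keys p" "(v', w') \<in> Poly_Mapping.keys q" for v w v' w'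
      using that p q by (intro AA.formal_single) auto
    have f2: "AA.formal (sum (\<lambda>(v', w'). Poly_Mapping.single (v \<otimes> v', w \<otimes> w') 1) (Poly_Mapping.keys q))"
      if "(v, w) \<in> Poly_Mapping.keys p" for v w
      by (rule formal_sum) (use f1[OF that] in auto)
    have inner: "AA.cls (sum (\<lambda>(v', w'). Poly_Mapping.single (v \<otimes> v', w \<otimes> w') 1) (Poly_Mapping.keys q)) =
        tensor_lift A2 (\<lambda>v' w'. tens A A (v \<otimes> v') (w \<otimes> w')) t"
      if vw: "(v, w) \<in> Poly_Mapping.keys p" for v w
    proof -
      have c: "v \<in> carrier A" "w \<in> carrier A" using vw p by auto
      have "AA.cls (sum (\<lambda>(v', w'). Poly_Mapping.single (v \<otimes> v', w \<otimes> w') 1) (Poly_Mapping.keys q)) =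
          finsum A2 (\<lambda>i. AA.cls (case i of (v', w') \<Rightarrow> Poly_Mapping.single (v \<otimes> v', w \<otimes> w') 1)) (Poly_Mapping.keys q)"
        by (rule AA.cls_sum) (use f1[OF vw] in auto)
      also have "\<dots> = finsum A2 (\<lambda>(v', w'). tens A A (v \<otimes> v') (w \<otimes> w')) (Poly_Mapping.keys q)"
        by (rule A2.finsum_cong') (use q c in \<open>auto simp: tens_def AA.tens_closed[unfolded tens_def]\<close>)
      also have "\<dots> = tensor_lift A2 (\<lambda>v' w'. tens A A (v \<otimes> v') (w \<otimes> w')) t"
        unfolding q(2)[symmetric] by (rule AA.lift_cls[OF AA.T_boolean inner_mult_bilin[OF c] q(1), symmetric])
      finally show ?thesis .
    qed
    have "AA.cls (sum (\<lambda>(v, w). sum (\<lambda>(v', w').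
             Poly_Mapping.single (v \<otimes> v', w \<otimes> w') 1) (Poly_Mapping.keys q)) (Poly_Mapping.keys p)) =
        finsum A2 (\<lambda>i. AA.cls (case i of (v, w) \<Rightarrow> sum (\<lambda>(v', w').
             Poly_Mapping.single (v \<otimes> v', w \<otimes> w') 1) (Poly_Mapping.keys q))) (Poly_Mapping.keys p)"
      by (rule AA.cls_sum) (use f2 in auto)
    also have "\<dots> = finsum A2 (\<lambda>(v, w). tensor_lift A2 (\<lambda>v' w'. tens A A (v \<otimes> v') (w \<otimes> w')) t) (Poly_Mapping.keys p)"
      by (rule A2.finsum_cong')
        (use p inner bilin_closed[OF outer_mult_bilin[OF t]] in auto)
    also have "\<dots> = tensor_lift A2 (\<lambda>v w. tensor_lift A2 (\<lambda>v' w'. tens A A (v \<otimes> v') (w \<otimes> w')) t) s"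
      unfolding p(2)[symmetric]
      by (rule AA.lift_cls[OF AA.T_boolean outer_mult_bilin[OF t] p(1), symmetric])
    finally show ?thesis .
  qed
  obtain p0 q0 where p0: "AA.formal p0" "s = AA.cls p0" and q0: "AA.formal q0" "t = AA.cls q0"
    using s t by (auto simp: AA.T_carrier)
  have mem: "AA.formal p \<and> AA.cls p = AA.cls p'" if pm: "p \<in> AA.cls p'" "AA.formal p'" for p p'
  proof -
    obtain r where r: "p = p' + r" "r \<in> AA.R" using pm(1) unfolding tensor_class_def by blast
    have "p + p' = r" unfolding r by (metis add.commute add.left_commute add.right_neutral pm_bit_add_self)
    then have "AA.cls p = AA.cls p'" using r(2) by (simp only: AA.cls_eq_iff)
    moreover have "AA.formal p"
      unfolding r(1) by (rule AA.formal_add[OF pm(2) AA.relations_vanish(1)[OF r(2)]])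
    ultimately show ?thesis by simp
  qed
  have "{AA.cls (sum (\<lambda>(v, w). sum (\<lambda>(v', w').
             Poly_Mapping.single (v \<otimes> v', w \<otimes> w') 1)
           (Poly_Mapping.keys q)) (Poly_Mapping.keys p)) | p q. p \<in> s \<and> q \<in> t} =
      {tensor_lift A2 (\<lambda>v w. tensor_lift A2 (\<lambda>v' w'. tens A A (v \<otimes> v') (w \<otimes> w')) t) s}" (is "?X = {?y}")
  proof (rule Set.set_eqI, rule iffI)
    fix x assume "x \<in> ?X"
    then obtain p q where "x = AA.cls (sum (\<lambda>(v, w). sum (\<lambda>(v', w').
             Poly_Mapping.single (v \<otimes> v', w \<otimes> w') 1)
           (Poly_Mapping.keys q)) (Poly_Mapping.keys p))" "p \<in> s" "q \<in> t" by blast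
    then show "x \<in> {?y}" using eq[of p q] mem[of p p0] mem[of q q0] p0 q0 by auto
  next
    fix x assume "x \<in> {?y}"
    then show "x \<in> ?X" using eq[of p0 q0] AA.mem_cls_self[of p0] AA.mem_cls_self[of q0] p0 q0 by blast
  qed
  then show ?thesis by (simp add: tensor_def)
qed

lemma tensor_mult_tens:
  "a \<in> carrier A \<Longrightarrow> b \<in> carrier A \<Longrightarrow> c \<in> carrier A \<Longrightarrow> e \<in> carrier A \<Longrightarrow>
    tens A A a b \<otimes>\<^bsub>A2\<^esub> tens A A c e = tens A A (a \<otimes> c) (b \<otimes> e)"
  by (simp add: tensor_mult_eq_lift AA.tens_closed AA.lift_tens[OF AA.T_boolean outer_mult_bilin]
      AA.lift_tens[OF AA.T_boolean inner_mult_bilin])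

lemma tensor_mult_bilin: "bilin A2 A2 A2 (\<lambda>s t. s \<otimes>\<^bsub>A2\<^esub> t)"
proof (rule bilinI)
  note L = linear_maps_closed[OF AA.lift_linear[OF AA.T_boolean outer_mult_bilin]]
    linear_maps_add[OF AA.lift_linear[OF AA.T_boolean outer_mult_bilin]]
  fix s t assume "s \<in> carrier A2" "t \<in> carrier A2"
  then show "s \<otimes>\<^bsub>A2\<^esub> t \<in> carrier A2" by (simp add: tensor_mult_eq_lift L)
next
  note L = linear_maps_closed[OF AA.lift_linear[OF AA.T_boolean outer_mult_bilin]]
    linear_maps_add[OF AA.lift_linear[OF AA.T_boolean outer_mult_bilin]]
  fix s s' t assume "s \<in> carrier A2" "s' \<in> carrier A2" "t \<in> carrier A2"
  then show "(s \<oplus>\<^bsub>A2\<^esub> s') \<otimes>\<^bsub>A2\<^esub> t = s \<otimes>\<^bsub>A2\<^esub> t \<oplus>\<^bsub>A2\<^esub> s' \<otimes>\<^bsub>A2\<^esub> t"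
    by (simp add: tensor_mult_eq_lift L)
next
  note L = AA.lift_tens[OF AA.T_boolean outer_mult_bilin]
    linear_maps_zero[OF AA.T_boolean AA.T_boolean AA.lift_linear[OF AA.T_boolean outer_mult_bilin]]
    linear_maps_add[OF AA.lift_linear[OF AA.T_boolean outer_mult_bilin]]
    linear_maps_closed[OF AA.lift_linear[OF AA.T_boolean outer_mult_bilin]]
    linear_maps_add[OF AA.lift_linear[OF AA.T_boolean inner_mult_bilin]]
  fix s t t' assume s: "s \<in> carrier A2" and t: "t \<in> carrier A2" "t' \<in> carrier A2"
  show "s \<otimes>\<^bsub>A2\<^esub> (t \<oplus>\<^bsub>A2\<^esub> t') = s \<otimes>\<^bsub>A2\<^esub> t \<oplus>\<^bsub>A2\<^esub> s \<otimes>\<^bsub>A2\<^esub> t'"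
    using s
  proof (induct rule: AA.tensor_induct)
    case (add u v)
    then show ?case using t by (simp add: tensor_mult_eq_lift L A2.a_ac)
  qed (use t in \<open>simp_all add: tensor_mult_eq_lift L AA.tens_closed\<close>)
qed

lemmas tensor_mult_closed = bilin_closed[OF tensor_mult_bilin]
  and tensor_mult_add_left = bilin_add_left[OF tensor_mult_bilin]
  and tensor_mult_add_right = bilin_add_right[OF tensor_mult_bilin]

lemma tensor_mult_zero_left [simp]: "t \<in> carrier A2 \<Longrightarrow> \<zero>\<^bsub>A2\<^esub> \<otimes>\<^bsub>A2\<^esub> t = \<zero>\<^bsub>A2\<^esub>"
  using linear_maps_zero[OF AA.T_boolean AA.T_boolean, of "\<lambda>s. s \<otimes>\<^bsub>A2\<^esub> t"] tensor_mult_bilin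
  by (simp add: bilin_def)

lemma tensor_mult_zero_right [simp]: "t \<in> carrier A2 \<Longrightarrow> t \<otimes>\<^bsub>A2\<^esub> \<zero>\<^bsub>A2\<^esub> = \<zero>\<^bsub>A2\<^esub>"
  using linear_maps_zero[OF AA.T_boolean AA.T_boolean, of "\<lambda>s. t \<otimes>\<^bsub>A2\<^esub> s"] tensor_mult_bilin
  by (simp add: bilin_def)

lemma lslice_bilin: "f \<in> linear_maps A F2 \<Longrightarrow> bilin A A A (\<lambda>x y. scale2 A (f x) y)"
  by (intro bilinI) (auto simp: scale2_def linear_maps_add add_self)

lemma rslice_bilin: "f \<in> linear_maps A F2 \<Longrightarrow> bilin A A A (\<lambda>x y. scale2 A (f y) x)"
  by (intro bilinI) (auto simp: scale2_def linear_maps_add add_self)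

lemma lslice_linear: "f \<in> linear_maps A F2 \<Longrightarrow> lslice A f \<in> linear_maps A2 A"
  unfolding lslice_def by (intro AA.lift_linear boolean_group_axioms lslice_bilin)

lemma rslice_linear: "f \<in> linear_maps A F2 \<Longrightarrow> rslice A f \<in> linear_maps A2 A"
  unfolding rslice_def by (intro AA.lift_linear boolean_group_axioms rslice_bilin)

lemma lslice_tens: "f \<in> linear_maps A F2 \<Longrightarrow> x \<in> carrier A \<Longrightarrow> y \<in> carrier A \<Longrightarrow>
    lslice A f (tens A A x y) = scale2 A (f x) y"
  unfolding lslice_def by (intro AA.lift_tens boolean_group_axioms lslice_bilin)

lemma rslice_tens: "f \<in> linear_maps A F2 \<Longrightarrow> x \<in> carrier A \<Longrightarrow> y \<in> carrier A \<Longrightarrow>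
    rslice A f (tens A A x y) = scale2 A (f y) x"
  unfolding rslice_def by (intro AA.lift_tens boolean_group_axioms rslice_bilin)

lemma lslice_closed: "f \<in> linear_maps A F2 \<Longrightarrow> t \<in> carrier A2 \<Longrightarrow> lslice A f t \<in> carrier A"
  by (rule linear_maps_closed[OF lslice_linear])

lemma rslice_closed: "f \<in> linear_maps A F2 \<Longrightarrow> t \<in> carrier A2 \<Longrightarrow> rslice A f t \<in> carrier A"
  by (rule linear_maps_closed[OF rslice_linear])

lemma lslice_zero [simp]: "f \<in> linear_maps A F2 \<Longrightarrow> lslice A f \<zero>\<^bsub>A2\<^esub> = \<zero>"
  by (rule linear_maps_zero[OF AA.T_boolean boolean_group_axioms lslice_linear])

lemma rslice_zero [simp]: "f \<in> linear_maps A F2 \<Longrightarrow> rslice A f \<zero>\<^bsub>A2\<^esub> = \<zero>"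
  by (rule linear_maps_zero[OF AA.T_boolean boolean_group_axioms rslice_linear])

lemmas lslice_add = linear_maps_add[OF lslice_linear]
  and rslice_add = linear_maps_add[OF rslice_linear]

lemma lslice_counit: "a \<in> carrier A \<Longrightarrow> lslice A (counit A) (coprod A a) = a"
  unfolding lslice_def by (rule counit_left)

lemma rslice_counit: "a \<in> carrier A \<Longrightarrow> rslice A (counit A) (coprod A a) = a"
  unfolding rslice_def by (rule counit_right)

lemma counit_lslice:
  assumes "f \<in> linear_maps A F2" "t \<in> carrier A2"
  shows "counit A (lslice A f t) = f (rslice A (counit A) t)"
  using assms(2)
proof (induct rule: AA.tensor_induct)
  case zero
  then show ?case using assms(1) linear_maps_zero[OF boolean_group_axioms boolean_group_F2 assms(1)]
    by (simp add: counit_linear)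
next
  case (tens v w)
  have "f \<zero> = 0" using linear_maps_zero[OF boolean_group_axioms boolean_group_F2 assms(1)] by simp
  then show ?case using assms(1) tens by (simp add: lslice_tens rslice_tens counit_linear scale2_def bit_eq_if_not_zero)
next
  case (add t t')
  then show ?case using assms(1)
    by (simp add: lslice_add rslice_add counit_linear lslice_closed rslice_closed counit_add linear_maps_add[OF assms(1)])
qed

lemma counit_rslice:
  assumes "f \<in> linear_maps A F2" "t \<in> carrier A2"
  shows "counit A (rslice A f t) = f (lslice A (counit A) t)"
  using assms(2)
proof (induct rule: AA.tensor_induct)
  case zero
  then show ?case using assms(1) linear_maps_zero[OF boolean_group_axioms boolean_group_F2 assms(1)]
    by (simp add: counit_linear)
next
  case (tens v w)
  have "f \<zero> = 0" using linear_maps_zero[OF boolean_group_axioms boolean_group_F2 assms(1)] by simp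
  then show ?case using assms(1) tens by (simp add: lslice_tens rslice_tens counit_linear scale2_def bit_eq_if_not_zero)
next
  case (add t t')
  then show ?case using assms(1)
    by (simp add: lslice_add rslice_add counit_linear lslice_closed rslice_closed counit_add linear_maps_add[OF assms(1)])
qed

lemma low_terms_closed: "t \<in> low_terms A n \<Longrightarrow> t \<in> carrier A2"
  by (induct rule: low_terms.induct) (auto intro: AA.tens_closed homog_closed)

lemma aug_ideal_iff: "a \<in> aug_ideal A \<longleftrightarrow> a \<in> carrier A \<and> counit A a = 0"
  by (simp add: aug_ideal_def)

lemma aug_closed: "a \<in> aug_ideal A \<Longrightarrow> a \<in> carrier A"
  by (simp add: aug_ideal_def)

lemma counit_comp: "a \<in> carrier A \<Longrightarrow> counit A a = counit A (component A 0 a)"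
proof (induct rule: graded_induct)
  case (homog n x)
  then show ?case using counit_homog[of x n] comp_of_homog[of x n 0] by auto
qed (auto simp: comp_add counit_add)

lemma comp_mult_left: "c \<in> homog A m \<Longrightarrow> x \<in> carrier A \<Longrightarrow> component A (n + m) (c \<otimes> x) = c \<otimes> component A n x"
  by (rule comp_degree_map[OF graded_space_axioms graded_space_axioms])
    (auto simp: linear_maps_iff r_distr homog_closed mult_homog add.commute[of _ m])

end

locale conn_hopf = hopf_algebra +
  assumes connected: "connected_hopf A" and finite_dim: "finite_dimensional A"
begin

lemma homog_neg: "n < 0 \<Longrightarrow> homog A n = {\<zero>}"
  using connected by (simp add: connected_hopf_def)

lemma homog_0: "homog A 0 = {\<zero>, \<one>}"
  using connected by (simp add: connected_hopf_def)

lemma finite_carrier: "finite (carrier A)"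
proof -
  obtain S where S: "finite S" "S \<subseteq> carrier A" "generate (add_monoid A) S = carrier A"
    using finite_dim by (auto simp: finite_dimensional_def)
  let ?U = "(\<lambda>T. finsum A (\<lambda>x. x) T) ` Pow S"
  have "bool_subspace A ?U"
    unfolding bool_subspace_def
  proof (intro conjI ballI)
    show "?U \<subseteq> carrier A" using S by (auto intro!: finsum_closed)
    show "\<zero> \<in> ?U" by (rule image_eqI[of _ _ "{}"]) auto
    fix x y assume "x \<in> ?U" "y \<in> ?U"
    then obtain P Q where PQ: "P \<subseteq> S" "Q \<subseteq> S" "x = finsum A (\<lambda>x. x) P" "y = finsum A (\<lambda>x. x) Q" by auto
    then have "finsum A (\<lambda>x. x) ((P - Q) \<union> (Q - P)) = x \<oplus> y"
      using S by (subst finsum_sym_diff) (auto intro: finite_subset)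
    then show "x \<oplus> y \<in> ?U" using PQ by (intro image_eqI[of _ _ "(P - Q) \<union> (Q - P)"]) auto
  qed
  then have "subgroup ?U (add_monoid A)" by (rule bool_subspace_imp_subgroup)
  moreover have "S \<subseteq> ?U"
  proof
    fix s assume "s \<in> S"
    then show "s \<in> ?U" using S by (intro image_eqI[of _ _ "{s}"]) auto
  qed
  ultimately have "generate (add_monoid A) S \<subseteq> ?U"
    by (metis a_group group.generate_subgroup_incl)
  then show ?thesis using S by (metis finite_Pow_iff finite_imageI finite_subset)
qed

lemma aug_iff_comp: "a \<in> aug_ideal A \<longleftrightarrow> a \<in> carrier A \<and> component A 0 a = \<zero>"
  using counit_comp[of a] comp_homog[of a 0] homog_0 counit_zero counit_one
  by (auto simp: aug_ideal_iff)

lemma homog_pos_aug: "a \<in> homog A n \<Longrightarrow> n > 0 \<Longrightarrow> a \<in> aug_ideal A"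
  using counit_homog homog_closed by (auto simp: aug_ideal_iff)

lemma aug_induct [consumes 1, case_names zero homog add]:
  assumes a: "a \<in> aug_ideal A" and P: "P \<zero>" "\<And>n x. n > 0 \<Longrightarrow> x \<in> homog A n \<Longrightarrow> P x"
    "\<And>x y. x \<in> carrier A \<Longrightarrow> y \<in> carrier A \<Longrightarrow> P x \<Longrightarrow> P y \<Longrightarrow> P (x \<oplus> y)"
  shows "P a"
proof (rule comps_induct)
  show "a \<in> carrier A" using a by (rule aug_closed)
  fix n show "P (component A n a)"
    using P a aug_iff_comp[of a] comp_homog[of a n] homog_neg[of n]
    by (cases n "0 :: int" rule: linorder_cases) auto
qed (use P in auto)

text \<open>
  In a connected algebra a term with left factor of the full degree has the form \<open>c \<otimes> 1\<close>, and the
  counit identity forces \<open>c = b\<close>.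
\<close>

lemma coprod_leading:
  assumes b: "b \<in> homog A n"
  shows "\<exists>s\<in>low_terms A n. coprod A b = tens A A b \<one> \<oplus>\<^bsub>A2\<^esub> s"
proof -
  have ex: "\<exists>c\<in>homog A n. \<exists>s\<in>low_terms A n. t = tens A A c \<one> \<oplus>\<^bsub>A2\<^esub> s" if "t \<in> homog A2 n" for t
    using that
  proof (induct rule: AA.homog_tensor_induct)
    case zero
    show ?case by (intro bexI[of _ \<zero>] bexI[of _ "\<zero>\<^bsub>A2\<^esub>"]) (auto intro: low_terms.zero)
  next
    case (tens i v w)
    then have c: "v \<in> carrier A" "w \<in> carrier A" using homog_closed by auto
    consider "i < n" | "i = n" "w = \<zero>" | "i = n" "w = \<one>" | "i > n" "w = \<zero>"
      using tens(2) homog_0 homog_neg[of "n - i"] by (cases i n rule: linorder_cases) auto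
    then show ?case
    proof cases
      case 1
      then show ?thesis using c tens AA.tens_closed
        by (intro bexI[of _ \<zero>] bexI[of _ "tens A A v w"]) (auto intro: low_terms.tens)
    next
      case 3
      then show ?thesis using c tens AA.tens_closed
        by (intro bexI[of _ v] bexI[of _ "\<zero>\<^bsub>A2\<^esub>"]) (auto intro: low_terms.zero)
    qed (use c in \<open>auto intro!: bexI[of _ \<zero>] bexI[of _ "\<zero>\<^bsub>A2\<^esub>"] low_terms.zero\<close>)
  next
    case (add t t')
    then obtain c s c' s' where *: "c \<in> homog A n" "c' \<in> homog A n" "s \<in> low_terms A n" "s' \<in> low_terms A n"
      "t = tens A A c \<one> \<oplus>\<^bsub>A2\<^esub> s" "t' = tens A A c' \<one> \<oplus>\<^bsub>A2\<^esub> s'" by auto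
    then have "c \<in> carrier A" "c' \<in> carrier A" "s \<in> carrier A2" "s' \<in> carrier A2"
      using homog_closed low_terms_closed by auto
    then have "t \<oplus>\<^bsub>A2\<^esub> t' = tens A A (c \<oplus> c') \<one> \<oplus>\<^bsub>A2\<^esub> (s \<oplus>\<^bsub>A2\<^esub> s')"
      using AA.tens_closed by (simp add: * AA.tens_add_left A2.a_ac)
    then show ?case using * homog_add low_terms.add by blast
  qed
  obtain c s where c: "c \<in> homog A n" and s: "s \<in> low_terms A n"
    and eq: "coprod A b = tens A A c \<one> \<oplus>\<^bsub>A2\<^esub> s"
    using ex[OF coprod_homog[OF b]] by auto
  have "rslice A (counit A) s = \<zero>" using s
  proof (induct rule: low_terms.induct)
    case (tens v i w)
    then show ?case using homog_closed counit_homog[OF tens(2)] by (simp add: rslice_tens counit_linear)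
  next
    case (add s t)
    then show ?case using low_terms_closed by (simp add: rslice_add counit_linear)
  qed (simp add: counit_linear)
  then have "b = c"
    using rslice_counit[OF homog_closed[OF b]] homog_closed[OF c] low_terms_closed[OF s]
    unfolding eq by (simp add: rslice_add counit_linear AA.tens_closed rslice_tens)
  with s eq show ?thesis by auto
qed

section \<open>The socle of a finite connected Hopf algebra\<close>

text \<open>
  Let \<open>\<Lambda>\<close> be a homogeneous element killed by the augmentation ideal.  The elements
  \<open>\<Sum> \<Lambda>' f(\<Lambda>'')\<close> form a left ideal: comparing the terms of \<open>\<Delta>(b)\<Delta>(\<Lambda>) = \<Delta>(b\<Lambda>) = 0\<close> expresses
  \<open>b\<Lambda>' \<otimes> \<Lambda>''\<close> by terms \<open>b'\<Lambda>' \<otimes> b''\<Lambda>''\<close> with \<open>b'\<close> of smaller degree.  It contains \<open>1\<close>, which comes from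
  a functional of degree \<open>|\<Lambda>|\<close> with \<open>f(\<Lambda>) = 1\<close>, so it is everything.  Since \<open>|\<Lambda>'| \<le> |\<Lambda>|\<close>, no degree
  exceeds \<open>|\<Lambda>|\<close>, and in degree \<open>|\<Lambda>|\<close> only the term \<open>\<Lambda> \<otimes> 1\<close> of the coproduct contributes.
\<close>

lemma socle_homog:
  assumes L: "L \<in> homog A i" "L \<noteq> \<zero>" and ann: "\<And>c. c \<in> aug_ideal A \<Longrightarrow> c \<otimes> L = \<zero>"
  shows "homog A i = {\<zero>, L}" and "n > i \<Longrightarrow> homog A n = {\<zero>}"
proof -
  let ?F = "linear_maps A F2"
  define J where "J f = rslice A f (coprod A L)" for f
  have Lc: "L \<in> carrier A" using L homog_closed by auto
  have F0: "(\<lambda>a. 0) \<in> ?F" by (simp add: linear_maps_iff)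
  have F_add: "(\<lambda>a. f a + g a) \<in> ?F" if "f \<in> ?F" "g \<in> ?F" for f g
    using that by (auto simp: linear_maps_iff ac_simps)
  have F_mult: "(\<lambda>a. f (w \<otimes> a)) \<in> ?F" if "f \<in> ?F" "w \<in> carrier A" for f w
    using that by (auto simp: linear_maps_iff r_distr)
  have f0: "f \<zero> = 0" if "f \<in> ?F" for f
    using linear_maps_zero[OF boolean_group_axioms boolean_group_F2 that] by simp
  have Jc: "J f \<in> carrier A" if "f \<in> ?F" for f using that Lc by (simp add: J_def rslice_closed)
  have J0: "J (\<lambda>a. 0) = \<zero>"
  proof -
    have "rslice A (\<lambda>a. 0) t = \<zero>" if "t \<in> carrier A2" for t using that
      by (induct rule: AA.tensor_induct) (simp_all add: F0 rslice_tens rslice_add)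
    then show ?thesis using Lc by (simp add: J_def)
  qed
  have J_add: "J (\<lambda>a. f a + g a) = J f \<oplus> J g" if fg: "f \<in> ?F" "g \<in> ?F" for f g
  proof -
    have "rslice A (\<lambda>a. f a + g a) t = rslice A f t \<oplus> rslice A g t" if "t \<in> carrier A2" for t using that
    proof (induct rule: AA.tensor_induct)
      case (add t t')
      then show ?case using fg F_add[OF fg] by (simp add: rslice_add rslice_closed a_ac)
    next
      case (tens v w)
      show ?case unfolding rslice_tens[OF F_add[OF fg] tens] rslice_tens[OF fg(1) tens]
        rslice_tens[OF fg(2) tens] by (rule scale2_add_left[OF tens(1)])
    qed (use fg F_add[OF fg] in simp)
    then show ?thesis using Lc by (simp add: J_def)
  qed
  have slice_mult: "rslice A f (tens A A v w \<otimes>\<^bsub>A2\<^esub> t) = v \<otimes> rslice A (\<lambda>a. f (w \<otimes> a)) t"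
    if "f \<in> ?F" "v \<in> carrier A" "w \<in> carrier A" "t \<in> carrier A2" for f v w t
    using that(4)
  proof (induct rule: AA.tensor_induct)
    case zero
    then show ?case using that F_mult by (simp add: AA.tens_closed)
  next
    case (tens x y)
    then show ?case using that F_mult[OF that(1,3)] by (simp add: tensor_mult_tens rslice_tens scale2_def)
  next
    case (add s t)
    then show ?case using that F_mult[OF that(1,3)]
      by (simp add: tensor_mult_add_right AA.tens_closed tensor_mult_closed rslice_add rslice_closed r_distr)
  qed
  have ideal: "\<exists>g\<in>?F. b \<otimes> J f = J g" if "b \<in> homog A (int n)" "f \<in> ?F" for b n f
    using that
  proof (induct n arbitrary: b f rule: less_induct)
    case (less n)
    show ?case
    proof (cases "n = 0")
      case True
      then consider "b = \<zero>" | "b = \<one>" using less(2) homog_0 by auto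
      then show ?thesis
      proof cases
        case 1
        then show ?thesis using less(3) J0 Jc by (intro bexI[OF _ F0]) simp
      next
        case 2
        then show ?thesis using less(3) Jc by (intro bexI[of _ f]) simp_all
      qed
    next
      case False
      have bc: "b \<in> carrier A" using less(2) homog_closed by auto
      obtain s where s: "s \<in> low_terms A (int n)" "coprod A b = tens A A b \<one> \<oplus>\<^bsub>A2\<^esub> s"
        using coprod_leading[OF less(2)] by auto
      have sc: "s \<in> carrier A2" using low_terms_closed s by auto
      have "b \<otimes> L = \<zero>" using homog_pos_aug[OF less(2)] False ann by auto
      then have "coprod A b \<otimes>\<^bsub>A2\<^esub> coprod A L = \<zero>\<^bsub>A2\<^esub>"
        using coprod_mult[OF bc Lc] by simp
      then have "tens A A b \<one> \<otimes>\<^bsub>A2\<^esub> coprod A L \<oplus>\<^bsub>A2\<^esub> s \<otimes>\<^bsub>A2\<^esub> coprod A L = \<zero>\<^bsub>A2\<^esub>"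
        using s sc bc Lc by (simp add: tensor_mult_add_left AA.tens_closed)
      then have "tens A A b \<one> \<otimes>\<^bsub>A2\<^esub> coprod A L = s \<otimes>\<^bsub>A2\<^esub> coprod A L"
        using A2.add_eq_zero_iff sc bc Lc by (simp add: AA.tens_closed tensor_mult_closed)
      moreover have "rslice A f (tens A A b \<one> \<otimes>\<^bsub>A2\<^esub> coprod A L) = b \<otimes> rslice A (\<lambda>a. f (\<one> \<otimes> a)) (coprod A L)"
        using slice_mult less(3) bc Lc by simp
      moreover have "rslice A (\<lambda>a. f (\<one> \<otimes> a)) (coprod A L) = J f"
      proof -
        have "rslice A (\<lambda>a. f (\<one> \<otimes> a)) t = rslice A f t" if "t \<in> carrier A2" for t using that
          by (induct rule: AA.tensor_induct)
            (use less(3) F_mult[OF less(3) one_closed] in \<open>simp_all add: rslice_tens rslice_add\<close>)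
        then show ?thesis using Lc by (simp add: J_def)
      qed
      ultimately have "b \<otimes> J f = rslice A f (s \<otimes>\<^bsub>A2\<^esub> coprod A L)" by simp
      moreover have "\<exists>g\<in>?F. rslice A f (s \<otimes>\<^bsub>A2\<^esub> coprod A L) = J g"
        using s(1)
      proof (induct rule: low_terms.induct)
        case zero
        then show ?case using Lc less(3) J0 by (intro bexI[OF _ F0]) simp
      next
        case (tens v j w)
        then have c: "v \<in> carrier A" "w \<in> carrier A" using homog_closed by auto
        then have eq: "rslice A f (tens A A v w \<otimes>\<^bsub>A2\<^esub> coprod A L) = v \<otimes> J (\<lambda>a. f (w \<otimes> a))"
          using slice_mult less(3) Lc by (simp add: J_def)
        show ?case
        proof (cases "j < 0")
          case True
          then have "v = \<zero>" using tens homog_neg by auto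
          then show ?thesis using eq Jc[OF F_mult[OF less(3) c(2)]] J0 by (intro bexI[OF _ F0]) simp
        next
          case False
          then have "v \<in> homog A (int (nat j))" "nat j < n" using tens by auto
          then show ?thesis using less(1) F_mult[OF less(3) c(2)] eq by metis
        qed
      next
        case (add s t)
        then obtain g g' where "g \<in> ?F" "g' \<in> ?F" "rslice A f (s \<otimes>\<^bsub>A2\<^esub> coprod A L) = J g"
          "rslice A f (t \<otimes>\<^bsub>A2\<^esub> coprod A L) = J g'" by auto
        then have "rslice A f ((s \<oplus>\<^bsub>A2\<^esub> t) \<otimes>\<^bsub>A2\<^esub> coprod A L) = J g \<oplus> J g'"
          using low_terms_closed[OF add(1)] low_terms_closed[OF add(3)] Lc less(3)
          by (simp add: tensor_mult_add_left tensor_mult_closed rslice_add)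
        then show ?case
          using F_add[OF \<open>g \<in> ?F\<close> \<open>g' \<in> ?F\<close>] J_add[OF \<open>g \<in> ?F\<close> \<open>g' \<in> ?F\<close>] by metis
      qed
      ultimately show ?thesis by simp
    qed
  qed
  \<comment> \<open>a functional of degree \<open>i\<close> with \<open>f L = 1\<close>; then \<open>J f\<close> has degree \<open>0\<close> and augmentation \<open>1\<close>\<close>
  obtain f where f: "f \<in> ?F" "J f = \<one>"
  proof -
    have "bool_subspace A {\<zero>}" "L \<notin> {\<zero>}" using L by (simp_all add: bool_subspace_def)
    from separating_functional[OF this(1) Lc this(2)]
    obtain h :: "'a \<Rightarrow> bit" where h: "\<And>v w. v \<in> carrier A \<Longrightarrow> w \<in> carrier A \<Longrightarrow> h (v \<oplus> w) = h v + h w"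
      "\<And>w. w \<in> {\<zero>} \<Longrightarrow> h w = 0" "h L = 1"
      by blast
    define f where "f a = h (component A i a)" for a
    have f: "f \<in> ?F" by (auto simp: linear_maps_iff f_def comp_add h)
    have fL: "f L = 1" using comp_of_homog[OF L(1)] h by (simp add: f_def)
    have "rslice A f t \<in> homog A 0" if "t \<in> homog A2 i" for t using that
    proof (induct rule: AA.homog_tensor_induct)
      case (tens j v w)
      have "f w = 0 \<or> j = 0" using comp_of_homog[OF tens(2), of i] h by (auto simp: f_def)
      then show ?case using tens homog_closed f by (auto simp: rslice_tens scale2_def)
    next
      case (add s t)
      then show ?case using f A2.homog_closed homog_add by (simp add: rslice_add)
    qed (use f in simp)
    then have "J f \<in> {\<zero>, \<one>}" using coprod_homog[OF L(1)] homog_0 by (auto simp: J_def)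
    moreover have "counit A (J f) = 1"
      unfolding J_def using counit_rslice[OF f] lslice_counit fL Lc by simp
    ultimately have "J f = \<one>" by auto
    with f that show thesis by blast
  qed
  have all: "\<exists>g\<in>?F. b = J g" if b: "b \<in> homog A n" for b n
  proof (cases "n < 0")
    case True
    then have "b = \<zero>" using b homog_neg by auto
    then show ?thesis using J0 by (intro bexI[OF _ F0]) simp
  next
    case False
    then have "b \<in> homog A (int (nat n))" using b by simp
    from ideal[OF this f(1)] show ?thesis using f homog_closed[OF b] by simp
  qed
  have g1: "b = \<zero>" if ni: "n > i" and bn: "b \<in> homog A n" for b n
  proof -
    obtain g where g: "g \<in> ?F" "b = J g" using all[OF bn] by blast
    have "component A n (rslice A g t) = \<zero>" if "t \<in> homog A2 i" for t using that
    proof (induct rule: AA.homog_tensor_induct)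
      case (tens j v w)
      have "n = j \<Longrightarrow> w = \<zero>" using tens(2) homog_neg[of "i - j"] ni by auto
      then show ?case using tens homog_closed g comp_of_homog[OF tens(1), of n] f0[OF g(1)]
        by (auto simp: rslice_tens scale2_def)
    next
      case (add s t)
      then show ?case using g A2.homog_closed by (simp add: rslice_add comp_add rslice_closed)
    qed (use g in simp)
    then have "component A n b = \<zero>" using g coprod_homog[OF L(1)] by (simp add: J_def)
    then show ?thesis using comp_of_homog[OF bn] by simp
  qed
  then show "n > i \<Longrightarrow> homog A n = {\<zero>}" using homog_zero by blast
  have "b \<in> {\<zero>, L}" if b: "b \<in> homog A i" for b
  proof -
    obtain g where g: "g \<in> ?F" "b = J g" using all[OF b] by blast
    obtain s where s: "s \<in> low_terms A i" "coprod A L = tens A A L \<one> \<oplus>\<^bsub>A2\<^esub> s"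
      using coprod_leading[OF L(1)] by auto
    have "component A i (rslice A g s) = \<zero>" using s(1)
    proof (induct rule: low_terms.induct)
      case (tens v j w)
      then show ?case using homog_closed g comp_of_homog[OF tens(1), of i] by (simp add: rslice_tens scale2_def)
    next
      case (add s t)
      then show ?case using g low_terms_closed by (simp add: rslice_add comp_add rslice_closed)
    qed (use g in simp)
    then have "component A i b = scale2 A (g \<one>) L"
      using g s low_terms_closed[OF s(1)] Lc comp_of_homog[OF L(1)]
      by (simp add: J_def rslice_add AA.tens_closed rslice_tens comp_add rslice_closed scale2_def)
    then show ?thesis using comp_of_homog[OF b] by (auto simp: scale2_def split: if_splits)
  qed
  then show "homog A i = {\<zero>, L}" using L by auto
qed

lemma degrees_finite: "finite {n. \<exists>x\<in>homog A n. x \<noteq> \<zero>}"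
proof -
  define g where "g n = (SOME x. x \<in> homog A n \<and> x \<noteq> \<zero>)" for n
  have g: "g n \<in> homog A n \<and> g n \<noteq> \<zero>" if "\<exists>x\<in>homog A n. x \<noteq> \<zero>" for n
    unfolding g_def by (rule someI_ex) (use that in auto)
  have "inj_on g {n. \<exists>x\<in>homog A n. x \<noteq> \<zero>}"
  proof (rule inj_onI, rule ccontr)
    fix m n assume "m \<in> {n. \<exists>x\<in>homog A n. x \<noteq> \<zero>}" "n \<in> {n. \<exists>x\<in>homog A n. x \<noteq> \<zero>}" "g m = g n" "m \<noteq> n"
    then show False using g[of m] g[of n] homog_disjoint[of "g m" m n] by auto
  qed
  moreover have "g ` {n. \<exists>x\<in>homog A n. x \<noteq> \<zero>} \<subseteq> carrier A"
  proof (rule image_subsetI)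
    fix n assume "n \<in> {n. \<exists>x\<in>homog A n. x \<noteq> \<zero>}"
    then show "g n \<in> carrier A" using g[of n] homog_closed[of "g n" n] by simp
  qed
  ultimately show ?thesis by (rule finite_imageD[OF finite_subset[OF _ finite_carrier], rotated])
qed

lemma top_degree_attained: "\<exists>x\<in>homog A (top_degree A). x \<noteq> \<zero>"
proof -
  have "{n. \<exists>x\<in>homog A n. x \<noteq> \<zero>} \<noteq> {}" using one_homog one_not_zero by blast
  from Max_in[OF degrees_finite this] show ?thesis unfolding top_degree_def by blast
qed

lemma above_top: "n > top_degree A \<Longrightarrow> homog A n = {\<zero>}"
proof -
  assume n: "n > top_degree A"
  have "n \<notin> {n. \<exists>x\<in>homog A n. x \<noteq> \<zero>}"
    using Max_ge[OF degrees_finite, of n] n unfolding top_degree_def by linarith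
  then show ?thesis using homog_zero[of n] by blast
qed

definition lam :: 'a where
  "lam = (SOME x. x \<in> homog A (top_degree A) \<and> x \<noteq> \<zero>)"

lemma lam_homog: "lam \<in> homog A (top_degree A)" and lam_nonzero: "lam \<noteq> \<zero>"
proof -
  have "lam \<in> homog A (top_degree A) \<and> lam \<noteq> \<zero>"
    unfolding lam_def by (rule someI_ex) (use top_degree_attained in blast)
  then show "lam \<in> homog A (top_degree A)" "lam \<noteq> \<zero>" by blast+
qed

lemma lam_closed [simp]: "lam \<in> carrier A"
  using lam_homog homog_closed by auto

lemma aug_mult_lam: "c \<in> aug_ideal A \<Longrightarrow> c \<otimes> lam = \<zero>"
proof (induct rule: aug_induct)
  case (homog n x)
  then show ?case using mult_homog[OF homog(2) lam_homog] above_top[of "n + top_degree A"] by auto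
qed (simp_all add: l_distr)

lemma homog_top: "homog A (top_degree A) = {\<zero>, lam}"
  using socle_homog(1)[OF lam_homog lam_nonzero aug_mult_lam] .

lemma lam_aug: "top_degree A > 0 \<Longrightarrow> lam \<in> aug_ideal A"
  using homog_pos_aug lam_homog by blast

text \<open>
  The homogeneous components of an element killed by the augmentation ideal are killed as well, and a
  nonzero one must live in the top degree, since nothing lies above it.
\<close>

lemma socle:
  assumes a: "a \<in> carrier A" and ann: "\<And>c. c \<in> aug_ideal A \<Longrightarrow> c \<otimes> a = \<zero>"
  shows "a = \<zero> \<or> a = lam"
proof -
  have z: "component A n a = \<zero>" if n: "n \<noteq> top_degree A" for n
  proof (rule ccontr)
    assume nz: "component A n a \<noteq> \<zero>"
    have "c \<otimes> component A n a = \<zero>" if "c \<in> aug_ideal A" for c using that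
    proof (induct rule: aug_induct)
      case (homog m c)
      then show ?case using comp_mult_left[OF homog(2) a, of n] ann homog_pos_aug[OF homog(2,1)] by simp
    qed (use a in \<open>simp_all add: l_distr\<close>)
    note S = socle_homog(2)[OF comp_homog[OF a] nz this]
    consider "n > top_degree A" | "top_degree A > n" using n by linarith
    then show False
    proof cases
      case 1
      then show False using above_top comp_homog[OF a, of n] nz by blast
    next
      case 2
      then show False using S lam_homog lam_nonzero by blast
    qed
  qed
  have "component A (top_degree A) a = a"
  proof -
    let ?t = "component A (top_degree A) a"
    have "component A n (a \<oplus> ?t) = \<zero>" for n
    proof (cases "n = top_degree A")
      case True
      have "component A n ?t = component A n a" using comp_of_homog[OF comp_homog[OF a], of n] True by simp
      then show ?thesis using a by (simp add: comp_add add_self)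
    next
      case False
      have "component A n ?t = \<zero>" using comp_of_homog[OF comp_homog[OF a], of n] False by simp
      then show ?thesis using a z[OF False] by (simp add: comp_add)
    qed
    then have "a \<oplus> ?t = \<zero>" using a by (rule_tac eq_zero_if_comps_zero) simp_all
    then show ?thesis by (rule iffD1[OF add_eq_zero_iff[OF a comp_closed[OF a]], symmetric])
  qed
  moreover have "component A (top_degree A) a \<in> {\<zero>, lam}"
    unfolding homog_top[symmetric] by (rule comp_homog[OF a])
  ultimately show ?thesis by simp
qed

end

section \<open>Finitely supported families\<close>

definition coeffs :: "('a, 's) ring_scheme \<Rightarrow> 'y set \<Rightarrow> ('y \<Rightarrow> 'a) set" where
  "coeffs A Y = {c. finite {y. c y \<noteq> \<zero>\<^bsub>A\<^esub>} \<and> {y. c y \<noteq> \<zero>\<^bsub>A\<^esub>} \<subseteq> Y \<and> range c \<subseteq> carrier A}"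

lemma coeffs_supp:
  assumes "c \<in> coeffs V Y"
  shows "finite {y. c y \<noteq> \<zero>\<^bsub>V\<^esub>}" "c y \<in> carrier V" "{y. c y \<noteq> \<zero>\<^bsub>V\<^esub>} \<subseteq> Y"
  using assms unfolding coeffs_def by auto

lemma (in boolean_group) coeffs_sum:
  assumes c: "c \<in> coeffs V Y" and e: "e \<in> coeffs V Y"
  shows "(\<lambda>y. c y \<oplus> e y) \<in> coeffs V Y"
proof -
  have "{y. c y \<oplus> e y \<noteq> \<zero>} \<subseteq> {y. c y \<noteq> \<zero>} \<union> {y. e y \<noteq> \<zero>}" by auto
  then have "finite {y. c y \<oplus> e y \<noteq> \<zero>}" "{y. c y \<oplus> e y \<noteq> \<zero>} \<subseteq> Y"
    using c e unfolding coeffs_def by (blast intro: finite_subset)+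
  then show ?thesis using coeffs_supp(2)[OF c] coeffs_supp(2)[OF e] unfolding coeffs_def by auto
qed

lemma finsum_coeffs_add:
  assumes V: "boolean_group V" and Z: "boolean_group Z" and L: "\<And>y. y \<in> Y \<Longrightarrow> L y \<in> linear_maps V Z"
    and c: "c \<in> coeffs V Y" and e: "e \<in> coeffs V Y"
  shows "finsum Z (\<lambda>y. L y (c y \<oplus>\<^bsub>V\<^esub> e y)) {y. c y \<oplus>\<^bsub>V\<^esub> e y \<noteq> \<zero>\<^bsub>V\<^esub>} =
    finsum Z (\<lambda>y. L y (c y)) {y. c y \<noteq> \<zero>\<^bsub>V\<^esub>} \<oplus>\<^bsub>Z\<^esub> finsum Z (\<lambda>y. L y (e y)) {y. e y \<noteq> \<zero>\<^bsub>V\<^esub>}"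
proof -
  interpret V: boolean_group V by fact
  interpret Z: boolean_group Z by fact
  let ?S = "{y. c y \<noteq> \<zero>\<^bsub>V\<^esub>} \<union> {y. e y \<noteq> \<zero>\<^bsub>V\<^esub>}"
  have S: "finite ?S" "?S \<subseteq> Y" using c e by (auto simp: coeffs_def)
  have sup: "finsum Z (\<lambda>y. L y (g y)) {y. g y \<noteq> \<zero>\<^bsub>V\<^esub>} = finsum Z (\<lambda>y. L y (g y)) ?S"
    if g: "g \<in> coeffs V Y" "{y. g y \<noteq> \<zero>\<^bsub>V\<^esub>} \<subseteq> ?S" for g
  proof (rule Z.finsum_support[OF S(1) _ g(2)])
    show "L y (g y) \<in> carrier Z" if "y \<in> ?S" for y
      using linear_maps_closed[OF L coeffs_supp(2)[OF g(1)]] S(2) that by blast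
    show "{y \<in> ?S. L y (g y) \<noteq> \<zero>\<^bsub>Z\<^esub>} \<subseteq> {y. g y \<noteq> \<zero>\<^bsub>V\<^esub>}"
    proof (rule subsetI, rule ccontr)
      fix y assume y: "y \<in> {y \<in> ?S. L y (g y) \<noteq> \<zero>\<^bsub>Z\<^esub>}" "y \<notin> {y. g y \<noteq> \<zero>\<^bsub>V\<^esub>}"
      then have "y \<in> Y" using S(2) by blast
      then show False using y linear_maps_zero[OF V Z L] by simp
    qed
  qed
  have cc: "c y \<in> carrier V" "e y \<in> carrier V" for y using coeffs_supp(2)[OF c] coeffs_supp(2)[OF e] by auto
  have "finsum Z (\<lambda>y. L y (c y \<oplus>\<^bsub>V\<^esub> e y)) {y. c y \<oplus>\<^bsub>V\<^esub> e y \<noteq> \<zero>\<^bsub>V\<^esub>} = finsum Z (\<lambda>y. L y (c y \<oplus>\<^bsub>V\<^esub> e y)) ?S"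
    by (rule sup[OF V.coeffs_sum[OF c e]]) auto
  also have "\<dots> = finsum Z (\<lambda>y. L y (c y) \<oplus>\<^bsub>Z\<^esub> L y (e y)) ?S"
  proof (rule Z.finsum_cong')
    show "L y (c y \<oplus>\<^bsub>V\<^esub> e y) = L y (c y) \<oplus>\<^bsub>Z\<^esub> L y (e y)" if "y \<in> ?S" for y
      using linear_maps_add[OF L cc] S(2) that by blast
    show "(\<lambda>y. L y (c y) \<oplus>\<^bsub>Z\<^esub> L y (e y)) \<in> ?S \<rightarrow> carrier Z"
      using linear_maps_closed[OF L] cc S(2) by (auto intro!: Z.a_closed)
  qed simp
  also have "\<dots> = finsum Z (\<lambda>y. L y (c y)) ?S \<oplus>\<^bsub>Z\<^esub> finsum Z (\<lambda>y. L y (e y)) ?S"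
    by (rule Z.finsum_addf) (use linear_maps_closed[OF L] cc S(2) in auto)
  finally show ?thesis using sup[OF c] sup[OF e] by auto
qed

section \<open>Modules and free coordinates\<close>

lemma mod_homI:
  assumes "\<And>x. x \<in> carrier M \<Longrightarrow> f x \<in> carrier N"
    "\<And>x y. x \<in> carrier M \<Longrightarrow> y \<in> carrier M \<Longrightarrow> f (x \<oplus>\<^bsub>M\<^esub> y) = f x \<oplus>\<^bsub>N\<^esub> f y"
    "\<And>n x. x \<in> homog M n \<Longrightarrow> f x \<in> homog N n"
    "\<And>a x. a \<in> carrier A \<Longrightarrow> x \<in> carrier M \<Longrightarrow> f (act M a x) = act N a (f x)"
  shows "f \<in> mod_hom A M N"
  using assms by (auto simp: mod_hom_def graded_maps_def linear_maps_iff)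

lemma mod_hom_linear: "f \<in> mod_hom A M N \<Longrightarrow> f \<in> linear_maps M N"
  by (auto simp: mod_hom_def graded_maps_def)

lemma mod_hom_closed: "f \<in> mod_hom A M N \<Longrightarrow> x \<in> carrier M \<Longrightarrow> f x \<in> carrier N"
  by (rule linear_maps_closed[OF mod_hom_linear])

lemma mod_hom_add: "f \<in> mod_hom A M N \<Longrightarrow> x \<in> carrier M \<Longrightarrow> y \<in> carrier M \<Longrightarrow>
    f (x \<oplus>\<^bsub>M\<^esub> y) = f x \<oplus>\<^bsub>N\<^esub> f y"
  by (rule linear_maps_add[OF mod_hom_linear])

lemma mod_hom_act: "f \<in> mod_hom A M N \<Longrightarrow> a \<in> carrier A \<Longrightarrow> x \<in> carrier M \<Longrightarrow> f (act M a x) = act N a (f x)"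
  by (auto simp: mod_hom_def)

lemma mod_hom_homog: "f \<in> mod_hom A M N \<Longrightarrow> x \<in> homog M n \<Longrightarrow> f x \<in> homog N n"
  by (auto simp: mod_hom_def graded_maps_def)

lemma mod_hom_comp:
  assumes f: "f \<in> mod_hom A M N" and g: "g \<in> mod_hom A N L"
  shows "(\<lambda>x. g (f x)) \<in> mod_hom A M L"
  by (rule mod_homI)
    (simp_all add: mod_hom_closed[OF f] mod_hom_closed[OF g] mod_hom_add[OF f] mod_hom_add[OF g]
      mod_hom_homog[OF f] mod_hom_homog[OF g] mod_hom_act[OF f] mod_hom_act[OF g])

lemma mod_hom_id: "(\<lambda>x. x) \<in> mod_hom A M M"
  by (rule mod_homI) auto

lemma mod_hom_zero:
  assumes "gmodule A M" "gmodule A N" "f \<in> mod_hom A M N"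
  shows "f \<zero>\<^bsub>M\<^esub> = \<zero>\<^bsub>N\<^esub>"
proof -
  interpret M: gmodule A M by fact
  interpret N: gmodule A N by fact
  show ?thesis
    by (rule linear_maps_zero[OF M.boolean_group_axioms N.boolean_group_axioms mod_hom_linear[OF assms(3)]])
qed

inductive_set aug_span :: "'a hopf \<Rightarrow> ('a, 'm) gmod \<Rightarrow> 'm set" for A M where
  zero: "\<zero>\<^bsub>M\<^esub> \<in> aug_span A M"
| step: "s \<in> aug_span A M \<Longrightarrow> a \<in> aug_ideal A \<Longrightarrow> x \<in> carrier M \<Longrightarrow> s \<oplus>\<^bsub>M\<^esub> act M a x \<in> aug_span A M"

text \<open>
  For modules that are bounded below, freeness is detected by the top class \<open>\<lambda>\<close>: the kernel of
  \<open>\<lambda>\<close> is never smaller than the span of the augmentation ideal, and equality means freeness.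
\<close>

definition socle_exact :: "'a hopf \<Rightarrow> ('a, 'm) gmod \<Rightarrow> bool" where
  "socle_exact A M \<longleftrightarrow>
    (\<forall>y\<in>carrier M. act M (conn_hopf.lam A) y = \<zero>\<^bsub>M\<^esub> \<longrightarrow> y \<in> aug_span A M)"

definition lincomb :: "'a hopf \<Rightarrow> ('a, 'm) gmod \<Rightarrow> ('y \<Rightarrow> 'm) \<Rightarrow> ('y \<Rightarrow> 'a) \<Rightarrow> 'm" where
  "lincomb A M x c = finsum M (\<lambda>y. act M (c y) (x y)) {y. c y \<noteq> \<zero>\<^bsub>A\<^esub>}"

text \<open>\<open>\<beta> v\<close> is the family of coordinates of \<open>v\<close> with respect to the homogeneous basis \<open>Y\<close>.\<close>

definition free_on :: "'a hopf \<Rightarrow> ('a, 'm) gmod \<Rightarrow> 'm set \<Rightarrow> ('m \<Rightarrow> 'm \<Rightarrow> 'a) \<Rightarrow> bool" where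
  "free_on A M Y \<beta> \<longleftrightarrow> (\<forall>y\<in>Y. \<exists>n. y \<in> homog M n) \<and>
    (\<forall>v\<in>carrier M. \<beta> v \<in> coeffs A Y \<and> lincomb A M (\<lambda>y. y) (\<beta> v) = v) \<and>
    (\<forall>c\<in>coeffs A Y. lincomb A M (\<lambda>y. y) c = \<zero>\<^bsub>M\<^esub> \<longrightarrow> c = (\<lambda>_. \<zero>\<^bsub>A\<^esub>))"

locale hopf_module = conn_hopf A + M: gmodule A M
  for A :: "'a hopf" (structure) and M :: "('a, 'm) gmod"
begin

lemma act_linear: "a \<in> carrier A \<Longrightarrow> act M a \<in> linear_maps M M"
  by (simp add: linear_maps_iff M.act_closed M.act_add_right)

lemma act_linear_left: "x \<in> carrier M \<Longrightarrow> (\<lambda>a. act M a x) \<in> linear_maps A M"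
  by (simp add: linear_maps_iff M.act_closed M.act_add_left)

lemma act_zero_right [simp]: "a \<in> carrier A \<Longrightarrow> act M a \<zero>\<^bsub>M\<^esub> = \<zero>\<^bsub>M\<^esub>"
  by (rule linear_maps_zero[OF M.boolean_group_axioms M.boolean_group_axioms act_linear])

lemma act_zero_left [simp]: "x \<in> carrier M \<Longrightarrow> act M \<zero> x = \<zero>\<^bsub>M\<^esub>"
  using linear_maps_zero[OF boolean_group_axioms M.boolean_group_axioms act_linear_left] .

lemma comp_act: "a \<in> homog A m \<Longrightarrow> x \<in> carrier M \<Longrightarrow> component M (n + m) (act M a x) = act M a (component M n x)"
  using M.act_homog[of a m]
  by (intro comp_degree_map[OF M.graded_space_axioms M.graded_space_axioms act_linear])
    (auto simp: homog_closed add.commute)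

lemma comp_act_left: "a \<in> carrier A \<Longrightarrow> x \<in> homog M m \<Longrightarrow> component M (n + m) (act M a x) = act M (component A n a) x"
  by (rule comp_degree_map[OF graded_space_axioms M.graded_space_axioms act_linear_left])
    (auto simp: M.homog_closed M.act_homog)

lemma aug_span_closed: "s \<in> aug_span A M \<Longrightarrow> s \<in> carrier M"
  by (induct rule: aug_span.induct) (auto simp: M.act_closed aug_closed)

lemma aug_span_act1: "a \<in> aug_ideal A \<Longrightarrow> x \<in> carrier M \<Longrightarrow> act M a x \<in> aug_span A M"
  using aug_span.step[OF aug_span.zero, of a A x M] by (simp add: M.act_closed aug_closed)

lemma aug_span_add: "t \<in> aug_span A M \<Longrightarrow> s \<in> aug_span A M \<Longrightarrow> s \<oplus>\<^bsub>M\<^esub> t \<in> aug_span A M"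
proof (induct rule: aug_span.induct)
  case (step t a x)
  then have "s \<oplus>\<^bsub>M\<^esub> (t \<oplus>\<^bsub>M\<^esub> act M a x) = (s \<oplus>\<^bsub>M\<^esub> t) \<oplus>\<^bsub>M\<^esub> act M a x"
    using aug_span_closed by (simp add: M.a_assoc M.act_closed aug_closed)
  then show ?case using step aug_span.step by metis
qed (simp add: aug_span_closed)

lemma aug_span_subspace: "bool_subspace M (aug_span A M)"
  unfolding bool_subspace_def using aug_span_closed aug_span_add aug_span.zero by blast

lemma comp_act_mem:
  assumes a: "a \<in> aug_ideal A" and x: "x \<in> carrier M" and G: "bool_subspace M G"
    and step: "\<And>m b. m > 0 \<Longrightarrow> b \<in> homog A m \<Longrightarrow> act M b (component M (n - m) x) \<in> G"
  shows "component M n (act M a x) \<in> G"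
  using a
proof (induct rule: aug_induct)
  case zero
  then show ?case using x G by (simp add: bool_subspace_def)
next
  case (homog m b)
  then show ?case using comp_act[OF homog(2) x, of "n - m"] step by simp
next
  case (add b c)
  then show ?case using x G by (simp add: M.act_add_left M.comp_add M.act_closed bool_subspace_def)
qed

lemma aug_span_comp: "s \<in> aug_span A M \<Longrightarrow> component M n s \<in> aug_span A M"
proof (induct rule: aug_span.induct)
  case (step s a x)
  have "component M n (act M a x) \<in> aug_span A M"
    by (rule comp_act_mem[OF step(3,4) aug_span_subspace])
      (use step(4) homog_pos_aug in \<open>auto intro!: aug_span_act1\<close>)
  then show ?case using step aug_span_closed aug_span_add
    by (simp add: M.comp_add M.act_closed aug_closed)
qed (simp add: aug_span.zero)

lemma aug_span_if_comps:
  assumes "y \<in> carrier M" "\<And>n. component M n y \<in> aug_span A M"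
  shows "y \<in> aug_span A M"
  using assms by (intro M.comps_induct[of y "\<lambda>y. y \<in> aug_span A M"]) (auto intro: aug_span.zero aug_span_add)

lemma coeffs_map:
  assumes "c \<in> coeffs A Y" "\<And>y. f y \<zero> = \<zero>" "\<And>y a. a \<in> carrier A \<Longrightarrow> f y a \<in> carrier A"
  shows "(\<lambda>y. f y (c y)) \<in> coeffs A Y"
proof -
  have "{y. f y (c y) \<noteq> \<zero>} \<subseteq> {y. c y \<noteq> \<zero>}" using assms(2) by force
  then have "finite {y. f y (c y) \<noteq> \<zero>}" "{y. f y (c y) \<noteq> \<zero>} \<subseteq> Y"
    using assms(1) unfolding coeffs_def by (blast intro: finite_subset)+
  then show ?thesis using coeffs_supp(2)[OF assms(1)] assms(3) unfolding coeffs_def by auto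
qed

lemma coeffs_zero: "(\<lambda>_. \<zero>) \<in> coeffs A Y"
  by (auto simp: coeffs_def)

lemma coeffs_single: "y \<in> Y \<Longrightarrow> a \<in> carrier A \<Longrightarrow> (\<lambda>z. if z = y then a else \<zero>) \<in> coeffs A Y"
  by (auto simp: coeffs_def intro: finite_subset[of _ "{y}"])

lemma lincomb_superset:
  assumes "c \<in> coeffs A Y" "\<And>y. y \<in> Y \<Longrightarrow> x y \<in> carrier M" "finite S" "{y. c y \<noteq> \<zero>} \<subseteq> S" "S \<subseteq> Y"
  shows "lincomb A M x c = finsum M (\<lambda>y. act M (c y) (x y)) S"
  unfolding lincomb_def
proof (rule M.finsum_support)
  fix y assume "y \<in> S"
  then have "y \<in> Y" using assms by auto
  then show "act M (c y) (x y) \<in> carrier M" using assms(2) coeffs_supp(2)[OF assms(1)] by (simp add: M.act_closed)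
next
  show "{y \<in> S. act M (c y) (x y) \<noteq> \<zero>\<^bsub>M\<^esub>} \<subseteq> {y. c y \<noteq> \<zero>}"
  proof (rule subsetI, rule ccontr)
    fix y assume "y \<in> {y \<in> S. act M (c y) (x y) \<noteq> \<zero>\<^bsub>M\<^esub>}" "y \<notin> {y. c y \<noteq> \<zero>}"
    then have "y \<in> Y" "c y = \<zero>" "act M (c y) (x y) \<noteq> \<zero>\<^bsub>M\<^esub>" using assms(5) by auto
    then show False using assms(2) by simp
  qed
qed (use assms in auto)

context
  fixes Y :: "'y set" and x :: "'y \<Rightarrow> 'm"
  assumes x: "\<And>y. y \<in> Y \<Longrightarrow> x y \<in> carrier M"
begin

lemma lincomb_closed: "c \<in> coeffs A Y \<Longrightarrow> lincomb A M x c \<in> carrier M"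
  unfolding lincomb_def using x coeffs_supp
  by (intro M.finsum_closed) (auto simp: coeffs_def intro!: M.act_closed)

lemma lincomb_add:
  assumes "c \<in> coeffs A Y" "e \<in> coeffs A Y"
  shows "lincomb A M x (\<lambda>y. c y \<oplus> e y) = lincomb A M x c \<oplus>\<^bsub>M\<^esub> lincomb A M x e"
  unfolding lincomb_def
  by (rule finsum_coeffs_add[OF boolean_group_axioms M.boolean_group_axioms act_linear_left[OF x] assms])

lemma lincomb_single:
  assumes "y \<in> Y" "a \<in> carrier A"
  shows "lincomb A M x (\<lambda>z. if z = y then a else \<zero>) = act M a (x y)"
proof -
  have "lincomb A M x (\<lambda>z. if z = y then a else \<zero>) = finsum M (\<lambda>z. act M (if z = y then a else \<zero>) (x z)) {y}"
    by (rule lincomb_superset[OF coeffs_single[OF assms] x]) (use assms in auto)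
  then show ?thesis using assms x by (simp add: M.act_closed)
qed

text \<open>
  The transformation \<open>g\<close> of the coefficients is the identity for module maps, a left multiplication
  for the action of a single element, and a right multiplication when the vectors are changed
  from \<open>a y\<close> to \<open>y\<close>.
\<close>

lemma linear_lincomb:
  fixes N :: "('a, 'n) gmod"
  assumes N: "hopf_module A N" and f: "f \<in> linear_maps M N" and x': "\<And>y. y \<in> Y \<Longrightarrow> x' y \<in> carrier N"
    and g: "\<And>y. g y \<zero> = \<zero>" "\<And>y a. a \<in> carrier A \<Longrightarrow> g y a \<in> carrier A"
    and fx: "\<And>y a. y \<in> Y \<Longrightarrow> a \<in> carrier A \<Longrightarrow> f (act M a (x y)) = act N (g y a) (x' y)"
    and c: "c \<in> coeffs A Y"
  shows "f (lincomb A M x c) = lincomb A N x' (\<lambda>y. g y (c y))"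
proof -
  interpret N: hopf_module A N by fact
  let ?S = "{y. c y \<noteq> \<zero>}"
  have S: "finite ?S" "?S \<subseteq> Y" using c by (auto simp: coeffs_def)
  have cc: "c y \<in> carrier A" for y using coeffs_supp(2)[OF c] .
  have "f (lincomb A M x c) = finsum N (\<lambda>y. f (act M (c y) (x y))) ?S"
    unfolding lincomb_def
    by (rule linear_maps_finsum[OF M.boolean_group_axioms N.M.boolean_group_axioms f])
      (use S x cc in \<open>auto intro!: M.act_closed\<close>)
  also have "\<dots> = finsum N (\<lambda>y. act N (g y (c y)) (x' y)) ?S"
    by (rule N.M.finsum_cong') (use S cc fx g x' in \<open>auto intro!: N.M.act_closed\<close>)
  also have "\<dots> = lincomb A N x' (\<lambda>y. g y (c y))"
    by (rule N.lincomb_superset[OF coeffs_map[OF c] x' S(1) _ S(2), symmetric]) (use g in auto)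
  finally show ?thesis .
qed

lemma act_lincomb:
  assumes "a \<in> carrier A" "c \<in> coeffs A Y"
  shows "act M a (lincomb A M x c) = lincomb A M x (\<lambda>y. a \<otimes> c y)"
  by (rule linear_lincomb[OF hopf_module_axioms act_linear x, where g = "\<lambda>y b. a \<otimes> b"])
    (use assms x in \<open>auto simp: M.act_mult\<close>)

lemma lincomb_homog:
  assumes c: "c \<in> coeffs A Y" and h: "\<And>y. y \<in> Y \<Longrightarrow> \<exists>i. c y \<in> homog A (n - i) \<and> x y \<in> homog M i"
  shows "lincomb A M x c \<in> homog M n"
  unfolding lincomb_def
proof (rule M.bool_subspace_finsum[OF M.homog_subspace])
  fix y assume "y \<in> {y. c y \<noteq> \<zero>}"
  then have "y \<in> Y" using c by (auto simp: coeffs_def)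
  then obtain i where "c y \<in> homog A (n - i)" "x y \<in> homog M i" using h by blast
  then show "act M (c y) (x y) \<in> homog M n" using M.act_homog by fastforce
qed

end

lemma free_coordinates:
  assumes F: "free_on A M Y \<beta>"
  shows free_carrier: "y \<in> Y \<Longrightarrow> y \<in> carrier M"
    and free_coeffs: "v \<in> carrier M \<Longrightarrow> \<beta> v \<in> coeffs A Y"
    and free_lincomb: "v \<in> carrier M \<Longrightarrow> lincomb A M (\<lambda>y. y) (\<beta> v) = v"
    and free_indep: "c \<in> coeffs A Y \<Longrightarrow> lincomb A M (\<lambda>y. y) c = \<zero>\<^bsub>M\<^esub> \<Longrightarrow> c = (\<lambda>_. \<zero>)"
  using F M.homog_closed unfolding free_on_def by blast+

lemma free_unique:
  assumes F: "free_on A M Y \<beta>" and c: "c \<in> coeffs A Y" "e \<in> coeffs A Y"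
    and eq: "lincomb A M (\<lambda>y. y) c = lincomb A M (\<lambda>y. y) e"
  shows "c = e"
proof -
  note Y = free_carrier[OF F]
  have "lincomb A M (\<lambda>y. y) (\<lambda>y. c y \<oplus> e y) = \<zero>\<^bsub>M\<^esub>"
    using lincomb_add[OF Y c] eq lincomb_closed[OF Y c(2)] by (simp add: M.add_self)
  then have "(\<lambda>y. c y \<oplus> e y) = (\<lambda>_. \<zero>)" using free_indep[OF F coeffs_sum[OF c]] by simp
  then have "c y \<oplus> e y = \<zero>" for y by meson
  then show ?thesis using add_eq_zero_iff coeffs_supp(2)[OF c(1)] coeffs_supp(2)[OF c(2)] by blast
qed

lemma free_coords_eq:
  "free_on A M Y \<beta> \<Longrightarrow> c \<in> coeffs A Y \<Longrightarrow> \<beta> (lincomb A M (\<lambda>y. y) c) = c"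
proof -
  assume F: "free_on A M Y \<beta>" and c: "c \<in> coeffs A Y"
  have v: "lincomb A M (\<lambda>y. y) c \<in> carrier M" by (rule lincomb_closed[OF free_carrier[OF F] c])
  show ?thesis by (rule free_unique[OF F free_coeffs[OF F v] c free_lincomb[OF F v]])
qed

lemma free_coords_add:
  assumes F: "free_on A M Y \<beta>" and "v \<in> carrier M" "w \<in> carrier M"
  shows "\<beta> (v \<oplus>\<^bsub>M\<^esub> w) = (\<lambda>y. \<beta> v y \<oplus> \<beta> w y)"
  using free_coords_eq[OF F coeffs_sum[OF free_coeffs[OF F assms(2)] free_coeffs[OF F assms(3)]]]
  by (simp add: lincomb_add[OF free_carrier[OF F]] free_coeffs[OF F] free_lincomb[OF F] assms)

lemma coeffs_mult: "a \<in> carrier A \<Longrightarrow> c \<in> coeffs A Y \<Longrightarrow> (\<lambda>y. a \<otimes> c y) \<in> coeffs A Y"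
  using coeffs_map[of c Y "\<lambda>_ b. a \<otimes> b"] by simp

lemma free_coords_act:
  assumes F: "free_on A M Y \<beta>" and "v \<in> carrier M" "a \<in> carrier A"
  shows "\<beta> (act M a v) = (\<lambda>y. a \<otimes> \<beta> v y)"
  using free_coords_eq[OF F coeffs_mult[OF assms(3) free_coeffs[OF F assms(2)]]]
  by (simp add: act_lincomb[OF free_carrier[OF F], symmetric] free_coeffs[OF F] free_lincomb[OF F] assms)

lemma free_coords_basis:
  assumes F: "free_on A M Y \<beta>" and "y \<in> Y"
  shows "\<beta> y = (\<lambda>z. if z = y then \<one> else \<zero>)"
  using free_coords_eq[OF F coeffs_single[OF assms(2) one_closed]]
  by (simp add: lincomb_single[OF free_carrier[OF F]] assms free_carrier[OF F] M.act_one)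

lemma free_coords_homog:
  assumes F: "free_on A M Y \<beta>" and v: "v \<in> homog M n" and y: "y \<in> Y" "y \<in> homog M m"
  shows "\<beta> v y \<in> homog A (n - m)"
proof -
  define dg where "dg z = (if z = y then m else (SOME k. z \<in> homog M k))" for z
  have dg: "z \<in> homog M (dg z)" if "z \<in> Y" for z
    using that y F unfolding dg_def free_on_def by (auto intro: someI_ex)
  have vc: "v \<in> carrier M" using v M.homog_closed by auto
  have "component M n (lincomb A M (\<lambda>z. z) (\<beta> v)) = lincomb A M (\<lambda>z. z) (\<lambda>z. component A (n - dg z) (\<beta> v z))"
  proof (rule linear_lincomb[OF free_carrier[OF F] hopf_module_axioms M.comp_linear free_carrier[OF F],
        where g = "\<lambda>z a. component A (n - dg z) a"])
    fix z a assume "z \<in> Y" "a \<in> carrier A"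
    then show "component M n (act M a z) = act M (component A (n - dg z) a) z"
      using comp_act_left[OF _ dg, of a z "n - dg z"] by simp
  qed (use free_coeffs[OF F vc] in auto)
  then have "lincomb A M (\<lambda>z. z) (\<lambda>z. component A (n - dg z) (\<beta> v z)) = lincomb A M (\<lambda>z. z) (\<beta> v)"
    using free_lincomb[OF F vc] M.comp_of_homog[OF v] by simp
  then have "(\<lambda>z. component A (n - dg z) (\<beta> v z)) = \<beta> v"
    using free_unique[OF F coeffs_map[OF free_coeffs[OF F vc], of "\<lambda>z a. component A (n - dg z) a"] free_coeffs[OF F vc]]
    by simp
  then have "\<beta> v y = component A (n - m) (\<beta> v y)" by (metis dg_def)
  then show ?thesis using comp_homog coeffs_supp(2)[OF free_coeffs[OF F vc]] by metis
qed

end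

inductive_set generated :: "'a hopf \<Rightarrow> ('a, 'm) gmod \<Rightarrow> 'm set \<Rightarrow> 'm set" for A M Y where
  zero: "\<zero>\<^bsub>M\<^esub> \<in> generated A M Y"
| step: "s \<in> generated A M Y \<Longrightarrow> a \<in> carrier A \<Longrightarrow> y \<in> Y \<Longrightarrow> s \<oplus>\<^bsub>M\<^esub> act M a y \<in> generated A M Y"

context hopf_module
begin

context
  fixes Y :: "'m set"
  assumes Y: "Y \<subseteq> carrier M"
begin

lemma generated_lincomb: "s \<in> generated A M Y \<Longrightarrow> \<exists>c\<in>coeffs A Y. lincomb A M (\<lambda>y. y) c = s"
proof (induct rule: generated.induct)
  case zero
  show ?case by (rule bexI[OF _ coeffs_zero]) (simp add: lincomb_def)
next
  case (step s a y)
  then obtain c where c: "c \<in> coeffs A Y" "lincomb A M (\<lambda>y. y) c = s" by auto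
  show ?case
  proof (rule bexI)
    show "(\<lambda>z. c z \<oplus> (if z = y then a else \<zero>)) \<in> coeffs A Y"
      by (rule coeffs_sum[OF c(1) coeffs_single[OF step(4,3)]])
    show "lincomb A M (\<lambda>y. y) (\<lambda>z. c z \<oplus> (if z = y then a else \<zero>)) = s \<oplus>\<^bsub>M\<^esub> act M a y"
    proof -
      have x: "\<And>z. z \<in> Y \<Longrightarrow> z \<in> carrier M" using Y by blast
      show ?thesis
        using lincomb_add[where x = "\<lambda>y. y", OF x c(1) coeffs_single[OF step(4,3)]]
          lincomb_single[where x = "\<lambda>y. y", OF x step(4,3)] c(2) by simp
    qed
  qed
qed

lemma generated_closed: "s \<in> generated A M Y \<Longrightarrow> s \<in> carrier M"
  by (induct rule: generated.induct) (use Y in \<open>auto intro!: M.act_closed\<close>)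

lemma generated_add: "t \<in> generated A M Y \<Longrightarrow> s \<in> generated A M Y \<Longrightarrow> s \<oplus>\<^bsub>M\<^esub> t \<in> generated A M Y"
proof (induct rule: generated.induct)
  case (step t a x)
  then have "s \<oplus>\<^bsub>M\<^esub> (t \<oplus>\<^bsub>M\<^esub> act M a x) = (s \<oplus>\<^bsub>M\<^esub> t) \<oplus>\<^bsub>M\<^esub> act M a x"
    using generated_closed Y by (subst M.a_assoc) (auto intro!: M.act_closed)
  then show ?case using step generated.step by metis
qed (simp add: generated_closed)

lemma generated_act: "s \<in> generated A M Y \<Longrightarrow> a \<in> carrier A \<Longrightarrow> act M a s \<in> generated A M Y"
proof (induct rule: generated.induct)
  case (step s b x)
  have "x \<in> carrier M" using Y step by auto
  then have "act M a (s \<oplus>\<^bsub>M\<^esub> act M b x) = act M a s \<oplus>\<^bsub>M\<^esub> act M (a \<otimes> b) x"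
    using generated_closed step by (simp add: M.act_add_right M.act_closed M.act_mult)
  then show ?case using step generated.step[of "act M a s" A M Y "a \<otimes> b" x] by simp
qed (simp add: generated.zero)

lemma generated_subspace: "bool_subspace M (generated A M Y)"
  unfolding bool_subspace_def using generated_closed generated_add generated.zero by blast

lemma generated_base: "y \<in> Y \<Longrightarrow> y \<in> generated A M Y"
  using generated.step[OF generated.zero one_closed, of y Y M] Y by (auto simp: M.act_one)

text \<open>
  Nakayama's lemma, by induction on the degree, which is bounded below: an element of the span of the
  augmentation ideal is a combination of elements of smaller degree.
\<close>

lemma nakayama:
  assumes hY: "\<And>y. y \<in> Y \<Longrightarrow> \<exists>n. y \<in> homog M n"
    and gen: "\<And>n v. v \<in> homog M n \<Longrightarrow> \<exists>t\<in>generated A M Y. \<exists>s\<in>aug_span A M. v = t \<oplus>\<^bsub>M\<^esub> s"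
  shows "carrier M \<subseteq> generated A M Y"
proof -
  have gcomp: "component M n t \<in> generated A M Y" if "t \<in> generated A M Y" for n t using that
  proof (induct rule: generated.induct)
    case (step s a y)
    then have y: "y \<in> carrier M" using Y by auto
    obtain m where m: "y \<in> homog M m" using hY step by blast
    have "component M n (act M a y) = act M (component A (n - m) a) y"
      using comp_act_left[OF step(3) m, of "n - m"] by simp
    then show ?case using step y generated_closed
      by (simp add: M.comp_add M.act_closed generated.step)
  qed (simp add: generated.zero)
  obtain k where k: "\<forall>n<k. homog M n = {\<zero>\<^bsub>M\<^esub>}" using M.bounded_below by (auto simp: bounded_below_def)
  have h: "homog M (k + int n) \<subseteq> generated A M Y" for n
  proof (induct n rule: less_induct)
    case (less n)
    have low: "homog M j \<subseteq> generated A M Y" if "j < k + int n" for j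
    proof (cases "j < k")
      case True
      then show ?thesis using k generated.zero by auto
    next
      case False
      then show ?thesis using less[of "nat (j - k)"] that by auto
    qed
    show ?case
    proof
      fix v assume v: "v \<in> homog M (k + int n)"
      then obtain t s where ts: "t \<in> generated A M Y" "s \<in> aug_span A M" "v = t \<oplus>\<^bsub>M\<^esub> s" using gen by blast
      have "component M (k + int n) s \<in> generated A M Y" using ts(2)
      proof (induct rule: aug_span.induct)
        case (step s a x)
        have "component M (k + int n) (act M a x) \<in> generated A M Y"
        proof (rule comp_act_mem[OF step(3,4) generated_subspace])
          fix m b assume mb: "m > 0" "b \<in> homog A m"
          have "component M (k + int n - m) x \<in> generated A M Y"
            using low[of "k + int n - m"] M.comp_homog[OF step(4)] mb(1) by auto
          then show "act M b (component M (k + int n - m) x) \<in> generated A M Y"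
            using generated_act homog_closed[OF mb(2)] by blast
        qed
        then show ?case using step aug_span_closed generated_add
          by (simp add: M.comp_add M.act_closed aug_closed)
      qed (simp add: generated.zero)
      moreover have "v = component M (k + int n) t \<oplus>\<^bsub>M\<^esub> component M (k + int n) s"
        using M.comp_of_homog[OF v, of "k + int n"] ts generated_closed aug_span_closed
        by (simp add: M.comp_add)
      ultimately show "v \<in> generated A M Y" using gcomp[OF ts(1)] generated_add by metis
    qed
  qed
  show ?thesis
  proof
    fix v assume "v \<in> carrier M"
    then show "v \<in> generated A M Y"
    proof (induct rule: M.graded_induct)
      case (homog n v)
      show ?case
      proof (cases "n < k")
        case True
        then show ?thesis using k homog generated.zero by auto
      next
        case False
        then show ?thesis using h[of "nat (n - k)"] homog by auto
      qed
    qed (auto intro: generated.zero generated_add)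
  qed
qed

end

text \<open>
  Lift a basis of \<open>M/IM\<close> to homogeneous elements; they generate by Nakayama's lemma.  A relation
  between them, multiplied by a ring element of the largest degree that does not kill it, has
  coefficients in the socle, hence says that \<open>\<lambda>\<close> kills a nontrivial sum of basis elements.
\<close>

theorem free_if_socle_exact:
  assumes ex: "socle_exact A M"
  shows "\<exists>Y \<beta>. free_on A M Y \<beta>"
proof -
  define Fam where "Fam = {Y. Y \<subseteq> {y. \<exists>n. y \<in> homog M n} \<and>
    (\<forall>T. finite T \<and> T \<subseteq> Y \<and> T \<noteq> {} \<longrightarrow> finsum M (\<lambda>y. y) T \<notin> aug_span A M)}"
  have "\<exists>Y\<in>Fam. \<forall>E\<in>Fam. Y \<subseteq> E \<longrightarrow> E = Y"
  proof (rule subset_Zorn_nonempty)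
    show "Fam \<noteq> {}" by (auto simp: Fam_def intro!: exI[of _ "{}"])
  next
    fix C assume C: "C \<noteq> {}" "subset.chain Fam C"
    then have sub: "C \<subseteq> Fam" by (auto simp: subset_chain_def)
    have "finsum M (\<lambda>y. y) T \<notin> aug_span A M" if T: "finite T" "T \<subseteq> \<Union>C" "T \<noteq> {}" for T
    proof -
      obtain E where "E \<in> C" "T \<subseteq> E" using finite_subset_Union_chain[OF T(1,2) C] by blast
      then show ?thesis using sub T by (auto simp: Fam_def)
    qed
    moreover have "\<Union>C \<subseteq> {y. \<exists>n. y \<in> homog M n}" using sub by (auto simp: Fam_def)
    ultimately show "\<Union>C \<in> Fam" by (auto simp: Fam_def)
  qed
  then obtain Y where YF: "Y \<in> Fam" and max: "\<And>E. E \<in> Fam \<Longrightarrow> Y \<subseteq> E \<Longrightarrow> E = Y" by blast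
  have hY: "\<And>y. y \<in> Y \<Longrightarrow> \<exists>n. y \<in> homog M n" using YF by (auto simp: Fam_def)
  have Yc: "Y \<subseteq> carrier M" using hY M.homog_closed by blast
  have ind: "finsum M (\<lambda>y. y) T \<notin> aug_span A M" if "finite T" "T \<subseteq> Y" "T \<noteq> {}" for T
    using YF that by (auto simp: Fam_def)
  have gen: "\<exists>t\<in>generated A M Y. \<exists>s\<in>aug_span A M. v = t \<oplus>\<^bsub>M\<^esub> s" if v: "v \<in> homog M n" for n v
  proof (cases "v \<in> Y")
    case True
    then show ?thesis using generated_base[OF Yc True] M.homog_closed[OF v]
      by (intro bexI[of _ v] bexI[of _ "\<zero>\<^bsub>M\<^esub>"]) (auto intro: aug_span.zero)
  next
    case False
    have vc: "v \<in> carrier M" using v M.homog_closed by blast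
    have "insert v Y \<notin> Fam" using max[of "insert v Y"] False by blast
    then obtain T where T: "finite T" "T \<subseteq> insert v Y" "T \<noteq> {}" "finsum M (\<lambda>y. y) T \<in> aug_span A M"
      using hY v by (auto simp: Fam_def)
    have vT: "v \<in> T" using ind[of T] T by blast
    define T' where "T' = T - {v}"
    have T': "finite T'" "T' \<subseteq> Y" "v \<notin> T'" "T = insert v T'" using T vT by (auto simp: T'_def)
    have tc: "finsum M (\<lambda>y. y) T' \<in> carrier M" using T' Yc by (intro M.finsum_closed) auto
    have eq: "finsum M (\<lambda>y. y) T = v \<oplus>\<^bsub>M\<^esub> finsum M (\<lambda>y. y) T'"
      unfolding T'(4) using T' Yc vc by (intro M.finsum_insert) auto
    have "v = finsum M (\<lambda>y. y) T' \<oplus>\<^bsub>M\<^esub> finsum M (\<lambda>y. y) T"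
      unfolding eq using vc tc by (metis M.a_comm M.add_cancel_left)
    moreover have "finsum M (\<lambda>y. y) T' \<in> generated A M Y"
      by (rule M.bool_subspace_finsum[OF generated_subspace[OF Yc]]) (use T' generated_base[OF Yc] in auto)
    ultimately show ?thesis using T(4) by blast
  qed
  have span: "carrier M \<subseteq> generated A M Y" by (rule nakayama[OF Yc hY gen])
  define \<beta> where "\<beta> v = (SOME c. c \<in> coeffs A Y \<and> lincomb A M (\<lambda>y. y) c = v)" for v
  have \<beta>: "\<beta> v \<in> coeffs A Y \<and> lincomb A M (\<lambda>y. y) (\<beta> v) = v" if v: "v \<in> carrier M" for v
  proof -
    obtain c where "c \<in> coeffs A Y \<and> lincomb A M (\<lambda>y. y) c = v"
      using generated_lincomb[OF Yc subsetD[OF span v]] by (elim bexE) simp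
    then show ?thesis unfolding \<beta>_def by (rule someI[of "\<lambda>c. c \<in> coeffs A Y \<and> lincomb A M (\<lambda>y. y) c = v"])
  qed
  have indep: "c = (\<lambda>_. \<zero>)" if c: "c \<in> coeffs A Y" "lincomb A M (\<lambda>y. y) c = \<zero>\<^bsub>M\<^esub>" for c
  proof (rule ccontr)
    assume "c \<noteq> (\<lambda>_. \<zero>)"
    then obtain y0 where y0: "c y0 \<noteq> \<zero>" by auto
    have cc: "c y \<in> carrier A" for y using coeffs_supp(2)[OF c(1)] .
    define Q where "Q n \<longleftrightarrow> (\<exists>b\<in>homog A (int n). \<exists>y. b \<otimes> c y \<noteq> \<zero>)" for n
    have "Q 0" unfolding Q_def using one_homog y0 cc by (intro bexI[of _ \<one>] exI[of _ y0]) auto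
    moreover have "n \<le> nat (top_degree A)" if "Q n" for n
    proof (rule ccontr)
      assume "\<not> ?thesis"
      then have "homog A (int n) = {\<zero>}" using above_top[of "int n"] by linarith
      then show False using \<open>Q n\<close> cc by (auto simp: Q_def)
    qed
    ultimately obtain n where n: "Q n" "\<And>m. Q m \<Longrightarrow> m \<le> n" using Nat.ex_has_greatest_nat[of Q 0 "nat (top_degree A)"] by blast
    then obtain b y1 where b: "b \<in> homog A (int n)" "b \<otimes> c y1 \<noteq> \<zero>" by (auto simp: Q_def)
    have bc: "b \<in> carrier A" using b homog_closed by blast
    define e where "e y = b \<otimes> c y" for y
    have e: "e \<in> coeffs A Y" unfolding e_def using coeffs_mult[OF bc c(1)] .
    have ec: "e y \<in> carrier A" for y using coeffs_supp(2)[OF e] .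
    have e_lc: "lincomb A M (\<lambda>y. y) e = \<zero>\<^bsub>M\<^esub>"
    proof -
      have "\<And>y. y \<in> Y \<Longrightarrow> y \<in> carrier M" using Yc by blast
      then show ?thesis
        unfolding e_def using act_lincomb[where x = "\<lambda>y. y", OF _ bc c(1)] c(2) bc by simp
    qed
    have "a \<otimes> e y = \<zero>" if "a \<in> aug_ideal A" for a y using that
    proof (induct rule: aug_induct)
      case (homog m a)
      have "a \<otimes> b \<in> homog A (int (nat m + n))" using mult_homog[OF homog(2) b(1)] homog(1) by simp
      then have "(a \<otimes> b) \<otimes> c y = \<zero>" using n(2)[of "nat m + n"] homog(1) by (auto simp: Q_def)
      then show ?case using homog_closed[OF homog(2)] bc cc by (simp add: e_def m_assoc)
    qed (use ec in \<open>simp_all add: l_distr\<close>)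
    then have e01: "e y = \<zero> \<or> e y = lam" for y using socle[OF ec] by blast
    define T where "T = {y. e y \<noteq> \<zero>}"
    have T: "finite T" "T \<subseteq> Y" "T \<noteq> {}" using e b by (auto simp: T_def coeffs_def e_def)
    have Tc: "finsum M (\<lambda>y. y) T \<in> carrier M" using T Yc by (intro M.finsum_closed) auto
    have "\<zero>\<^bsub>M\<^esub> = finsum M (\<lambda>y. act M lam y) T"
      unfolding e_lc[symmetric] lincomb_def T_def[symmetric]
    proof (rule M.finsum_cong')
      show "act M (e y) y = act M lam y" if "y \<in> T" for y using that e01[of y] by (simp add: T_def)
    qed (use T Yc in \<open>auto intro!: M.act_closed\<close>)
    also have "\<dots> = act M lam (finsum M (\<lambda>y. y) T)"
      by (rule linear_maps_finsum[OF M.boolean_group_axioms M.boolean_group_axioms act_linear, symmetric])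
        (use T Yc in auto)
    finally have "finsum M (\<lambda>y. y) T \<in> aug_span A M" using ex Tc by (auto simp: socle_exact_def)
    then show False using ind[OF T] by blast
  qed
  show ?thesis
    using hY \<beta> indep by (intro exI[of _ Y] exI[of _ \<beta>]) (auto simp: free_on_def)
qed

end

section \<open>Copies and submodules\<close>

lemma gmodule_copy:
  fixes M :: "('a, 'm) gmod" and i :: "'m \<Rightarrow> 'n"
  assumes M: "gmodule A M" and i: "inj_on i (carrier M)"
  shows "\<exists>N :: ('a, 'n) gmod. gmodule A N \<and> mod_iso A M N"
proof -
  interpret M: gmodule A M by fact
  define j where "j = inv_into (carrier M) i"
  have ji: "j (i x) = x" if "x \<in> carrier M" for x using that i by (simp add: j_def)
  have jc: "j x \<in> carrier M" and ij: "i (j x) = x" if "x \<in> i ` carrier M" for x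
    using that ji by auto
  define N :: "('a, 'n) gmod" where "N = \<lparr>carrier = i ` carrier M, monoid.mult = (\<lambda>_ _. i \<zero>\<^bsub>M\<^esub>), one = i \<zero>\<^bsub>M\<^esub>,
    ring.zero = i \<zero>\<^bsub>M\<^esub>, ring.add = (\<lambda>x y. i (j x \<oplus>\<^bsub>M\<^esub> j y)), homog = (\<lambda>n. i ` homog M n),
    act = (\<lambda>a x. i (act M a (j x)))\<rparr>"
  have N [simp]: "carrier N = i ` carrier M" "\<zero>\<^bsub>N\<^esub> = i \<zero>\<^bsub>M\<^esub>" "x \<oplus>\<^bsub>N\<^esub> y = i (j x \<oplus>\<^bsub>M\<^esub> j y)"
    "homog N n = i ` homog M n" "act N a x = i (act M a (j x))" for x y n a
    by (simp_all add: N_def)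
  note hc = M.homog_closed
  have ab: "abelian_group N"
  proof (rule abelian_groupI)
    fix x assume "x \<in> carrier N"
    then show "\<exists>y\<in>carrier N. y \<oplus>\<^bsub>N\<^esub> x = \<zero>\<^bsub>N\<^esub>"
      by (intro bexI[of _ x]) (auto simp: ji M.add_self)
  qed (auto simp: ji M.a_ac)
  have bool: "boolean_group N"
    using ab by (intro boolean_group.intro boolean_group_axioms.intro) (auto simp: ji M.add_self)
  have gr: "graded_space N"
  proof (rule graded_spaceI[where P = "\<lambda>n x. i (component M n (j x))"])
    show "bool_subspace N (homog N n)" for n
      unfolding bool_subspace_def using hc by (auto simp: ji M.homog_add)
    show "(\<lambda>x. i (component M n (j x))) \<in> linear_maps N N" for n
      by (auto simp: linear_maps_iff ji M.comp_add)
    show "i (component M n (j x)) = (if n = m then x else \<zero>\<^bsub>N\<^esub>)" if "x \<in> homog N m" for n m x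
      using that hc by (auto simp: ji M.comp_of_homog)
    have "i x \<in> homog_span N" if "x \<in> carrier M" for x using that
    proof (induct rule: M.graded_induct)
      case zero
      then show ?case using homog_span.zero[of N] by simp
    next
      case (homog n x)
      then show ?case using homog_span.homog[of "i x" N n] by simp
    next
      case (add x y)
      then show ?case using homog_span.add[of "i x" N "i y"] by (simp add: ji)
    qed
    then show "x \<in> homog_span N" if "x \<in> carrier N" for x using that by auto
  qed (rule bool)
  obtain k where k: "\<forall>n<k. homog M n = {\<zero>\<^bsub>M\<^esub>}" using M.bounded_below by (auto simp: bounded_below_def)
  have "gmodule A N"
  proof (intro gmodule.intro gr gmodule_axioms.intro)
    show "bounded_below N" using k unfolding bounded_below_def by (intro exI[of _ k]) simp
    show "act N a x \<in> homog N (m + n)" if "a \<in> homog A m" "x \<in> homog N n" for a m x n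
      using that M.act_homog hc by (auto simp: ji)
  qed (auto simp: ji M.act_closed M.act_add_left M.act_add_right M.act_mult M.act_one)
  moreover have "mod_iso A M N"
    unfolding mod_iso_def
  proof (intro bexI conjI ballI)
    show "i \<in> mod_hom A M N" by (rule mod_homI) (auto simp: ji)
    show "j \<in> mod_hom A N M" by (rule mod_homI) (use hc in \<open>auto simp: ji M.act_closed\<close>)
  qed (auto simp: ji)
  ultimately show ?thesis by blast
qed

text \<open>
  Projectivity is tested only on modules inside the universe, so the finite modules on which it will be
  tested have to be copied there.
\<close>

lemma finite_copy:
  fixes M :: "('a, 'm) gmod"
  assumes "gmodule A M" "finite (carrier M)"
  shows "\<exists>N :: ('a, 'u::infinite) gmod. gmodule A N \<and> mod_iso A M N"
proof -
  obtain U :: "'u set" where "finite U" "card U = card (carrier M)"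
    using infinite_arbitrarily_large[OF infinite_UNIV] by blast
  then obtain i :: "'m \<Rightarrow> 'u" where "inj_on i (carrier M)"
    using card_le_inj[OF assms(2), of U] by auto
  then show ?thesis by (rule gmodule_copy[OF assms(1)])
qed

lemma graded_subspace:
  fixes W :: "('v, 's) graded_scheme" and V :: "('v, 't) graded_scheme"
  assumes "graded_space V" and U: "bool_subspace V (carrier W)"
    and comps: "\<And>n x. x \<in> carrier W \<Longrightarrow> component V n x \<in> carrier W"
    and W: "\<zero>\<^bsub>W\<^esub> = \<zero>\<^bsub>V\<^esub>" "\<And>x y. x \<oplus>\<^bsub>W\<^esub> y = x \<oplus>\<^bsub>V\<^esub> y" "\<And>n. homog W n = homog V n \<inter> carrier W"
  shows "graded_space W"
proof -
  interpret V: graded_space V by fact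
  have Uc: "x \<in> carrier W \<Longrightarrow> x \<in> carrier V" and U0: "\<zero>\<^bsub>V\<^esub> \<in> carrier W"
    and Ua: "x \<in> carrier W \<Longrightarrow> y \<in> carrier W \<Longrightarrow> x \<oplus>\<^bsub>V\<^esub> y \<in> carrier W" for x y
    using U by (auto simp: bool_subspace_def)
  have "abelian_group W"
  proof (rule abelian_groupI)
    fix x assume "x \<in> carrier W"
    then show "\<exists>y\<in>carrier W. y \<oplus>\<^bsub>W\<^esub> x = \<zero>\<^bsub>W\<^esub>"
      by (intro bexI[of _ x]) (auto simp: W V.add_self Uc)
  qed (auto simp: W Uc U0 Ua V.a_ac)
  then have bool: "boolean_group W"
    by (intro boolean_group.intro boolean_group_axioms.intro) (auto simp: W V.add_self Uc)
  show ?thesis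
  proof (rule graded_spaceI[where P = "component V", OF bool])
    show "bool_subspace W (homog W n)" for n
      using U0 Ua V.homog_add by (auto simp: bool_subspace_def W)
    show "component V n \<in> linear_maps W W" for n
      using comps by (auto simp: linear_maps_iff W V.comp_add Uc)
    show "component V n x = (if n = m then x else \<zero>\<^bsub>W\<^esub>)" if "x \<in> homog W m" for n m x
      using that by (auto simp: W V.comp_of_homog)
    fix x assume x: "x \<in> carrier W"
    have "finsum V (\<lambda>n. component V n x) S \<in> homog_span W" if "finite S" for S
      using that
    proof (induct S rule: finite_induct)
      case empty
      then show ?case using homog_span.zero[of W] by (simp add: W)
    next
      case (insert n S)
      then have eq: "finsum V (\<lambda>n. component V n x) (insert n S) = component V n x \<oplus>\<^bsub>W\<^esub> finsum V (\<lambda>n. component V n x) S"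
        using Uc[OF x] by (simp add: W Pi_def)
      have "component V n x \<in> homog W n" using V.comp_homog[OF Uc[OF x]] comps[OF x] by (simp add: W)
      then show ?case unfolding eq by (rule homog_span.add[OF homog_span.homog insert(3)])
    qed
    then show "x \<in> homog_span W" using V.comp_sum[OF Uc[OF x]] V.comp_finite[OF Uc[OF x]] by metis
  qed
qed

definition restrict_mod :: "('a, 'm) gmod \<Rightarrow> 'm set \<Rightarrow> ('a, 'm) gmod" where
  "restrict_mod M U = M\<lparr>carrier := U, homog := (\<lambda>n. homog M n \<inter> U)\<rparr>"

lemma restrict_mod_simps [simp]:
  "carrier (restrict_mod M U) = U" "homog (restrict_mod M U) n = homog M n \<inter> U"
  "\<zero>\<^bsub>restrict_mod M U\<^esub> = \<zero>\<^bsub>M\<^esub>" "x \<oplus>\<^bsub>restrict_mod M U\<^esub> y = x \<oplus>\<^bsub>M\<^esub> y"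
  "act (restrict_mod M U) = act M"
  by (simp_all add: restrict_mod_def)

lemma gmodule_restrict:
  assumes "gmodule A M" and U: "bool_subspace M U" and "\<And>n x. x \<in> U \<Longrightarrow> component M n x \<in> U"
    and act: "\<And>a x. a \<in> carrier A \<Longrightarrow> x \<in> U \<Longrightarrow> act M a x \<in> U"
    and hA: "\<And>n a. a \<in> homog A n \<Longrightarrow> a \<in> carrier A"
  shows "gmodule A (restrict_mod M U)"
proof -
  interpret M: gmodule A M by fact
  have Uc: "x \<in> U \<Longrightarrow> x \<in> carrier M" and U0: "\<zero>\<^bsub>M\<^esub> \<in> U" for x
    using U by (auto simp: bool_subspace_def)
  obtain k where k: "\<forall>n<k. homog M n = {\<zero>\<^bsub>M\<^esub>}" using M.bounded_below by (auto simp: bounded_below_def)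
  show ?thesis
  proof (intro gmodule.intro gmodule_axioms.intro)
    show "graded_space (restrict_mod M U)"
      by (rule graded_subspace[OF M.graded_space_axioms]) (use assms in simp_all)
    show "bounded_below (restrict_mod M U)" using k U0 by (auto simp: bounded_below_def)
  qed (auto simp: act Uc hA M.act_add_left M.act_add_right M.act_mult M.act_one M.act_homog)
qed

lemma aug_span_map:
  assumes "s \<in> aug_span A M" "f \<in> mod_hom A M N" "gmodule A M" "gmodule A N" "conn_hopf A"
  shows "f s \<in> aug_span A N"
proof -
  interpret M: hopf_module A M using assms by (simp add: hopf_module_def)
  show ?thesis using assms(1)
  proof (induct rule: aug_span.induct)
    case zero
    then show ?case using mod_hom_zero[OF assms(3,4,2)] aug_span.zero[of N A] by simp
  next
    case (step s a x)
    then have "f (s \<oplus>\<^bsub>M\<^esub> act M a x) = f s \<oplus>\<^bsub>N\<^esub> act N a (f x)"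
      using M.aug_span_closed M.aug_closed M.M.act_closed
      by (simp add: mod_hom_add[OF assms(2)] mod_hom_act[OF assms(2)])
    then show ?case using aug_span.step[OF step(2,3) mod_hom_closed[OF assms(2) step(4)]] by simp
  qed
qed

section \<open>Projective modules\<close>

lemma projective_lift:
  fixes P :: "('a, 'u::infinite) gmod" and M N :: "('a, 'u) gmod"
  assumes "projective A P" "gmodule A M" "gmodule A N" "e \<in> mod_hom A M N" "e ` carrier M = carrier N"
    "f \<in> mod_hom A P N"
  shows "\<exists>g\<in>mod_hom A P M. \<forall>x\<in>carrier P. e (g x) = f x"
  using assms unfolding projective_def by blast

text \<open>
  The module is free, and a map out of it is lifted by lifting the images of a homogeneous basis; taking
  components makes these lifts homogeneous of the right degree.
\<close>

theorem projective_if_socle_exact: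
  fixes P :: "('a, 'u::infinite) gmod"
  assumes "conn_hopf A" "gmodule A P" "socle_exact A P"
  shows "projective A P"
  unfolding projective_def
proof (intro conjI allI ballI impI)
  interpret P: hopf_module A P using assms by (simp add: hopf_module_def)
  show "gmodule A P" by fact
  fix M N :: "('a, 'u) gmod" and e f
  assume e: "e \<in> mod_hom A M N" and f: "f \<in> mod_hom A P N"
    and MN: "gmodule A M \<and> gmodule A N \<and> e ` carrier M = carrier N"
  interpret M: hopf_module A M using assms MN by (simp add: hopf_module_def)
  interpret N: hopf_module A N using assms MN by (simp add: hopf_module_def)
  obtain Y \<beta> where F: "free_on A P Y \<beta>" using P.free_if_socle_exact[OF assms(3)] by blast
  note Yc = P.free_carrier[OF F] and \<beta> = P.free_coeffs[OF F]
  define dg where "dg y = (SOME n. y \<in> homog P n)" for y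
  have dg: "y \<in> homog P (dg y)" if "y \<in> Y" for y
    using that F unfolding dg_def free_on_def by (auto intro: someI_ex)
  have "\<exists>x. x \<in> homog M (dg y) \<and> e x = f y" if y: "y \<in> Y" for y
  proof -
    have fy: "f y \<in> homog N (dg y)" using mod_hom_homog[OF f dg[OF y]] .
    then have "f y \<in> e ` carrier M" using N.M.homog_closed conjunct2[OF conjunct2[OF MN]] by simp
    then obtain x where x: "x \<in> carrier M" "e x = f y" by auto
    have "component N (dg y + 0) (e x) = e (component M (dg y) x)"
      by (rule comp_degree_map[OF M.M.graded_space_axioms N.M.graded_space_axioms mod_hom_linear[OF e]])
        (use x mod_hom_homog[OF e] in simp_all)
    then show ?thesis using x N.M.comp_of_homog[OF fy] M.M.comp_homog by (intro exI[of _ "component M (dg y) x"]) simp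
  qed
  then obtain l where l: "\<And>y. y \<in> Y \<Longrightarrow> l y \<in> homog M (dg y)" "\<And>y. y \<in> Y \<Longrightarrow> e (l y) = f y" by metis
  have lc: "\<And>y. y \<in> Y \<Longrightarrow> l y \<in> carrier M" using l M.M.homog_closed by blast
  let ?g = "\<lambda>v. lincomb A M l (\<beta> v)"
  show "\<exists>g\<in>mod_hom A P M. \<forall>x\<in>carrier P. e (g x) = f x"
  proof (intro bexI ballI)
    show "?g \<in> mod_hom A P M"
    proof (rule mod_homI)
      fix n v assume v: "v \<in> homog P n"
      show "?g v \<in> homog M n"
        by (rule M.lincomb_homog[OF lc \<beta>[OF P.M.homog_closed[OF v]]])
          (use P.free_coords_homog[OF F v _ dg] l in blast)+
    qed (simp_all add: M.lincomb_closed[OF lc \<beta>] P.free_coords_add[OF F] M.lincomb_add[OF lc \<beta> \<beta>]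
        P.free_coords_act[OF F] M.act_lincomb[OF lc _ \<beta>])
    fix v assume v: "v \<in> carrier P"
    have fy: "\<And>y. y \<in> Y \<Longrightarrow> f y \<in> carrier N" using mod_hom_closed[OF f] Yc by blast
    have "e (?g v) = lincomb A N f (\<beta> v)"
      by (rule M.linear_lincomb[where g = "\<lambda>_ a. a", OF lc N.hopf_module_axioms mod_hom_linear[OF e] fy])
        (use l lc mod_hom_act[OF e] \<beta>[OF v] in auto)
    also have "\<dots> = f (lincomb A P (\<lambda>y. y) (\<beta> v))"
      by (rule P.linear_lincomb[where g = "\<lambda>_ a. a", OF Yc N.hopf_module_axioms mod_hom_linear[OF f] fy, symmetric])
        (use Yc mod_hom_act[OF f] \<beta>[OF v] in auto)
    finally show "e (?g v) = f v" using P.free_lincomb[OF F v] by simp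
  qed
qed

definition shifted_algebra :: "'a hopf \<Rightarrow> int \<Rightarrow> ('a, 'a) gmod" where
  "shifted_algebra A e = \<lparr>carrier = carrier A, monoid.mult = monoid.mult A, one = one A, ring.zero = ring.zero A,
     ring.add = ring.add A, homog = (\<lambda>n. homog A (n - e)), act = monoid.mult A\<rparr>"

definition shifted_unit :: "'a hopf \<Rightarrow> int \<Rightarrow> ('a, bit) gmod" where
  "shifted_unit A e = (unit_mod A)\<lparr>homog := (\<lambda>n. if n = e then UNIV else {0})\<rparr>"

lemma unit_mod_simps [simp]:
  "carrier (unit_mod A) = UNIV" "\<zero>\<^bsub>unit_mod A\<^esub> = 0" "x \<oplus>\<^bsub>unit_mod A\<^esub> y = x + y"
  "homog (unit_mod A) n = (if n = 0 then UNIV else {0})" "act (unit_mod A) a x = counit A a * x"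
  by (simp_all add: unit_mod_def graded.extend_def gmod.fields_def F2_def)

lemma shifted_unit_simps [simp]:
  "carrier (shifted_unit A e) = UNIV" "\<zero>\<^bsub>shifted_unit A e\<^esub> = 0" "x \<oplus>\<^bsub>shifted_unit A e\<^esub> y = x + y"
  "homog (shifted_unit A e) n = (if n = e then UNIV else {0})" "act (shifted_unit A e) a x = counit A a * x"
  by (simp_all add: shifted_unit_def)

lemma shifted_unit_0: "shifted_unit A 0 = unit_mod A"
  by (simp add: shifted_unit_def unit_mod_def graded.extend_def gmod.fields_def F2_def)

lemma finite_bit: "finite (UNIV :: bit set)"
proof (rule finite_subset)
  show "(UNIV :: bit set) \<subseteq> {0, 1}" using bit_eq_if_not_zero by blast
qed simp

text \<open>
  The quotient by the span of the augmentation ideal is a sum of trivial modules, so on it any functional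
  concentrated in one degree is a module map.
\<close>

lemma (in hopf_module) detecting_map:
  assumes z2: "z \<in> homog M e" and e: "z \<notin> aug_span A M"
  shows "\<exists>u \<in> mod_hom A M (shifted_unit A e). u z = 1"
proof -
  have z: "z \<in> carrier M" "z \<in> homog M e" using z2 M.homog_closed by simp_all
  obtain h :: "'m \<Rightarrow> bit" where h: "\<And>v w. v \<in> carrier M \<Longrightarrow> w \<in> carrier M \<Longrightarrow> h (v \<oplus>\<^bsub>M\<^esub> w) = h v + h w"
    "\<And>w. w \<in> aug_span A M \<Longrightarrow> h w = 0" "h z = 1"
    using M.separating_functional[OF aug_span_subspace z(1) e] by blast
  define u where "u v = h (component M e v)" for v
  have u_span: "u s = 0" if "s \<in> aug_span A M" for s
    using that aug_span_comp h(2) by (simp add: u_def)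
  have u: "u \<in> mod_hom A M (shifted_unit A e)"
  proof (rule mod_homI)
    fix n x assume "x \<in> homog M n"
    then show "u x \<in> homog (shifted_unit A e) n"
      using M.comp_of_homog[of x n e] h(2)[OF aug_span.zero] by (simp add: u_def)
  next
    fix a x assume a: "a \<in> carrier A" and x: "x \<in> carrier M"
    show "u (act M a x) = act (shifted_unit A e) a (u x)"
    proof (cases "counit A a = 0")
      case True
      then show ?thesis using u_span aug_span_act1[of a x] a x by (simp add: aug_ideal_iff)
    next
      case False
      let ?b = "a \<oplus> \<one>"
      have ca: "counit A a = 1" using False by (rule bit_eq_if_not_zero)
      have b: "?b \<in> aug_ideal A" using a ca by (simp add: aug_ideal_iff counit_add)
      have "a = ?b \<oplus> \<one>" using a by (simp add: a_assoc add_self)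
      then have "act M a x = act M ?b x \<oplus>\<^bsub>M\<^esub> x"
        using M.act_add_left[of ?b \<one> x] a x by (simp add: M.act_one)
      then have "u (act M a x) = u (act M ?b x) + u x"
        using x a by (simp add: u_def M.comp_add M.act_closed h(1))
      then show ?thesis using u_span aug_span_act1[OF b x] ca by simp
    qed
  qed (simp_all add: u_def M.comp_add h(1))
  moreover have "u z = 1" using M.comp_of_homog[OF z(2), of e] h(3) by (simp add: u_def)
  ultimately show ?thesis by blast
qed

context conn_hopf
begin

lemma gmodule_shifted_unit: "gmodule A (shifted_unit A e)"
proof -
  let ?U = "shifted_unit A e"
  have "abelian_group ?U"
  proof (rule abelian_groupI)
    fix x :: bit
    show "\<exists>y\<in>carrier ?U. y \<oplus>\<^bsub>?U\<^esub> x = \<zero>\<^bsub>?U\<^esub>" by (intro bexI[of _ x]) auto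
  qed (auto simp: ac_simps)
  then have b: "boolean_group ?U" by (intro boolean_group.intro boolean_group_axioms.intro) auto
  have "x \<in> homog_span ?U" for x by (rule homog_span.homog[of _ _ e]) simp
  then have "graded_space ?U"
    by (intro graded_spaceI[where P = "\<lambda>n x. if n = e then x else 0"] b)
      (auto simp: bool_subspace_def linear_maps_iff split: if_splits)
  then show ?thesis
  proof (intro gmodule.intro gmodule_axioms.intro)
    show "bounded_below ?U" unfolding bounded_below_def by (intro exI[of _ e]) simp
    show "act ?U a x \<in> homog ?U (m + n)" if "a \<in> homog A m" "x \<in> homog ?U n" for a m x n
      using that counit_homog[of a m] by (cases "m = 0") (auto split: if_splits)
  qed (auto simp: counit_add counit_mult algebra_simps)
qed

lemma gmodule_unit: "gmodule A (unit_mod A)"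
  using gmodule_shifted_unit[of 0] by (simp add: shifted_unit_0)

lemma gmodule_shifted_algebra: "gmodule A (shifted_algebra A e)"
proof -
  let ?U = "shifted_algebra A e"
  have [simp]: "carrier ?U = carrier A" "\<zero>\<^bsub>?U\<^esub> = \<zero>" "x \<oplus>\<^bsub>?U\<^esub> y = x \<oplus> y" "homog ?U n = homog A (n - e)"
    "act ?U a x = a \<otimes> x" for x y n a
    by (simp_all add: shifted_algebra_def)
  have "abelian_group ?U"
  proof (rule abelian_groupI)
    fix x assume "x \<in> carrier ?U"
    then show "\<exists>y\<in>carrier ?U. y \<oplus>\<^bsub>?U\<^esub> x = \<zero>\<^bsub>?U\<^esub>" by (intro bexI[of _ x]) (auto simp: add_self)
  qed (auto simp: a_ac)
  then have b: "boolean_group ?U" by (intro boolean_group.intro boolean_group_axioms.intro) (auto simp: add_self)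
  have span: "x \<in> homog_span ?U" if "x \<in> carrier A" for x using that
  proof (induct rule: graded_induct)
    case zero
    then show ?case using homog_span.zero[of ?U] by simp
  next
    case (homog n x)
    then show ?case using homog_span.homog[of x ?U "n + e"] by simp
  next
    case (add x y)
    then show ?case using homog_span.add[of x ?U y] by simp
  qed
  have "graded_space ?U"
  proof (rule graded_spaceI[where P = "\<lambda>n. component A (n - e)", OF b])
    show "bool_subspace ?U (homog ?U n)" for n
      using homog_subspace[of "n - e"] by (simp add: bool_subspace_def)
    show "component A (n - e) \<in> linear_maps ?U ?U" for n by (simp add: linear_maps_iff comp_add)
    show "component A (n - e) x = (if n = m then x else \<zero>\<^bsub>?U\<^esub>)" if "x \<in> homog ?U m" for n m x
      using that comp_of_homog[of x "m - e"] by simp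
    show "x \<in> homog_span ?U" if "x \<in> carrier ?U" for x using that span by simp
  qed
  then show ?thesis
  proof (intro gmodule.intro gmodule_axioms.intro)
    show "bounded_below ?U" unfolding bounded_below_def
      by (intro exI[of _ e] allI impI) (simp add: homog_neg)
    show "act ?U a x \<in> homog ?U (m + n)" if "a \<in> homog A m" "x \<in> homog ?U n" for a m x n
      using that mult_homog[of a m x "n - e"] by (simp add: algebra_simps)
  qed (auto simp: l_distr r_distr m_assoc)
qed

text \<open>
  A homogeneous element \<open>z\<close> outside the span of the augmentation ideal is detected by a module map onto
  a trivial module, which for projective modules lifts to a map \<open>g\<close> to the free module of rank one.
  There \<open>g z\<close> is the generator, and \<open>\<lambda>\<close> does not kill it.
\<close>

theorem socle_exact_if_projective:
  fixes P :: "('a, 'u::infinite) gmod"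
  assumes proj: "projective A P"
  shows "socle_exact A P"
  unfolding socle_exact_def
proof (intro ballI impI, rule ccontr)
  have "gmodule A P" using proj by (simp add: projective_def)
  then interpret P: hopf_module A P by (simp add: hopf_module_def conn_hopf_axioms)
  fix y assume y: "y \<in> carrier P" "act P lam y = \<zero>\<^bsub>P\<^esub>" "y \<notin> aug_span A P"
  then obtain e where e: "component P e y \<notin> aug_span A P" using P.aug_span_if_comps by blast
  let ?z = "component P e y"
  have z: "?z \<in> carrier P" "?z \<in> homog P e" using y P.M.comp_homog by simp_all
  have lz: "act P lam ?z = \<zero>\<^bsub>P\<^esub>"
    using P.comp_act[OF lam_homog y(1), of e] y(2) by simp
  obtain u where u: "u \<in> mod_hom A P (shifted_unit A e)" "u ?z = 1"
    using P.detecting_map[OF z(2) e] by blast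
  let ?SA = "shifted_algebra A e" and ?SF = "shifted_unit A e"
  have [simp]: "carrier ?SA = carrier A" "\<zero>\<^bsub>?SA\<^esub> = \<zero>" "x \<oplus>\<^bsub>?SA\<^esub> y = x \<oplus> y" "homog ?SA n = homog A (n - e)"
    "act ?SA a x = a \<otimes> x" for x y n a
    by (simp_all add: shifted_algebra_def)
  obtain M :: "('a, 'u) gmod" where M: "gmodule A M" "mod_iso A ?SA M"
    using finite_copy[OF gmodule_shifted_algebra, of e] finite_carrier by auto
  obtain N :: "('a, 'u) gmod" where N: "gmodule A N" "mod_iso A ?SF N"
    using finite_copy[OF gmodule_shifted_unit, of e] finite_bit by auto
  obtain i i' where i: "i \<in> mod_hom A ?SA M" "i' \<in> mod_hom A M ?SA"
    "\<And>x. x \<in> carrier A \<Longrightarrow> i' (i x) = x" "\<And>x. x \<in> carrier M \<Longrightarrow> i (i' x) = x"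
    using M(2) unfolding mod_iso_def by auto
  obtain j j' where j: "j \<in> mod_hom A ?SF N" "j' \<in> mod_hom A N ?SF"
    "\<And>x. j' (j x) = x" "\<And>x. x \<in> carrier N \<Longrightarrow> j (j' x) = x"
    using N(2) unfolding mod_iso_def by auto
  have eps: "counit A \<in> mod_hom A ?SA ?SF"
    by (rule mod_homI) (auto simp: counit_add counit_mult counit_homog)
  let ?e = "\<lambda>x. j (counit A (i' x))"
  have e': "?e \<in> mod_hom A M N" by (rule mod_hom_comp[OF mod_hom_comp[OF i(2) eps] j(1)])
  have f': "(\<lambda>x. j (u x)) \<in> mod_hom A P N" by (rule mod_hom_comp[OF u(1) j(1)])
  have surj: "?e ` carrier M = carrier N"
  proof
    show "?e ` carrier M \<subseteq> carrier N" using mod_hom_closed[OF e'] by blast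
    show "carrier N \<subseteq> ?e ` carrier M"
    proof
      fix n assume n: "n \<in> carrier N"
      let ?a = "scale2 A (j' n) \<one>"
      have "counit A ?a = j' n" by (cases "j' n") (simp_all)
      then have "?e (i ?a) = n" using i(3)[of ?a] j(4)[OF n] by simp
      moreover have "i ?a \<in> carrier M" using mod_hom_closed[OF i(1), of ?a] by simp
      ultimately show "n \<in> ?e ` carrier M" by (intro image_eqI[of _ _ "i ?a"]) simp_all
    qed
  qed
  obtain g where g: "g \<in> mod_hom A P M" "\<And>x. x \<in> carrier P \<Longrightarrow> ?e (g x) = j (u x)"
    using projective_lift[OF proj M(1) N(1) e' surj f'] by (elim bexE) simp
  let ?g = "\<lambda>x. i' (g x)"
  have g': "?g \<in> mod_hom A P ?SA" by (rule mod_hom_comp[OF g(1) i(2)])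
  have "counit A (?g ?z) = u ?z" using g(2)[OF z(1)] j(3) by metis
  also have "u ?z = 1" by (rule u(2))
  finally have "?g ?z = \<one>" using mod_hom_homog[OF g' z(2)] homog_0 by auto
  then have "lam = ?g (act P lam ?z)" using mod_hom_act[OF g' lam_closed z(1)] by simp
  also have "\<dots> = \<zero>" using lz mod_hom_zero[OF _ gmodule_shifted_algebra g'] P.M.gmodule_axioms by simp
  finally show False using lam_nonzero by simp
qed

end

section \<open>Modules stably isomorphic to the unit\<close>

definition invariant :: "'a hopf \<Rightarrow> ('a, 'm) gmod \<Rightarrow> 'm \<Rightarrow> bool" where
  "invariant A M m \<longleftrightarrow> m \<in> carrier M \<and> (\<forall>a\<in>aug_ideal A. act M a m = \<zero>\<^bsub>M\<^esub>)"

definition kernel_of :: "('a, 'm) gmod \<Rightarrow> ('m \<Rightarrow> bit) \<Rightarrow> 'm set" where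
  "kernel_of M r = {v \<in> carrier M. r v = 0}"

definition unit_summand :: "'a hopf \<Rightarrow> ('a, 'm) gmod \<Rightarrow> 'm \<Rightarrow> ('m \<Rightarrow> bit) \<Rightarrow> bool" where
  "unit_summand A M m r \<longleftrightarrow> m \<in> homog M 0 \<and> invariant A M m \<and> r \<in> mod_hom A M (unit_mod A) \<and> r m = 1"

text \<open>
  \<open>M\<close> is the direct sum of a trivial module and a free one.  This condition on \<open>M\<close> alone is
  equivalent to being stably isomorphic to the unit, and it is how stable isomorphisms are handled.
\<close>

definition stably_unit :: "'a hopf \<Rightarrow> ('a, 'm) gmod \<Rightarrow> bool" where
  "stably_unit A M \<longleftrightarrow> (\<exists>m r. unit_summand A M m r \<and> socle_exact A (restrict_mod M (kernel_of M r)))"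

context hopf_module
begin

lemma act_invariant:
  assumes "invariant A M m" "a \<in> carrier A"
  shows "act M a m = scale2 M (counit A a) m"
proof (cases "counit A a = 0")
  case True
  then show ?thesis using assms by (simp add: invariant_def aug_ideal_iff)
next
  case False
  let ?b = "a \<oplus> \<one>"
  have m: "m \<in> carrier M" using assms(1) by (simp add: invariant_def)
  have ca: "counit A a = 1" using False by (rule bit_eq_if_not_zero)
  have b: "?b \<in> aug_ideal A" using assms(2) ca by (simp add: aug_ideal_iff counit_add)
  have "a = ?b \<oplus> \<one>" using assms(2) by (simp add: a_assoc add_self)
  then have "act M a m = act M ?b m \<oplus>\<^bsub>M\<^esub> m"
    using M.act_add_left[of ?b \<one> m] assms(2) m by (simp add: M.act_one)
  then show ?thesis using b assms(1) ca m by (simp add: invariant_def)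
qed

lemma unit_map_simps:
  assumes r: "r \<in> mod_hom A M (unit_mod A)"
  shows unit_map_add: "x \<in> carrier M \<Longrightarrow> y \<in> carrier M \<Longrightarrow> r (x \<oplus>\<^bsub>M\<^esub> y) = r x + r y"
    and unit_map_act: "a \<in> carrier A \<Longrightarrow> x \<in> carrier M \<Longrightarrow> r (act M a x) = counit A a * r x"
    and unit_map_zero: "r \<zero>\<^bsub>M\<^esub> = 0"
    and unit_map_homog: "x \<in> homog M n \<Longrightarrow> n \<noteq> 0 \<Longrightarrow> r x = 0"
  using mod_hom_add[OF r] mod_hom_act[OF r] mod_hom_zero[OF M.gmodule_axioms gmodule_unit r]
    mod_hom_homog[OF r, of x n] by auto

lemma unit_map_comp:
  assumes r: "r \<in> mod_hom A M (unit_mod A)" and x: "x \<in> carrier M"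
  shows "r (component M n x) = (if n = 0 then r x else 0)"
  using x
proof (induct rule: M.graded_induct)
  case (homog m x)
  then show ?case
    using M.comp_of_homog[OF homog, of n] unit_map_homog[OF r homog] unit_map_zero[OF r] by auto
next
  case (add x y)
  then show ?case by (simp add: M.comp_add unit_map_add[OF r])
qed (simp add: unit_map_zero[OF r])

lemma gmodule_kernel:
  assumes r: "r \<in> mod_hom A M (unit_mod A)"
  shows "gmodule A (restrict_mod M (kernel_of M r))"
  by (rule gmodule_restrict[OF M.gmodule_axioms])
    (auto simp: kernel_of_def bool_subspace_def unit_map_simps[OF r] unit_map_comp[OF r] M.act_closed homog_closed)

lemma aug_span_unit: "s \<in> aug_span A (unit_mod A) \<Longrightarrow> s = 0"
  by (induct rule: aug_span.induct) (auto simp: aug_ideal_iff)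

lemma unit_map_aug_span:
  "r \<in> mod_hom A M (unit_mod A) \<Longrightarrow> s \<in> aug_span A M \<Longrightarrow> r s = 0"
  using aug_span_map[OF _ _ M.gmodule_axioms gmodule_unit conn_hopf_axioms] aug_span_unit by blast

end

locale unit_summand_module = hopf_module A M for A :: "'a hopf" (structure) and M :: "('a, 'm) gmod" +
  fixes m :: 'm and r :: "'m \<Rightarrow> bit"
  assumes summand: "unit_summand A M m r"
begin

lemma m: "m \<in> homog M 0" "invariant A M m" "m \<in> carrier M"
  and r: "r \<in> mod_hom A M (unit_mod A)" and rm: "r m = 1"
  using summand by (auto simp: unit_summand_def invariant_def)

definition pr :: "'m \<Rightarrow> 'm" where "pr v = v \<oplus>\<^bsub>M\<^esub> scale2 M (r v) m"

lemma pr_hom: "pr \<in> mod_hom A M (restrict_mod M (kernel_of M r))"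
proof (rule mod_homI)
  fix v assume v: "v \<in> carrier M"
  show "pr v \<in> carrier (restrict_mod M (kernel_of M r))"
    using v m rm unit_map_simps[OF r] by (cases "r v") (auto simp: pr_def kernel_of_def)
  show "pr (act M a v) = act (restrict_mod M (kernel_of M r)) a (pr v)" if a: "a \<in> carrier A" for a
  proof (cases "r v")
    case zero
    then show ?thesis using a v unit_map_act[OF r a v] by (simp add: pr_def M.act_closed)
  next
    case one
    then show ?thesis using a v m unit_map_act[OF r a v] act_invariant[OF m(2) a]
      by (simp add: pr_def M.act_closed M.act_add_right)
  qed
  fix w assume w: "w \<in> carrier M"
  show "pr (v \<oplus>\<^bsub>M\<^esub> w) = pr v \<oplus>\<^bsub>restrict_mod M (kernel_of M r)\<^esub> pr w"
    using v w m by (simp add: pr_def unit_map_add[OF r] M.scale2_add_left M.a_ac)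
next
  fix n v assume v: "v \<in> homog M n"
  then have vc: "v \<in> carrier M" using M.homog_closed by blast
  have "pr v \<in> homog M n"
    using v m unit_map_homog[OF r v] M.homog_add[of v n m] M.homog_closed[OF v]
    by (cases "n = 0") (auto simp: pr_def scale2_def)
  moreover have "pr v \<in> kernel_of M r"
    using vc m rm unit_map_simps[OF r] by (cases "r v") (auto simp: pr_def kernel_of_def)
  ultimately show "pr v \<in> homog (restrict_mod M (kernel_of M r)) n" by simp
qed

lemma pr_kernel: "v \<in> kernel_of M r \<Longrightarrow> pr v = v"
  by (simp add: pr_def kernel_of_def)

lemma aug_span_kernel:
  assumes "v \<in> kernel_of M r" "v \<in> aug_span A M"
  shows "v \<in> aug_span A (restrict_mod M (kernel_of M r))"
  using aug_span_map[OF assms(2) pr_hom M.gmodule_axioms gmodule_kernel[OF r] conn_hopf_axioms]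
  by (simp add: pr_kernel[OF assms(1)])

lemma aug_span_incl: "v \<in> aug_span A (restrict_mod M (kernel_of M r)) \<Longrightarrow> v \<in> aug_span A M"
proof -
  assume v: "v \<in> aug_span A (restrict_mod M (kernel_of M r))"
  have "(\<lambda>x. x) \<in> mod_hom A (restrict_mod M (kernel_of M r)) M"
    by (rule mod_homI) (auto simp: kernel_of_def)
  from aug_span_map[OF v this gmodule_kernel[OF r] M.gmodule_axioms conn_hopf_axioms] show ?thesis .
qed

lemma socle_exact_kernel_iff:
  "socle_exact A (restrict_mod M (kernel_of M r)) \<longleftrightarrow>
    (\<forall>v\<in>carrier M. r v = 0 \<longrightarrow> act M lam v = \<zero>\<^bsub>M\<^esub> \<longrightarrow> v \<in> aug_span A M)"
  using aug_span_kernel aug_span_incl unfolding socle_exact_def by (auto simp: kernel_of_def)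

end

context conn_hopf
begin

lemma stably_unitE:
  assumes "stably_unit A M" "gmodule A M"
  obtains m r where "unit_summand_module A M m r" "socle_exact A (restrict_mod M (kernel_of M r))"
  using assms by (auto simp: stably_unit_def unit_summand_module_def hopf_module_def conn_hopf_axioms
      unit_summand_module_axioms_def)

lemma stably_unitI:
  assumes "gmodule A M" "unit_summand A M m r"
    "\<And>v. v \<in> carrier M \<Longrightarrow> r v = 0 \<Longrightarrow> act M lam v = \<zero>\<^bsub>M\<^esub> \<Longrightarrow> v \<in> aug_span A M"
  shows "stably_unit A M"
proof -
  interpret unit_summand_module A M m r
    using assms by (simp add: unit_summand_module_def hopf_module_def conn_hopf_axioms
      unit_summand_module_axioms_def)
  show ?thesis using assms socle_exact_kernel_iff unfolding stably_unit_def by blast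
qed

lemma stably_unit_unit: "stably_unit A (unit_mod A)"
proof (rule stably_unitI[OF gmodule_unit, of 1 "\<lambda>x. x"])
  show "unit_summand A (unit_mod A) 1 (\<lambda>x. x)"
    by (auto simp: unit_summand_def invariant_def aug_ideal_iff mod_hom_id)
  show "v \<in> aug_span A (unit_mod A)" if "v = 0" for v
    using that aug_span.zero[of "unit_mod A" A] by simp
qed

lemma stably_unit_iso:
  assumes M: "gmodule A M" and N: "gmodule A N" and iso: "mod_iso A M N" and s: "stably_unit A M"
  shows "stably_unit A N"
proof -
  obtain m r where mr: "unit_summand_module A M m r" "socle_exact A (restrict_mod M (kernel_of M r))"
    using stably_unitE[OF s M] by blast
  interpret M: unit_summand_module A M m r by fact
  interpret N: hopf_module A N using N by (simp add: hopf_module_def conn_hopf_axioms)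
  obtain f g where f: "f \<in> mod_hom A M N" and g: "g \<in> mod_hom A N M"
    and gf: "\<And>x. x \<in> carrier M \<Longrightarrow> g (f x) = x" and fg: "\<And>x. x \<in> carrier N \<Longrightarrow> f (g x) = x"
    using iso unfolding mod_iso_def by auto
  show ?thesis
  proof (rule stably_unitI[OF N, of "f m" "\<lambda>x. r (g x)"])
    have "invariant A N (f m)"
      unfolding invariant_def
    proof (intro conjI ballI)
      show "f m \<in> carrier N" using mod_hom_closed[OF f M.m(3)] .
      fix a assume a: "a \<in> aug_ideal A"
      have "act N a (f m) = f (act M a m)" using mod_hom_act[OF f _ M.m(3)] aug_closed[OF a] by simp
      then show "act N a (f m) = \<zero>\<^bsub>N\<^esub>"
        using a M.m(2) mod_hom_zero[OF M N f] by (simp add: invariant_def)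
    qed
    then show "unit_summand A N (f m) (\<lambda>x. r (g x))"
      using mod_hom_homog[OF f M.m(1)] mod_hom_comp[OF g M.r] gf[OF M.m(3)] M.rm
      by (simp add: unit_summand_def)
    fix v assume v: "v \<in> carrier N" "r (g v) = 0" "act N lam v = \<zero>\<^bsub>N\<^esub>"
    have "act M lam (g v) = \<zero>\<^bsub>M\<^esub>"
      using mod_hom_act[OF g lam_closed v(1)] v(3) mod_hom_zero[OF N M g] by simp
    then have "g v \<in> aug_span A M"
      using mr(2) v mod_hom_closed[OF g v(1)] unfolding M.socle_exact_kernel_iff by blast
    from aug_span_map[OF this f M N conn_hopf_axioms] show "v \<in> aug_span A N" using fg[OF v(1)] by simp
  qed
qed

text \<open>
  Maps that factor through a projective module are invisible to the criterion for freeness: in the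
  projective module everything that \<open>\<lambda>\<close> kills lies in the span of the augmentation ideal.
\<close>

lemma invariant_through_projective:
  fixes P :: "('a, 'u::infinite) gmod"
  assumes top: "top_degree A > 0" and M: "gmodule A M" and N: "gmodule A N" and P: "projective A P"
    and h: "h \<in> mod_hom A M P" and k: "k \<in> mod_hom A P N"
    and v: "v \<in> carrier M" "act M lam v = \<zero>\<^bsub>M\<^esub>"
  shows "k (h v) \<in> aug_span A N"
proof -
  have gP: "gmodule A P" using P by (simp add: projective_def)
  have "act P lam (h v) = \<zero>\<^bsub>P\<^esub>"
    using mod_hom_act[OF h lam_closed v(1)] v(2) mod_hom_zero[OF M gP h] by simp
  then have "h v \<in> aug_span A P"
    using socle_exact_if_projective[OF P] mod_hom_closed[OF h v(1)] by (simp add: socle_exact_def)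
  then show ?thesis by (rule aug_span_map[OF _ k gP N conn_hopf_axioms])
qed

text \<open>
  Let \<open>f\<close> and \<open>g\<close> be inverse to each other stably.  The invariant \<open>m\<close> goes to \<open>f m\<close>, which is retracted
  by \<open>r \<circ> g\<close>: as \<open>\<lambda>\<close> lies in the augmentation ideal it kills \<open>m\<close>, so \<open>g (f m)\<close> and \<open>m\<close> differ by an element of
  the span of the augmentation ideal, on which \<open>r\<close> vanishes.  The same argument transports the freeness of the
  complement.
\<close>

lemma stably_unit_if_stable_iso:
  fixes M N :: "('a, 'u::infinite) gmod"
  assumes top: "top_degree A > 0" and M: "gmodule A M" and N: "gmodule A N"
    and s: "stably_unit A M" and iso: "stable_iso A M N"
  shows "stably_unit A N"
proof -
  obtain m r where mr: "unit_summand_module A M m r" "socle_exact A (restrict_mod M (kernel_of M r))"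
    using stably_unitE[OF s M] by blast
  interpret M: unit_summand_module A M m r by fact
  interpret N: hopf_module A N using N by (simp add: hopf_module_def conn_hopf_axioms)
  obtain f g where f: "f \<in> mod_hom A M N" and g: "g \<in> mod_hom A N M"
    and e1: "stable_eq A M M (g \<circ> f) id" and e2: "stable_eq A N N (f \<circ> g) id"
    using iso unfolding stable_iso_def by blast
  obtain P :: "('a, 'u) gmod" and h k where P: "projective A P" "h \<in> mod_hom A M P" "k \<in> mod_hom A P M"
    "\<forall>x\<in>carrier M. g (f x) \<ominus>\<^bsub>M\<^esub> x = k (h x)"
    using e1 unfolding stable_eq_def by auto
  obtain Q :: "('a, 'u) gmod" and h' k' where Q: "projective A Q" "h' \<in> mod_hom A N Q" "k' \<in> mod_hom A Q N"
    "\<forall>x\<in>carrier N. f (g x) \<ominus>\<^bsub>N\<^esub> x = k' (h' x)"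
    using e2 unfolding stable_eq_def by auto
  have gc: "g x \<in> carrier M" if "x \<in> carrier N" for x using mod_hom_closed[OF g that] .
  have fc: "f x \<in> carrier N" if "x \<in> carrier M" for x using mod_hom_closed[OF f that] .
  have lm: "act M lam m = \<zero>\<^bsub>M\<^esub>" using M.m(2) lam_aug[OF top] by (simp add: invariant_def)
  have km: "k (h m) \<in> aug_span A M"
    by (rule invariant_through_projective[OF top M M P(1-3) M.m(3) lm])
  have "g (f m) \<oplus>\<^bsub>M\<^esub> m = k (h m)"
    using P(4) M.m(3) M.M.minus_self[OF gc[OF fc[OF M.m(3)]] M.m(3)] by simp
  then have "r (g (f m)) + r m = 0"
    using M.unit_map_aug_span[OF M.r km] M.unit_map_add[OF M.r gc[OF fc[OF M.m(3)]] M.m(3)] by simp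
  then have rgf: "r (g (f m)) = 1" using M.rm by (cases "r (g (f m))") auto
  show ?thesis
  proof (rule stably_unitI[OF N, of "f m" "\<lambda>x. r (g x)"])
    have "invariant A N (f m)"
      unfolding invariant_def
    proof (intro conjI ballI)
      show "f m \<in> carrier N" using fc[OF M.m(3)] .
      fix a assume a: "a \<in> aug_ideal A"
      have "act N a (f m) = f (act M a m)" using mod_hom_act[OF f _ M.m(3)] aug_closed[OF a] by simp
      then show "act N a (f m) = \<zero>\<^bsub>N\<^esub>"
        using a M.m(2) mod_hom_zero[OF M N f] by (simp add: invariant_def)
    qed
    then show "unit_summand A N (f m) (\<lambda>x. r (g x))"
      using mod_hom_homog[OF f M.m(1)] mod_hom_comp[OF g M.r] rgf by (simp add: unit_summand_def)
    fix v assume v: "v \<in> carrier N" "r (g v) = 0" "act N lam v = \<zero>\<^bsub>N\<^esub>"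
    have "act M lam (g v) = \<zero>\<^bsub>M\<^esub>"
      using mod_hom_act[OF g lam_closed v(1)] v(3) mod_hom_zero[OF N M g] by simp
    then have "g v \<in> aug_span A M"
      using mr(2) v gc[OF v(1)] unfolding M.socle_exact_kernel_iff by blast
    then have 1: "f (g v) \<in> aug_span A N" by (rule aug_span_map[OF _ f M N conn_hopf_axioms])
    have 2: "k' (h' v) \<in> aug_span A N"
      by (rule invariant_through_projective[OF top N N Q(1-3) v(1) v(3)])
    have "f (g v) \<oplus>\<^bsub>N\<^esub> v = k' (h' v)"
      using Q(4) v(1) N.M.minus_self[OF fc[OF gc[OF v(1)]] v(1)] by simp
    then have "v = f (g v) \<oplus>\<^bsub>N\<^esub> k' (h' v)"
      using N.M.add_cancel_left[OF fc[OF gc[OF v(1)]] v(1)] by simp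
    then show "v \<in> aug_span A N" using N.aug_span_add[OF 2 1] by simp
  qed
qed

text \<open>
  Both modules are compared through their trivial summands.  The composites differ from the identity by
  the projections to the free complements, which factor through a projective module.
\<close>

lemma stable_iso_if_stably_unit:
  fixes M N :: "('a, 'u::infinite) gmod"
  assumes M: "gmodule A M" and N: "gmodule A N" and s: "stably_unit A M" and t: "stably_unit A N"
  shows "stable_iso A M N"
proof -
  obtain m r where mr: "unit_summand_module A M m r" "socle_exact A (restrict_mod M (kernel_of M r))"
    using stably_unitE[OF s M] by blast
  obtain n t where nt: "unit_summand_module A N n t" "socle_exact A (restrict_mod N (kernel_of N t))"
    using stably_unitE[OF t N] by blast
  interpret M: unit_summand_module A M m r by fact
  interpret N: unit_summand_module A N n t by fact
  have map: "(\<lambda>v. scale2 N' (r' v) n') \<in> mod_hom A M' N'"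
    if "unit_summand_module A M' m' r'" "unit_summand_module A N' n' t'"
    for M' N' :: "('a, 'u) gmod" and m' r' n' t'
  proof -
    interpret M': unit_summand_module A M' m' r' by fact
    interpret N': unit_summand_module A N' n' t' by fact
    show ?thesis
    proof (rule mod_homI)
      fix a x assume ax: "a \<in> carrier A" "x \<in> carrier M'"
      show "scale2 N' (r' (act M' a x)) n' = act N' a (scale2 N' (r' x) n')"
        using M'.unit_map_act[OF M'.r ax] N'.act_invariant[OF N'.m(2) ax(1)] ax
        by (cases "r' x") simp_all
    next
      fix k x assume x: "x \<in> homog M' k"
      then show "scale2 N' (r' x) n' \<in> homog N' k"
        using M'.unit_map_homog[OF M'.r x] N'.m by (cases "k = 0") (auto simp: scale2_def)
    qed (use N'.m in \<open>simp_all add: M'.unit_map_add[OF M'.r] N'.M.scale2_add_left\<close>)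
  qed
  have eq: "stable_eq A M' M' ((\<lambda>w. scale2 M' (t' w) m') \<circ> (\<lambda>v. scale2 N' (r' v) n')) id"
    if M': "unit_summand_module A M' m' r'" "socle_exact A (restrict_mod M' (kernel_of M' r'))"
      and N': "unit_summand_module A N' n' t'"
    for M' N' :: "('a, 'u) gmod" and m' r' n' t'
  proof -
    interpret M': unit_summand_module A M' m' r' by fact
    interpret N': unit_summand_module A N' n' t' by fact
    show ?thesis
      unfolding stable_eq_def
    proof (intro exI bexI conjI ballI)
      show "projective A (restrict_mod M' (kernel_of M' r'))"
        by (rule projective_if_socle_exact[OF conn_hopf_axioms M'.gmodule_kernel[OF M'.r] M'(2)])
      show "M'.pr \<in> mod_hom A M' (restrict_mod M' (kernel_of M' r'))" by (rule M'.pr_hom)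
      show "(\<lambda>x. x) \<in> mod_hom A (restrict_mod M' (kernel_of M' r')) M'"
        by (rule mod_homI) (auto simp: kernel_of_def)
      fix x assume x: "x \<in> carrier M'"
      have "t' (scale2 N' (r' x) n') = r' x"
        using N'.rm N'.unit_map_zero[OF N'.r] by (cases "r' x") simp_all
      then show "((\<lambda>w. scale2 M' (t' w) m') \<circ> (\<lambda>v. scale2 N' (r' v) n')) x \<ominus>\<^bsub>M'\<^esub> id x = M'.pr x"
        using x M'.m(3) by (simp add: M'.M.minus_self M'.pr_def M'.M.a_comm)
    qed
  qed
  show ?thesis
    unfolding stable_iso_def
    using map[OF mr(1) nt(1)] map[OF nt(1) mr(1)] eq[OF mr nt(1)] eq[OF nt mr(1)] by blast
qed

lemma stable_class_eq:
  fixes M :: "('a, 'u::infinite) gmod"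
  assumes "top_degree A > 0" "gmodule A M" "stably_unit A M"
  shows "stable_class A M = {N. gmodule A N \<and> stably_unit A N}"
  unfolding stable_class_def
  using stably_unit_if_stable_iso[OF assms(1,2) _ assms(3)] stable_iso_if_stably_unit[OF assms(2) _ assms(3)]
  by blast

lemma in_universe:
  assumes "\<exists>N :: ('a, 'u::infinite) gmod. gmodule A N \<and> mod_iso A M N"
  shows "gmodule A (in_universe A M :: ('a, 'u) gmod)" "mod_iso A M (in_universe A M :: ('a, 'u) gmod)"
  using someI_ex[OF assms] by (simp_all add: in_universe_def)

lemma unit_obj:
  "gmodule A (unit_obj A :: ('a, 'u::infinite) gmod)" "stably_unit A (unit_obj A :: ('a, 'u) gmod)"
proof -
  have "\<exists>N :: ('a, 'u) gmod. gmodule A N \<and> mod_iso A (unit_mod A) N"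
    using finite_copy[OF gmodule_unit] finite_bit by simp
  note I = in_universe[OF this]
  show "gmodule A (unit_obj A :: ('a, 'u) gmod)" unfolding unit_obj_def by (rule I(1))
  show "stably_unit A (unit_obj A :: ('a, 'u) gmod)"
    unfolding unit_obj_def by (rule stably_unit_iso[OF gmodule_unit I stably_unit_unit])
qed

lemma stable_iso_refl:
  fixes M :: "('a, 'u::infinite) gmod"
  assumes M: "gmodule A M"
  shows "stable_iso A M M"
proof -
  interpret M: hopf_module A M using M by (simp add: hopf_module_def conn_hopf_axioms)
  let ?Z = "restrict_mod M {\<zero>\<^bsub>M\<^esub>}"
  have Z: "gmodule A ?Z"
    by (rule gmodule_restrict[OF M]) (auto simp: bool_subspace_def homog_closed)
  have "socle_exact A ?Z" using aug_span.zero[of ?Z A] by (simp add: socle_exact_def)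
  then have P: "projective A ?Z" by (rule projective_if_socle_exact[OF conn_hopf_axioms Z])
  have "(\<lambda>_. \<zero>\<^bsub>M\<^esub>) \<in> mod_hom A M ?Z" by (rule mod_homI) auto
  moreover have "(\<lambda>_. \<zero>\<^bsub>M\<^esub>) \<in> mod_hom A ?Z M" by (rule mod_homI) auto
  ultimately have "stable_eq A M M (id \<circ> id) id"
    unfolding stable_eq_def using P by (intro exI[of _ ?Z] conjI bexI) (auto simp: M.M.minus_self M.M.add_self)
  then show ?thesis unfolding stable_iso_def using mod_hom_id[of A M] by (auto simp: id_def)
qed

end

section \<open>Tensor products of modules\<close>

lemma tensor_mod_simps [simp]:
  "carrier (tensor_mod A M N) = carrier (tensor M N)" "\<zero>\<^bsub>tensor_mod A M N\<^esub> = \<zero>\<^bsub>tensor M N\<^esub>"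
  "s \<oplus>\<^bsub>tensor_mod A M N\<^esub> t = s \<oplus>\<^bsub>tensor M N\<^esub> t" "homog (tensor_mod A M N) n = homog (tensor M N) n"
  by (simp_all add: tensor_mod_def graded.extend_def gmod.fields_def)

lemma graded_space_cong:
  assumes "graded_space V" "carrier W = carrier V" "\<zero>\<^bsub>W\<^esub> = \<zero>\<^bsub>V\<^esub>" "\<And>x y. x \<oplus>\<^bsub>W\<^esub> y = x \<oplus>\<^bsub>V\<^esub> y"
    "\<And>n. homog W n = homog V n"
  shows "graded_space W"
proof -
  interpret V: graded_space V by fact
  show ?thesis
    by (rule graded_subspace[OF assms(1)])
      (use assms V.homog_closed in \<open>auto simp: bool_subspace_def\<close>)
qed

locale two_modules = M: hopf_module A M + N: hopf_module A N
  for A :: "'a hopf" (structure) and M :: "('a, 'm) gmod" and N :: "('a, 'n) gmod"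
begin

sublocale T: tensor_graded M N by unfold_locales

abbreviation "MN \<equiv> tensor M N"

sublocale MN: graded_space MN by (rule T.T_graded)

lemma map_bilin:
  "a \<in> carrier A \<Longrightarrow> b \<in> carrier A \<Longrightarrow> bilin M N MN (\<lambda>v w. tens M N (act M a v) (act N b w))"
  by (intro bilinI)
    (auto simp: T.tens_closed M.M.act_closed N.M.act_closed M.M.act_add_right N.M.act_add_right
      T.tens_add_left T.tens_add_right)

lemma map_tens:
  "a \<in> carrier A \<Longrightarrow> b \<in> carrier A \<Longrightarrow> v \<in> carrier M \<Longrightarrow> w \<in> carrier N \<Longrightarrow>
    tensor_map M N (act M a) (act N b) (tens M N v w) = tens M N (act M a v) (act N b w)"
  unfolding tensor_map_def by (rule T.lift_tens[OF T.T_boolean map_bilin])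

lemma map_linear:
  "a \<in> carrier A \<Longrightarrow> b \<in> carrier A \<Longrightarrow> tensor_map M N (act M a) (act N b) \<in> linear_maps MN MN"
  unfolding tensor_map_def by (rule T.lift_linear[OF T.T_boolean map_bilin])

lemmas map_simps = map_tens linear_maps_zero[OF T.T_boolean T.T_boolean map_linear]
  linear_maps_add[OF map_linear] linear_maps_closed[OF map_linear]

text \<open>
  The action of \<open>A \<otimes> A\<close>, from which the action of \<open>A\<close> is pulled back along the coproduct.
\<close>

definition act2 where
  "act2 s t = tensor_lift MN (\<lambda>a b. tensor_map M N (act M a) (act N b) t) s"

lemma act2_bilin:
  assumes t: "t \<in> carrier MN"
  shows "bilin A A MN (\<lambda>a b. tensor_map M N (act M a) (act N b) t)"
proof (rule bilinI)
  fix a a' b assume c: "a \<in> carrier A" "a' \<in> carrier A" "b \<in> carrier A"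
  show "tensor_map M N (act M (a \<oplus> a')) (act N b) t =
      tensor_map M N (act M a) (act N b) t \<oplus>\<^bsub>MN\<^esub> tensor_map M N (act M a') (act N b) t"
    using t
  proof (induct rule: T.tensor_induct)
    case (tens v w)
    then show ?case using c by (simp add: map_simps M.M.act_add_left T.tens_add_left M.M.act_closed N.M.act_closed)
  next
    case (add s t)
    then show ?case using c by (simp add: map_simps MN.a_ac)
  qed (use c in \<open>simp add: map_simps\<close>)
next
  fix a b b' assume c: "a \<in> carrier A" "b \<in> carrier A" "b' \<in> carrier A"
  show "tensor_map M N (act M a) (act N (b \<oplus> b')) t =
      tensor_map M N (act M a) (act N b) t \<oplus>\<^bsub>MN\<^esub> tensor_map M N (act M a) (act N b') t"
    using t
  proof (induct rule: T.tensor_induct)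
    case (tens v w)
    then show ?case using c by (simp add: map_simps N.M.act_add_left T.tens_add_right M.M.act_closed N.M.act_closed)
  next
    case (add s t)
    then show ?case using c by (simp add: map_simps MN.a_ac)
  qed (use c in \<open>simp add: map_simps\<close>)
qed (use t in \<open>simp add: map_simps\<close>)

lemma act2_linear_left: "t \<in> carrier MN \<Longrightarrow> (\<lambda>s. act2 s t) \<in> linear_maps M.A2 MN"
  unfolding act2_def by (rule M.AA.lift_linear[OF T.T_boolean act2_bilin])

lemmas act2_left = linear_maps_zero[OF M.AA.T_boolean T.T_boolean act2_linear_left]
  linear_maps_add[OF act2_linear_left] linear_maps_closed[OF act2_linear_left]

lemma act2_tens_left: "a \<in> carrier A \<Longrightarrow> b \<in> carrier A \<Longrightarrow> t \<in> carrier MN \<Longrightarrow>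
    act2 (tens A A a b) t = tensor_map M N (act M a) (act N b) t"
  unfolding act2_def by (rule M.AA.lift_tens[OF T.T_boolean act2_bilin])

lemma act2_linear: "s \<in> carrier M.A2 \<Longrightarrow> act2 s \<in> linear_maps MN MN"
  unfolding linear_maps_iff
proof (intro conjI ballI)
  fix t t' assume s: "s \<in> carrier M.A2" and t: "t \<in> carrier MN" "t' \<in> carrier MN"
  show "act2 s (t \<oplus>\<^bsub>MN\<^esub> t') = act2 s t \<oplus>\<^bsub>MN\<^esub> act2 s t'"
    using s
  proof (induct rule: M.AA.tensor_induct)
    case (add u v)
    then show ?case using t by (simp add: act2_left MN.a_ac)
  qed (use t in \<open>simp_all add: act2_left act2_tens_left map_simps\<close>)
qed (simp add: act2_left)

lemmas act2_right = linear_maps_zero[OF T.T_boolean T.T_boolean act2_linear]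
  linear_maps_add[OF act2_linear] linear_maps_closed[OF act2_linear]

lemma act2_tens: "a \<in> carrier A \<Longrightarrow> b \<in> carrier A \<Longrightarrow> v \<in> carrier M \<Longrightarrow> w \<in> carrier N \<Longrightarrow>
    act2 (tens A A a b) (tens M N v w) = tens M N (act M a v) (act N b w)"
  by (simp add: act2_tens_left T.tens_closed map_simps)

lemma act2_mult:
  assumes "s \<in> carrier M.A2" "s' \<in> carrier M.A2" "t \<in> carrier MN"
  shows "act2 (s \<otimes>\<^bsub>M.A2\<^esub> s') t = act2 s (act2 s' t)"
  using assms(1)
proof (induct rule: M.AA.tensor_induct)
  case (tens a b)
  note ab = tens
  show ?case using assms(2)
  proof (induct rule: M.AA.tensor_induct)
    case (tens a' b')
    note ab' = tens
    show ?case using assms(3)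
    proof (induct rule: T.tensor_induct)
      case (tens v w)
      then show ?case using ab ab'
        by (simp add: M.tensor_mult_tens act2_tens M.M.act_closed N.M.act_closed M.M.act_mult N.M.act_mult)
    next
      case (add t u)
      then show ?case using ab ab' by (simp add: act2_right M.AA.tens_closed M.tensor_mult_closed)
    qed (use ab ab' in \<open>simp add: act2_right M.AA.tens_closed M.tensor_mult_closed\<close>)
  next
    case (add u v)
    then show ?case using ab assms(3)
      by (simp add: M.tensor_mult_add_right M.AA.tens_closed M.tensor_mult_closed act2_left act2_right)
  qed (use ab assms(3) in \<open>simp add: M.AA.tens_closed act2_left act2_right\<close>)
next
  case (add u v)
  then show ?case using assms(2,3)
    by (simp add: M.tensor_mult_add_left M.tensor_mult_closed act2_left)
qed (use assms(2,3) in \<open>simp add: act2_left\<close>)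

abbreviation "TM \<equiv> tensor_mod A M N"

lemma TM_act: "act TM a t = act2 (coprod A a) t"
  by (simp add: tensor_mod_def graded.extend_def gmod.fields_def act2_def)

lemma act2_homog:
  assumes "s \<in> homog M.A2 i" "t \<in> homog MN j"
  shows "act2 s t \<in> homog MN (i + j)"
  using assms(1)
proof (induct rule: M.AA.homog_tensor_induct)
  case zero
  then show ?case using assms(2) MN.homog_closed by (simp add: act2_left)
next
  case (tens k a b)
  note ab = tens M.homog_closed[OF tens(1)] M.homog_closed[OF tens(2)]
  show ?case using assms(2)
  proof (induct rule: T.homog_tensor_induct)
    case zero
    then show ?case using ab by (simp add: act2_right M.AA.tens_closed)
  next
    case (tens l v w)
    have "tens M N (act M a v) (act N b w) \<in> homog MN ((k + l) + ((i - k) + (j - l)))"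
      by (intro T.tens_homog M.M.act_homog N.M.act_homog ab tens)
    then show ?case using ab tens M.M.homog_closed N.M.homog_closed by (simp add: act2_tens algebra_simps)
  next
    case (add t u)
    then show ?case using ab MN.homog_closed
      by (simp add: act2_right M.AA.tens_closed MN.homog_add)
  qed
next
  case (add u v)
  then show ?case using assms(2) MN.homog_closed M.A2.homog_closed by (simp add: act2_left MN.homog_add)
qed

lemma gmodule_tensor: "gmodule A TM"
proof (intro gmodule.intro gmodule_axioms.intro)
  show "graded_space TM"
    by (rule graded_space_cong[OF MN.graded_space_axioms]) simp_all
  fix a b t u assume ab: "a \<in> carrier A" "b \<in> carrier A" and t: "t \<in> carrier TM" "u \<in> carrier TM"
  show "act TM a t \<in> carrier TM" using ab t by (simp add: TM_act act2_left)
  show "act TM (a \<oplus> b) t = act TM a t \<oplus>\<^bsub>TM\<^esub> act TM b t"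
    using ab t by (simp add: TM_act M.coprod_add act2_left)
  show "act TM a (t \<oplus>\<^bsub>TM\<^esub> u) = act TM a t \<oplus>\<^bsub>TM\<^esub> act TM a u"
    using ab t by (simp add: TM_act act2_right)
  show "act TM (a \<otimes> b) t = act TM a (act TM b t)"
    using ab t by (simp add: TM_act M.coprod_mult act2_mult)
next
  fix t assume "t \<in> carrier TM"
  then have "t \<in> carrier MN" by simp
  then have "act2 (tens A A \<one> \<one>) t = t"
    by (induct rule: T.tensor_induct)
      (simp_all add: act2_right act2_tens M.AA.tens_closed M.M.act_one N.M.act_one)
  then show "act TM \<one> t = t" by (simp add: TM_act M.coprod_one)
next
  fix a i t j assume "a \<in> homog A i" "t \<in> homog TM j"
  then show "act TM a t \<in> homog TM (i + j)" using act2_homog M.coprod_homog by (simp add: TM_act)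
next
  obtain k where k: "\<forall>n<k. homog M n = {\<zero>\<^bsub>M\<^esub>}" using M.M.bounded_below by (auto simp: bounded_below_def)
  obtain l where l: "\<forall>n<l. homog N n = {\<zero>\<^bsub>N\<^esub>}" using N.M.bounded_below by (auto simp: bounded_below_def)
  have "t = \<zero>\<^bsub>MN\<^esub>" if "t \<in> homog MN n" "n < k + l" for n t
    using that(1)
  proof (induct rule: T.homog_tensor_induct)
    case (tens i v w)
    have "v = \<zero>\<^bsub>M\<^esub> \<or> w = \<zero>\<^bsub>N\<^esub>"
      using k l tens that(2) by (cases "i < k") auto
    then show ?case using tens M.M.homog_closed N.M.homog_closed by auto
  next
    case (add t t')
    show ?case unfolding add using MN.add_self[OF MN.zero_closed] by simp
  qed simp
  then have "homog TM n = {\<zero>\<^bsub>TM\<^esub>}" if "n < k + l" for n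
    using MN.homog_zero[of n] that by auto
  then show "bounded_below TM" unfolding bounded_below_def by blast
qed

sublocale TM: hopf_module A TM
  by (simp add: hopf_module_def M.conn_hopf_axioms gmodule_tensor)

end

context two_modules
begin

lemma lam_aug_span: "s \<in> aug_span A TM \<Longrightarrow> act TM M.lam s = \<zero>\<^bsub>MN\<^esub>"
proof (induct rule: aug_span.induct)
  case zero
  then show ?case using TM.act_zero_right[OF M.lam_closed] by simp
next
  case (step s a x)
  have la: "M.lam \<otimes> a = \<zero>" using step(3)
  proof (induct rule: M.aug_induct)
    case (homog n x)
    then show ?case using M.mult_homog[OF M.lam_homog homog(2)] M.above_top[of "top_degree A + n"] by auto
  qed (simp_all add: M.r_distr)
  have ac: "a \<in> carrier A" using step(3) by (rule M.aug_closed)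
  have sc: "s \<in> carrier TM" "act TM a x \<in> carrier TM"
    using step TM.aug_span_closed TM.M.act_closed[OF ac] by auto
  have "act TM M.lam (act TM a x) = \<zero>\<^bsub>MN\<^esub>"
    using TM.M.act_mult[OF M.lam_closed ac step(4)] la TM.act_zero_left[OF step(4)] by simp
  then show ?case using TM.M.act_add_right[OF M.lam_closed sc] step(2) by simp
qed

end

text \<open>
  If \<open>K\<close> is free on \<open>Y\<close>, then every element of \<open>K \<otimes> N\<close> is \<open>\<Sum> y \<otimes> w(y)\<close> modulo the span of the
  augmentation ideal, and \<open>w(y)\<close> is recovered from the action of \<open>\<lambda>\<close>, whose coproduct has leading
  term \<open>\<lambda> \<otimes> 1\<close>.
\<close>

locale summand_tensor = unit_summand_module A M m r + N: hopf_module A N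
  for A :: "'a hopf" (structure) and M :: "('a, 'm) gmod" and m r and N :: "('a, 'n) gmod"
begin

sublocale two_modules A M N by unfold_locales

text \<open>
  The map \<open>r \<otimes> id\<close>, which splits off the summand \<open>m \<otimes> N\<close>.
\<close>

definition slice where "slice = tensor_lift N (\<lambda>v w. scale2 N (r v) w)"

lemma slice_bilin: "bilin M N N (\<lambda>v w. scale2 N (r v) w)"
  by (intro bilinI) (auto simp: scale2_def unit_map_add[OF r] N.M.add_self)

lemma slice_linear: "slice \<in> linear_maps MN N"
  unfolding slice_def by (rule T.lift_linear[OF N.M.boolean_group_axioms slice_bilin])

lemma slice_tens: "v \<in> carrier M \<Longrightarrow> w \<in> carrier N \<Longrightarrow> slice (tens M N v w) = scale2 N (r v) w"
  unfolding slice_def by (rule T.lift_tens[OF N.M.boolean_group_axioms slice_bilin])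

lemmas slice_simps = slice_tens linear_maps_zero[OF T.T_boolean N.M.boolean_group_axioms slice_linear]
  linear_maps_add[OF slice_linear] linear_maps_closed[OF slice_linear]

lemma slice_hom: "slice \<in> mod_hom A TM N"
proof (rule mod_homI)
  fix n t assume "t \<in> homog TM n"
  then have "t \<in> homog MN n" by simp
  then show "slice t \<in> homog N n"
  proof (induct rule: T.homog_tensor_induct)
    case (tens i v w)
    then show ?case using unit_map_homog[OF r tens(1)] M.homog_closed N.M.homog_closed
      by (cases "i = 0") (auto simp: slice_simps scale2_def)
  qed (auto simp: slice_simps MN.homog_closed N.M.homog_add)
next
  fix a t assume a: "a \<in> carrier A" and t: "t \<in> carrier TM"
  have "slice (act2 s t) = act N (lslice A (counit A) s) (slice t)" if "s \<in> carrier A2" for s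
    using that
  proof (induct rule: AA.tensor_induct)
    case zero
    then show ?case using t by (simp add: act2_left slice_simps counit_linear)
  next
    case (tens a b)
    note ab = tens
    have "t \<in> carrier MN" using t by simp
    then show ?case
    proof (induct rule: T.tensor_induct)
      case zero
      then show ?case using ab by (simp add: act2_right AA.tens_closed slice_simps lslice_closed counit_linear)
    next
      case (tens v w)
      then show ?case using ab
        by (cases "counit A a"; cases "r v")
          (simp_all add: act2_tens slice_simps M.act_closed N.M.act_closed unit_map_act[OF r] lslice_tens counit_linear)
    next
      case (add t u)
      then show ?case using ab
        by (simp add: act2_right AA.tens_closed slice_simps lslice_closed counit_linear N.M.act_add_right)
    qed
  next
    case (add s s')
    then show ?case using t
      by (simp add: act2_left slice_simps lslice_add lslice_closed counit_linear N.M.act_add_left)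
  qed
  from this[OF coprod_closed[OF a]] show "slice (act TM a t) = act N a (slice t)"
    by (simp add: TM_act lslice_counit[OF a])
qed (simp_all add: slice_simps)

lemma incl_hom: "(\<lambda>w. tens M N m w) \<in> mod_hom A N TM"
proof (rule mod_homI)
  show "tens M N m w \<in> homog TM n" if "w \<in> homog N n" for w n
    using T.tens_homog[OF m(1) that] by simp
  fix a w assume a: "a \<in> carrier A" and w: "w \<in> carrier N"
  have "act2 s (tens M N m w) = tens M N m (act N (lslice A (counit A) s) w)" if "s \<in> carrier A2" for s
    using that
  proof (induct rule: AA.tensor_induct)
    case zero
    then show ?case using w m(3) by (simp add: act2_left counit_linear T.tens_closed)
  next
    case (tens a b)
    then show ?case using w m(3) act_invariant[OF m(2) tens(1)]
      by (cases "counit A a") (simp_all add: act2_tens lslice_tens counit_linear N.M.act_closed)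
  next
    case (add s s')
    then show ?case using w m(3)
      by (simp add: act2_left T.tens_closed counit_linear lslice_add lslice_closed N.M.act_add_left
          N.M.act_closed T.tens_add_right)
  qed
  from this[OF coprod_closed[OF a]] show "tens M N m (act N a w) = act TM a (tens M N m w)"
    by (simp add: TM_act lslice_counit[OF a])
qed (use m(3) in \<open>simp_all add: T.tens_closed T.tens_add_right\<close>)

abbreviation "K \<equiv> restrict_mod M (kernel_of M r)"

context
  fixes Y and \<beta>
  assumes F: "free_on A K Y \<beta>"
begin

interpretation K: hopf_module A K
  by (simp add: hopf_module_def conn_hopf_axioms gmodule_kernel[OF r])

lemma KM: "k \<in> carrier K \<Longrightarrow> k \<in> carrier M" by (simp add: kernel_of_def)

lemma YM: "y \<in> Y \<Longrightarrow> y \<in> carrier K" "y \<in> Y \<Longrightarrow> y \<in> carrier M"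
  using K.free_carrier[OF F] KM by blast+

definition E where "E w = finsum MN (\<lambda>y. tens M N y (w y)) {y. w y \<noteq> \<zero>\<^bsub>N\<^esub>}"

lemma tens_linear: "v \<in> carrier M \<Longrightarrow> tens M N v \<in> linear_maps N MN"
  by (simp add: linear_maps_iff T.tens_closed T.tens_add_right)

lemma E_closed: "w \<in> coeffs N Y \<Longrightarrow> E w \<in> carrier MN"
  unfolding E_def using YM coeffs_supp[of w N Y] by (intro MN.finsum_closed) (auto intro!: T.tens_closed)

text \<open>
  This subspace will turn out to contain all of \<open>K \<otimes> N\<close>.
\<close>

definition G where "G = {t \<in> carrier MN. \<exists>w\<in>coeffs N Y. \<exists>s\<in>aug_span A TM. t = E w \<oplus>\<^bsub>MN\<^esub> s}"

lemma G_intro: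
  assumes "w \<in> coeffs N Y" "s \<in> aug_span A TM"
  shows "E w \<oplus>\<^bsub>MN\<^esub> s \<in> G"
  unfolding G_def using assms E_closed TM.aug_span_closed[OF assms(2)] by auto

lemma E_zero: "(\<lambda>_. \<zero>\<^bsub>N\<^esub>) \<in> coeffs N Y" "E (\<lambda>_. \<zero>\<^bsub>N\<^esub>) = \<zero>\<^bsub>MN\<^esub>"
  by (auto simp: coeffs_def E_def)

lemma aug_span_G: "s \<in> aug_span A TM \<Longrightarrow> s \<in> G"
  using G_intro[OF E_zero(1), of s] E_zero(2) TM.aug_span_closed[of s] by simp

lemma G_subspace: "bool_subspace MN G"
  unfolding bool_subspace_def
proof (intro conjI ballI)
  show "G \<subseteq> carrier MN" by (auto simp: G_def)
  show "\<zero>\<^bsub>MN\<^esub> \<in> G" using aug_span_G[OF aug_span.zero[of TM A]] by simp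
  fix t t' assume "t \<in> G" "t' \<in> G"
  then obtain w w' s s' where w: "w \<in> coeffs N Y" "w' \<in> coeffs N Y" and s: "s \<in> aug_span A TM" "s' \<in> aug_span A TM"
    and t: "t = E w \<oplus>\<^bsub>MN\<^esub> s" "t' = E w' \<oplus>\<^bsub>MN\<^esub> s'" by (auto simp: G_def)
  have c: "E w \<in> carrier MN" "E w' \<in> carrier MN" "s \<in> carrier MN" "s' \<in> carrier MN"
    using E_closed w TM.aug_span_closed s by auto
  have "E (\<lambda>y. w y \<oplus>\<^bsub>N\<^esub> w' y) = E w \<oplus>\<^bsub>MN\<^esub> E w'"
    unfolding E_def
    by (rule finsum_coeffs_add[OF N.M.boolean_group_axioms T.T_boolean tens_linear w]) (use YM in auto)
  then have "t \<oplus>\<^bsub>MN\<^esub> t' = E (\<lambda>y. w y \<oplus>\<^bsub>N\<^esub> w' y) \<oplus>\<^bsub>MN\<^esub> (s \<oplus>\<^bsub>MN\<^esub> s')"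
    unfolding t using c by (simp add: MN.a_ac)
  moreover have "(\<lambda>y. w y \<oplus>\<^bsub>N\<^esub> w' y) \<in> coeffs N Y" by (rule N.M.coeffs_sum[OF w])
  moreover have "s \<oplus>\<^bsub>MN\<^esub> s' \<in> aug_span A TM" using TM.aug_span_add[OF s(2,1)] by simp
  ultimately show "t \<oplus>\<^bsub>MN\<^esub> t' \<in> G" by (simp only: G_intro)
qed

lemma tens_basis_G:
  assumes "y \<in> Y" "w \<in> carrier N"
  shows "tens M N y w \<in> G"
proof -
  let ?w = "\<lambda>z. if z = y then w else \<zero>\<^bsub>N\<^esub>"
  have c: "?w \<in> coeffs N Y" using assms by (auto simp: coeffs_def intro: finite_subset[of _ "{y}"])
  have "E ?w = finsum MN (\<lambda>z. tens M N z (?w z)) {y}"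
    unfolding E_def
    by (rule MN.finsum_support) (use assms YM in \<open>auto intro!: T.tens_closed\<close>)
  also have "\<dots> = tens M N y w" using assms YM by (simp add: T.tens_closed)
  finally show ?thesis
    using G_intro[OF c aug_span.zero[of TM A]] T.tens_closed[OF YM(2)[OF assms(1)] assms(2)] by simp
qed

text \<open>
  In \<open>a(y \<otimes> w) = ay \<otimes> w + \<dots>\<close> the remaining terms \<open>by \<otimes> cw\<close> have \<open>|b| < |a|\<close>, so the degree of \<open>a\<close> can be
  lowered modulo the span of the augmentation ideal.
\<close>

lemma act_basis_G:
  assumes y: "y \<in> Y" and w: "w \<in> carrier N" and a: "a \<in> homog A (int n)"
  shows "tens M N (act M a y) w \<in> G"
  using w a
proof (induct n arbitrary: a w rule: less_induct)
  case (less n)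
  note yM = YM(2)[OF y]
  have G0: "\<zero>\<^bsub>MN\<^esub> \<in> G" and Ga: "\<And>s t. s \<in> G \<Longrightarrow> t \<in> G \<Longrightarrow> s \<oplus>\<^bsub>MN\<^esub> t \<in> G"
    using G_subspace by (auto simp: bool_subspace_def)
  show ?case
  proof (cases "n = 0")
    case True
    then consider "a = \<zero>" | "a = \<one>" using less(3) homog_0 by auto
    then show ?thesis
      by cases (use G0 less(2) yM tens_basis_G[OF y] in \<open>simp_all add: M.act_one\<close>)
  next
    case False
    have ac: "a \<in> carrier A" using homog_closed[OF less(3)] .
    obtain s where s: "s \<in> low_terms A (int n)" "coprod A a = tens A A a \<one> \<oplus>\<^bsub>A2\<^esub> s"
      using coprod_leading[OF less(3)] by blast
    have t: "tens M N y w \<in> carrier MN" using T.tens_closed[OF yM less(2)] .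
    have "act2 s (tens M N y w) \<in> G" using s(1)
    proof (induct rule: low_terms.induct)
      case zero
      then show ?case using G0 t by (simp add: act2_left)
    next
      case (tens b i c)
      note bc = homog_closed[OF tens(1)] homog_closed[OF tens(2)]
      have "tens M N (act M b y) (act N c w) \<in> G"
      proof (cases "i < 0")
        case True
        then have "b = \<zero>" using homog_neg tens(1) by auto
        then show ?thesis using G0 yM bc less(2) by (simp add: N.M.act_closed)
      next
        case False
        then show ?thesis
          using less(1)[of "nat i" "act N c w" b] tens N.M.act_closed[OF bc(2) less(2)] by simp
      qed
      then show ?case using act2_tens[OF bc yM less(2)] by simp
    next
      case (add s s')
      then show ?case using Ga t low_terms_closed by (simp add: act2_left)
    qed
    moreover have "act TM a (tens M N y w) \<in> G"
      using aug_span_G[OF TM.aug_span_act1[OF homog_pos_aug[OF less(3)]]] False t by simp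
    moreover have "act TM a (tens M N y w) = tens M N (act M a y) w \<oplus>\<^bsub>MN\<^esub> act2 s (tens M N y w)"
      using t ac low_terms_closed[OF s(1)] yM less(2)
      by (simp add: TM_act s(2) act2_left AA.tens_closed act2_tens N.M.act_one)
    moreover have "tens M N (act M a y) w \<in> carrier MN" "act2 s (tens M N y w) \<in> carrier MN"
      using t ac low_terms_closed[OF s(1)] yM less(2) by (simp_all add: T.tens_closed M.act_closed act2_left)
    ultimately have "tens M N (act M a y) w = act2 s (tens M N y w) \<oplus>\<^bsub>MN\<^esub> act TM a (tens M N y w)"
      by (metis MN.a_comm MN.add_cancel_left)
    then show ?thesis using Ga \<open>act2 s (tens M N y w) \<in> G\<close> \<open>act TM a (tens M N y w) \<in> G\<close> by simp
  qed
qed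

lemma kernel_tens_G:
  assumes p: "p \<in> carrier K" and w: "w \<in> carrier N"
  shows "tens M N p w \<in> G"
proof -
  have G0: "\<zero>\<^bsub>MN\<^esub> \<in> G" and Ga: "\<And>s t. s \<in> G \<Longrightarrow> t \<in> G \<Longrightarrow> s \<oplus>\<^bsub>MN\<^esub> t \<in> G"
    using G_subspace by (auto simp: bool_subspace_def)
  have a: "tens M N (act M a y) w \<in> G" if "a \<in> carrier A" "y \<in> Y" for a y
    using that(1)
  proof (induct rule: graded_induct)
    case zero
    then show ?case using G0 YM(2)[OF that(2)] w by simp
  next
    case (homog n a)
    show ?case
    proof (cases "n < 0")
      case True
      then show ?thesis using homog_neg homog G0 YM(2)[OF that(2)] w by auto
    next
      case False
      then show ?thesis using act_basis_G[OF that(2) w, of a "nat n"] homog by simp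
    qed
  next
    case (add a b)
    then show ?case using Ga YM(2)[OF that(2)] w by (simp add: M.act_add_left T.tens_add_left M.act_closed)
  qed
  have lin: "(\<lambda>p. tens M N p w) \<in> linear_maps K MN"
    using w KM by (auto simp: linear_maps_iff T.tens_closed T.tens_add_left)
  note cp = coeffs_supp[OF K.free_coeffs[OF F p]]
  have "tens M N p w = tens M N (lincomb A K (\<lambda>y. y) (\<beta> p)) w" using K.free_lincomb[OF F p] by simp
  also have "\<dots> = finsum MN (\<lambda>y. tens M N (act K (\<beta> p y) y) w) {y. \<beta> p y \<noteq> \<zero>}"
    unfolding lincomb_def
    by (rule linear_maps_finsum[OF K.M.boolean_group_axioms T.T_boolean lin])
      (use cp YM in \<open>blast intro: K.M.act_closed\<close>)
  also have "\<dots> \<in> G"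
    by (rule MN.bool_subspace_finsum[OF G_subspace]) (use cp a in auto)
  finally show ?thesis .
qed

definition top_coeff :: "'a \<Rightarrow> bit" where
  "top_coeff a = (if component A (top_degree A) a = \<zero> then 0 else 1)"

lemma top_coeff_add:
  assumes "a \<in> carrier A" "b \<in> carrier A"
  shows "top_coeff (a \<oplus> b) = top_coeff a + top_coeff b"
proof -
  have "component A (top_degree A) a \<in> {\<zero>, lam}" "component A (top_degree A) b \<in> {\<zero>, lam}"
    unfolding homog_top[symmetric] using assms by (auto intro: comp_homog)
  then show ?thesis using assms lam_nonzero by (auto simp: top_coeff_def comp_add add_self)
qed

lemma top_coeff_homog: "a \<in> homog A i \<Longrightarrow> i < top_degree A \<Longrightarrow> top_coeff a = 0"
  by (simp add: top_coeff_def comp_of_homog)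

lemma top_coeff_lam: "top_coeff lam = 1" "top_coeff \<zero> = 0"
  using comp_of_homog[OF lam_homog] lam_nonzero by (simp_all add: top_coeff_def)

text \<open>
  Reads off the coefficient of \<open>\<lambda> y\<^sub>0\<close> in the left factor.
\<close>

definition detect where
  "detect y0 = tensor_lift N (\<lambda>v w. scale2 N (top_coeff (\<beta> (pr v) y0)) w)"

lemma detect_bilin: "bilin M N N (\<lambda>v w. scale2 N (top_coeff (\<beta> (pr v) y0)) w)"
proof -
  have c: "\<beta> (pr v) y0 \<in> carrier A" if "v \<in> carrier M" for v
    using coeffs_supp(2)[OF K.free_coeffs[OF F]] mod_hom_closed[OF pr_hom that] by simp
  have "top_coeff (\<beta> (pr (v \<oplus>\<^bsub>M\<^esub> v')) y0) = top_coeff (\<beta> (pr v) y0) + top_coeff (\<beta> (pr v') y0)"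
    if "v \<in> carrier M" "v' \<in> carrier M" for v v'
    using K.free_coords_add[OF F mod_hom_closed[OF pr_hom that(1)] mod_hom_closed[OF pr_hom that(2)]]
      mod_hom_add[OF pr_hom that] top_coeff_add[OF c[OF that(1)] c[OF that(2)]] by simp
  then show ?thesis
    by (intro bilinI) (simp_all add: N.M.scale2_add_left N.M.scale2_add_right)
qed

lemma detect_linear: "detect y0 \<in> linear_maps MN N"
  unfolding detect_def by (rule T.lift_linear[OF N.M.boolean_group_axioms detect_bilin])

lemma detect_tens: "v \<in> carrier M \<Longrightarrow> w \<in> carrier N \<Longrightarrow>
    detect y0 (tens M N v w) = scale2 N (top_coeff (\<beta> (pr v) y0)) w"
  unfolding detect_def by (rule T.lift_tens[OF N.M.boolean_group_axioms detect_bilin])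

lemmas detect_simps = linear_maps_zero[OF T.T_boolean N.M.boolean_group_axioms detect_linear]
  linear_maps_add[OF detect_linear] linear_maps_closed[OF detect_linear]

lemma coords_act_basis:
  assumes "y \<in> Y" "a \<in> carrier A"
  shows "\<beta> (pr (act M a y)) y0 = (if y0 = y then a else \<zero>)"
proof -
  have "act M a y \<in> kernel_of M r" using K.M.act_closed[OF assms(2) YM(1)[OF assms(1)]] by simp
  then have "\<beta> (pr (act M a y)) y0 = \<beta> (act K a y) y0" by (simp add: pr_kernel)
  also have "\<dots> = a \<otimes> \<beta> y y0" using K.free_coords_act[OF F YM(1)[OF assms(1)] assms(2)] by simp
  finally show ?thesis using K.free_coords_basis[OF F assms(1)] assms(2) by simp
qed

text \<open>
  The terms of the coproduct of \<open>\<lambda>\<close> other than \<open>\<lambda> \<otimes> 1\<close> have left factors of degree too small to contribute.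
\<close>

lemma detect_lam:
  assumes y: "y \<in> Y" and w: "w \<in> carrier N"
  shows "detect y0 (act TM lam (tens M N y w)) = (if y0 = y then w else \<zero>\<^bsub>N\<^esub>)"
proof -
  note yM = YM(2)[OF y]
  have t: "tens M N y w \<in> carrier MN" using T.tens_closed[OF yM w] .
  obtain s where s: "s \<in> low_terms A (top_degree A)" "coprod A lam = tens A A lam \<one> \<oplus>\<^bsub>A2\<^esub> s"
    using coprod_leading[OF lam_homog] by blast
  have "detect y0 (act2 s (tens M N y w)) = \<zero>\<^bsub>N\<^esub>" using s(1)
  proof (induct rule: low_terms.induct)
    case zero
    then show ?case using t by (simp add: act2_left detect_simps)
  next
    case (tens b i c)
    note bc = homog_closed[OF tens(1)] homog_closed[OF tens(2)]
    show ?case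
      using act2_tens[OF bc yM w] detect_tens[OF M.act_closed[OF bc(1) yM] N.M.act_closed[OF bc(2) w]]
        coords_act_basis[OF y bc(1)] top_coeff_homog[OF tens(1,3)] top_coeff_lam(2) by simp
  next
    case (add s s')
    then show ?case using t low_terms_closed by (simp add: act2_left detect_simps)
  qed
  moreover have "detect y0 (act2 (tens A A lam \<one>) (tens M N y w)) = (if y0 = y then w else \<zero>\<^bsub>N\<^esub>)"
    using act2_tens[OF lam_closed one_closed yM w] detect_tens[OF M.act_closed[OF lam_closed yM] w]
      coords_act_basis[OF y lam_closed] top_coeff_lam w by (simp add: N.M.act_one)
  ultimately show ?thesis
    using t low_terms_closed[OF s(1)] w
    by (simp add: TM_act s(2) act2_left AA.tens_closed detect_simps)
qed

lemma G_exact: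
  assumes q: "q \<in> G" "act TM lam q = \<zero>\<^bsub>MN\<^esub>"
  shows "q \<in> aug_span A TM"
proof -
  obtain w s where w: "w \<in> coeffs N Y" and s: "s \<in> aug_span A TM" and eq: "q = E w \<oplus>\<^bsub>MN\<^esub> s"
    using q(1) by (auto simp: G_def)
  note cw = coeffs_supp[OF w]
  have sc: "s \<in> carrier MN" using TM.aug_span_closed[OF s] by simp
  have lE: "act TM lam (E w) = \<zero>\<^bsub>MN\<^esub>"
    using q(2) TM.M.act_add_right[OF lam_closed, of "E w" s] E_closed[OF w] sc lam_aug_span[OF s]
      TM.M.act_closed[OF lam_closed, of "E w"] by (simp add: eq)
  have "w y0 = \<zero>\<^bsub>N\<^esub>" for y0
  proof (rule ccontr)
    assume nz: "w y0 \<noteq> \<zero>\<^bsub>N\<^esub>"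
    let ?S = "{y. w y \<noteq> \<zero>\<^bsub>N\<^esub>}"
    have lin: "(\<lambda>t. detect y0 (act TM lam t)) \<in> linear_maps MN N"
      using linear_maps_add[OF TM.act_linear[OF lam_closed]] linear_maps_closed[OF TM.act_linear[OF lam_closed]]
      by (simp add: linear_maps_iff detect_simps)
    have "detect y0 (act TM lam (E w)) = finsum N (\<lambda>y. detect y0 (act TM lam (tens M N y (w y)))) ?S"
      unfolding E_def
      by (rule linear_maps_finsum[OF T.T_boolean N.M.boolean_group_axioms lin])
        (use cw YM in \<open>blast intro: T.tens_closed\<close>)
    also have "\<dots> = finsum N (\<lambda>y. if y0 = y then w y else \<zero>\<^bsub>N\<^esub>) ?S"
    proof (rule N.M.finsum_cong')
      show "detect y0 (act TM lam (tens M N y (w y))) = (if y0 = y then w y else \<zero>\<^bsub>N\<^esub>)" if "y \<in> ?S" for y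
        using detect_lam[OF _ cw(2)] cw(3) that by blast
    qed (use cw in auto)
    also have "\<dots> = w y0" using nz cw by (subst N.M.add.finprod_singleton) auto
    finally show False using nz lE by (simp add: detect_simps)
  qed
  then have "E w = \<zero>\<^bsub>MN\<^esub>" by (simp add: E_def)
  then show ?thesis using eq s sc by simp
qed

end

text \<open>
  Removing \<open>m \<otimes> slice t\<close> from \<open>t\<close> leaves an element of \<open>K \<otimes> N\<close>, where the criterion holds by freeness.
\<close>

lemma kernel_part_exact:
  assumes ex: "socle_exact A K" and t: "t \<in> carrier MN" and l: "act TM lam t = \<zero>\<^bsub>MN\<^esub>"
    and sl: "slice t \<in> aug_span A N"
  shows "t \<in> aug_span A TM"
proof -
  interpret K: hopf_module A K
    by (simp add: hopf_module_def conn_hopf_axioms gmodule_kernel[OF r])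
  obtain Y \<beta> where F: "free_on A K Y \<beta>" using K.free_if_socle_exact[OF ex] by blast
  let ?j = "\<lambda>w. tens M N m w"
  have sub: "u \<oplus>\<^bsub>MN\<^esub> ?j (slice u) \<in> G Y" if "u \<in> carrier MN" for u
    using that
  proof (induct rule: T.tensor_induct)
    case zero
    then show ?case using G_subspace[OF F] m(3) by (simp add: slice_simps bool_subspace_def)
  next
    case (tens v w)
    have "tens M N v w \<oplus>\<^bsub>MN\<^esub> ?j (slice (tens M N v w)) = tens M N (pr v) w"
      using tens m(3) by (cases "r v") (simp_all add: slice_simps pr_def T.tens_add_left T.tens_closed)
    moreover have "tens M N (pr v) w \<in> G Y"
      by (rule kernel_tens_G[OF F mod_hom_closed[OF pr_hom tens(1)] tens(2)])
    ultimately show ?case by simp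
  next
    case (add u u')
    have "(u \<oplus>\<^bsub>MN\<^esub> u') \<oplus>\<^bsub>MN\<^esub> ?j (slice (u \<oplus>\<^bsub>MN\<^esub> u')) =
        (u \<oplus>\<^bsub>MN\<^esub> ?j (slice u)) \<oplus>\<^bsub>MN\<^esub> (u' \<oplus>\<^bsub>MN\<^esub> ?j (slice u'))"
      using add m(3) by (simp add: slice_simps T.tens_add_right T.tens_closed MN.a_ac)
    then show ?case using add G_subspace[OF F] by (simp add: bool_subspace_def)
  qed
  have jc: "?j (slice t) \<in> carrier MN" using t m(3) by (simp add: T.tens_closed slice_simps)
  have j: "?j (slice t) \<in> aug_span A TM"
    by (rule aug_span_map[OF sl incl_hom N.M.gmodule_axioms gmodule_tensor conn_hopf_axioms])
  have "act TM lam (t \<oplus>\<^bsub>MN\<^esub> ?j (slice t)) = \<zero>\<^bsub>MN\<^esub>"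
    using TM.M.act_add_right[OF lam_closed, of t "?j (slice t)"] t jc l lam_aug_span[OF j] by simp
  then have "t \<oplus>\<^bsub>MN\<^esub> ?j (slice t) \<in> aug_span A TM" by (rule G_exact[OF F sub[OF t]])
  then have "(t \<oplus>\<^bsub>MN\<^esub> ?j (slice t)) \<oplus>\<^bsub>TM\<^esub> ?j (slice t) \<in> aug_span A TM" using TM.aug_span_add[OF j] by blast
  then show ?thesis using t jc by (simp add: MN.a_assoc MN.add_self)
qed

end

context conn_hopf
begin

theorem stably_unit_tensor:
  assumes M: "gmodule A M" "stably_unit A M" and N: "gmodule A N" "stably_unit A N"
  shows "gmodule A (tensor_mod A M N)" "stably_unit A (tensor_mod A M N)"
proof -
  obtain m r where mr: "unit_summand_module A M m r" "socle_exact A (restrict_mod M (kernel_of M r))"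
    using stably_unitE[OF M(2,1)] by blast
  obtain n t where nt: "unit_summand_module A N n t" "socle_exact A (restrict_mod N (kernel_of N t))"
    using stably_unitE[OF N(2,1)] by blast
  interpret M: unit_summand_module A M m r by fact
  interpret N: unit_summand_module A N n t by fact
  interpret S: summand_tensor A M m r N by unfold_locales
  show g: "gmodule A (tensor_mod A M N)" by (rule S.gmodule_tensor)
  let ?u = "tens M N m n"
  have uc: "?u \<in> carrier (tensor M N)" using M.m(3) N.m(3) by (rule S.T.tens_closed)
  show "stably_unit A (tensor_mod A M N)"
  proof (rule stably_unitI[OF g, of ?u "\<lambda>v. t (S.slice v)"])
    have "invariant A (tensor_mod A M N) ?u"
      unfolding invariant_def
    proof (intro conjI ballI)
      show "?u \<in> carrier (tensor_mod A M N)" using uc by simp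
      fix a assume a: "a \<in> aug_ideal A"
      have "act (tensor_mod A M N) a ?u = tens M N m (act N a n)"
        using mod_hom_act[OF S.incl_hom aug_closed[OF a] N.m(3)] by simp
      then show "act (tensor_mod A M N) a ?u = \<zero>\<^bsub>tensor_mod A M N\<^esub>"
        using N.m(2) a M.m(3) by (simp add: invariant_def)
    qed
    moreover have "?u \<in> homog (tensor_mod A M N) 0" using S.T.tens_homog[OF M.m(1) N.m(1)] by simp
    moreover have "t (S.slice ?u) = 1" using M.m(3) N.m(3) M.rm N.rm by (simp add: S.slice_tens)
    ultimately show "unit_summand A (tensor_mod A M N) ?u (\<lambda>v. t (S.slice v))"
      using mod_hom_comp[OF S.slice_hom N.r] by (simp add: unit_summand_def)
    fix v assume v: "v \<in> carrier (tensor_mod A M N)" "t (S.slice v) = 0"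
      "act (tensor_mod A M N) lam v = \<zero>\<^bsub>tensor_mod A M N\<^esub>"
    have "act N lam (S.slice v) = \<zero>\<^bsub>N\<^esub>"
      using mod_hom_act[OF S.slice_hom lam_closed v(1)] v(3) mod_hom_zero[OF g N(1) S.slice_hom] by simp
    then have "S.slice v \<in> aug_span A N"
      using nt(2) v mod_hom_closed[OF S.slice_hom v(1)] unfolding N.socle_exact_kernel_iff by blast
    then show "v \<in> aug_span A (tensor_mod A M N)"
      using S.kernel_part_exact[OF mr(2)] v by simp
  qed
qed

end

section \<open>The universe is closed under tensor products\<close>

text \<open>
  An infinite set is in bijection with its square, so a finite set of pairs is coded by the length of a list
  of its elements together with an iterated pair.
\<close>

lemma formal_sums_injection:
  "\<exists>f :: (('u::infinite \<times> 'u) \<Rightarrow>\<^sub>0 bit) \<Rightarrow> 'u. inj f"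
proof -
  have "|UNIV \<times> UNIV :: ('u \<times> 'u) set| =o |UNIV :: 'u set|"
    by (rule card_of_Times_same_infinite) (rule infinite_UNIV)
  then obtain e :: "'u \<times> 'u \<Rightarrow> 'u" where "bij_betw e (UNIV \<times> UNIV) UNIV"
    by (auto simp: card_of_ordIso[symmetric])
  then have e: "inj e" by (simp add: bij_betw_def)
  obtain \<nu> :: "nat \<Rightarrow> 'u" where \<nu>: "inj \<nu>"
    using infinite_countable_subset[OF infinite_UNIV] by blast
  define enc :: "('u \<times> 'u) list \<Rightarrow> 'u" where "enc xs = foldr (\<lambda>x c. e (e x, c)) xs undefined" for xs
  have enc: "xs = ys" if "length xs = length ys" "enc xs = enc ys" for xs ys
    using that
  proof (induct xs ys rule: list_induct2)
    case (Cons x xs y ys)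
    then have "e (e x, enc xs) = e (e y, enc ys)" by (simp add: enc_def)
    then have "e x = e y \<and> enc xs = enc ys" using injD[OF e, of "(e x, enc xs)" "(e y, enc ys)"] by simp
    then show ?case using Cons(2) injD[OF e, of x y] by simp
  qed simp
  define f :: "(('u \<times> 'u) \<Rightarrow>\<^sub>0 bit) \<Rightarrow> 'u" where
    "f p = (let xs = SOME xs. set xs = Poly_Mapping.keys p in e (\<nu> (length xs), enc xs))" for p
  have "inj f"
  proof (rule injI)
    fix p q assume eq: "f p = f q"
    let ?l = "\<lambda>p. SOME xs. set xs = Poly_Mapping.keys (p :: ('u \<times> 'u) \<Rightarrow>\<^sub>0 bit)"
    have l: "set (?l p) = Poly_Mapping.keys p" for p
      by (rule someI_ex) (rule finite_list[OF finite_keys])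
    have "(\<nu> (length (?l p)), enc (?l p)) = (\<nu> (length (?l q)), enc (?l q))"
      by (rule injD[OF e]) (use eq in \<open>simp add: f_def Let_def\<close>)
    then have "length (?l p) = length (?l q)" "enc (?l p) = enc (?l q)"
      using injD[OF \<nu>] by auto
    then have "?l p = ?l q" by (rule enc)
    then have k: "Poly_Mapping.keys p = Poly_Mapping.keys q" using l by metis
    show "p = q"
    proof (rule poly_mapping_eqI)
      fix x
      have "Poly_Mapping.lookup p x = 0 \<longleftrightarrow> Poly_Mapping.lookup q x = 0"
        using k by (metis in_keys_iff)
      then show "Poly_Mapping.lookup p x = Poly_Mapping.lookup q x"
        using bit_eq_if_not_zero by metis
    qed
  qed
  then show ?thesis by blast
qed

context conn_hopf
begin

text \<open>
  The choice made by \<open>in_universe\<close> is meaningful because a tensor product has no more elements than the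
  universe.
\<close>

lemma tens_obj:
  fixes M N :: "('a, 'u::infinite) gmod"
  assumes M: "gmodule A M" "stably_unit A M" and N: "gmodule A N" "stably_unit A N"
  shows "gmodule A (tens_obj A M N)" "stably_unit A (tens_obj A M N)"
proof -
  obtain f :: "(('u \<times> 'u) \<Rightarrow>\<^sub>0 bit) \<Rightarrow> 'u" where f: "inj f" using formal_sums_injection by blast
  let ?T = "tensor_mod A M N"
  define i where "i t = f (SOME p. t = tensor_class M N p)" for t
  have rep: "t = tensor_class M N (SOME p. t = tensor_class M N p)" if "t \<in> carrier ?T" for t
    by (rule someI_ex) (use that in \<open>auto simp: tensor_def\<close>)
  have "inj_on i (carrier ?T)"
  proof (rule inj_onI)
    fix s t assume st: "s \<in> carrier ?T" "t \<in> carrier ?T" "i s = i t"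
    then have "(SOME p. s = tensor_class M N p) = (SOME p. t = tensor_class M N p)"
      using injD[OF f] by (simp add: i_def)
    then show "s = t" using rep[OF st(1)] rep[OF st(2)] by simp
  qed
  note I = in_universe[OF gmodule_copy[OF stably_unit_tensor(1)[OF assms] this]]
  show "gmodule A (tens_obj A M N)" unfolding tens_obj_def by (rule I(1))
  show "stably_unit A (tens_obj A M N)"
    unfolding tens_obj_def
    by (rule stably_unit_iso[OF stably_unit_tensor(1)[OF assms] I stably_unit_tensor(2)[OF assms]])
qed

end

section \<open>The structure of \<open>A\<close> over \<open>B\<close>\<close>

lemma sub_hopf_simps [simp]:
  "carrier (sub_hopf A B) = B" "homog (sub_hopf A B) n = homog A n \<inter> B" "\<zero>\<^bsub>sub_hopf A B\<^esub> = \<zero>\<^bsub>A\<^esub>"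
  "\<one>\<^bsub>sub_hopf A B\<^esub> = \<one>\<^bsub>A\<^esub>" "x \<oplus>\<^bsub>sub_hopf A B\<^esub> y = x \<oplus>\<^bsub>A\<^esub> y" "x \<otimes>\<^bsub>sub_hopf A B\<^esub> y = x \<otimes>\<^bsub>A\<^esub> y"
  "counit (sub_hopf A B) = counit A"
  by (simp_all add: sub_hopf_def sub_graded_def)

lemma sub_graded_simps [simp]:
  "carrier (sub_graded A B) = B" "homog (sub_graded A B) n = homog A n \<inter> B" "\<zero>\<^bsub>sub_graded A B\<^esub> = \<zero>\<^bsub>A\<^esub>"
  "x \<oplus>\<^bsub>sub_graded A B\<^esub> y = x \<oplus>\<^bsub>A\<^esub> y"
  by (simp_all add: sub_graded_def)

locale exterior_extension = conn_hopf A for A :: "'a hopf" (structure) +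
  fixes B :: "'a set" and \<tau> :: "'a set \<Rightarrow> bit" and d :: int
  assumes normal: "normal_hopf_subalgebra B A"
    and exterior: "exterior_on (dual_algebra (quot_hopf A B)) \<tau>"
    and \<tau>_degree: "\<tau> \<in> homog (dual_algebra (quot_hopf A B)) d" and d: "d \<ge> 1"
begin

abbreviation "H \<equiv> sub_hopf A B"
abbreviation "Q \<equiv> quot_hopf A B"
abbreviation "L \<equiv> left_aug A B"
abbreviation "qm \<equiv> quot_map A B"

lemma B_subset: "B \<subseteq> carrier A"
  using normal subringE(1) unfolding normal_hopf_subalgebra_def hopf_subalgebra_def by blast

lemma B_closed: "b \<in> B \<Longrightarrow> b \<in> carrier A" using B_subset by blast

lemma conn_H: "conn_hopf H"
proof (intro conn_hopf.intro conn_hopf_axioms.intro)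
  show h: "hopf_algebra H"
    using normal unfolding normal_hopf_subalgebra_def hopf_subalgebra_def by blast
  interpret H: hopf_algebra H by (rule h)
  show "connected_hopf H"
    using connected H.one_closed H.zero_closed by (auto simp: connected_hopf_def)
  have "generate (add_monoid H) B = B"
  proof
    show "generate (add_monoid H) B \<subseteq> B"
      using group.generate_incl[OF H.a_group, of B] by simp
    show "B \<subseteq> generate (add_monoid H) B" by (auto intro: generate.incl)
  qed
  then show "finite_dimensional H"
    unfolding finite_dimensional_def
    using finite_subset[OF B_subset finite_carrier] by (intro exI[of _ B]) simp
qed

sublocale H: conn_hopf H by (rule conn_H)

lemma aug_H: "b \<in> aug_ideal H \<longleftrightarrow> b \<in> B \<and> counit A b = 0"
  by (simp add: aug_ideal_def)

lemma aug_H_A: "b \<in> aug_ideal H \<Longrightarrow> b \<in> aug_ideal A"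
  using B_closed by (simp add: aug_ideal_def)

lemma left_right: "L = right_aug A B"
  using normal by (simp add: normal_hopf_subalgebra_def)

lemma generate_induct [consumes 1, case_names zero base add]:
  assumes "l \<in> generate (add_monoid A) S" "S \<subseteq> carrier A" "P \<zero>" "\<And>s. s \<in> S \<Longrightarrow> P s"
    "\<And>x y. x \<in> carrier A \<Longrightarrow> y \<in> carrier A \<Longrightarrow> P x \<Longrightarrow> P y \<Longrightarrow> P (x \<oplus> y)"
  shows "P l"
proof -
  have "l \<in> carrier A \<and> P l" using assms(1)
  proof (induct rule: generate.induct)
    case (inv h)
    then have hc: "h \<in> carrier A" using assms(2) by blast
    have "inv\<^bsub>add_monoid A\<^esub> h = h" using uminus_self[OF hc] by (simp add: a_inv_def)
    then show ?case using assms(4)[OF inv] hc by simp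
  qed (use assms in auto)
  then show ?thesis by simp
qed

lemma L_subspace: "bool_subspace A L"
proof (rule subgroup_imp_bool_subspace)
  have "{a \<otimes> b |a b. a \<in> carrier A \<and> b \<in> aug_ideal H} \<subseteq> carrier (add_monoid A)"
    using aug_closed aug_H_A by auto
  then show "subgroup L (add_monoid A)"
    unfolding left_aug_def by (rule group.generate_is_subgroup[OF a_group])
qed

lemma L_induct_left [consumes 1, case_names zero mult add]:
  assumes "l \<in> L" "P \<zero>" "\<And>a b. a \<in> carrier A \<Longrightarrow> b \<in> aug_ideal H \<Longrightarrow> P (a \<otimes> b)"
    "\<And>x y. x \<in> carrier A \<Longrightarrow> y \<in> carrier A \<Longrightarrow> P x \<Longrightarrow> P y \<Longrightarrow> P (x \<oplus> y)"
  shows "P l"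
  using assms(1)[unfolded left_aug_def]
  by (rule generate_induct) (use assms aug_closed aug_H_A in auto)

lemma L_induct_right [consumes 1, case_names zero mult add]:
  assumes "l \<in> L" "P \<zero>" "\<And>a b. a \<in> carrier A \<Longrightarrow> b \<in> aug_ideal H \<Longrightarrow> P (b \<otimes> a)"
    "\<And>x y. x \<in> carrier A \<Longrightarrow> y \<in> carrier A \<Longrightarrow> P x \<Longrightarrow> P y \<Longrightarrow> P (x \<oplus> y)"
  shows "P l"
  using assms(1)[unfolded left_right right_aug_def]
  by (rule generate_induct) (use assms aug_closed aug_H_A in auto)

lemma L_left_mem: "a \<in> carrier A \<Longrightarrow> b \<in> aug_ideal H \<Longrightarrow> a \<otimes> b \<in> L"
  unfolding left_aug_def by (rule generate.incl) auto

lemma L_right_mem: "a \<in> carrier A \<Longrightarrow> b \<in> aug_ideal H \<Longrightarrow> b \<otimes> a \<in> L"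
  unfolding left_right right_aug_def by (rule generate.incl) auto

lemma L_closed: "l \<in> L \<Longrightarrow> l \<in> carrier A" and L_zero: "\<zero> \<in> L"
  and L_add: "l \<in> L \<Longrightarrow> l' \<in> L \<Longrightarrow> l \<oplus> l' \<in> L"
  using L_subspace by (auto simp: bool_subspace_def)

lemma L_mult_left: "l \<in> L \<Longrightarrow> c \<in> carrier A \<Longrightarrow> c \<otimes> l \<in> L"
proof (induct rule: L_induct_left)
  case (mult a b)
  then have "c \<otimes> (a \<otimes> b) = (c \<otimes> a) \<otimes> b" using aug_closed aug_H_A by (simp add: m_assoc)
  then show ?case using mult L_left_mem by simp
qed (simp_all add: L_zero r_distr L_add)

lemma L_mult_right: "l \<in> L \<Longrightarrow> c \<in> carrier A \<Longrightarrow> l \<otimes> c \<in> L"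
proof (induct rule: L_induct_right)
  case (mult a b)
  then have "(b \<otimes> a) \<otimes> c = b \<otimes> (a \<otimes> c)" using aug_closed aug_H_A by (simp add: m_assoc)
  then show ?case using mult L_right_mem by simp
qed (simp_all add: L_zero l_distr L_add)

lemma counit_L: "l \<in> L \<Longrightarrow> counit A l = 0"
proof (induct rule: L_induct_left)
  case (mult a b)
  then show ?case using aug_closed aug_H_A[of b] by (simp add: counit_mult aug_ideal_iff)
qed (simp_all add: counit_add)

subsection \<open>Functionals on the quotient\<close>

lemma abelian_L: "abelian_subgroup L A"
proof (rule abelian_subgroupI3)
  show "additive_subgroup L A"
    using bool_subspace_imp_subgroup[OF L_subspace] by (simp add: additive_subgroup_def)
  show "abelian_group A" by (rule is_abelian_group)
qed

lemma qm_eq_iff: "a \<in> carrier A \<Longrightarrow> b \<in> carrier A \<Longrightarrow> qm a = qm b \<longleftrightarrow> a \<oplus> b \<in> L"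
proof -
  interpret L: abelian_subgroup L A by (rule abelian_L)
  assume ab: "a \<in> carrier A" "b \<in> carrier A"
  show ?thesis
  proof
    assume "qm a = qm b"
    then have "a \<in> L +> b" using L.a_rcos_self[OF ab(1)] by (simp add: quot_map_def)
    then obtain l where "l \<in> L" "a = l \<oplus> b" by (auto simp: a_r_coset_def')
    then show "a \<oplus> b \<in> L" using ab L_closed by (metis add_self a_assoc r_zero)
  next
    assume l: "a \<oplus> b \<in> L"
    have sub: "L +> u \<subseteq> L +> v" if uv: "u \<in> carrier A" "v \<in> carrier A" "u \<oplus> v \<in> L" for u v
    proof
      fix y assume "y \<in> L +> u"
      then obtain h where h: "h \<in> L" "y = h \<oplus> u" by (auto simp: a_r_coset_def')
      have "y = (h \<oplus> (u \<oplus> v)) \<oplus> v" using h L_closed uv(1,2) by (simp add: a_assoc add_self)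
      then show "y \<in> L +> v" using L_add[OF h(1) uv(3)] by (auto simp: a_r_coset_def')
    qed
    have "b \<oplus> a \<in> L" using l ab by (simp add: a_comm)
    then show "qm a = qm b" using sub[OF ab l] sub[OF ab(2,1)] unfolding quot_map_def by blast
  qed
qed

lemma Q_carrier: "carrier Q = qm ` carrier A"
  by (auto simp: quot_hopf_def quot_graded_def graded.extend_def hopf.fields_def ring.extend_def
      graded.fields_def FactRing_def A_RCOSETS_def' quot_map_def)

lemma Q_add: "a \<in> carrier A \<Longrightarrow> b \<in> carrier A \<Longrightarrow> qm a \<oplus>\<^bsub>Q\<^esub> qm b = qm (a \<oplus> b)"
  using abelian_subgroup.a_rcos_sum[OF abelian_L]
  by (simp add: quot_hopf_def quot_graded_def graded.extend_def hopf.fields_def ring.extend_def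
      graded.fields_def FactRing_def quot_map_def)

lemma Q_counit: "a \<in> carrier A \<Longrightarrow> counit Q (qm a) = counit A a"
proof -
  assume a: "a \<in> carrier A"
  have "counit A ` (L +> a) = {counit A a}"
  proof
    show "counit A ` (L +> a) \<subseteq> {counit A a}"
      using a counit_L L_closed by (auto simp: a_r_coset_def' counit_add)
    show "{counit A a} \<subseteq> counit A ` (L +> a)"
      using abelian_subgroup.a_rcos_self[OF abelian_L a] by blast
  qed
  then show ?thesis
    by (simp add: quot_hopf_def quot_graded_def graded.extend_def hopf.fields_def ring.extend_def
      graded.fields_def FactRing_def quot_map_def)
qed

lemma Q_homog: "homog Q n = qm ` homog A n"
  by (simp add: quot_hopf_def quot_graded_def graded.extend_def hopf.fields_def ring.extend_def
      graded.fields_def FactRing_def)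

definition tt :: "'a \<Rightarrow> bit" where "tt a = \<tau> (qm a)"

lemma tt_add: "a \<in> carrier A \<Longrightarrow> b \<in> carrier A \<Longrightarrow> tt (a \<oplus> b) = tt a + tt b"
proof -
  assume ab: "a \<in> carrier A" "b \<in> carrier A"
  have "\<tau> \<in> linear_maps Q F2" using \<tau>_degree by (simp add: dual_algebra_def)
  then have "\<tau> (qm a \<oplus>\<^bsub>Q\<^esub> qm b) = \<tau> (qm a) + \<tau> (qm b)"
    using ab linear_maps_add[of \<tau> Q F2 "qm a" "qm b"] by (simp add: Q_carrier)
  then show ?thesis using ab by (simp add: tt_def Q_add)
qed

lemma tt_linear: "tt \<in> linear_maps A F2"
  by (simp add: linear_maps_iff tt_add)

lemma tt_zero [simp]: "tt \<zero> = 0"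
  using tt_add[of \<zero> \<zero>] by simp

lemma tt_homog: "a \<in> homog A m \<Longrightarrow> m \<noteq> d \<Longrightarrow> tt a = 0"
  using \<tau>_degree by (auto simp: dual_algebra_def tt_def Q_homog)

lemma tt_L: "l \<in> L \<Longrightarrow> tt l = 0"
proof -
  assume l: "l \<in> L"
  then have "qm l = qm \<zero>" using qm_eq_iff L_closed by simp
  then show ?thesis using tt_zero unfolding tt_def by simp
qed

text \<open>
  A functional separating \<open>l\<close> from \<open>L\<close> would be an element of the dual of the quotient, but that dual is
  spanned by the counit and \<open>\<tau>\<close>.
\<close>

lemma L_iff: "l \<in> L \<longleftrightarrow> l \<in> carrier A \<and> counit A l = 0 \<and> tt l = 0"
proof (intro iffI conjI)
  assume l: "l \<in> carrier A \<and> counit A l = 0 \<and> tt l = 0"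
  show "l \<in> L"
  proof (rule ccontr)
    assume "l \<notin> L"
    from separating_functional[OF L_subspace _ this] l
    obtain g :: "'a \<Rightarrow> bit" where g: "\<And>v w. v \<in> carrier A \<Longrightarrow> w \<in> carrier A \<Longrightarrow> g (v \<oplus> w) = g v + g w"
      "\<And>w. w \<in> L \<Longrightarrow> g w = 0" "g l = 1" by blast
    define f where "f S = (if S \<in> carrier Q then g (SOME a. a \<in> carrier A \<and> qm a = S) else 0)" for S
    have fq: "f (qm a) = g a" if a: "a \<in> carrier A" for a
    proof -
      define a' where "a' = (SOME a'. a' \<in> carrier A \<and> qm a' = qm a)"
      have "a' \<in> carrier A \<and> qm a' = qm a"
        unfolding a'_def by (rule someI[of "\<lambda>a'. a' \<in> carrier A \<and> qm a' = qm a" a]) (use a in simp)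
      then have a': "a' \<in> carrier A" "a' \<oplus> a \<in> L" using qm_eq_iff a by auto
      then have "g a' + g a = 0" using g a by metis
      moreover have "f (qm a) = g a'" using a by (simp add: f_def a'_def Q_carrier)
      ultimately show ?thesis by (cases "g a"; cases "g a'") auto
    qed
    have "f \<in> linear_maps Q F2"
      using fq g(1) by (auto simp: linear_maps_iff Q_carrier Q_add)
    then have "f \<in> carrier (dual_algebra Q)" by (simp add: dual_algebra_def f_def)
    then have "f \<in> {\<zero>\<^bsub>dual_algebra Q\<^esub>, \<one>\<^bsub>dual_algebra Q\<^esub>, \<tau>, \<one>\<^bsub>dual_algebra Q\<^esub> \<oplus>\<^bsub>dual_algebra Q\<^esub> \<tau>}"
      using exterior unfolding exterior_on_def by blast
    moreover have "\<zero>\<^bsub>dual_algebra Q\<^esub> (qm l) = 0" "\<one>\<^bsub>dual_algebra Q\<^esub> (qm l) = 0" "\<tau> (qm l) = 0"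
      "(\<one>\<^bsub>dual_algebra Q\<^esub> \<oplus>\<^bsub>dual_algebra Q\<^esub> \<tau>) (qm l) = 0"
      using l by (simp_all add: dual_algebra_def Q_counit tt_def)
    ultimately have "f (qm l) = 0" by auto
    then show False using fq l g(3) by simp
  qed
qed (use L_closed counit_L tt_L in auto)

lemma ex_x: "\<exists>x\<in>homog A d. tt x = 1"
proof -
  have "\<tau> \<noteq> \<zero>\<^bsub>dual_algebra Q\<^esub>" using exterior by (auto simp: exterior_on_def)
  then have "\<tau> \<noteq> (\<lambda>_. 0)" by (simp add: dual_algebra_def)
  then obtain S where "\<tau> S \<noteq> 0" by (metis ext)
  moreover have "S \<notin> carrier Q \<longrightarrow> \<tau> S = 0" using \<tau>_degree by (simp add: dual_algebra_def)
  ultimately obtain a where a: "a \<in> carrier A" "tt a \<noteq> 0" by (auto simp: Q_carrier tt_def)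
  have "tt a = tt (component A d a)" using a(1)
  proof (induct rule: graded_induct)
    case (homog n x)
    then show ?case using tt_homog[of x n] comp_of_homog[of x n d] by auto
  qed (simp_all add: tt_add comp_add)
  then show ?thesis using a comp_homog[OF a(1), of d] bit_eq_if_not_zero by metis
qed

text \<open>
  A lift of the element of the quotient dual to \<open>\<tau>\<close>.
\<close>

definition x where "x = (SOME x. x \<in> homog A d \<and> tt x = 1)"

lemma x_homog: "x \<in> homog A d" and tt_x [simp]: "tt x = 1"
proof -
  have "x \<in> homog A d \<and> tt x = 1" unfolding x_def by (rule someI_ex) (use ex_x in blast)
  then show "x \<in> homog A d" "tt x = 1" by auto
qed

lemma x_closed [simp]: "x \<in> carrier A" using x_homog homog_closed by blast

lemma counit_x [simp]: "counit A x = 0" using counit_homog[OF x_homog] d by simp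

lemma tt_one [simp]: "tt \<one> = 0" using tt_homog[OF one_homog] d by simp

lemma xx_L: "x \<otimes> x \<in> L"
  using tt_homog[OF mult_homog[OF x_homog x_homog]] d counit_mult[of x x] by (simp add: L_iff)

lemma decompose: "a \<in> carrier A \<Longrightarrow> \<exists>l\<in>L. a = scale2 A (counit A a) \<one> \<oplus> (scale2 A (tt a) x \<oplus> l)"
proof -
  assume a: "a \<in> carrier A"
  let ?u = "scale2 A (counit A a) \<one>" and ?v = "scale2 A (tt a) x"
  have uv: "?u \<in> carrier A" "?v \<in> carrier A" by simp_all
  have "counit A ?u = counit A a" "counit A ?v = 0" "tt ?u = 0" "tt ?v = tt a"
    by (cases "counit A a"; cases "tt a"; simp)+
  then have "?v \<oplus> (?u \<oplus> a) \<in> L" using a uv by (simp add: L_iff counit_add tt_add)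
  moreover have "a = ?u \<oplus> (?v \<oplus> (?v \<oplus> (?u \<oplus> a)))" using a uv by (simp add: add_cancel_left)
  ultimately show ?thesis by blast
qed

lemma decompose_induct:
  assumes "a \<in> carrier A" "P \<zero>" "P \<one>" "P x" "\<And>l. l \<in> L \<Longrightarrow> P l"
    "\<And>u v. u \<in> carrier A \<Longrightarrow> v \<in> carrier A \<Longrightarrow> P u \<Longrightarrow> P v \<Longrightarrow> P (u \<oplus> v)"
  shows "P a"
proof -
  obtain l where l: "l \<in> L" "a = scale2 A (counit A a) \<one> \<oplus> (scale2 A (tt a) x \<oplus> l)"
    using decompose[OF assms(1)] by blast
  have "P (scale2 A (counit A a) \<one>)" "P (scale2 A (tt a) x)" using assms by (simp_all add: scale2_def)
  then have "P (scale2 A (counit A a) \<one> \<oplus> (scale2 A (tt a) x \<oplus> l))"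
    using assms(5)[OF l(1)] L_closed[OF l(1)] by (intro assms(6)) simp_all
  then show ?thesis using l(2) by simp
qed

text \<open>
  The functional \<open>\<tau>\<close> is primitive: the quotient has the basis \<open>1\<close>, \<open>x\<close>, and \<open>x\<^sup>2 = 0\<close> there for degree reasons.
\<close>

lemma tt_mult:
  assumes a: "a \<in> carrier A" and b: "b \<in> carrier A"
  shows "tt (a \<otimes> b) = tt a * counit A b + counit A a * tt b"
  using a
proof (rule decompose_induct[where P = "\<lambda>a. tt (a \<otimes> b) = tt a * counit A b + counit A a * tt b"])
  show "tt (l \<otimes> b) = tt l * counit A b + counit A l * tt b" if "l \<in> L" for l
    using that L_mult_right[OF that b] tt_L counit_L by simp
  show "tt (x \<otimes> b) = tt x * counit A b + counit A x * tt b"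
    using b
  proof (rule decompose_induct[where P = "\<lambda>b. tt (x \<otimes> b) = tt x * counit A b + counit A x * tt b"])
    show "tt (x \<otimes> l) = tt x * counit A l + counit A x * tt l" if "l \<in> L" for l
      using that L_mult_left[OF that x_closed] tt_L counit_L by simp
    show "tt (x \<otimes> x) = tt x * counit A x + counit A x * tt x" using xx_L tt_L by simp
  qed (simp_all add: r_distr tt_add counit_add)
qed (use b in \<open>simp_all add: l_distr tt_add counit_add algebra_simps\<close>)

lemma tt_B: "b \<in> B \<Longrightarrow> tt b = 0"
proof -
  assume b: "b \<in> B"
  let ?c = "b \<oplus> scale2 A (counit A b) \<one>"
  have bc: "b \<in> carrier A" using B_closed b .
  have "scale2 A (counit A b) \<one> \<in> B" using H.one_closed H.zero_closed by (simp add: scale2_def)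
  then have "?c \<in> B" using H.a_closed[of b "scale2 A (counit A b) \<one>"] b by simp
  moreover have "counit A ?c = 0" using bc by (cases "counit A b") (simp_all add: counit_add)
  ultimately have "\<one> \<otimes> ?c \<in> L" by (intro L_left_mem) (simp_all add: aug_H)
  then have "tt ?c = 0" using tt_L bc by simp
  moreover have "tt (scale2 A (counit A b) \<one>) = 0" by (simp add: scale2_def)
  ultimately show ?thesis using bc by (simp add: tt_add)
qed

subsection \<open>The derivation dual to \<open>\<tau>\<close>\<close>

text \<open>
  The functional \<open>\<tau>\<close> acts on \<open>A\<close> through the coproduct, \<open>D(a) = \<Sum> \<tau>(a') a''\<close>.  As \<open>\<tau>\<close> is primitive,
  \<open>D\<close> is a derivation; it vanishes on \<open>B\<close> and sends \<open>x\<close> to \<open>1\<close>, so it picks out the coefficient of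
  \<open>x\<close> and shows that \<open>A = B \<oplus> Bx\<close> is free over \<open>B\<close>.
\<close>

definition D :: "'a \<Rightarrow> 'a" where "D a = lslice A tt (coprod A a)"

lemma D_linear: "D \<in> linear_maps A A"
  by (simp add: linear_maps_iff D_def coprod_add lslice_closed[OF tt_linear] lslice_add[OF tt_linear])

lemmas D_closed [simp] = linear_maps_closed[OF D_linear]
  and D_add = linear_maps_add[OF D_linear]

lemma D_zero [simp]: "D \<zero> = \<zero>"
  by (rule linear_maps_zero[OF boolean_group_axioms boolean_group_axioms D_linear])

lemma counit_D: "a \<in> carrier A \<Longrightarrow> counit A (D a) = tt a"
  by (simp add: D_def counit_lslice[OF tt_linear] rslice_counit)

lemma D_mult:
  assumes a: "a \<in> carrier A" and b: "b \<in> carrier A"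
  shows "D (a \<otimes> b) = D a \<otimes> b \<oplus> a \<otimes> D b"
proof -
  note S = lslice_tens[OF tt_linear] lslice_tens[OF counit_linear] lslice_add[OF tt_linear] lslice_add[OF counit_linear]
    lslice_closed[OF tt_linear] lslice_closed[OF counit_linear] lslice_zero[OF tt_linear] lslice_zero[OF counit_linear]
  have key: "lslice A tt (s \<otimes>\<^bsub>A2\<^esub> t) =
      lslice A tt s \<otimes> lslice A (counit A) t \<oplus> lslice A (counit A) s \<otimes> lslice A tt t"
    if s: "s \<in> carrier A2" and t: "t \<in> carrier A2" for s t
    using s
  proof (induct rule: AA.tensor_induct)
    case (tens v w)
    note vw = tens
    show ?case using t
    proof (induct rule: AA.tensor_induct)
      case (tens v' w')
      then show ?case using vw
        by (cases "tt v"; cases "tt v'"; cases "counit A v"; cases "counit A v'")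
          (simp_all add: tensor_mult_tens S tt_mult add_self)
    next
      case (add u u')
      then show ?case using vw
        by (simp add: tensor_mult_add_right tensor_mult_closed AA.tens_closed S r_distr a_ac)
    qed (use vw in \<open>simp add: S AA.tens_closed\<close>)
  next
    case (add u u')
    then show ?case using t
      by (simp add: tensor_mult_add_left tensor_mult_closed S l_distr a_ac)
  qed (use t in \<open>simp add: S\<close>)
  show ?thesis
    using key[OF coprod_closed[OF a] coprod_closed[OF b]] a b
    by (simp add: D_def coprod_mult lslice_counit)
qed

lemma D_homog: "a \<in> homog A n \<Longrightarrow> D a \<in> homog A (n - d)"
proof -
  have "lslice A tt t \<in> homog A (n - d)" if "t \<in> homog A2 n" for t using that
  proof (induct rule: AA.homog_tensor_induct)
    case (tens i v w)
    then show ?case using tt_homog[OF tens(1)] homog_closed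
      by (cases "i = d") (auto simp: lslice_tens[OF tt_linear] scale2_def)
  qed (simp_all add: lslice_zero[OF tt_linear] lslice_add[OF tt_linear] A2.homog_closed homog_add)
  then show "a \<in> homog A n \<Longrightarrow> D a \<in> homog A (n - d)" using coprod_homog by (simp add: D_def)
qed

lemma D_x [simp]: "D x = \<one>"
  using D_homog[OF x_homog] homog_0 counit_D[OF x_closed] by auto

text \<open>
  The coproduct of an element of \<open>B\<close> lies in \<open>B \<otimes> B\<close>, where \<open>\<tau>\<close> vanishes.
\<close>

lemma D_B: "b \<in> B \<Longrightarrow> D b = \<zero>"
proof -
  let ?S = "sub_graded A B"
  have "abelian_group ?S"
  proof (rule abelian_groupI)
    fix u assume "u \<in> carrier ?S"
    then show "\<exists>v\<in>carrier ?S. v \<oplus>\<^bsub>?S\<^esub> u = \<zero>\<^bsub>?S\<^esub>"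
      using B_closed by (intro bexI[of _ u]) (auto simp: add_self)
  qed (use B_closed H.a_closed H.zero_closed in \<open>auto simp: a_ac\<close>)
  then have S: "boolean_group ?S"
    by (intro boolean_group.intro boolean_group_axioms.intro) (auto simp: add_self B_closed)
  then interpret S: tensor_spaces ?S ?S by (simp add: tensor_spaces_def)
  have b2: "bilin ?S ?S A2 (\<lambda>v w. tens A A (id v) (id w))"
    by (intro bilinI) (auto simp: B_closed AA.tens_closed AA.tens_add_left AA.tens_add_right)
  note M = S.lift_linear[OF AA.T_boolean b2]
  have "lslice A tt (tensor_map A A id id t) = \<zero>" if "t \<in> carrier S.T" for t
    using that unfolding tensor_map_def
  proof (induct rule: S.tensor_induct)
    case zero
    then show ?case
      using linear_maps_zero[OF S.T_boolean AA.T_boolean M] by (simp add: lslice_zero[OF tt_linear])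
  next
    case (tens v w)
    have "tensor_lift A2 (\<lambda>v w. tens A A (id v) (id w)) (tens ?S ?S v w) = tens A A (id v) (id w)"
      by (rule S.lift_tens[OF AA.T_boolean b2 tens])
    then show ?case using tens by (simp add: lslice_tens[OF tt_linear] B_closed tt_B)
  next
    case (add t t')
    then show ?case
      using linear_maps_add[OF M add(1,2)] linear_maps_closed[OF M add(1)] linear_maps_closed[OF M add(2)]
      by (simp add: lslice_add[OF tt_linear])
  qed
  moreover assume "b \<in> B"
  then have "coprod A b \<in> tensor_map A A id id ` carrier S.T"
    using normal unfolding normal_hopf_subalgebra_def hopf_subalgebra_def by blast
  ultimately show "D b = \<zero>" by (auto simp: D_def)
qed

lemma gmodule_H:
  assumes "gmodule A M"
  shows "gmodule H M"
proof -
  interpret M: gmodule A M by fact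
  show ?thesis
    by (intro gmodule.intro gmodule_axioms.intro M.graded_space_axioms)
      (auto simp: M.act_closed M.act_add_left M.act_add_right M.act_mult M.act_one M.act_homog
        M.bounded_below B_closed)
qed

text \<open>
  Normality writes the ideal \<open>L\<close> as \<open>I(B) A\<close>, so by Nakayama's lemma over \<open>B\<close> the left \<open>B\<close>-module \<open>A\<close> is
  generated by \<open>1\<close> and \<open>x\<close>; and \<open>D\<close> reads off the coefficient of \<open>x\<close>.
\<close>

lemma A_decomposition:
  assumes "a \<in> carrier A"
  shows "D a \<in> B" "a \<oplus> D a \<otimes> x \<in> B"
proof -
  define W where "W = {a \<in> carrier A. D a \<in> B \<and> a \<oplus> D a \<otimes> x \<in> B}"
  let ?R = "shifted_algebra A 0"
  have R [simp]: "carrier ?R = carrier A" "\<zero>\<^bsub>?R\<^esub> = \<zero>" "u \<oplus>\<^bsub>?R\<^esub> v = u \<oplus> v" "homog ?R n = homog A n"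
    "act ?R c u = c \<otimes> u" for u v n c
    by (simp_all add: shifted_algebra_def)
  interpret R: hopf_module H ?R
    by (simp add: hopf_module_def H.conn_hopf_axioms gmodule_H gmodule_shifted_algebra)
  have ac: "u \<oplus> v \<in> B" "u \<otimes> v \<in> B" if "u \<in> B" "v \<in> B" for u v
    using H.a_closed[of u v] H.m_closed[of u v] that by simp_all
  have W_add: "u \<oplus> v \<in> W" if uv: "u \<in> W" "v \<in> W" for u v
  proof -
    have c: "u \<in> carrier A" "v \<in> carrier A" using uv by (auto simp: W_def)
    have "(u \<oplus> v) \<oplus> D (u \<oplus> v) \<otimes> x = (u \<oplus> D u \<otimes> x) \<oplus> (v \<oplus> D v \<otimes> x)"
      using c by (simp add: D_add l_distr a_ac)
    then show ?thesis using uv c ac by (simp add: W_def D_add)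
  qed
  have W_mult: "c \<otimes> y \<in> W" if c: "c \<in> B" and y: "y \<in> {\<one>, x}" for c y
  proof -
    have cc: "c \<in> carrier A" using B_closed c .
    have D1: "D \<one> = \<zero>" using D_B H.one_closed by simp
    have "D (c \<otimes> y) = c \<otimes> D y" using cc y by (auto simp: D_mult D_B[OF c] D1)
    then show ?thesis using y cc c D1 H.zero_closed by (auto simp: W_def add_self)
  qed
  have "carrier ?R \<subseteq> generated H ?R {\<one>, x}"
  proof (rule R.nakayama)
    show "\<And>y. y \<in> {\<one>, x} \<Longrightarrow> \<exists>n. y \<in> homog ?R n" using one_homog x_homog by auto
    fix n v assume "v \<in> homog ?R n"
    then have v: "v \<in> carrier A" using homog_closed by simp
    obtain l where l: "l \<in> L" "v = scale2 A (counit A v) \<one> \<oplus> (scale2 A (tt v) x \<oplus> l)"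
      using decompose[OF v] by blast
    have gc: "{\<one>, x} \<subseteq> carrier ?R" by simp
    have g: "scale2 A e y \<in> generated H ?R {\<one>, x}" if "y \<in> {\<one>, x}" for e y
      using R.generated_base[OF gc that] generated.zero[of ?R H] by (simp add: scale2_def)
    have "l \<in> aug_span H ?R" using l(1)
    proof (induct rule: L_induct_right)
      case (mult a b)
      then show ?case using R.aug_span_act1[of b a] by simp
    next
      case (add u v)
      then show ?case using R.aug_span_add[of v u] by simp
    qed (use aug_span.zero[of ?R H] in simp)
    moreover have "v = (scale2 A (counit A v) \<one> \<oplus> scale2 A (tt v) x) \<oplus>\<^bsub>?R\<^esub> l"
      using l(2) L_closed[OF l(1)] by (simp add: a_assoc)
    moreover have "scale2 A (counit A v) \<one> \<oplus> scale2 A (tt v) x \<in> generated H ?R {\<one>, x}"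
      using R.generated_add[OF gc g g, of x \<one>] by simp
    ultimately show "\<exists>t\<in>generated H ?R {\<one>, x}. \<exists>s\<in>aug_span H ?R. v = t \<oplus>\<^bsub>?R\<^esub> s" by blast
  qed simp
  moreover have "g \<in> W" if "g \<in> generated H ?R {\<one>, x}" for g using that
  proof (induct rule: generated.induct)
    case zero
    show ?case using H.zero_closed by (simp add: W_def)
  next
    case (step s a y)
    then show ?case using W_add W_mult[of a y] by simp
  qed
  ultimately have "a \<in> W" using assms by auto
  then show "D a \<in> B" "a \<oplus> D a \<otimes> x \<in> B" by (auto simp: W_def)
qed

lemma A_split:
  assumes "a \<in> carrier A"
  obtains b b' where "b \<in> B" "b' \<in> B" "a = b \<oplus> b' \<otimes> x" "b' = D a"
proof -
  have "a = (a \<oplus> D a \<otimes> x) \<oplus> D a \<otimes> x" using assms by (simp add: a_assoc add_self)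
  from that[OF A_decomposition(2)[OF assms] A_decomposition(1)[OF assms] this refl] show thesis .
qed

lemma D_split: "b \<in> B \<Longrightarrow> b' \<in> B \<Longrightarrow> D (b \<oplus> b' \<otimes> x) = b'"
  by (simp add: B_closed D_add D_mult D_B)

abbreviation "topB \<equiv> top_degree H"
abbreviation "lamB \<equiv> H.lam"

lemma lamB_facts: "lamB \<in> B" "lamB \<in> carrier A" "lamB \<in> homog A topB" "lamB \<noteq> \<zero>"
  using H.lam_homog H.lam_nonzero B_closed by auto

lemma above_top_A: "m > topB + d \<Longrightarrow> homog A m = {\<zero>}"
proof -
  assume m: "m > topB + d"
  have "a = \<zero>" if a: "a \<in> homog A m" for a
  proof -
    have ac: "a \<in> carrier A" using homog_closed[OF a] .
    have "D a \<in> homog H (m - d)" using D_homog[OF a] A_decomposition(1)[OF ac] by simp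
    then have Da: "D a = \<zero>" using H.above_top[of "m - d"] m by auto
    then have "a \<in> homog H m" using A_decomposition(2)[OF ac] a ac by simp
    then show ?thesis using H.above_top[of m] m d by auto
  qed
  then show ?thesis using homog_zero by blast
qed

lemma lamB_x: "lamB \<otimes> x \<noteq> \<zero>" "x \<otimes> lamB \<noteq> \<zero>"
proof -
  have "D (lamB \<otimes> x) = lamB" "D (x \<otimes> lamB) = lamB" using lamB_facts by (simp_all add: D_mult D_B)
  then show "lamB \<otimes> x \<noteq> \<zero>" "x \<otimes> lamB \<noteq> \<zero>" using lamB_facts(4) by auto
qed

lemma top_A: "top_degree A = topB + d"
proof (rule antisym)
  show "top_degree A \<le> topB + d"
  proof (rule ccontr)
    assume "\<not> ?thesis"
    then have "homog A (top_degree A) = {\<zero>}" by (intro above_top_A) simp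
    then show False using lam_homog lam_nonzero by simp
  qed
  have "lamB \<otimes> x \<in> homog A (topB + d)" by (rule mult_homog[OF lamB_facts(3) x_homog])
  show "topB + d \<le> top_degree A"
  proof (rule ccontr)
    assume "\<not> ?thesis"
    then have "homog A (topB + d) = {\<zero>}" by (intro above_top) simp
    then show False using \<open>lamB \<otimes> x \<in> homog A (topB + d)\<close> lamB_x(1) by simp
  qed
qed

text \<open>
  Both products are nonzero, because \<open>D\<close> sends them to \<open>\<lambda>\<^sub>B\<close>, and they live in the top degree of \<open>A\<close>.
\<close>

lemma lam_A: "lam = lamB \<otimes> x" "lam = x \<otimes> lamB"
proof -
  have "lamB \<otimes> x \<in> {\<zero>, lam}" unfolding homog_top[symmetric] top_A by (rule mult_homog[OF lamB_facts(3) x_homog])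
  then show "lam = lamB \<otimes> x" using lamB_x(1) by simp
  have "x \<otimes> lamB \<in> homog A (d + topB)" by (rule mult_homog[OF x_homog lamB_facts(3)])
  then have "x \<otimes> lamB \<in> {\<zero>, lam}" unfolding homog_top[symmetric] top_A by (simp add: add.commute)
  then show "lam = x \<otimes> lamB" using lamB_x(2) by simp
qed

lemma lamB_aug: "b \<in> aug_ideal H \<Longrightarrow> lamB \<otimes> b = \<zero>" "b \<in> aug_ideal H \<Longrightarrow> b \<otimes> lamB = \<zero>"
proof -
  assume b: "b \<in> aug_ideal H"
  show "b \<otimes> lamB = \<zero>" using H.aug_mult_lam[OF b] by simp
  have "lamB \<otimes>\<^bsub>H\<^esub> b = \<zero>\<^bsub>H\<^esub>" using b
  proof (induct rule: H.aug_induct)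
    case zero
    then show ?case using H.r_null[of lamB] lamB_facts by simp
  next
    case (homog m c)
    then show ?case using H.mult_homog[OF H.lam_homog homog(2)] H.above_top[of "topB + m"] by auto
  next
    case (add u v)
    then show ?case using lamB_facts B_closed by (simp add: r_distr)
  qed
  then show "lamB \<otimes> b = \<zero>" by simp
qed

lemma lamB_mult: "b \<in> B \<Longrightarrow> lamB \<otimes> b = scale2 A (counit A b) lamB"
proof -
  assume b: "b \<in> B"
  let ?c = "b \<oplus> scale2 A (counit A b) \<one>"
  have bc: "b \<in> carrier A" using B_closed b .
  have e: "scale2 A (counit A b) \<one> \<in> B" using H.one_closed H.zero_closed by (simp add: scale2_def)
  have "?c \<in> aug_ideal H" using H.a_closed[of b "scale2 A (counit A b) \<one>"] b e bc
    by (cases "counit A b") (simp_all add: aug_H counit_add)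
  then have "lamB \<otimes> ?c = \<zero>" by (rule lamB_aug)
  then have "lamB \<otimes> b \<oplus> lamB \<otimes> scale2 A (counit A b) \<one> = \<zero>" using bc lamB_facts by (simp add: r_distr)
  then have "lamB \<otimes> b = lamB \<otimes> scale2 A (counit A b) \<one>"
    using bc lamB_facts add_eq_zero_iff by simp
  then show ?thesis using lamB_facts by (cases "counit A b") simp_all
qed

text \<open>Freeness over \<open>A\<close> implies freeness over \<open>B\<close>, since \<open>A = B \<oplus> Bx\<close>.\<close>

lemma socle_exact_H:
  assumes M: "gmodule A M" and ex: "socle_exact A M"
  shows "socle_exact H M"
  unfolding socle_exact_def
proof (intro ballI impI)
  interpret M: hopf_module A M using M by (simp add: hopf_module_def conn_hopf_axioms)
  interpret HM: hopf_module H M using gmodule_H[OF M] by (simp add: hopf_module_def H.conn_hopf_axioms)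
  obtain Y \<beta> where F: "free_on A M Y \<beta>" using M.free_if_socle_exact[OF ex] by blast
  fix y assume y: "y \<in> carrier M" "act M lamB y = \<zero>\<^bsub>M\<^esub>"
  note c = coeffs_supp[OF M.free_coeffs[OF F y(1)]]
  have "\<beta> (act M lamB y) = (\<lambda>z. \<zero>)"
    unfolding y(2) using M.free_indep[OF F M.free_coeffs[OF F] M.free_lincomb[OF F]] by simp
  then have lz: "lamB \<otimes> \<beta> y z = \<zero>" for z
    using M.free_coords_act[OF F y(1) lamB_facts(2)] by metis
  have "act M (\<beta> y z) z \<in> aug_span H M" if z: "z \<in> carrier M" for z
  proof -
    obtain b b' where b: "b \<in> B" "b' \<in> B" "\<beta> y z = b \<oplus> b' \<otimes> x" using A_split[OF c(2)] by blast
    have bc: "b \<in> carrier A" "b' \<in> carrier A" using b B_closed by auto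
    have lb: "lamB \<otimes> b = scale2 A (counit A b) lamB" "lamB \<otimes> b' = scale2 A (counit A b') lamB" using lamB_mult b by auto
    have sB: "scale2 A e lamB \<in> B" for e using lamB_facts H.zero_closed by (simp add: scale2_def)
    have "scale2 A (counit A b) lamB \<oplus> scale2 A (counit A b') lamB \<otimes> x = \<zero>"
      using lz[of z] b bc lamB_facts by (simp add: r_distr lb m_assoc[symmetric])
    moreover from this have b'0: "scale2 A (counit A b') lamB = \<zero>"
      using D_split[OF sB sB, of "counit A b" "counit A b'"] by simp
    ultimately have "scale2 A (counit A b) lamB = \<zero>" using lamB_facts by simp
    then have "counit A b = 0" using lamB_facts(4) by (cases "counit A b") simp_all
    moreover have "counit A b' = 0" using b'0 lamB_facts(4) by (cases "counit A b'") simp_all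
    ultimately have "b \<in> aug_ideal H" "b' \<in> aug_ideal H" using b by (simp_all add: aug_H)
    then have "act M b' (act M x z) \<in> aug_span H M" "act M b z \<in> aug_span H M"
      using HM.aug_span_act1 z M.M.act_closed[OF x_closed z] by blast+
    then show ?thesis
      using HM.aug_span_add bc z b(3) by (simp add: M.M.act_add_left M.M.act_mult)
  qed
  then have "lincomb A M (\<lambda>z. z) (\<beta> y) \<in> aug_span H M"
    unfolding lincomb_def
    by (intro M.M.bool_subspace_finsum[OF HM.aug_span_subspace])
      (use c(3) M.free_carrier[OF F] in blast)
  then show "y \<in> aug_span H M" using M.free_lincomb[OF F y(1)] by simp
qed

lemma stably_unit_H:
  assumes M: "gmodule A M" and s: "stably_unit A M"
  shows "stably_unit H M"
proof -
  obtain m r where mr: "unit_summand_module A M m r" "socle_exact A (restrict_mod M (kernel_of M r))"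
    using stably_unitE[OF s M] by blast
  interpret M: unit_summand_module A M m r by fact
  have "invariant H M m" using M.m(2) aug_H_A by (auto simp: invariant_def)
  moreover have "r \<in> mod_hom H M (unit_mod H)"
    by (rule mod_homI)
      (use M.unit_map_add[OF M.r] M.unit_map_act[OF M.r] mod_hom_homog[OF M.r] B_closed in auto)
  ultimately have "unit_summand H M m r" using M.m(1) M.rm by (simp add: unit_summand_def)
  moreover have "socle_exact H (restrict_mod M (kernel_of M r))"
    by (rule socle_exact_H[OF M.gmodule_kernel[OF M.r] mr(2)])
  ultimately show ?thesis unfolding stably_unit_def by blast
qed

end

section \<open>Nilpotence of \<open>\<theta>\<close> in terms of the cobar complex\<close>

lemma zero_coboundary: "(\<lambda>xs. 0) \<in> coboundaries A"
proof -
  have "(\<lambda>xs. 0) \<in> carrier (cobar A)" by (simp add: cobar_def)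
  moreover have "cobar_diff A (\<lambda>xs. 0) = (\<lambda>xs. 0)" by (simp add: cobar_diff_def fun_eq_iff)
  ultimately show ?thesis unfolding coboundaries_def by (metis image_eqI)
qed

lemma mem_coset:
  assumes "\<And>f g. f \<oplus>\<^bsub>R\<^esub> g = (\<lambda>xs. f xs + g xs)"
  shows "f \<in> coboundaries A +>\<^bsub>R\<^esub> f"
  unfolding a_r_coset_def' using zero_coboundary[of A]
  by (auto simp: assms intro!: bexI[of _ "\<lambda>xs. 0"])

context exterior_extension
begin

text \<open>
  The cochain \<open>[\<tau>|\<dots>|\<tau>]\<close>, pulled back to \<open>A\<close>.
\<close>

definition tau_power :: "nat \<Rightarrow> 'a list \<Rightarrow> bit" where
  "tau_power n xs = (if length xs = n \<and> set xs \<subseteq> aug_ideal A then prod_list (map tt xs) else 0)"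

lemma tau_power_mult:
  "(\<Sum>i\<le>length xs. tau_power k (take i xs) * tau_power 1 (drop i xs)) = tau_power (Suc k) xs"
proof (cases "length xs = Suc k \<and> set xs \<subseteq> aug_ideal A")
  case True
  have z: "tau_power k (take i xs) * tau_power 1 (drop i xs) = 0" if "i \<in> {..length xs} - {k}" for i
    using that by (simp add: tau_power_def)
  have "(\<Sum>i\<le>length xs. tau_power k (take i xs) * tau_power 1 (drop i xs)) =
      tau_power k (take k xs) * tau_power 1 (drop k xs)"
    using True sum.mono_neutral_right[of "{..length xs}" "{k}"
        "\<lambda>i. tau_power k (take i xs) * tau_power 1 (drop i xs)"] z by simp
  also have "\<dots> = prod_list (map tt (take k xs)) * prod_list (map tt (drop k xs))"
    using True set_take_subset[of k xs] set_drop_subset[of k xs] by (auto simp: tau_power_def)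
  also have "\<dots> = prod_list (map tt (take k xs @ drop k xs))" by (simp only: map_append prod_list.append)
  finally show ?thesis using True by (simp add: tau_power_def)
next
  case False
  have "tau_power k (take i xs) * tau_power 1 (drop i xs) = 0" if "i \<le> length xs" for i
  proof (rule ccontr)
    assume "\<not> ?thesis"
    then have t: "tau_power k (take i xs) \<noteq> 0" "tau_power 1 (drop i xs) \<noteq> 0" by auto
    then have l: "length (take i xs) = k" "length (drop i xs) = 1"
      and s: "set (take i xs) \<subseteq> aug_ideal A" "set (drop i xs) \<subseteq> aug_ideal A"
      by (auto simp: tau_power_def split: if_splits)
    have "length xs = Suc k" using l that by simp
    moreover have "set xs \<subseteq> aug_ideal A" using s by (metis Un_least append_take_drop_id set_append)
    ultimately show False using False by blast
  qed
  then have "(\<Sum>i\<le>length xs. tau_power k (take i xs) * tau_power 1 (drop i xs)) = 0"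
    by (intro sum.neutral) simp
  moreover have "tau_power (Suc k) xs = 0" using False unfolding tau_power_def by (rule if_not_P)
  ultimately show ?thesis by simp
qed

lemma tau_mem_theta: "tau_power 1 \<in> theta A B \<tau>"
proof -
  let ?f = "cobar_single Q \<tau>"
  have "(\<lambda>xs. if set xs \<subseteq> aug_ideal A then ?f (map qm xs) else 0) = tau_power 1"
  proof
    fix xs :: "'a list"
    have "qm a \<in> aug_ideal Q" if "a \<in> aug_ideal A" for a
      using that by (simp add: aug_ideal_def Q_counit Q_carrier)
    then show "(if set xs \<subseteq> aug_ideal A then ?f (map qm xs) else 0) = tau_power 1 xs"
      by (cases xs) (auto simp: cobar_single_def tau_power_def tt_def)
  qed
  moreover have "?f \<in> Ext_class Q ?f"
    unfolding Ext_class_def by (rule mem_coset) (simp add: cobar_def)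
  moreover have "tau_power 1 \<in> Ext_class A (tau_power 1)"
    unfolding Ext_class_def by (rule mem_coset) (simp add: cobar_def)
  ultimately show ?thesis unfolding theta_def Ext_map_def by (intro UN_I[of ?f]) simp_all
qed

text \<open>
  The product of two cosets contains the product of any two representatives.
\<close>

lemma tau_power_mem: "tau_power k \<in> theta A B \<tau> [^]\<^bsub>Ext A\<^esub> k"
proof (induct k)
  case 0
  let ?R = "(cobar A)\<lparr>carrier := cocycles A\<rparr>"
  have "tau_power 0 = \<one>\<^bsub>?R\<^esub>" by (auto simp: tau_power_def cobar_def fun_eq_iff)
  moreover have "\<one>\<^bsub>?R\<^esub> \<in> coboundaries A +>\<^bsub>?R\<^esub> \<one>\<^bsub>?R\<^esub>" by (rule mem_coset) (simp add: cobar_def)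
  ultimately show ?case by (simp add: nat_pow_def Ext_def FactRing_def)
next
  case (Suc k)
  let ?R = "(cobar A)\<lparr>carrier := cocycles A\<rparr>"
  let ?T = "theta A B \<tau>"
  have "?T [^]\<^bsub>Ext A\<^esub> Suc k = rcoset_mult ?R (coboundaries A) (?T [^]\<^bsub>Ext A\<^esub> k) ?T"
    by (simp add: nat_pow_def Ext_def FactRing_def)
  moreover have "tau_power (Suc k) = tau_power k \<otimes>\<^bsub>?R\<^esub> tau_power 1"
    using tau_power_mult[of k] by (simp add: cobar_def fun_eq_iff)
  moreover have "tau_power k \<otimes>\<^bsub>?R\<^esub> tau_power 1 \<in> coboundaries A +>\<^bsub>?R\<^esub> (tau_power k \<otimes>\<^bsub>?R\<^esub> tau_power 1)"
    by (rule mem_coset) (simp add: cobar_def)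
  ultimately show ?case using Suc tau_mem_theta unfolding rcoset_mult_def by auto
qed

text \<open>
  The terms of the cobar differential.
\<close>

definition merge :: "nat \<Rightarrow> 'a list \<Rightarrow> 'a list" where
  "merge t xs = take t xs @ (xs ! t \<otimes> xs ! Suc t) # drop (Suc (Suc t)) xs"

lemma bounding_cochain:
  assumes "theta A B \<tau> [^]\<^bsub>Ext A\<^esub> q = \<zero>\<^bsub>Ext A\<^esub>"
  obtains \<phi> where
    "\<And>us a b vs. set us \<subseteq> aug_ideal A \<Longrightarrow> set vs \<subseteq> aug_ideal A \<Longrightarrow> a \<in> aug_ideal A \<Longrightarrow> b \<in> aug_ideal A \<Longrightarrow>
      \<phi> (us @ (a \<oplus> b) # vs) = \<phi> (us @ a # vs) + \<phi> (us @ b # vs)"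
    "\<And>xs. length xs = q \<Longrightarrow> set xs \<subseteq> aug_ideal A \<Longrightarrow> (\<Sum>t<q-1. \<phi> (merge t xs)) = prod_list (map tt xs)"
proof -
  have "tau_power q \<in> coboundaries A"
    using tau_power_mem[of q] unfolding assms by (simp add: Ext_def FactRing_def)
  then obtain \<phi> where \<phi>: "\<phi> \<in> carrier (cobar A)" "cobar_diff A \<phi> = tau_power q"
    unfolding coboundaries_def by auto
  show thesis
  proof (rule that[of \<phi>])
    fix us a b vs
    assume "set us \<subseteq> aug_ideal A" "set vs \<subseteq> aug_ideal A" "a \<in> aug_ideal A" "b \<in> aug_ideal A"
    then have "set (us @ a # b # vs) \<subseteq> aug_ideal A" by simp
    moreover have "\<forall>us x y vs. set (us @ x # y # vs) \<subseteq> aug_ideal A \<longrightarrow>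
        \<phi> (us @ (x \<oplus> y) # vs) = \<phi> (us @ x # vs) + \<phi> (us @ y # vs)"
      using \<phi>(1) by (simp add: cobar_def)
    ultimately show "\<phi> (us @ (a \<oplus> b) # vs) = \<phi> (us @ a # vs) + \<phi> (us @ b # vs)" by blast
  next
    fix xs :: "'a list" assume xs: "length xs = q" "set xs \<subseteq> aug_ideal A"
    have "{i. Suc i < length xs} = {..<q-1}" using xs(1) by auto
    then have "cobar_diff A \<phi> xs = (\<Sum>t<q-1. \<phi> (merge t xs))"
      using xs by (simp add: cobar_diff_def merge_def)
    then show "(\<Sum>t<q-1. \<phi> (merge t xs)) = prod_list (map tt xs)"
      using \<phi>(2) xs by (simp add: tau_power_def)
  qed
qed

lemma merge_snoc: "Suc t < length xs \<Longrightarrow> merge t (xs @ [b]) = merge t xs @ [b]"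
  by (simp add: merge_def nth_append)

lemma merge_last: "length as = p \<Longrightarrow> merge p (as @ [a, b]) = as @ [a \<otimes> b]"
  by (simp add: merge_def nth_append)

lemma aug_mult_A: "a \<in> aug_ideal A \<Longrightarrow> b \<in> carrier A \<Longrightarrow> a \<otimes> b \<in> aug_ideal A"
  by (simp add: aug_ideal_iff counit_mult)

lemma merge_aug: "Suc t < length xs \<Longrightarrow> set xs \<subseteq> aug_ideal A \<Longrightarrow>
    set (merge t xs) \<subseteq> aug_ideal A \<and> length (merge t xs) = length xs - 1"
proof -
  assume t: "Suc t < length xs" and xs: "set xs \<subseteq> aug_ideal A"
  have "xs ! t \<in> aug_ideal A" "xs ! Suc t \<in> aug_ideal A" using t xs by (auto intro!: subsetD[OF xs] nth_mem)
  then have "xs ! t \<otimes> xs ! Suc t \<in> aug_ideal A" using aug_mult_A aug_closed by blast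
  moreover have "set (take t xs) \<subseteq> aug_ideal A" "set (drop (Suc (Suc t)) xs) \<subseteq> aug_ideal A"
    by (rule subset_trans[OF set_take_subset xs], rule subset_trans[OF set_drop_subset xs])
  ultimately show ?thesis using t by (simp add: merge_def min_def)
qed

section \<open>Descending along powers of \<open>\<theta>\<close>\<close>

text \<open>
  A cochain \<open>\<chi>\<close> on \<open>V\<close> with \<open>s\<close> slots, in degrees below \<open>c\<close>, whose coboundary is \<open>\<theta>\<^sup>s\<^sup>+\<^sup>1 u\<close>; the functional \<open>u\<close>
  will be \<open>A\<close>-linear.  The last slot of the coboundary acts on \<open>V\<close>, and it is restricted to homogeneous elements
  so that all degrees stay below \<open>c\<close>.
\<close>

definition cobounds :: "('a, 'm) gmod \<Rightarrow> ('m \<Rightarrow> bit) \<Rightarrow> nat \<Rightarrow> int \<Rightarrow> ('a list \<Rightarrow> 'm \<Rightarrow> bit) \<Rightarrow> bool" where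
  "cobounds V u s c \<chi> \<longleftrightarrow>
    (\<forall>us a b vs v. length us + length vs + 1 = s \<longrightarrow> set us \<subseteq> aug_ideal A \<longrightarrow> set vs \<subseteq> aug_ideal A \<longrightarrow>
      a \<in> aug_ideal A \<longrightarrow> b \<in> aug_ideal A \<longrightarrow> v \<in> carrier V \<longrightarrow>
      \<chi> (us @ (a \<oplus> b) # vs) v = \<chi> (us @ a # vs) v + \<chi> (us @ b # vs) v) \<and>
    (\<forall>as v w j. length as = s \<longrightarrow> set as \<subseteq> aug_ideal A \<longrightarrow> v \<in> homog V j \<longrightarrow> w \<in> homog V j \<longrightarrow> j < c \<longrightarrow>
      \<chi> as (v \<oplus>\<^bsub>V\<^esub> w) = \<chi> as v + \<chi> as w) \<and>
    (\<forall>as a v i j. length as = s \<longrightarrow> set as \<subseteq> aug_ideal A \<longrightarrow> i > 0 \<longrightarrow> a \<in> homog A i \<longrightarrow> v \<in> homog V j \<longrightarrow>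
      i + j < c \<longrightarrow>
      (\<Sum>t<s. \<chi> (merge t (as @ [a])) v) + \<chi> as (act V a v) = prod_list (map tt as) * tt a * u v)"

end

lemma (in boolean_group) sum_additive_on:
  fixes f :: "_ \<Rightarrow> bit"
  assumes U: "bool_subspace V U" and f: "\<And>v w. v \<in> U \<Longrightarrow> w \<in> U \<Longrightarrow> f (v \<oplus> w) = f v + f w"
    and S: "finite S" "\<And>i. i \<in> S \<Longrightarrow> g i \<in> U"
  shows "f (finsum V g S) = (\<Sum>i\<in>S. f (g i))"
  using S
proof (induct S rule: finite_induct)
  case empty
  have "\<zero> \<in> U" using U by (simp add: bool_subspace_def)
  then show ?case using f[of \<zero> \<zero>] by simp
next
  case (insert i S)
  have c: "g i \<in> carrier V" "g \<in> S \<rightarrow> carrier V" using insert U by (auto simp: bool_subspace_def)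
  have "finsum V g S \<in> U" using insert by (intro bool_subspace_finsum[OF U]) auto
  then show ?case using insert c f by (simp add: finsum_insert)
qed

lemma finsum_restrict:
  assumes "boolean_group V" "boolean_group (restrict_mod V U)" "U \<subseteq> carrier V" "finite S" "\<And>i. i \<in> S \<Longrightarrow> g i \<in> U"
  shows "finsum (restrict_mod V U) g S = finsum V g S"
proof -
  interpret V: boolean_group V by fact
  interpret U: boolean_group "restrict_mod V U" by fact
  show ?thesis using assms(4,5)
  proof (induct S rule: finite_induct)
    case (insert i S)
    then have "g i \<in> carrier V" "g \<in> S \<rightarrow> carrier V" "g i \<in> carrier (restrict_mod V U)"
      "g \<in> S \<rightarrow> carrier (restrict_mod V U)" using assms(3) by auto
    then show ?case using insert by (simp add: V.finsum_insert U.finsum_insert)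
  qed simp
qed

text \<open>
  An \<open>A\<close>-module that is free over \<open>B\<close> as far as degrees below \<open>g\<close> are concerned.  The case to keep in mind is a sum
  of a trivial \<open>B\<close>-module and a free one, in negative degrees.
\<close>

locale low_free = exterior_extension A B \<tau> d + V: hopf_module A V
  for A :: "'a hopf" (structure) and B \<tau> d and V :: "('a, 'm) gmod" +
  fixes K :: "'m set" and Y :: "'m set" and \<beta> :: "'m \<Rightarrow> 'm \<Rightarrow> 'a" and g :: int
  assumes K: "K \<subseteq> carrier V" and K_module: "gmodule (sub_hopf A B) (restrict_mod V K)"
    and free: "free_on (sub_hopf A B) (restrict_mod V K) Y \<beta>"
    and low: "\<And>i. i < g \<Longrightarrow> homog V i \<subseteq> K"
begin

interpretation HK: hopf_module H "restrict_mod V K"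
  by (simp add: hopf_module_def H.conn_hopf_axioms K_module)

interpretation HV: hopf_module H V
  by (simp add: hopf_module_def H.conn_hopf_axioms gmodule_H V.M.gmodule_axioms)

lemma Y_K: "y \<in> Y \<Longrightarrow> y \<in> K" and Y_V: "y \<in> Y \<Longrightarrow> y \<in> carrier V"
  using HK.free_carrier[OF free] K by auto

abbreviation "lc \<equiv> lincomb A V (\<lambda>y. y)"

lemma coeffs_H_A: "c \<in> coeffs H Y \<Longrightarrow> c \<in> coeffs A Y"
  using B_subset by (auto simp: coeffs_def)

lemma lc_H: "c \<in> coeffs H Y \<Longrightarrow> lincomb H (restrict_mod V K) (\<lambda>y. y) c = lc c"
proof -
  assume c: "c \<in> coeffs H Y"
  note cc = coeffs_supp[OF c]
  have "act V (c y) y \<in> K" if "y \<in> {y. c y \<noteq> \<zero>}" for y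
    using HK.M.act_closed[of "c y" y] cc that Y_K by auto
  then show ?thesis
    unfolding lincomb_def using cc finsum_restrict[OF V.M.boolean_group_axioms HK.M.boolean_group_axioms K, of "{y. c y \<noteq> \<zero>}" "\<lambda>y. act V (c y) y"]
    by simp
qed

lemma D_coeffs: "e \<in> coeffs A Y \<Longrightarrow> (\<lambda>y. D (e y)) \<in> coeffs H Y"
proof -
  assume e: "e \<in> coeffs A Y"
  have "(\<lambda>y. D (e y)) \<in> coeffs A Y" by (rule V.coeffs_map[OF e]) simp_all
  then show ?thesis using A_decomposition(1)[OF coeffs_supp(2)[OF e]] by (auto simp: coeffs_def)
qed

lemma lc_D_add:
  "e \<in> coeffs A Y \<Longrightarrow> e' \<in> coeffs A Y \<Longrightarrow>
    lc (\<lambda>y. D (e y \<oplus> e' y)) = lc (\<lambda>y. D (e y)) \<oplus>\<^bsub>V\<^esub> lc (\<lambda>y. D (e' y))"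
  using V.lincomb_add[where x = "\<lambda>y. y", OF Y_V D_coeffs[THEN coeffs_H_A] D_coeffs[THEN coeffs_H_A], of e e']
    coeffs_supp(2)[of e A Y] coeffs_supp(2)[of e' A Y] by (simp add: D_add)

text \<open>
  If \<open>V = K\<close>, the kernel of the action \<open>A \<otimes>\<^sub>B V \<rightarrow> V\<close> is a copy of \<open>\<Sigma>\<^sup>d V\<close>, and the extension is \<open>\<theta>\<close> tensored with \<open>V\<close>.
  The element \<open>v\<close> corresponds to the family of coefficients \<open>e\<close> with \<open>\<Sum> e(y) y = 0\<close> and \<open>\<Sum> D(e(y)) y = v\<close>.
\<close>

definition resolves :: "'m \<Rightarrow> ('m \<Rightarrow> 'a) \<Rightarrow> bool" where
  "resolves v e \<longleftrightarrow> e \<in> coeffs A Y \<and> lc e = \<zero>\<^bsub>V\<^esub> \<and> lc (\<lambda>y. D (e y)) = v"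

text \<open>
  For the difference of two solutions \<open>D\<close> vanishes, so its coefficients lie in \<open>B\<close>, where the freeness of \<open>K\<close>
  applies.  Uniqueness makes the solution depend \<open>A\<close>-linearly on \<open>v\<close>.
\<close>

lemma resolves_unique:
  assumes "resolves v e" "resolves v e'"
  shows "e = e'"
proof -
  let ?f = "\<lambda>y. e y \<oplus> e' y"
  have e: "e \<in> coeffs A Y" "e' \<in> coeffs A Y" using assms by (auto simp: resolves_def)
  have ec: "e y \<in> carrier A" "e' y \<in> carrier A" for y
    using coeffs_supp(2)[OF e(1)] coeffs_supp(2)[OF e(2)] by simp_all
  have f: "?f \<in> coeffs A Y" by (rule coeffs_sum[OF e])
  have lcc: "lc (\<lambda>y. D (e y)) \<in> carrier V" by (rule V.lincomb_closed[OF Y_V coeffs_H_A[OF D_coeffs[OF e(1)]]])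
  have "lc (\<lambda>y. D (?f y)) = \<zero>\<^bsub>V\<^esub>"
    using lc_D_add[OF e] assms lcc by (simp add: resolves_def V.M.add_self)
  then have "(\<lambda>y. D (?f y)) = (\<lambda>_. \<zero>\<^bsub>H\<^esub>)"
    using lc_H[OF D_coeffs[OF f]] by (intro HK.free_indep[OF free D_coeffs[OF f]]) simp
  then have Df: "D (?f y) = \<zero>" for y by (metis sub_hopf_simps(3))
  have "?f y \<in> B" for y
    using A_decomposition(2)[of "?f y"] Df[of y] ec[of y] by simp
  then have fH: "?f \<in> coeffs H Y" using f by (auto simp: coeffs_def)
  have "lc ?f = \<zero>\<^bsub>V\<^esub>"
    using V.lincomb_add[where x = "\<lambda>y. y", OF Y_V e] assms by (simp add: resolves_def)
  then have "?f = (\<lambda>_. \<zero>\<^bsub>H\<^esub>)"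
    using lc_H[OF fH] by (intro HK.free_indep[OF free fH]) simp
  then have "e y \<oplus> e' y = \<zero>" for y by (metis sub_hopf_simps(3))
  then show ?thesis using add_eq_zero_iff[OF ec] by blast
qed

lemma resolves_add: "resolves v e \<Longrightarrow> resolves v' e' \<Longrightarrow> resolves (v \<oplus>\<^bsub>V\<^esub> v') (\<lambda>y. e y \<oplus> e' y)"
  unfolding resolves_def
  using coeffs_sum lc_D_add V.lincomb_add[where x = "\<lambda>y. y", OF Y_V] by auto

lemma resolves_act:
  assumes a: "a \<in> carrier A" and e: "resolves v e"
  shows "resolves (act V a v) (\<lambda>y. a \<otimes> e y)"
proof -
  have c: "e \<in> coeffs A Y" using e by (simp add: resolves_def)
  have ec: "e y \<in> carrier A" for y using coeffs_supp(2)[OF c] .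
  note De = coeffs_H_A[OF D_coeffs[OF c]]
  have al: "act V b (lc f) = lc (\<lambda>y. b \<otimes> f y)" if "b \<in> carrier A" "f \<in> coeffs A Y" for b f
    by (rule V.act_lincomb[where x = "\<lambda>y. y", OF Y_V that])
  have v: "v \<in> carrier V" using e V.lincomb_closed[OF Y_V De] by (auto simp: resolves_def)
  have 1: "lc (\<lambda>y. a \<otimes> e y) = \<zero>\<^bsub>V\<^esub>" using al[OF a c] e a by (simp add: resolves_def)
  have "(\<lambda>y. D (a \<otimes> e y)) = (\<lambda>y. D a \<otimes> e y \<oplus> a \<otimes> D (e y))" using a ec by (simp add: D_mult)
  then have "lc (\<lambda>y. D (a \<otimes> e y)) = lc (\<lambda>y. D a \<otimes> e y) \<oplus>\<^bsub>V\<^esub> lc (\<lambda>y. a \<otimes> D (e y))"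
    using V.lincomb_add[where x = "\<lambda>y. y", OF Y_V V.coeffs_mult[OF D_closed[OF a] c] V.coeffs_mult[OF a De]]
    by simp
  also have "\<dots> = act V (D a) \<zero>\<^bsub>V\<^esub> \<oplus>\<^bsub>V\<^esub> act V a v"
    using al[OF D_closed[OF a] c] al[OF a De] e by (simp add: resolves_def)
  also have "\<dots> = act V a v" using a v by (simp add: V.M.act_closed)
  finally show ?thesis using 1 V.coeffs_mult[OF a c] by (simp add: resolves_def)
qed

text \<open>
  As \<open>D(bx + b') = b\<close>, the second equation asks for \<open>e(y) = \<beta>\<^sub>v(y) x + b'(y)\<close> with \<open>b'(y)\<close> in \<open>B\<close>.  The first one then
  says that \<open>b'\<close> is the family of coordinates of \<open>\<Sum> \<beta>\<^sub>v(y) x y\<close>.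
\<close>

definition twist :: "'m \<Rightarrow> 'm" where "twist v = lincomb A V (\<lambda>y. act V x y) (\<beta> v)"

definition lift :: "'m \<Rightarrow> 'm \<Rightarrow> 'a" where
  "lift v = (if v \<in> K \<and> twist v \<in> K then (\<lambda>y. \<beta> v y \<otimes> x \<oplus> \<beta> (twist v) y) else (\<lambda>_. \<zero>))"

lemma \<beta>_coeffs: "v \<in> K \<Longrightarrow> \<beta> v \<in> coeffs H Y" "v \<in> K \<Longrightarrow> lc (\<beta> v) = v"
  using HK.free_coeffs[OF free, of v] HK.free_lincomb[OF free, of v] lc_H[of "\<beta> v"] by simp_all

lemma coeffs_mult_x: "c \<in> coeffs A Y \<Longrightarrow> (\<lambda>y. c y \<otimes> x) \<in> coeffs A Y"
  by (rule V.coeffs_map[where f = "\<lambda>_ a. a \<otimes> x"]) simp_all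

lemma lift_coeffs: "lift v \<in> coeffs A Y"
  unfolding lift_def
  using coeffs_sum[OF coeffs_mult_x] coeffs_H_A[OF \<beta>_coeffs(1)] V.coeffs_zero by auto

lemma Y_homog: "y \<in> Y \<Longrightarrow> \<exists>i. y \<in> homog V i"
  using free unfolding free_on_def by auto

text \<open>
  The solution involves the element \<open>\<Sum> \<beta>\<^sub>v(y) x y\<close>, whose degree exceeds that of \<open>v\<close> by \<open>d\<close> and which has to lie
  in \<open>K\<close>.  This is the price in degrees of each factor \<open>\<theta>\<close>.
\<close>

lemma low_lift:
  assumes v: "v \<in> homog V j" and j: "j + d < g"
  shows "resolves v (lift v)" "y \<in> Y \<Longrightarrow> y \<in> homog V i \<Longrightarrow> lift v y \<in> homog A (j + d - i)"
proof -
  have vK: "v \<in> K" using low[of j] v j d by auto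
  note b = \<beta>_coeffs[OF vK] and bA = coeffs_H_A[OF \<beta>_coeffs(1)[OF vK]]
  have xy: "\<And>y. y \<in> Y \<Longrightarrow> act V x y \<in> carrier V" using Y_V V.M.act_closed by simp
  have bh: "\<beta> v y \<in> homog A (j - i)" if "y \<in> Y" "y \<in> homog V i" for y i
    using HK.free_coords_homog[OF free, of v j y i] v vK that Y_K by simp
  have th: "twist v \<in> homog V (j + d)"
    unfolding twist_def
  proof (rule V.lincomb_homog[OF xy bA])
    fix y assume y: "y \<in> Y"
    obtain i where i: "y \<in> homog V i" using Y_homog y by blast
    have "act V x y \<in> homog V (d + i)" by (rule V.M.act_homog[OF x_homog i])
    then show "\<exists>i. \<beta> v y \<in> homog A (j + d - i) \<and> act V x y \<in> homog V i"
      using bh[OF y i] by (intro exI[of _ "d + i"]) simp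
  qed
  then have tK: "twist v \<in> K" using low[OF j] by blast
  note t = \<beta>_coeffs[OF tK] and tA = coeffs_H_A[OF \<beta>_coeffs(1)[OF tK]]
  have L: "lift v = (\<lambda>y. \<beta> v y \<otimes> x \<oplus> \<beta> (twist v) y)" using vK tK by (simp add: lift_def)
  have bc: "\<beta> v y \<in> carrier A" "\<beta> (twist v) y \<in> carrier A" for y
    using coeffs_supp(2)[OF bA] coeffs_supp(2)[OF tA] by simp_all
  have "twist v = lc (\<lambda>y. \<beta> v y \<otimes> x)"
    unfolding twist_def
    by (rule V.linear_lincomb[where f = "\<lambda>v. v" and g = "\<lambda>_ a. a \<otimes> x", OF xy V.hopf_module_axioms _ Y_V _ _ _ bA])
      (use Y_V in \<open>simp_all add: linear_maps_iff V.M.act_mult\<close>)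
  then have "lc (lift v) = twist v \<oplus>\<^bsub>V\<^esub> twist v"
    unfolding L using V.lincomb_add[where x = "\<lambda>y. y", OF Y_V coeffs_mult_x[OF bA] tA] t(2) by simp
  then have 1: "lc (lift v) = \<zero>\<^bsub>V\<^esub>" using tK K by (auto simp: V.M.add_self)
  have "(\<lambda>y. D (lift v y)) = \<beta> v"
  proof
    fix y
    have "\<beta> v y \<in> B" "\<beta> (twist v) y \<in> B" using coeffs_supp(2)[OF b(1)] coeffs_supp(2)[OF t(1)] by simp_all
    then show "D (lift v y) = \<beta> v y"
      unfolding L using bc[of y] D_split[of "\<beta> (twist v) y" "\<beta> v y"] by (simp add: a_comm)
  qed
  then show "resolves v (lift v)" using 1 b(2) lift_coeffs by (simp add: resolves_def)
  assume y: "y \<in> Y" "y \<in> homog V i"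
  have "\<beta> (twist v) y \<in> homog A (j + d - i)"
    using HK.free_coords_homog[OF free, of "twist v" "j + d" y i] th tK y Y_K by simp
  moreover have "\<beta> v y \<otimes> x \<in> homog A ((j - i) + d)" by (rule mult_homog[OF bh[OF y] x_homog])
  ultimately show "lift v y \<in> homog A (j + d - i)"
    unfolding L by (intro homog_add) (simp_all add: algebra_simps)
qed

text \<open>
  The projection to the augmentation ideal, where the arguments of cochains live.
\<close>

definition reduce :: "'a \<Rightarrow> 'a" where "reduce a = a \<oplus> scale2 A (counit A a) \<one>"

lemma reduce_aug: "a \<in> carrier A \<Longrightarrow> reduce a \<in> aug_ideal A"
  unfolding reduce_def by (cases "counit A a") (simp_all add: aug_ideal_iff counit_add)

lemma reduce_add: "a \<in> carrier A \<Longrightarrow> b \<in> carrier A \<Longrightarrow> reduce (a \<oplus> b) = reduce a \<oplus> reduce b"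
  by (simp add: reduce_def counit_add scale2_add_left a_ac)

lemma reduce_of_aug: "a \<in> aug_ideal A \<Longrightarrow> reduce a = a"
  by (simp add: reduce_def aug_ideal_iff)

lemma reduce_homog: "a \<in> homog A k \<Longrightarrow> reduce a = \<zero> \<and> k \<le> 0 \<or> reduce a = a \<and> k > 0"
  using homog_pos_aug[of a k] reduce_of_aug homog_neg[of k] homog_0
  by (cases k "0::int" rule: linorder_cases) (auto simp: reduce_def add_self)

text \<open>
  The homotopy given by the basis of the free module \<open>A \<otimes>\<^sub>B K\<close> removes one factor \<open>\<theta>\<close>: if \<open>\<chi>\<close>
  cobounds \<open>\<theta>\<^sup>p\<^sup>+\<^sup>2 u\<close>, then \<open>(as, v) \<mapsto> \<Sum> \<chi>(as, e(y), y)\<close>, where \<open>e\<close> is the family attached to \<open>v\<close>,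
  cobounds \<open>\<theta>\<^sup>p\<^sup>+\<^sup>1 u\<close>.
\<close>

lemma descend:
  assumes \<chi>: "cobounds V u (Suc p) c \<chi>" and c: "c \<le> g" and u: "u \<in> mod_hom A V (shifted_unit A e)"
  shows "cobounds V u p (c - d) (\<lambda>as v. \<Sum>y | lift v y \<noteq> \<zero>. \<chi> (as @ [reduce (lift v y)]) y)"
proof -
  let ?\<alpha> = "\<lambda>as v. \<Sum>y | lift v y \<noteq> \<zero>. \<chi> (as @ [reduce (lift v y)]) y"
  have slot: "\<chi> (us @ (a \<oplus> b) # vs) v = \<chi> (us @ a # vs) v + \<chi> (us @ b # vs) v"
    if "length us + length vs = p" "set us \<subseteq> aug_ideal A" "set vs \<subseteq> aug_ideal A" "a \<in> aug_ideal A"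
      "b \<in> aug_ideal A" "v \<in> carrier V" for us a b vs v
    using \<chi> that unfolding cobounds_def by simp
  have addv: "\<chi> as (v \<oplus>\<^bsub>V\<^esub> w) = \<chi> as v + \<chi> as w"
    if "length as = Suc p" "set as \<subseteq> aug_ideal A" "v \<in> homog V j" "w \<in> homog V j" "j < c" for as v w j
    using \<chi> that unfolding cobounds_def by blast
  have ident: "(\<Sum>t<Suc p. \<chi> (merge t (as @ [a])) v) + \<chi> as (act V a v) = prod_list (map tt as) * tt a * u v"
    if "length as = Suc p" "set as \<subseteq> aug_ideal A" "i > 0" "a \<in> homog A i" "v \<in> homog V j" "i + j < c" for as a v i j
    using \<chi> that unfolding cobounds_def by blast
  have zero_aug: "\<zero> \<in> aug_ideal A" by (simp add: aug_ideal_iff)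
  have slot0: "\<chi> (as @ [\<zero>]) v = 0" if "length as = p" "set as \<subseteq> aug_ideal A" "v \<in> carrier V" for as v
    using slot[of as "[]" \<zero> \<zero> v] that zero_aug by simp
  have last_lin: "(\<lambda>a. \<chi> (as @ [reduce a]) y) \<in> linear_maps A F2"
    if "length as = p" "set as \<subseteq> aug_ideal A" "y \<in> Y" for as y
    using slot[of as "[]"] that reduce_aug Y_V by (simp add: linear_maps_iff reduce_add)
  have fin: "finite {y. lift v y \<noteq> \<zero>}" and supY: "lift v y \<noteq> \<zero> \<Longrightarrow> y \<in> Y" and lc_c: "lift v y \<in> carrier A" for v y
    using coeffs_supp[OF lift_coeffs[of v]] by auto
  show ?thesis
    unfolding cobounds_def
  proof (intro conjI allI impI)
    fix us a b vs v
    assume h: "length us + length vs + 1 = p" "set us \<subseteq> aug_ideal A" "set vs \<subseteq> aug_ideal A" "a \<in> aug_ideal A"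
      "b \<in> aug_ideal A" "v \<in> carrier V"
    have "\<chi> ((us @ (a \<oplus> b) # vs) @ [reduce (lift v y)]) y =
        \<chi> ((us @ a # vs) @ [reduce (lift v y)]) y + \<chi> ((us @ b # vs) @ [reduce (lift v y)]) y"
      if "y \<in> Y" for y
      using slot[of us "vs @ [reduce (lift v y)]" a b y] h that Y_V reduce_aug[OF lc_c] by simp
    then show "?\<alpha> (us @ (a \<oplus> b) # vs) v = ?\<alpha> (us @ a # vs) v + ?\<alpha> (us @ b # vs) v"
      unfolding sum.distrib[symmetric] using supY by (intro sum.cong) auto
  next
    fix as v w j
    assume h: "length as = p" "set as \<subseteq> aug_ideal A" "v \<in> homog V j" "w \<in> homog V j" "j < c - d"
    have jg: "j + d < g" using h c by simp
    have "lift (v \<oplus>\<^bsub>V\<^esub> w) = (\<lambda>y. lift v y \<oplus> lift w y)"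
      by (rule resolves_unique[OF low_lift(1)[OF V.M.homog_add[OF h(3,4)] jg]
            resolves_add[OF low_lift(1)[OF h(3) jg] low_lift(1)[OF h(4) jg]]])
    then show "?\<alpha> as (v \<oplus>\<^bsub>V\<^esub> w) = ?\<alpha> as v + ?\<alpha> as w"
      using finsum_coeffs_add[OF boolean_group_axioms boolean_group_F2 last_lin[OF h(1,2)] lift_coeffs[of v] lift_coeffs[of w]]
        fin[of v] fin[of w] fin[of "v \<oplus>\<^bsub>V\<^esub> w"] by (simp add: finsum_F2)
  next
    fix as a v i j
    assume h: "length as = p" "set as \<subseteq> aug_ideal A" "i > 0" "a \<in> homog A i" "v \<in> homog V j" "i + j < c - d"
    have jg: "j + d < g" and jc: "j + d < c" using h c by simp_all
    have aI: "a \<in> aug_ideal A" using homog_pos_aug[OF h(4,3)] .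
    have ac: "a \<in> carrier A" using aug_closed[OF aI] .
    let ?S = "{y. lift v y \<noteq> \<zero>}"
    let ?C = "lift v"
    let ?as = "as @ [a]"
    have as': "length ?as = Suc p" "set ?as \<subseteq> aug_ideal A" using h aI by auto
    have res: "resolves v ?C" by (rule low_lift(1)[OF h(5) jg])
    have SY: "y \<in> Y" "y \<in> carrier V" if "y \<in> ?S" for y using supY that Y_V by auto
    \<comment> \<open>the coboundary identity of \<open>\<chi>\<close> for the list \<open>as\<close>, \<open>a\<close>, \<open>e(y)\<close> and the vector \<open>y\<close>\<close>
    have summand: "(\<Sum>t<p. \<chi> (merge t ?as @ [reduce (?C y)]) y) + \<chi> (as @ [a \<otimes> ?C y]) y =
        prod_list (map tt as) * tt a * (tt (?C y) * u y) + \<chi> ?as (act V (?C y) y)"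
      and termh: "act V (?C y) y \<in> homog V (j + d)" if y: "y \<in> ?S" for y
    proof -
      obtain k where k: "y \<in> homog V k" using Y_homog[OF SY(1)[OF y]] by blast
      let ?b = "reduce (?C y)"
      have Ch: "?C y \<in> homog A (j + d - k)" by (rule low_lift(2)[OF h(5) jg SY(1)[OF y] k])
      have Cc: "?C y \<in> carrier A" by (rule lc_c)
      have bI: "?b \<in> aug_ideal A" and bc: "?b \<in> carrier A" using reduce_aug[OF Cc] aug_closed by auto
      show ah: "act V (?C y) y \<in> homog V (j + d)" using V.M.act_homog[OF Ch k] by simp
      have split: "(\<Sum>t<Suc p. \<chi> (merge t (?as @ [?b])) y) =
          (\<Sum>t<p. \<chi> (merge t ?as @ [?b]) y) + \<chi> (as @ [a \<otimes> ?b]) y"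
      proof -
        have "merge t (?as @ [?b]) = merge t ?as @ [?b]" if "t < p" for t
          by (rule merge_snoc) (use that h in simp)
        moreover have "merge p (?as @ [?b]) = as @ [a \<otimes> ?b]" using merge_last[OF h(1), of a ?b] by simp
        ultimately show ?thesis by simp
      qed
      have id: "(\<Sum>t<p. \<chi> (merge t ?as @ [?b]) y) + \<chi> (as @ [a \<otimes> ?b]) y + \<chi> ?as (act V ?b y) =
          prod_list (map tt as) * tt a * (tt ?b * u y)"
      proof (cases "?b = \<zero>")
        case True
        have "\<chi> (merge t ?as @ [\<zero>]) y = 0" if "t < p" for t
          using slot0[of "merge t ?as" y] merge_aug[of t ?as] as' that SY(2)[OF y] by simp
        moreover have "\<chi> (as @ [\<zero>]) y = 0" using slot0 h SY(2)[OF y] by simp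
        moreover have "\<chi> ?as \<zero>\<^bsub>V\<^esub> = 0"
          using addv[OF as' V.M.homog_zero V.M.homog_zero jc] by simp
        ultimately show ?thesis using True ac SY(2)[OF y] by simp
      next
        case False
        then have "?b = ?C y" "j + d - k > 0" using reduce_homog[OF Ch] by auto
        then show ?thesis
          using ident[OF as' _ _ k, of "j + d - k" ?b] Ch jc unfolding split by (simp add: mult.assoc)
      qed
      have eC: "?C y = ?b \<oplus> scale2 A (counit A (?C y)) \<one>"
        using Cc unfolding reduce_def by (simp add: a_assoc add_self)
      have e1: "\<chi> ?as (act V (?C y) y) = \<chi> ?as (act V ?b y) + \<chi> ?as (scale2 V (counit A (?C y)) y)"
      proof -
        have eq: "act V (?C y) y = act V ?b y \<oplus>\<^bsub>V\<^esub> scale2 V (counit A (?C y)) y"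
        proof -
          have "act V (?b \<oplus> scale2 A (counit A (?C y)) \<one>) y = act V ?b y \<oplus>\<^bsub>V\<^esub> scale2 V (counit A (?C y)) y"
            using V.M.act_add_left[OF bc _ SY(2)[OF y], of "scale2 A (counit A (?C y)) \<one>"] SY(2)[OF y]
            by (cases "counit A (?C y)") (simp_all add: V.M.act_one)
          then show ?thesis using eC by simp
        qed
        have "act V ?b y \<in> homog V (j + d)"
          using reduce_homog[OF Ch] ah SY(2)[OF y] by auto
        moreover have "scale2 V (counit A (?C y)) y \<in> homog V (j + d)"
          using counit_homog[OF Ch] k by (cases "j + d - k = 0") (auto simp: scale2_def)
        ultimately show ?thesis unfolding eq by (rule addv[OF as' _ _ jc])
      qed
      have e2: "\<chi> (as @ [a \<otimes> ?C y]) y = \<chi> (as @ [a \<otimes> ?b]) y + \<chi> ?as (scale2 V (counit A (?C y)) y)"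
      proof (cases "counit A (?C y)")
        case zero
        then have "?b = ?C y" using Cc by (simp add: reduce_def)
        moreover have "\<chi> ?as \<zero>\<^bsub>V\<^esub> = 0"
          using addv[OF as' V.M.homog_zero V.M.homog_zero jc] by simp
        ultimately show ?thesis using zero by simp
      next
        case one
        then have "?C y = ?b \<oplus> \<one>" using eC by simp
        then have "a \<otimes> ?C y = a \<otimes> ?b \<oplus> a" using r_distr[OF bc one_closed ac] ac by simp
        then show ?thesis
          using slot[of as "[]" "a \<otimes> ?b" a y] h aI bc aug_mult_A SY(2)[OF y] one by simp
      qed
      have "tt ?b = tt (?C y)"
        using Cc unfolding reduce_def by (cases "counit A (?C y)") (simp_all add: tt_add)
      then show "(\<Sum>t<p. \<chi> (merge t ?as @ [?b]) y) + \<chi> (as @ [a \<otimes> ?C y]) y =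
          prod_list (map tt as) * tt a * (tt (?C y) * u y) + \<chi> ?as (act V (?C y) y)"
        unfolding e1 e2 id[symmetric, unfolded \<open>tt ?b = tt (?C y)\<close>] by (simp add: ac_simps)
    qed
    have 1: "(\<Sum>t<p. ?\<alpha> (merge t ?as) v) = (\<Sum>y\<in>?S. \<Sum>t<p. \<chi> (merge t ?as @ [reduce (?C y)]) y)"
      by (rule sum.swap)
    have "lift (act V a v) = (\<lambda>y. a \<otimes> ?C y)"
      by (rule resolves_unique[OF low_lift(1)[OF V.M.act_homog[OF h(4,5)]] resolves_act[OF ac res]])
        (use h c in simp)
    then have "?\<alpha> as (act V a v) = (\<Sum>y | a \<otimes> ?C y \<noteq> \<zero>. \<chi> (as @ [a \<otimes> ?C y]) y)"
      using reduce_of_aug[OF aug_mult_A[OF aI lc_c]] by simp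
    also have "\<dots> = (\<Sum>y\<in>?S. \<chi> (as @ [a \<otimes> ?C y]) y)"
    proof (rule sum.mono_neutral_left[OF fin])
      show "{y. a \<otimes> ?C y \<noteq> \<zero>} \<subseteq> ?S" using ac by auto
      show "\<forall>y\<in>?S - {y. a \<otimes> ?C y \<noteq> \<zero>}. \<chi> (as @ [a \<otimes> ?C y]) y = 0"
        using slot0 h SY(2) by auto
    qed
    finally have "(\<Sum>t<p. ?\<alpha> (merge t ?as) v) + ?\<alpha> as (act V a v) =
        (\<Sum>y\<in>?S. (\<Sum>t<p. \<chi> (merge t ?as @ [reduce (?C y)]) y) + \<chi> (as @ [a \<otimes> ?C y]) y)"
      unfolding 1 by (simp only: sum.distrib)
    also have "\<dots> = (\<Sum>y\<in>?S. prod_list (map tt as) * tt a * (tt (?C y) * u y) + \<chi> ?as (act V (?C y) y))"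
      by (rule sum.cong) (use summand in auto)
    also have "\<dots> = prod_list (map tt as) * tt a * (\<Sum>y\<in>?S. tt (?C y) * u y) + (\<Sum>y\<in>?S. \<chi> ?as (act V (?C y) y))"
      by (simp only: sum.distrib sum_distrib_left)
    also have "(\<Sum>y\<in>?S. \<chi> ?as (act V (?C y) y)) = \<chi> ?as (lc ?C)"
      unfolding lincomb_def
      by (rule V.M.sum_additive_on[OF V.M.homog_subspace _ fin termh, symmetric]) (use addv[OF as' _ _ jc] in auto)
    also have "\<chi> ?as (lc ?C) = 0"
      using res addv[OF as' V.M.homog_zero V.M.homog_zero jc] by (simp add: resolves_def)
    also have "(\<Sum>y\<in>?S. tt (?C y) * u y) = u (lc (\<lambda>y. D (?C y)))"
    proof -
      have "lc (\<lambda>y. D (?C y)) = finsum V (\<lambda>y. act V (D (?C y)) y) ?S"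
        by (rule V.lincomb_superset[OF coeffs_H_A[OF D_coeffs[OF lift_coeffs]] Y_V fin]) (use supY in auto)
      moreover have "u (finsum V (\<lambda>y. act V (D (?C y)) y) ?S) = (\<Sum>y\<in>?S. u (act V (D (?C y)) y))"
      proof (rule V.M.sum_additive_on[OF _ _ fin])
        show "bool_subspace V (carrier V)" by (simp add: bool_subspace_def)
      qed (use mod_hom_add[OF u] SY(2) lc_c in \<open>simp_all add: V.M.act_closed\<close>)
      moreover have "u (act V (D (?C y)) y) = tt (?C y) * u y" if "y \<in> ?S" for y
        using mod_hom_act[OF u D_closed[OF lc_c] SY(2)[OF that]] counit_D[OF lc_c] by simp
      ultimately show ?thesis by simp
    qed
    also have "u (lc (\<lambda>y. D (?C y))) = u v" using res by (simp add: resolves_def)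
    finally show "(\<Sum>t<p. ?\<alpha> (merge t ?as) v) + ?\<alpha> as (act V a v) = prod_list (map tt as) * tt a * u v"
      by simp
  qed
qed

text \<open>
  This is where the nilpotence of \<open>\<theta>\<close> enters: \<open>k\<close> represents a class in the homology of \<open>V/I(B)V\<close>
  with respect to \<open>x\<close>.  Suppose that an \<open>A\<close>-linear functional \<open>u\<close> detects it.  A cochain cobounding \<open>\<theta>\<^sup>q u\<close> descends, in
  \<open>q - 1\<close> steps, to a functional \<open>\<chi>\<close> on \<open>V\<close> with \<open>\<chi>(av) = \<tau>(a) u(v)\<close>.  It vanishes on \<open>I(B)V\<close>, but \<open>\<chi>(xk) = u(k) = 1\<close>.
\<close>

theorem homology_vanishes:
  assumes theta: "theta A B \<tau> [^]\<^bsub>Ext A\<^esub> q = \<zero>\<^bsub>Ext A\<^esub>" and q: "q > 0"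
    and k: "k \<in> homog V e" and xk: "act V x k \<in> aug_span H V" and deg: "e + int q * d < g"
  shows "k \<in> aug_span A V"
proof (rule ccontr)
  assume "k \<notin> aug_span A V"
  then obtain u where u: "u \<in> mod_hom A V (shifted_unit A e)" "u k = 1" using V.detecting_map[OF k] by blast
  obtain \<phi> where \<phi>: "\<And>us a b vs. set us \<subseteq> aug_ideal A \<Longrightarrow> set vs \<subseteq> aug_ideal A \<Longrightarrow> a \<in> aug_ideal A \<Longrightarrow>
      b \<in> aug_ideal A \<Longrightarrow> \<phi> (us @ (a \<oplus> b) # vs) = \<phi> (us @ a # vs) + \<phi> (us @ b # vs)"
    "\<And>xs. length xs = q \<Longrightarrow> set xs \<subseteq> aug_ideal A \<Longrightarrow> (\<Sum>t<q-1. \<phi> (merge t xs)) = prod_list (map tt xs)"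
    using bounding_cochain[OF theta] by blast
  \<comment> \<open>start from \<open>\<phi>(as) u(v)\<close>, a cochain because \<open>u\<close> is \<open>A\<close>-linear, and remove one factor \<open>\<theta>\<close> per step\<close>
  have "\<exists>\<chi>. cobounds V u (q - 1 - t) (g - int t * d) \<chi>" if "t \<le> q - 1" for t
    using that
  proof (induct t)
    case 0
    have "cobounds V u (q - 1) g (\<lambda>as v. \<phi> as * u v)"
      unfolding cobounds_def
    proof (intro conjI allI impI)
      fix us a b vs v
      assume "set us \<subseteq> aug_ideal A" "set vs \<subseteq> aug_ideal A" "a \<in> aug_ideal A" "b \<in> aug_ideal A"
      then show "\<phi> (us @ (a \<oplus> b) # vs) * u v = \<phi> (us @ a # vs) * u v + \<phi> (us @ b # vs) * u v"
        by (simp add: \<phi>(1) distrib_right)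
    next
      fix as v w j assume "v \<in> homog V j" "w \<in> homog V j"
      then show "\<phi> as * u (v \<oplus>\<^bsub>V\<^esub> w) = \<phi> as * u v + \<phi> as * u w"
        using mod_hom_add[OF u(1)] V.M.homog_closed by (simp add: distrib_left)
    next
      fix as a v i j
      assume h: "length as = q - 1" "set as \<subseteq> aug_ideal A" "i > 0" "a \<in> homog A i" "v \<in> homog V j"
      have aI: "a \<in> aug_ideal A" using homog_pos_aug[OF h(4,3)] .
      have "u (act V a v) = 0"
        using mod_hom_act[OF u(1) aug_closed[OF aI] V.M.homog_closed[OF h(5)]] aI by (simp add: aug_ideal_iff)
      moreover have "(\<Sum>t<q-1. \<phi> (merge t (as @ [a]))) = prod_list (map tt (as @ [a]))"
        using \<phi>(2)[of "as @ [a]"] h q aI by simp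
      ultimately show "(\<Sum>t<q-1. \<phi> (merge t (as @ [a])) * u v) + \<phi> as * u (act V a v) =
          prod_list (map tt as) * tt a * u v"
        by (simp add: sum_distrib_right[symmetric])
    qed
    then show ?case by auto
  next
    case (Suc t)
    then obtain \<chi> where "cobounds V u (q - 1 - t) (g - int t * d) \<chi>" by auto
    moreover have "q - 1 - t = Suc (q - 1 - Suc t)" using Suc(2) by simp
    ultimately have \<chi>: "cobounds V u (Suc (q - 1 - Suc t)) (g - int t * d) \<chi>" by simp
    have "g - int t * d \<le> g" using d by simp
    from descend[OF \<chi> this u(1)]
    have "\<exists>\<chi>. cobounds V u (q - 1 - Suc t) (g - int t * d - d) \<chi>" by blast
    then show ?case by (simp add: algebra_simps)
  qed
  from this[of "q - 1"] obtain \<chi> where \<chi>: "cobounds V u 0 (g - int (q - 1) * d) \<chi>" by auto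
  define c where "c = g - int (q - 1) * d"
  have ec: "e + d < c" using deg q unfolding c_def by (simp add: algebra_simps of_nat_diff)
  have addv: "\<chi> [] (v \<oplus>\<^bsub>V\<^esub> w) = \<chi> [] v + \<chi> [] w" if "v \<in> homog V (e + d)" "w \<in> homog V (e + d)" for v w
    using \<chi> that ec unfolding cobounds_def c_def[symmetric] by auto
  have ident: "\<chi> [] (act V a v) = tt a * u v" if "i > 0" "a \<in> homog A i" "v \<in> homog V j" "i + j = e + d" for a v i j
    using \<chi> that ec unfolding cobounds_def c_def[symmetric] by fastforce
  \<comment> \<open>\<open>\<chi>\<close> vanishes on the part of \<open>I(B)V\<close> in degree \<open>e + d\<close>, because \<open>\<tau>\<close> vanishes on \<open>B\<close>\<close>
  define G where "G = {v \<in> homog V (e + d). \<chi> [] v = 0}"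
  have "\<chi> [] \<zero>\<^bsub>V\<^esub> = 0" using addv[OF V.M.homog_zero V.M.homog_zero] by simp
  then have G: "bool_subspace V G"
    unfolding bool_subspace_def G_def using V.M.homog_closed V.M.homog_add addv by auto
  have "component V (e + d) s \<in> G" if "s \<in> aug_span H V" for s using that
  proof (induct rule: aug_span.induct)
    case zero
    then show ?case using G by (simp add: bool_subspace_def)
  next
    case (step s b v)
    have "component V (e + d) (act V b v) \<in> G"
    proof (rule HV.comp_act_mem[OF step(3,4) G])
      fix m b assume b: "m > 0" "b \<in> homog H m"
      have v': "component V (e + d - m) v \<in> homog V (e + d - m)" using V.M.comp_homog[OF step(4)] .
      have "act V b (component V (e + d - m) v) \<in> homog V (m + (e + d - m))"
        using V.M.act_homog[OF _ v', of b m] b by simp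
      then show "act V b (component V (e + d - m) v) \<in> G"
        using ident[OF b(1) _ v'] b tt_B by (simp add: G_def)
    qed
    then show ?case using step G HV.aug_span_closed V.M.act_closed aug_closed aug_H_A
      by (simp add: V.M.comp_add bool_subspace_def)
  qed
  from this[OF xk] have "\<chi> [] (component V (e + d) (act V x k)) = 0" by (simp add: G_def)
  moreover have "act V x k \<in> homog V (e + d)" using V.M.act_homog[OF x_homog k] by (simp add: add.commute)
  ultimately have "\<chi> [] (act V x k) = 0" using V.M.comp_of_homog[of "act V x k" "e + d" "e + d"] by simp
  moreover have "\<chi> [] (act V x k) = 1" using ident[OF _ x_homog k] d u(2) by simp
  ultimately show False by simp
qed

end

section \<open>Lifting the trivial summand from \<open>B\<close> to \<open>A\<close>\<close>

text \<open>
  The coordinates of an invariant element are killed by the augmentation ideal, hence are \<open>0\<close> or \<open>\<lambda>\<close>.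
\<close>

lemma (in hopf_module) invariant_in_socle:
  assumes F: "free_on A M Y \<beta>" and v: "invariant A M v"
  shows "\<exists>k\<in>carrier M. v = act M lam k"
proof -
  have vc: "v \<in> carrier M" using v by (simp add: invariant_def)
  note c = coeffs_supp[OF free_coeffs[OF F vc]]
  have z: "\<beta> \<zero>\<^bsub>M\<^esub> = (\<lambda>_. \<zero>)"
    by (rule free_indep[OF F free_coeffs[OF F M.zero_closed] free_lincomb[OF F M.zero_closed]])
  have "a \<otimes> \<beta> v y = \<zero>" if "a \<in> aug_ideal A" for a y
    using free_coords_act[OF F vc aug_closed[OF that]] v that z by (simp add: invariant_def) metis
  then have s: "\<beta> v y = \<zero> \<or> \<beta> v y = lam" for y using socle[OF c(2)] by blast
  let ?S = "{y. \<beta> v y \<noteq> \<zero>}"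
  have S: "y \<in> carrier M" if "y \<in> ?S" for y using c(3) free_carrier[OF F] that by blast
  have "v = finsum M (\<lambda>y. act M (\<beta> v y) y) ?S"
    using free_lincomb[OF F vc] by (simp add: lincomb_def)
  also have "\<dots> = finsum M (\<lambda>y. act M lam y) ?S"
  proof (rule M.finsum_cong')
    show "act M (\<beta> v y) y = act M lam y" if "y \<in> ?S" for y using s[of y] that by auto
  qed (use S in \<open>auto intro!: M.act_closed\<close>)
  also have "\<dots> = act M lam (finsum M (\<lambda>y. y) ?S)"
    by (rule linear_maps_finsum[OF M.boolean_group_axioms M.boolean_group_axioms act_linear, symmetric])
      (use S in auto)
  finally show ?thesis using S by (intro bexI[of _ "finsum M (\<lambda>y. y) ?S"]) (auto intro!: M.finsum_closed)
qed

context exterior_extension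
begin

lemma invariant_A:
  assumes M: "gmodule A M" and H: "invariant H M m" and x: "act M x m = \<zero>\<^bsub>M\<^esub>"
  shows "invariant A M m"
proof -
  interpret M: hopf_module A M using M by (simp add: hopf_module_def conn_hopf_axioms)
  have mc: "m \<in> carrier M" using H by (simp add: invariant_def)
  have "act M a m = \<zero>\<^bsub>M\<^esub>" if a: "a \<in> aug_ideal A" for a
  proof -
    have ac: "a \<in> carrier A" using aug_closed[OF a] .
    obtain b b' where b: "b \<in> B" "b' \<in> B" "a = b \<oplus> b' \<otimes> x" using A_split[OF ac] by blast
    have "counit A b = 0" using a b B_closed by (simp add: aug_ideal_iff counit_add counit_mult)
    then have "act M b m = \<zero>\<^bsub>M\<^esub>" using H b by (simp add: invariant_def aug_H)
    then show ?thesis using b B_closed mc x by (simp add: M.M.act_add_left M.M.act_mult)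
  qed
  then show ?thesis using mc by (simp add: invariant_def)
qed

lemma L_kills:
  assumes M: "gmodule A M" and H: "invariant H M m" and l: "l \<in> L"
  shows "act M l m = \<zero>\<^bsub>M\<^esub>"
proof -
  interpret M: hopf_module A M using M by (simp add: hopf_module_def conn_hopf_axioms)
  have mc: "m \<in> carrier M" using H by (simp add: invariant_def)
  show ?thesis using l
  proof (induct rule: L_induct_left)
    case (mult a b)
    then show ?case using H aug_closed[OF aug_H_A[of b]] mc
      by (simp add: M.M.act_mult invariant_def)
  qed (use mc in \<open>simp_all add: M.M.act_add_left\<close>)
qed

text \<open>
  As \<open>A = B \<oplus> Bx\<close>, the product \<open>\<lambda>\<^sub>B a\<close> with \<open>a\<close> in the augmentation ideal is \<open>0\<close> or \<open>\<lambda>\<close>, and \<open>\<lambda> = x \<lambda>\<^sub>B\<close>.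
\<close>

lemma lamB_aug_span:
  assumes M: "gmodule A M" and k: "k \<in> aug_span A M"
  shows "\<exists>k'\<in>carrier M. act M lamB k = act M x (act M lamB k')"
proof -
  interpret M: hopf_module A M using M by (simp add: hopf_module_def conn_hopf_axioms)
  note lc = lamB_facts(2)
  show ?thesis using k
  proof (induct rule: aug_span.induct)
    case zero
    show ?case using lc by (intro bexI[of _ "\<zero>\<^bsub>M\<^esub>"]) simp_all
  next
    case (step s a v)
    then obtain k' where k': "k' \<in> carrier M" "act M lamB s = act M x (act M lamB k')" by blast
    have ac: "a \<in> carrier A" and sc: "s \<in> carrier M" using aug_closed[OF step(3)] M.aug_span_closed[OF step(1)] .
    obtain b b' where b: "b \<in> B" "b' \<in> B" "a = b \<oplus> b' \<otimes> x" using A_split[OF ac] by blast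
    have bc: "b \<in> carrier A" "b' \<in> carrier A" using b B_closed by auto
    have "counit A b = 0" using step(3) b bc by (simp add: aug_ideal_iff counit_add counit_mult)
    then have "lamB \<otimes> a = scale2 A (counit A b') lamB \<otimes> x"
      using b bc lc lamB_mult[OF b(1)] lamB_mult[OF b(2)] by (simp add: r_distr m_assoc[symmetric])
    then have la: "lamB \<otimes> a = scale2 A (counit A b') (x \<otimes> lamB)"
      using lam_A by (cases "counit A b'") simp_all
    let ?v = "scale2 M (counit A b') v"
    have vc: "?v \<in> carrier M" using step(4) by simp
    have "act M lamB (act M a v) = act M (scale2 A (counit A b') (x \<otimes> lamB)) v"
      using M.M.act_mult[OF lc ac step(4)] la by simp
    also have "\<dots> = act M x (act M lamB ?v)"
      using lc step(4) M.M.act_mult[OF x_closed lc step(4)] by (cases "counit A b'") simp_all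
    finally have "act M lamB (act M a v) = act M x (act M lamB ?v)" .
    then have "act M lamB (s \<oplus>\<^bsub>M\<^esub> act M a v) = act M x (act M lamB (k' \<oplus>\<^bsub>M\<^esub> ?v))"
      using k' vc lc ac sc step(4) by (simp add: M.M.act_add_right M.M.act_closed)
    then show ?case using k'(1) vc by (intro bexI[of _ "k' \<oplus>\<^bsub>M\<^esub> ?v"]) simp_all
  qed
qed

text \<open>
  If \<open>m\<^sub>0\<close> spans the trivial summand over \<open>B\<close>, the obstruction to \<open>A\<close>-invariance is \<open>x m\<^sub>0\<close>, which is
  \<open>B\<close>-invariant by normality and lies in the free complement for degree reasons, so \<open>x m\<^sub>0 = \<lambda>\<^sub>B k\<close>.  The class of \<open>k\<close> lives
  in degree \<open>d - |B|\<close>, where \<open>M\<close> is \<open>B\<close>-free, and it vanishes because \<open>\<theta>\<close> is nilpotent; hence \<open>m\<^sub>0\<close> can be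
  corrected.
\<close>

lemma corrected_generator:
  assumes theta: "theta A B \<tau> [^]\<^bsub>Ext A\<^esub> q = \<zero>\<^bsub>Ext A\<^esub>" and q: "q > 0" and deg: "(int q + 1) * d < topB"
    and M: "gmodule A M" and mr: "unit_summand_module H M m0 r" "socle_exact H (restrict_mod M (kernel_of M r))"
  shows "\<exists>m. unit_summand H M m r \<and> invariant A M m"
proof -
  interpret M: hopf_module A M using M by (simp add: hopf_module_def conn_hopf_axioms)
  interpret HM: unit_summand_module H M m0 r by fact
  let ?K = "kernel_of M r"
  interpret HK: hopf_module H "restrict_mod M ?K"
    by (simp add: hopf_module_def H.conn_hopf_axioms HM.gmodule_kernel[OF HM.r])
  obtain Y \<beta> where F: "free_on H (restrict_mod M ?K) Y \<beta>" using HK.free_if_socle_exact[OF mr(2)] by blast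
  have dtop: "2 * d < topB"
  proof -
    have "2 * d \<le> (int q + 1) * d" using q d by (intro mult_right_mono) auto
    then show ?thesis using deg by simp
  qed
  have top: "topB > 0" using dtop d by simp
  have lowK: "homog M i \<subseteq> ?K" if "i < 0" for i
    using HM.unit_map_homog[OF HM.r] M.M.homog_closed that by (fastforce simp: kernel_of_def)
  interpret LF: low_free A B \<tau> d M ?K Y \<beta> 0
  proof (intro low_free.intro low_free_axioms.intro)
    show "?K \<subseteq> carrier M" by (auto simp: kernel_of_def)
    show "gmodule H (restrict_mod M ?K)" by (rule HM.gmodule_kernel[OF HM.r])
    show "homog M i \<subseteq> ?K" if "i < 0" for i by (rule lowK[OF that])
  qed (rule exterior_extension_axioms M.hopf_module_axioms F)+
  note m0 = HM.m
  let ?v = "act M x m0"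
  have vh: "?v \<in> homog M d" using M.M.act_homog[OF x_homog m0(1)] by simp
  then have vK: "?v \<in> ?K" using HM.unit_map_homog[OF HM.r vh] d M.M.homog_closed by (auto simp: kernel_of_def)
  have "invariant H (restrict_mod M ?K) ?v"
    unfolding invariant_def
  proof (intro conjI ballI)
    show "?v \<in> carrier (restrict_mod M ?K)" using vK by simp
    fix b assume b: "b \<in> aug_ideal H"
    have "act M b ?v = act M (b \<otimes> x) m0"
      using M.M.act_mult[OF _ x_closed m0(3), of b] aug_closed[OF aug_H_A[OF b]] by simp
    also have "\<dots> = \<zero>\<^bsub>M\<^esub>" by (rule L_kills[OF M m0(2) L_right_mem[OF x_closed b]])
    finally show "act (restrict_mod M ?K) b ?v = \<zero>\<^bsub>restrict_mod M ?K\<^esub>" by simp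
  qed
  then obtain k1 where "k1 \<in> ?K" "?v = act M lamB k1" using HK.invariant_in_socle[OF F] by auto
  then have k1: "k1 \<in> carrier M" "?v = act M lamB k1" by (auto simp: kernel_of_def)
  let ?k = "component M (d - topB) k1"
  have k: "?k \<in> homog M (d - topB)" "?k \<in> carrier M" using k1 M.M.comp_homog by simp_all
  have vk: "?v = act M lamB ?k"
    using M.comp_act[OF lamB_facts(3) k1(1), of "d - topB"] k1(2) M.M.comp_of_homog[OF vh, of d] by simp
  have "act M lamB (act M x ?k) = act M lam ?k"
    using M.M.act_mult[OF lamB_facts(2) x_closed k(2)] lam_A(1) by simp
  also have "\<dots> = act M x ?v" using M.M.act_mult[OF x_closed lamB_facts(2) k(2)] lam_A(2) vk by simp
  also have "\<dots> = act M (x \<otimes> x) m0" using M.M.act_mult[OF x_closed x_closed m0(3)] by simp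
  also have "\<dots> = \<zero>\<^bsub>M\<^esub>" by (rule L_kills[OF M m0(2) xx_L])
  finally have lx: "act M lamB (act M x ?k) = \<zero>\<^bsub>M\<^esub>" .
  have xkh: "act M x ?k \<in> homog M (d + (d - topB))" by (rule M.M.act_homog[OF x_homog k(1)])
  have "r (act M x ?k) = 0" by (rule HM.unit_map_homog[OF HM.r xkh]) (use dtop in simp)
  then have "act M x ?k \<in> aug_span H M"
    using mr(2) lx M.M.act_closed[OF x_closed k(2)] unfolding HM.socle_exact_kernel_iff by simp
  then have "?k \<in> aug_span A M"
    using deg by (intro LF.homology_vanishes[OF theta q k(1)]) (simp_all add: algebra_simps)
  then obtain k2 where k2: "k2 \<in> carrier M" "?v = act M x (act M lamB k2)" using lamB_aug_span[OF M] vk by metis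
  let ?w = "act M lamB (component M (- topB) k2)"
  have wc: "?w \<in> carrier M" using k2 lamB_facts(2) by (simp add: M.M.act_closed)
  have w: "?w = component M 0 (act M lamB k2)" using M.comp_act[OF lamB_facts(3) k2(1), of "- topB"] by simp
  have xw: "act M x ?w = ?v"
    unfolding w using M.comp_act[OF x_homog, of "act M lamB k2" 0] k2 lamB_facts(2) M.M.comp_of_homog[OF vh, of d]
    by (simp add: M.M.act_closed)
  let ?m = "m0 \<oplus>\<^bsub>M\<^esub> ?w"
  have mc: "?m \<in> carrier M" using m0 wc by simp
  have mH: "invariant H M ?m"
    unfolding invariant_def
  proof (intro conjI ballI)
    fix b assume b: "b \<in> aug_ideal H"
    have bc: "b \<in> carrier A" using aug_closed[OF aug_H_A[OF b]] .
    have "act M b ?w = \<zero>\<^bsub>M\<^esub>"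
      using M.M.act_mult[OF bc lamB_facts(2), of "component M (- topB) k2"] lamB_aug(2)[OF b] k2 by simp
    then show "act M b ?m = \<zero>\<^bsub>M\<^esub>" using m0(2) b bc m0(3) wc by (simp add: M.M.act_add_right invariant_def)
  qed (rule mc)
  have "act M x ?m = \<zero>\<^bsub>M\<^esub>" using m0(3) wc xw by (simp add: M.M.act_add_right M.M.add_self M.M.act_closed)
  then have mA: "invariant A M ?m" by (rule invariant_A[OF M mH])
  have "r ?w = 0" using HM.unit_map_act[OF HM.r, of lamB "component M (- topB) k2"] k2 lamB_facts counit_homog[OF lamB_facts(3)] top by simp
  then have "r ?m = 1" using HM.unit_map_add[OF HM.r m0(3) wc] HM.rm by simp
  moreover have "?m \<in> homog M 0"
    unfolding w using M.M.homog_add[OF m0(1) M.M.comp_homog] k2 lamB_facts(2) by (simp add: M.M.act_closed)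
  ultimately have "unit_summand H M ?m r" using mH HM.r by (simp add: unit_summand_def)
  with mA show ?thesis by blast
qed

text \<open>
  With an \<open>A\<close>-invariant generator \<open>m\<close>, the quotient \<open>M/m\<close> is \<open>B\<close>-free.  Its underlying space is the
  complement \<open>K\<close> with the action projected back to \<open>K\<close>.  Nilpotence of \<open>\<theta>\<close>, now in all degrees, makes
  it \<open>A\<close>-free, so the quotient map splits.
\<close>

theorem stably_unit_descends:
  fixes M :: "('a, 'u::infinite) gmod"
  assumes theta: "theta A B \<tau> [^]\<^bsub>Ext A\<^esub> q = \<zero>\<^bsub>Ext A\<^esub>" and q: "q > 0" and deg: "(int q + 1) * d < topB"
    and M: "gmodule A M" and s: "stably_unit H M"
  shows "stably_unit A M"
proof -
  interpret M: hopf_module A M using M by (simp add: hopf_module_def conn_hopf_axioms)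
  obtain m0 r where mr0: "unit_summand_module H M m0 r" "socle_exact H (restrict_mod M (kernel_of M r))"
    using H.stably_unitE[OF s gmodule_H[OF M]] by blast
  obtain m where m: "unit_summand H M m r" "invariant A M m"
    using corrected_generator[OF theta q deg M mr0] by blast
  interpret HM: unit_summand_module H M m r
    using m(1) by (simp add: unit_summand_module_def hopf_module_def H.conn_hopf_axioms gmodule_H[OF M]
        unit_summand_module_axioms_def)
  let ?K = "kernel_of M r"
  let ?HK = "restrict_mod M ?K"
  have exK: "socle_exact H ?HK" by (rule mr0(2))
  have KM: "v \<in> ?K \<Longrightarrow> v \<in> carrier M" for v by (simp add: kernel_of_def)
  have prK: "HM.pr v \<in> ?K" if "v \<in> carrier M" for v using mod_hom_closed[OF HM.pr_hom that] by simp
  have pr_add: "HM.pr (v \<oplus>\<^bsub>M\<^esub> w) = HM.pr v \<oplus>\<^bsub>M\<^esub> HM.pr w" if "v \<in> carrier M" "w \<in> carrier M" for v w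
    using mod_hom_add[OF HM.pr_hom that] by simp
  have pr_eq: "v = HM.pr v \<oplus>\<^bsub>M\<^esub> scale2 M (r v) m" if "v \<in> carrier M" for v
    using that HM.m(3) by (simp add: HM.pr_def M.M.a_assoc M.M.add_self)
  have pr_m: "HM.pr (scale2 M e m) = \<zero>\<^bsub>M\<^esub>" for e
    using HM.m(3) HM.rm HM.unit_map_zero[OF HM.r] by (cases e) (simp_all add: HM.pr_def M.M.add_self)
  have pr_act: "HM.pr (act M a (HM.pr v)) = HM.pr (act M a v)" if a: "a \<in> carrier A" and v: "v \<in> carrier M" for a v
  proof -
    have pc: "HM.pr v \<in> carrier M" and sc: "scale2 M e m \<in> carrier M" for e using KM[OF prK[OF v]] HM.m(3) by simp_all
    have "act M a v = act M a (HM.pr v) \<oplus>\<^bsub>M\<^esub> act M a (scale2 M (r v) m)"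
      using arg_cong[OF pr_eq[OF v], of "act M a"] M.M.act_add_right[OF a pc sc] by simp
    also have "act M a (scale2 M (r v) m) = scale2 M (counit A a * r v) m"
      using M.act_invariant[OF m(2) a] a by (cases "r v") simp_all
    finally have "HM.pr (act M a v) = HM.pr (act M a (HM.pr v)) \<oplus>\<^bsub>M\<^esub> HM.pr (scale2 M (counit A a * r v) m)"
      using pr_add[OF M.M.act_closed[OF a pc] sc] by simp
    then show ?thesis using KM[OF prK[OF M.M.act_closed[OF a pc]]] by (simp add: pr_m)
  qed
  define C :: "('a, 'u) gmod" where "C = (restrict_mod M ?K)\<lparr>act := (\<lambda>a v. HM.pr (act M a v))\<rparr>"
  have C [simp]: "carrier C = ?K" "homog C n = homog M n \<inter> ?K" "\<zero>\<^bsub>C\<^esub> = \<zero>\<^bsub>M\<^esub>" "v \<oplus>\<^bsub>C\<^esub> w = v \<oplus>\<^bsub>M\<^esub> w"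
    "act C a v = HM.pr (act M a v)" for n v w a
    by (simp_all add: C_def restrict_mod_def)
  have gHK: "gmodule H ?HK" by (rule HM.gmodule_kernel[OF HM.r])
  interpret HK: hopf_module H ?HK by (simp add: hopf_module_def H.conn_hopf_axioms gHK)
  have grC: "graded_space C" by (rule graded_space_cong[OF HK.M.graded_space_axioms]) simp_all
  have gC: "gmodule A C"
  proof (intro gmodule.intro grC gmodule_axioms.intro)
    show "bounded_below C" using HK.M.bounded_below by (simp add: bounded_below_def)
    show "act C (a \<otimes> b) v = act C a (act C b v)" if "a \<in> carrier A" "b \<in> carrier A" "v \<in> carrier C" for a b v
      using that KM[of v] pr_act[of a "act M b v"] by (simp add: M.M.act_mult M.M.act_closed)
    show "act C \<one> v = v" if "v \<in> carrier C" for v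
      using that KM[of v] HM.pr_kernel[of v] by (simp add: M.M.act_one)
    show "act C a v \<in> homog C (i + j)" if "a \<in> homog A i" "v \<in> homog C j" for a i v j
      using that mod_hom_homog[OF HM.pr_hom M.M.act_homog[of a i v j]] by simp
  qed (use KM prK pr_add in \<open>simp_all add: M.M.act_closed M.M.act_add_left M.M.act_add_right\<close>)
  interpret C: hopf_module A C by (simp add: hopf_module_def conn_hopf_axioms gC)
  interpret HC: hopf_module H C by (simp add: hopf_module_def H.conn_hopf_axioms gmodule_H[OF gC])
  have same: "act C b v = act M b v" if "b \<in> B" "v \<in> ?K" for b v
    using HK.M.act_closed[of b v] that HM.pr_kernel by simp
  have id_hom: "(\<lambda>v. v) \<in> mod_hom H ?HK C" by (rule mod_homI) (use same in simp_all)
  have exC: "socle_exact H C"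
    unfolding socle_exact_def
  proof (intro ballI impI)
    fix v assume v: "v \<in> carrier C" "act C lamB v = \<zero>\<^bsub>C\<^esub>"
    then have "v \<in> aug_span H ?HK" using exK same[OF lamB_facts(1), of v] by (simp add: socle_exact_def)
    from aug_span_map[OF this id_hom gHK gmodule_H[OF gC] H.conn_hopf_axioms] show "v \<in> aug_span H C" .
  qed
  obtain Y \<beta> where F: "free_on H C Y \<beta>" using HC.free_if_socle_exact[OF exC] by blast
  have rC: "restrict_mod C (carrier C) = C" by (simp add: C_def restrict_mod_def)
  have ex: "socle_exact A C"
    unfolding socle_exact_def
  proof (intro ballI impI)
    fix v assume v: "v \<in> carrier C" "act C lam v = \<zero>\<^bsub>C\<^esub>"
    show "v \<in> aug_span A C"
    proof (rule C.aug_span_if_comps[OF v(1)])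
      fix n
      let ?k = "component C n v"
      have k: "?k \<in> homog C n" "?k \<in> carrier C" using C.M.comp_homog[OF v(1)] C.M.comp_closed[OF v(1)] .
      have "act C lam ?k = \<zero>\<^bsub>C\<^esub>" using C.comp_act[OF lam_homog v(1), of n] v(2) C.M.comp_zero by simp
      then have "act C lamB (act C x ?k) = \<zero>\<^bsub>C\<^esub>" using C.M.act_mult[OF lamB_facts(2) x_closed k(2)] lam_A(1) by simp
      then have xk: "act C x ?k \<in> aug_span H C"
        using exC C.M.act_closed[OF x_closed k(2)] unfolding socle_exact_def by blast
      \<comment> \<open>\<open>C\<close> is free over \<open>B\<close> in all degrees, so every bound is available; this one suits degree \<open>n\<close>\<close>
      interpret LF: low_free A B \<tau> d C "carrier C" Y \<beta> "n + int q * d + 1"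
      proof (intro low_free.intro low_free_axioms.intro)
        show "gmodule H (restrict_mod C (carrier C))" unfolding rC by (rule gmodule_H[OF gC])
        show "free_on H (restrict_mod C (carrier C)) Y \<beta>" unfolding rC by (rule F)
        show "homog C i \<subseteq> carrier C" for i by auto
      qed (rule exterior_extension_axioms C.hopf_module_axioms subset_refl)+
      show "?k \<in> aug_span A C" by (rule LF.homology_vanishes[OF theta q k(1) xk]) simp
    qed
  qed
  have pr_C: "HM.pr \<in> mod_hom A M C"
  proof (rule mod_homI)
    fix n v assume "v \<in> homog M n"
    then show "HM.pr v \<in> homog C n" using mod_hom_homog[OF HM.pr_hom, of v n] by simp
  qed (use prK pr_add pr_act in simp_all)
  have projC: "projective A C" by (rule projective_if_socle_exact[OF conn_hopf_axioms gC ex])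
  have surj: "HM.pr ` carrier M = carrier C"
  proof
    show "HM.pr ` carrier M \<subseteq> carrier C" using prK by auto
    show "carrier C \<subseteq> HM.pr ` carrier M"
    proof
      fix v assume "v \<in> carrier C"
      then have v: "v \<in> ?K" by simp
      show "v \<in> HM.pr ` carrier M" by (rule image_eqI[OF _ KM[OF v]]) (simp add: HM.pr_kernel[OF v])
    qed
  qed
  obtain g where g: "g \<in> mod_hom A C M" "\<And>v. v \<in> ?K \<Longrightarrow> HM.pr (g v) = v"
    using projective_lift[OF projC M gC pr_C surj mod_hom_id] by (elim bexE) simp
  let ?h = "\<lambda>v. g (HM.pr v)"
  have h: "?h \<in> mod_hom A M M" by (rule mod_hom_comp[OF pr_C g(1)])
  have hc: "?h v \<in> carrier M" if "v \<in> carrier M" for v using mod_hom_closed[OF h that] .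
  \<comment> \<open>\<open>v + h(v)\<close> is killed by the projection to \<open>K\<close>, so it is a multiple of \<open>m\<close>\<close>
  let ?r = "\<lambda>v. r (v \<oplus>\<^bsub>M\<^esub> ?h v)"
  have split: "v \<oplus>\<^bsub>M\<^esub> ?h v = scale2 M (?r v) m" if v: "v \<in> carrier M" for v
  proof -
    have c: "v \<oplus>\<^bsub>M\<^esub> ?h v \<in> carrier M" using v hc by simp
    have "HM.pr (v \<oplus>\<^bsub>M\<^esub> ?h v) = \<zero>\<^bsub>M\<^esub>"
      using pr_add[OF v hc[OF v]] g(2)[OF prK[OF v]] KM[OF prK[OF v]] by (simp add: M.M.add_self)
    then show ?thesis using pr_eq[OF c] HM.m(3) by simp
  qed
  show ?thesis
  proof (rule stably_unitI[OF M])
    have "?r \<in> mod_hom A M (unit_mod A)"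
    proof (rule mod_homI)
      fix v w assume vw: "v \<in> carrier M" "w \<in> carrier M"
      have "(v \<oplus>\<^bsub>M\<^esub> w) \<oplus>\<^bsub>M\<^esub> ?h (v \<oplus>\<^bsub>M\<^esub> w) = (v \<oplus>\<^bsub>M\<^esub> ?h v) \<oplus>\<^bsub>M\<^esub> (w \<oplus>\<^bsub>M\<^esub> ?h w)"
        using vw hc mod_hom_add[OF h vw] by (simp add: M.M.a_ac)
      then show "?r (v \<oplus>\<^bsub>M\<^esub> w) = ?r v \<oplus>\<^bsub>unit_mod A\<^esub> ?r w"
        using HM.unit_map_add[OF HM.r] vw hc by simp
    next
      fix n v assume v: "v \<in> homog M n"
      have "v \<oplus>\<^bsub>M\<^esub> ?h v \<in> homog M n" by (rule M.M.homog_add[OF v mod_hom_homog[OF h v]])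
      then show "?r v \<in> homog (unit_mod A) n" using HM.unit_map_homog[OF HM.r] by simp
    next
      fix a v assume a: "a \<in> carrier A" and v: "v \<in> carrier M"
      obtain c where c: "?r v = c" by blast
      have "v \<oplus>\<^bsub>M\<^esub> ?h v = scale2 M c m" using split[OF v] unfolding c .
      then have "act M a v \<oplus>\<^bsub>M\<^esub> ?h (act M a v) = act M a (scale2 M c m)"
        using mod_hom_act[OF h a v] M.M.act_add_right[OF a v hc[OF v]] by simp
      also have "\<dots> = scale2 M (counit A a * c) m"
        using M.act_invariant[OF m(2) a] a by (cases c) simp_all
      finally have "?r (act M a v) = r (scale2 M (counit A a * c) m)" by (rule arg_cong)
      also have "\<dots> = counit A a * ?r v"
        unfolding c using HM.rm HM.unit_map_zero[OF HM.r] by (cases "counit A a"; cases c) simp_all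
      finally show "?r (act M a v) = act (unit_mod A) a (?r v)" by simp
    qed simp
    moreover have "?r m = 1"
    proof -
      have "HM.pr m = \<zero>\<^bsub>M\<^esub>" using pr_m[of 1] by simp
      then have "?h m = \<zero>\<^bsub>M\<^esub>" using mod_hom_zero[OF gC M g(1)] by simp
      then show ?thesis using HM.rm HM.m(3) by simp
    qed
    ultimately show "unit_summand A M m ?r" using HM.m(1) m(2) by (simp add: unit_summand_def)
    fix v assume v: "v \<in> carrier M" "?r v = 0" "act M lam v = \<zero>\<^bsub>M\<^esub>"
    have "act C lam (HM.pr v) = HM.pr (act M lam v)" using mod_hom_act[OF pr_C lam_closed v(1)] by simp
    then have "act C lam (HM.pr v) = \<zero>\<^bsub>C\<^esub>" using v(3) mod_hom_zero[OF M gC pr_C] by simp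
    then have "HM.pr v \<in> aug_span A C" using ex prK[OF v(1)] unfolding socle_exact_def by simp
    then have hv: "?h v \<in> aug_span A M" by (rule aug_span_map[OF _ g(1) gC M conn_hopf_axioms])
    have "v = ?h v"
    proof -
      have "v \<oplus>\<^bsub>M\<^esub> ?h v = scale2 M 0 m" using split[OF v(1)] unfolding v(2) .
      then have "v \<oplus>\<^bsub>M\<^esub> ?h v = \<zero>\<^bsub>M\<^esub>" by (simp only: scale2_simps)
      then show ?thesis by (rule iffD1[OF M.M.add_eq_zero_iff[OF v(1) hc[OF v(1)]]])
    qed
    then show "v \<in> aug_span A M" by (rule ssubst) (rule hv)
  qed
qed

end

text \<open>
  The stably unit modules over \<open>A\<close> form a single stable class, the unit of the Picard group, and likewise over
  \<open>B\<close>.  A stable class that restricts to the unit contains a module that is stably unit over \<open>B\<close>, hence over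
  \<open>A\<close>.
\<close>

theorem lemma4p5:
  fixes A :: "'a hopf" and B :: "'a set" and \<tau> :: "'a set \<Rightarrow> bit" and d :: int and q :: nat
  assumes "hopf_algebra A" and "connected_hopf A" and "cocommutative A"
    and "finite_dimensional A"
    and "normal_hopf_subalgebra B A"
    and "q > 0"
    and "exterior_on (dual_algebra (quot_hopf A B)) \<tau>"
    and "\<tau> \<in> homog (dual_algebra (quot_hopf A B)) d" and "d \<ge> 1"
    and "theta A B \<tau> [^]\<^bsub>Ext A\<^esub> q = \<zero>\<^bsub>Ext A\<^esub>"
    and "(int q + 1) * d < top_degree (sub_hopf A B)"
  shows "trivial_group (rel_Pic A B :: ('a, 'u::infinite) gmod set monoid)"
proof -
  interpret exterior_extension A B \<tau> d
    using assms by (simp add: exterior_extension_def exterior_extension_axioms_def conn_hopf_def conn_hopf_axioms_def)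
  have "0 < (int q + 1) * d" using assms(9) by simp
  then have topB: "topB > 0" using assms(11) by simp
  then have topA: "top_degree A > 0" using top_A d by simp
  define UA :: "('a, 'u) gmod set" where "UA = {N. gmodule A N \<and> stably_unit A N}"
  define UB :: "('a, 'u) gmod set" where "UB = {N. gmodule H N \<and> stably_unit H N}"
  note unitA = unit_obj[where 'u = 'u] and unitB = H.unit_obj[where 'u = 'u]
  have clsA: "stable_class A M = UA" if "M \<in> UA" for M
    using stable_class_eq[OF topA, of M] that by (simp add: UA_def)
  have clsB: "stable_class H M = UB" if "M \<in> UB" for M
    using H.stable_class_eq[OF topB, of M] that by (simp add: UB_def)
  have unitA': "unit_obj A \<in> UA" using unitA by (simp add: UA_def)
  have unitB': "unit_obj H \<in> UB" using unitB by (simp add: UB_def)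
  have restrict: "M \<in> UB" if "M \<in> UA" for M
    using that gmodule_H[of M] stably_unit_H[of M] by (simp add: UA_def UB_def)
  have tens: "tens_obj A M N \<in> UA" if "M \<in> UA" "N \<in> UA" for M N
    using that tens_obj[of M N] by (simp add: UA_def)
  have self: "M \<in> stable_class A M" if "gmodule A M" for M :: "('a, 'u) gmod"
    using stable_iso_refl[OF that] that by (simp add: stable_class_def)
  have selfB: "M \<in> stable_class H M" if "gmodule H M" for M :: "('a, 'u) gmod"
    using H.stable_iso_refl[OF that] that by (simp add: stable_class_def)
  have oneA: "\<one>\<^bsub>Pic A\<^esub> = UA" and oneB: "\<one>\<^bsub>Pic H\<^esub> = UB"
    using clsA[OF unitA'] clsB[OF unitB'] by (simp_all add: Pic_def)
  have multA: "UA \<otimes>\<^bsub>Pic A\<^esub> UA = UA"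
  proof -
    have "UA \<otimes>\<^bsub>Pic A\<^esub> UA = (\<Union>M\<in>UA. \<Union>N\<in>UA. stable_class A (tens_obj A M N))" by (simp add: Pic_def)
    also have "\<dots> = (\<Union>M\<in>UA. \<Union>N\<in>UA. UA)" using clsA[OF tens] by simp
    also have "\<dots> = UA" using unitA' by blast
    finally show ?thesis .
  qed
  have UA_mem: "UA \<in> carrier (Pic A)"
  proof -
    have t: "tens_obj A (unit_obj A) (unit_obj A) \<in> UA" by (rule tens[OF unitA' unitA'])
    have "unit_obj A \<in> stable_class A (tens_obj A (unit_obj A) (unit_obj A) :: ('a, 'u) gmod)"
      unfolding clsA[OF t] by (rule unitA')
    then have "invertible_obj A (unit_obj A :: ('a, 'u) gmod)"
      using unitA(1) unfolding invertible_obj_def stable_class_def by blast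
    then show ?thesis using clsA[OF unitA'] by (auto simp: Pic_def)
  qed
  have UA_restrict: "Pic_restrict A B UA = UB"
  proof -
    have "Pic_restrict A B UA = (\<Union>M\<in>UA. UB)" unfolding Pic_restrict_def using clsB[OF restrict] by simp
    then show ?thesis using unitA' by blast
  qed
  have only: "T = UA" if T: "T \<in> carrier (Pic A)" "Pic_restrict A B T = UB" for T
  proof -
    obtain M :: "('a, 'u) gmod" where M: "T = stable_class A M" "gmodule A M"
      using T(1) by (auto simp: Pic_def invertible_obj_def)
    have "M \<in> stable_class H M" by (rule selfB[OF gmodule_H[OF M(2)]])
    then have "M \<in> Pic_restrict A B T" unfolding Pic_restrict_def using self[OF M(2)] M(1) by blast
    then have "stably_unit H M" using T(2) by (simp add: UB_def)
    then have "stably_unit A M" by (rule stably_unit_descends[OF assms(10,6,11) M(2)])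
    then show ?thesis using M clsA[of M] by (simp add: UA_def)
  qed
  have carrier: "carrier (rel_Pic A B) = {UA}"
  proof -
    have "carrier (rel_Pic A B) = {T \<in> carrier (Pic A). Pic_restrict A B T = UB}"
      by (simp add: rel_Pic_def kernel_def oneB)
    also have "\<dots> = {UA}"
    proof (rule Set.set_eqI, rule iffI)
      fix T assume "T \<in> {T \<in> carrier (Pic A). Pic_restrict A B T = UB}"
      then have "T = UA" by (intro only) simp_all
      then show "T \<in> {UA}" by simp
    next
      fix T assume "T \<in> {UA}"
      then show "T \<in> {T \<in> carrier (Pic A). Pic_restrict A B T = UB}" using UA_mem UA_restrict by simp
    qed
    finally show ?thesis .
  qed
  have one: "\<one>\<^bsub>rel_Pic A B\<^esub> = UA" using oneA by (simp add: rel_Pic_def)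
  have mult: "UA \<otimes>\<^bsub>rel_Pic A B\<^esub> UA = UA" using multA by (simp add: rel_Pic_def)
  have "group (rel_Pic A B :: ('a, 'u) gmod set monoid)"
    by (rule groupI) (simp_all add: carrier one mult)
  then show ?thesis unfolding trivial_group_def using carrier one by simp
qed

end
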